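(* Let $N\ge2$, let $\Omega\subset\mathbb{R}^N$ be a smooth bounded domain, and let $q(p)$ be a function of $p$ with $\lim_{p\to\infty}q(p)/p=Q$, where either $Q\in(0,1)$ and $N<q(p)<p$, or $Q\in(1,\infty)$ and $N<p<q(p)$. Let $\Lambda\ge\Lambda_\infty$ and let $\lambda_p>0$ be such that: if $\Lambda>\Lambda_\infty$, then $\lim_{p\to\infty}(\lambda_p)^{1/p}=\Lambda$; if $\Lambda=\Lambda_\infty$, then $\lambda_p=c|\Omega|(\Lambda_\infty)^p$ for some constant $c>1$. Let $(u_\Lambda,x_\Lambda)$ be a limit pair for $(\lambda_p)$ (as defined in the context). Then $u_\Lambda$ is $\infty$-harmonic in $D=\Omega\setminus\{x_\Lambda\}$. Therefore, $u_\Lambda$ is strictly positive in $\Omega$ and attains its maximum value only at $x_\Lambda$.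
   Context: $\|\cdot\|_s$ is the norm of $L^s(\Omega)$ and $|\Omega|$ the Lebesgue measure of $\Omega$. $C_0(\overline\Omega):=\{u\in C(\overline\Omega):u=0\text{ on }\partial\Omega\}$ and $\Lambda_\infty:=\min\{\|\nabla u\|_\infty/\|u\|_\infty:0\not\equiv u\in W^{1,\infty}(\Omega)\cap C_0(\overline\Omega)\}$. Least energy solutions: for $p,q>N$, $p\ne q$, $\lambda>0$, let $X_{p,q}:=W_0^{1,\max\{p,q\}}(\Omega)\hookrightarrow C(\overline\Omega)$, $J_\lambda(u):=\frac1p\|\nabla u\|_p^p+\frac1q\|\nabla u\|_q^q-\frac{\lambda}{p}\|u\|_\infty^p$ for $u\in X_{p,q}$, and $\mathcal N_{\lambda,\infty}:=\{u\in X_{p,q}\setminus\{0\}:\|\nabla u\|_p^p+\|\nabla u\|_q^q=\lambda\|u\|_\infty^p\}$. A least energy solution of $$-(\Delta_p+\Delta_q)u=\lambda\|u\|_\infty^{p-1}\delta_{x_u}\text{ in }\Omega,\quad u=0\text{ on }\partial\Omega$$ (where $(\Delta_p+\Delta_q)u:=\operatorname{div}[(|\nabla u|^{p-2}+|\nabla u|^{q-2})\nabla u]$, $x_u$ is the maximum point of $|u|$ and $\delta_{x_u}$ the Dirac delta at $x_u$) is a function $u\in X_{p,q}$ minimizing $J_\lambda$ over $X_{p,q}$ if $N<p<q$, or over $\mathcal N_{\lambda,\infty}$ (with $u\in\mathcal N_{\lambda,\infty}$) if $N<q<p$. For $q=q(p)$, $\lambda=\lambda_p$ as in the claim and $p$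 large, nonnegative least energy solutions exist and have a unique maximum point, and they are weak solutions of the problem, i.e. $\int_\Omega(|\nabla u|^{p-2}+|\nabla u|^{q-2})\nabla u\cdot\nabla v\,dx=\lambda\|u\|_\infty^{p-1}v(x_u)$ for all $v\in X_{p,q}$. Limit pair: for $p$ large let $u_p$ be a nonnegative least energy solution of the problem $-(\Delta_p+\Delta_{q(p)})u=\lambda_p\|u\|_\infty^{p-1}\delta_{x_u}$ in $\Omega$, $u=0$ on $\partial\Omega$, and let $x_p$ be its only maximum point. A limit pair for $(\lambda_p)$ is a pair $(u_\Lambda,x_\Lambda)$ with $u_\Lambda\in W^{1,\infty}(\Omega)\cap C_0(\overline\Omega)$, $x_\Lambda\in\Omega$, such that for some sequence $p_n\to\infty$ one has $x_{p_n}\to x_\Lambda$ and $u_{p_n}\to u_\Lambda$ uniformly in $\overline\Omega$. (Limit pairs exist.) $\infty$-harmonic: $\Delta_\infty\phi:=\frac12\nabla\phi\cdot\nabla|\nabla\phi|^2=\sum_{i,j=1}^N\phi_{x_i}\phi_{x_j}\phi_{x_ix_j}$. Let $D$ be a bounded domain and $u\in C(\overline D)$. A function $\phi\in C^2(D)$ touches $u$ at $x_0\in D$ from below (resp. above) if $\phi(x_0)=u(x_0)$ and $\phi(x)<u(x)$ (resp. $\phi(x)>u(x)$) for all $x\in D\setminus\{x_0\}$. $u$ is $\infty$-harmonic in $D$ if it is a viscosity solution of $\Delta_\infty u=0$ in $D$: $\Delta_\infty\phi(x_0)\ge0$ whenever $x_0\in D$ and $\phi\in C^2(D)$ touches $u$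 from above at $x_0$, and $\Delta_\infty\phi(x_0)\le0$ whenever $x_0\in D$ and $\phi\in C^2(D)$ touches $u$ from below at $x_0$. *)

theory Defs
  imports "HOL-Analysis.Analysis" "HOL-Probability.Essential_Supremum"
begin

section \<open>Classical differentiability\<close>

definition partial_deriv :: "'n \<Rightarrow> (real^'n \<Rightarrow> real) \<Rightarrow> real^'n \<Rightarrow> real" where
  "partial_deriv i f x = frechet_derivative f (at x) (axis i 1)"

definition grad :: "(real^'n \<Rightarrow> real) \<Rightarrow> real^'n \<Rightarrow> real^'n" where
  "grad f x = (\<chi> i. partial_deriv i f x)"

text \<open>The class \<open>C\<^sup>k(S)\<close>; meaningful for open \<open>S\<close>.\<close>

primrec Ck_on :: "nat \<Rightarrow> (real^'n) set \<Rightarrow> (real^'n \<Rightarrow> real) \<Rightarrow> bool" where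
  "Ck_on 0 S f \<longleftrightarrow> continuous_on S f"
| "Ck_on (Suc k) S f \<longleftrightarrow>
     (\<forall>x\<in>S. f differentiable (at x)) \<and> (\<forall>i. Ck_on k S (partial_deriv i f))"

definition Cinf_on :: "(real^'n) set \<Rightarrow> (real^'n \<Rightarrow> real) \<Rightarrow> bool" where
  "Cinf_on S f \<longleftrightarrow> (\<forall>k. Ck_on k S f)"

section \<open>Smooth bounded domains\<close>

definition bounded_domain :: "(real^'n) set \<Rightarrow> bool" where
  "bounded_domain \<Omega> \<longleftrightarrow> open \<Omega> \<and> connected \<Omega> \<and> \<Omega> \<noteq> {} \<and> bounded \<Omega>"

text \<open>
  The boundary is smooth if, near each of its points, and up to relabelling and reorienting the
  coordinate axes (the choice of \<open>i\<close> and of the sign \<open>\<sigma>\<close>), \<open>\<Omega>\<close> is the region above the graph of a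
  smooth function of the remaining \<open>N - 1\<close> coordinates. Such a function is encoded as a smooth
  function on the whole space that does not depend on the \<open>i\<close>-th coordinate.
\<close>

definition smooth_boundary :: "(real^'n) set \<Rightarrow> bool" where
  "smooth_boundary \<Omega> \<longleftrightarrow>
     (\<forall>x0\<in>frontier \<Omega>. \<exists>r>0. \<exists>i. \<exists>\<sigma>\<in>{1, -1}. \<exists>\<gamma>.
        Cinf_on UNIV \<gamma> \<and> (\<forall>x t. \<gamma> (x + t *\<^sub>R axis i 1) = \<gamma> x) \<and>
        \<Omega> \<inter> ball x0 r = {x \<in> ball x0 r. \<sigma> * x $ i > \<gamma> x})"

definition smooth_bounded_domain :: "(real^'n) set \<Rightarrow> bool" where
  "smooth_bounded_domain \<Omega> \<longleftrightarrow> bounded_domain \<Omega> \<and> smooth_boundary \<Omega>"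

section \<open>Lebesgue and Sobolev spaces\<close>

text \<open>
  Elements of function spaces are represented by functions on the whole space, of which only the
  restriction to \<open>\<Omega>\<close> (to its closure, for continuous functions) matters. The norms below are
  meaningful only for members of the corresponding spaces.
\<close>

definition in_Lp :: "(real^'n) set \<Rightarrow> real \<Rightarrow> (real^'n \<Rightarrow> 'b::euclidean_space) \<Rightarrow> bool" where
  "in_Lp \<Omega> s f \<longleftrightarrow>
     f \<in> borel_measurable (lebesgue_on \<Omega>) \<and> integrable (lebesgue_on \<Omega>) (\<lambda>x. norm (f x) powr s)"

definition Lp_norm :: "(real^'n) set \<Rightarrow> real \<Rightarrow> (real^'n \<Rightarrow> 'b::euclidean_space) \<Rightarrow> real" where
  "Lp_norm \<Omega> s f = (LINT x|lebesgue_on \<Omega>. norm (f x) powr s) powr (1 / s)"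

definition in_Linf :: "(real^'n) set \<Rightarrow> (real^'n \<Rightarrow> 'b::euclidean_space) \<Rightarrow> bool" where
  "in_Linf \<Omega> f \<longleftrightarrow>
     f \<in> borel_measurable (lebesgue_on \<Omega>) \<and> esssup (lebesgue_on \<Omega>) (\<lambda>x. ereal (norm (f x))) < \<infinity>"

definition Linf_norm :: "(real^'n) set \<Rightarrow> (real^'n \<Rightarrow> 'b::euclidean_space) \<Rightarrow> real" where
  "Linf_norm \<Omega> f = real_of_ereal (esssup (lebesgue_on \<Omega>) (\<lambda>x. ereal (norm (f x))))"

definition locally_integrable :: "(real^'n) set \<Rightarrow> (real^'n \<Rightarrow> 'b::euclidean_space) \<Rightarrow> bool" where
  "locally_integrable \<Omega> f \<longleftrightarrow> (\<forall>K. compact K \<and> K \<subseteq> \<Omega> \<longrightarrow> set_integrable lebesgue K f)"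

definition test_function :: "(real^'n) set \<Rightarrow> (real^'n \<Rightarrow> real) \<Rightarrow> bool" where
  "test_function \<Omega> \<phi> \<longleftrightarrow>
     Cinf_on UNIV \<phi> \<and> compact (closure {x. \<phi> x \<noteq> 0}) \<and> closure {x. \<phi> x \<noteq> 0} \<subseteq> \<Omega>"

definition is_weak_grad ::
  "(real^'n) set \<Rightarrow> (real^'n \<Rightarrow> real) \<Rightarrow> (real^'n \<Rightarrow> real^'n) \<Rightarrow> bool" where
  "is_weak_grad \<Omega> u g \<longleftrightarrow>
     locally_integrable \<Omega> u \<and> locally_integrable \<Omega> g \<and>
     (\<forall>\<phi> i. test_function \<Omega> \<phi> \<longrightarrow>
        (LINT x|lebesgue_on \<Omega>. u x * partial_deriv i \<phi> x) =
        - (LINT x|lebesgue_on \<Omega>. g x $ i * \<phi> x))"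

text \<open>
  Weak gradients on an open set are unique almost everywhere, so the choice made here is
  immaterial in integrals and norms.
\<close>

definition weak_grad :: "(real^'n) set \<Rightarrow> (real^'n \<Rightarrow> real) \<Rightarrow> real^'n \<Rightarrow> real^'n" where
  "weak_grad \<Omega> u = (SOME g. is_weak_grad \<Omega> u g)"

definition W1p :: "(real^'n) set \<Rightarrow> real \<Rightarrow> (real^'n \<Rightarrow> real) set" where
  "W1p \<Omega> s = {u. in_Lp \<Omega> s u \<and> (\<exists>g. is_weak_grad \<Omega> u g) \<and> in_Lp \<Omega> s (weak_grad \<Omega> u)}"

definition W1inf :: "(real^'n) set \<Rightarrow> (real^'n \<Rightarrow> real) set" where
  "W1inf \<Omega> = {u. in_Linf \<Omega> u \<and> (\<exists>g. is_weak_grad \<Omega> u g) \<and> in_Linf \<Omega> (weak_grad \<Omega> u)}"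

text \<open>\<open>W\<^sub>0\<^sup>1\<^sup>,\<^sup>s(\<Omega>)\<close> is the closure of the test functions in \<open>W\<^sup>1\<^sup>,\<^sup>s(\<Omega>)\<close>.\<close>

definition W01p :: "(real^'n) set \<Rightarrow> real \<Rightarrow> (real^'n \<Rightarrow> real) set" where
  "W01p \<Omega> s = {u \<in> W1p \<Omega> s. \<exists>\<phi>. (\<forall>n. test_function \<Omega> (\<phi> n)) \<and>
     (\<lambda>n. Lp_norm \<Omega> s (\<lambda>x. \<phi> n x - u x)) \<longlonglongrightarrow> 0 \<and>
     (\<lambda>n. Lp_norm \<Omega> s (\<lambda>x. grad (\<phi> n) x - weak_grad \<Omega> u x)) \<longlonglongrightarrow> 0}"

definition C0_closure :: "(real^'n) set \<Rightarrow> (real^'n \<Rightarrow> real) set" where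
  "C0_closure \<Omega> = {u. continuous_on (closure \<Omega>) u \<and> (\<forall>x\<in>frontier \<Omega>. u x = 0)}"

text \<open>The set below is nonempty and its infimum is attained, so this is the minimum.\<close>

definition Lambda_inf :: "(real^'n) set \<Rightarrow> real" where
  "Lambda_inf \<Omega> = Inf {Linf_norm \<Omega> (weak_grad \<Omega> u) / Linf_norm \<Omega> u | u.
     u \<in> W1inf \<Omega> \<inter> C0_closure \<Omega> \<and> (\<exists>x\<in>\<Omega>. u x \<noteq> 0)}"

section \<open>Least energy solutions and limit pairs\<close>

text \<open>
  For \<open>p, q > N\<close>, elements of \<open>W\<^sub>0\<^sup>1\<^sup>,\<^sup>m(\<Omega>)\<close> with \<open>m = max p q\<close> are identified with their
  representatives that are continuous up to the boundary.
\<close>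

definition Xpq :: "(real^'n) set \<Rightarrow> real \<Rightarrow> real \<Rightarrow> (real^'n \<Rightarrow> real) set" where
  "Xpq \<Omega> p q = {u \<in> W01p \<Omega> (max p q). continuous_on (closure \<Omega>) u}"

definition energy ::
  "(real^'n) set \<Rightarrow> real \<Rightarrow> real \<Rightarrow> real \<Rightarrow> (real^'n \<Rightarrow> real) \<Rightarrow> real" where
  "energy \<Omega> p q l u =
     1 / p * Lp_norm \<Omega> p (weak_grad \<Omega> u) powr p + 1 / q * Lp_norm \<Omega> q (weak_grad \<Omega> u) powr q
     - l / p * Linf_norm \<Omega> u powr p"

definition nehari :: "(real^'n) set \<Rightarrow> real \<Rightarrow> real \<Rightarrow> real \<Rightarrow> (real^'n \<Rightarrow> real) set" where
  "nehari \<Omega> p q l = {u \<in> Xpq \<Omega> p q. (\<exists>x\<in>\<Omega>. u x \<noteq> 0) \<and>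
     Lp_norm \<Omega> p (weak_grad \<Omega> u) powr p + Lp_norm \<Omega> q (weak_grad \<Omega> u) powr q
     = l * Linf_norm \<Omega> u powr p}"

definition least_energy_solution ::
  "(real^'n) set \<Rightarrow> real \<Rightarrow> real \<Rightarrow> real \<Rightarrow> (real^'n \<Rightarrow> real) \<Rightarrow> bool" where
  "least_energy_solution \<Omega> p q l u \<longleftrightarrow>
     real CARD('n) < p \<and> p < q \<and> u \<in> Xpq \<Omega> p q \<and>
       (\<forall>v\<in>Xpq \<Omega> p q. energy \<Omega> p q l u \<le> energy \<Omega> p q l v)
   \<or> real CARD('n) < q \<and> q < p \<and> u \<in> nehari \<Omega> p q l \<and>
       (\<forall>v\<in>nehari \<Omega> p q l. energy \<Omega> p q l u \<le> energy \<Omega> p q l v)"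

definition only_max_point :: "(real^'n) set \<Rightarrow> (real^'n \<Rightarrow> real) \<Rightarrow> real^'n \<Rightarrow> bool" where
  "only_max_point \<Omega> u x \<longleftrightarrow> x \<in> closure \<Omega> \<and> (\<forall>y\<in>closure \<Omega>. y \<noteq> x \<longrightarrow> u y < u x)"

definition limit_pair ::
  "(real^'n) set \<Rightarrow> (real \<Rightarrow> real^'n \<Rightarrow> real) \<Rightarrow> (real \<Rightarrow> real^'n)
    \<Rightarrow> (real^'n \<Rightarrow> real) \<Rightarrow> real^'n \<Rightarrow> bool" where
  "limit_pair \<Omega> u x u\<^sub>\<Lambda> x\<^sub>\<Lambda> \<longleftrightarrow>
     u\<^sub>\<Lambda> \<in> W1inf \<Omega> \<inter> C0_closure \<Omega> \<and> x\<^sub>\<Lambda> \<in> \<Omega> \<and>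
     (\<exists>P :: nat \<Rightarrow> real. filterlim P at_top sequentially \<and>
        (\<lambda>n. x (P n)) \<longlonglongrightarrow> x\<^sub>\<Lambda> \<and>
        uniform_limit (closure \<Omega>) (\<lambda>n. u (P n)) u\<^sub>\<Lambda> sequentially)"

section \<open>Infinity-harmonic functions\<close>

definition inf_laplacian :: "(real^'n \<Rightarrow> real) \<Rightarrow> real^'n \<Rightarrow> real" where
  "inf_laplacian \<phi> x = (\<Sum>i\<in>UNIV. \<Sum>j\<in>UNIV.
     partial_deriv i \<phi> x * partial_deriv j \<phi> x * partial_deriv j (partial_deriv i \<phi>) x)"

definition touches_below ::
  "(real^'n) set \<Rightarrow> (real^'n \<Rightarrow> real) \<Rightarrow> (real^'n \<Rightarrow> real) \<Rightarrow> real^'n \<Rightarrow> bool" where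
  "touches_below D \<phi> u x0 \<longleftrightarrow> \<phi> x0 = u x0 \<and> (\<forall>x\<in>D - {x0}. \<phi> x < u x)"

definition touches_above ::
  "(real^'n) set \<Rightarrow> (real^'n \<Rightarrow> real) \<Rightarrow> (real^'n \<Rightarrow> real) \<Rightarrow> real^'n \<Rightarrow> bool" where
  "touches_above D \<phi> u x0 \<longleftrightarrow> \<phi> x0 = u x0 \<and> (\<forall>x\<in>D - {x0}. \<phi> x > u x)"

definition inf_harmonic :: "(real^'n) set \<Rightarrow> (real^'n \<Rightarrow> real) \<Rightarrow> bool" where
  "inf_harmonic D u \<longleftrightarrow> bounded_domain D \<and> continuous_on (closure D) u \<and>
     (\<forall>x0\<in>D. \<forall>\<phi>. Ck_on 2 D \<phi> \<longrightarrow>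
        (touches_above D \<phi> u x0 \<longrightarrow> inf_laplacian \<phi> x0 \<ge> 0) \<and>
        (touches_below D \<phi> u x0 \<longrightarrow> inf_laplacian \<phi> x0 \<le> 0))"

end

theory Submission
  imports Defs "HOL-Computational_Algebra.Polynomial"
begin

text \<open>
  Away from its maximum point a least energy solution minimizes
  \<open>\<integral> |\<nabla>u|\<^sup>p / p + |\<nabla>u|\<^sup>q / q\<close> under compactly supported perturbations, since these do not change
  the sup norm when they are small and the functional is convex. If a quadratic polynomial
  \<open>\<phi>\<close> with \<open>\<Delta>\<^sub>\<infinity>\<phi> < 0\<close> touched the limit strictly from above, then for large exponents \<open>\<phi>\<close> would be
  a strict supersolution of the \<open>p\<close>- and of the \<open>q\<close>-Laplace equation, and convexity together with one
  integration by parts shows that cutting \<open>u\<close> off smoothly at the level \<open>\<phi> - c\<close> lowers both energies;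
  touching from below is the same statement for \<open>-u\<close>. Hence the limit is infinity-harmonic in the
  sense of second order jets, to which Hopf's strong maximum principle applies. The limit is not
  zero: for \<open>q < p\<close> by the Nehari identity and a Sobolev inequality uniform in the exponent, for
  \<open>p < q\<close> by comparing the energy with that of smooth cones, using that \<open>\<Lambda>\<^sub>\<infinity>\<close> is at least the
  reciprocal of the inradius.
\<close>

section \<open>Smooth functions\<close>

text \<open>The obstacle is the sup norm in the energy, which is not differentiable, together with
  the Nehari constraint for \<open>q < p\<close>. Both are handled by going only a small fraction t
  of the way to a competitor and letting convexity carry the comparison over to t = 1. The cut-off
  subtracts \<open>\<eta> * bump (u - \<phi>)\<close>, with the flat function exp (- 1 / t) in place
  of a positive part, because the Sobolev space is a closure of test functions and a smooth
  composition turns test functions into test functions. As the slope of \<open>bump\<close> lies in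
  [0, 1], the new gradient is a convex combination of the gradients of \<open>u\<close> and
  \<open>\<phi>\<close>. Jets are used because they are local: Hopf's barrier lives on a thin shell
  only. Positivity of the limit would fail if the maxima tended to 0, whence the lower bounds on
  them. If \<Lambda> equals the minimal quotient and p < q, the limit of the roots
  \<open>lam p powr (1 / p)\<close> is too weak for such a bound; the constant c > 1 supplies the
  margin, and the comparison cone has to grow with p.\<close>

definition smooth_real_on :: "real set \<Rightarrow> (real \<Rightarrow> real) \<Rightarrow> bool" where
  "smooth_real_on T h \<longleftrightarrow>
     (\<exists>D. D 0 = h \<and> (\<forall>k. \<forall>t\<in>T. (D k has_real_derivative D (Suc k) t) (at t)))"

lemma smooth_real_on_deriv:
  assumes "smooth_real_on T h"
  obtains h' where "smooth_real_on T h'" "\<And>t. t \<in> T \<Longrightarrow> (h has_real_derivative h' t) (at t)"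
proof -
  obtain D where D: "D 0 = h" "\<And>k t. t \<in> T \<Longrightarrow> (D k has_real_derivative D (Suc k) t) (at t)"
    using assms unfolding smooth_real_on_def by blast
  have "smooth_real_on T (D (Suc 0))"
    unfolding smooth_real_on_def using D by (intro exI[of _ "\<lambda>k. D (Suc k)"]) auto
  with D show ?thesis using that by metis
qed

section \<open>Functions that are flat at the origin\<close>

definition bump_poly :: "real poly \<Rightarrow> real \<Rightarrow> real" where
  "bump_poly p t = (if t \<le> 0 then 0 else poly p (1 / t) * exp (- 1 / t))"

definition bump :: "real \<Rightarrow> real" where
  "bump t = (if t \<le> 0 then 0 else exp (- 1 / t))"

lemma poly_div_exp_tendsto_0: "((\<lambda>x. poly p x / exp x) \<longlongrightarrow> (0::real)) at_top"
proof -
  have "((\<lambda>x. \<Sum>i\<le>degree p. coeff p i * (x ^ i / exp x)) \<longlongrightarrow> (\<Sum>i\<le>degree p. coeff p i * 0)) at_top"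
    by (intro tendsto_intros tendsto_power_div_exp_0)
  then show ?thesis by (simp add: poly_altdef sum_divide_distrib)
qed

text \<open>The family p(1 / t) exp (- 1 / t) is closed under differentiation: with s = 1 / t the
  chain rule yields the polynomial s^2 (p - p'). Iterating this map on polynomials lists all
  derivatives of \<open>bump\<close> at once. At t = 0 both one-sided difference quotients vanish in
  the limit, since the exponential beats every polynomial.\<close>

lemma bump_poly_deriv:
  "(bump_poly p has_real_derivative bump_poly ([:0, 0, 1:] * (p - pderiv p)) t) (at t)"
proof -
  consider "t < 0" | "t > 0" | "t = 0" by linarith
  then show ?thesis
  proof cases
    case 1
    have "((\<lambda>_. 0) has_real_derivative 0) (at t)" by simp
    then show ?thesis
      by (rule has_field_derivative_transform_within_open[where S="{..<0}", THEN DERIV_cong])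
        (use 1 in \<open>auto simp: bump_poly_def\<close>)
  next
    case 2
    have "((\<lambda>t. poly p (1 / t) * exp (- 1 / t)) has_real_derivative
        bump_poly ([:0, 0, 1:] * (p - pderiv p)) t) (at t)"
      using 2
      by (auto intro!: derivative_eq_intros poly_DERIV[THEN DERIV_chain2]
          simp: bump_poly_def field_simps power2_eq_square)
    then show ?thesis
      by (rule has_field_derivative_transform_within_open[where S="{0<..}"])
        (use 2 in \<open>auto simp: bump_poly_def\<close>)
  next
    case 3
    have L: "((\<lambda>h. bump_poly p h / h) \<longlongrightarrow> 0) (at_left 0)"
      by (rule tendsto_eventually) (auto simp: eventually_at_left_field bump_poly_def intro: exI[of _ "-1"])
    \<comment> \<open>Under h = 1 / x the quotient \<open>bump_poly p h / h\<close> becomes x p(x)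
      exp (- x), and \<open>pCons 0 p\<close> is the polynomial x p(x).\<close>
    have "((\<lambda>x. poly (pCons 0 p) x / exp x) \<longlongrightarrow> 0) at_top"
      by (rule poly_div_exp_tendsto_0)
    then have "((\<lambda>x. bump_poly p (inverse x) / inverse x) \<longlongrightarrow> 0) at_top"
      by (rule Lim_transform_eventually)
        (auto intro!: eventually_mono[OF eventually_gt_at_top[of 0]]
          simp: bump_poly_def field_simps exp_minus)
    then have R: "((\<lambda>h. bump_poly p h / h) \<longlongrightarrow> 0) (at_right 0)"
      by (simp add: filterlim_at_right_to_top)
    have "((\<lambda>h. bump_poly p h / h) \<longlongrightarrow> 0) (at 0)"
      using L R by (simp add: filterlim_split_at)
    then show ?thesis using 3 by (simp add: DERIV_def bump_poly_def)
  qed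
qed

lemma bump_eq_bump_poly: "bump = bump_poly 1"
  by (auto simp: bump_def bump_poly_def)

lemma smooth_real_on_bump_poly: "smooth_real_on T (bump_poly p)"
proof -
  define D where "D k = bump_poly (((\<lambda>p. [:0, 0, 1:] * (p - pderiv p)) ^^ k) p)" for k
  show ?thesis unfolding smooth_real_on_def
    by (rule exI[of _ D]) (simp add: D_def bump_poly_deriv del: mult_pCons_left)
qed

lemma smooth_real_on_bump: "smooth_real_on T bump"
  by (simp add: bump_eq_bump_poly smooth_real_on_bump_poly)

definition bump' :: "real \<Rightarrow> real" where
  "bump' t = (if t \<le> 0 then 0 else exp (- 1 / t) / t\<^sup>2)"

lemma bump'_eq_bump_poly: "bump' = bump_poly [:0, 0, 1:]"
  by (auto simp: bump'_def bump_poly_def power2_eq_square)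

lemma bump_deriv: "(bump has_real_derivative bump' t) (at t)"
  using bump_poly_deriv[of 1 t] by (simp add: bump_eq_bump_poly bump'_eq_bump_poly)

lemma continuous_on_bump: "continuous_on S bump"
  using bump_deriv by (meson DERIV_isCont continuous_at_imp_continuous_on)

lemma continuous_on_bump': "continuous_on S bump'"
  using bump_poly_deriv unfolding bump'_eq_bump_poly
  by (meson DERIV_isCont continuous_at_imp_continuous_on)

lemma bump'_nonneg: "0 \<le> bump' t" by (simp add: bump'_def)

text \<open>Squaring 1 + x \<le> exp x at x = s / 2 - 1 gives s^2 \<le> (4 / exp 2) exp s, and exp 2
  is at least 4. Read at s = 1 / t, this bounds the slope of \<open>bump\<close>.\<close>

lemma square_le_exp: "(s::real)\<^sup>2 \<le> exp s" if "s \<ge> 0"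
proof -
  have "s / 2 \<le> exp (s / 2 - 1)" using exp_ge_add_one_self[of "s/2 - 1"] by simp
  then have "(s / 2)\<^sup>2 \<le> (exp (s / 2 - 1))\<^sup>2" using that by (intro power_mono) auto
  also have "\<dots> = exp (s - 2)" by (simp add: power2_eq_square flip: exp_add)
  also have "\<dots> = exp s / exp 2" by (simp add: exp_diff)
  finally have "s\<^sup>2 \<le> exp s * (4 / exp 2)" by (simp add: field_simps power2_eq_square)
  also have "4 / exp 2 \<le> (1::real)"
  proof -
    have "(2::real) \<le> exp 1" using exp_ge_add_one_self[of 1] by simp
    then have "(2::real)\<^sup>2 \<le> (exp 1)\<^sup>2" by (intro power_mono) auto
    also have "\<dots> = exp 2" by (simp add: power2_eq_square flip: exp_add)
    finally show ?thesis by simp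
  qed
  finally show ?thesis by (simp add: mult_left_le)
qed

text \<open>The constant one, and not just some bound, matters later: together with 0 \<le> \<eta>
  \<le> 1 it makes \<open>\<eta> x * bump' (u x - \<phi> x)\<close> a weight in [0, 1], so that the
  gradient of the truncated function is a convex combination.\<close>

lemma bump'_le_1: "bump' t \<le> 1"
proof (cases "t \<le> 0")
  case False
  have "(1 / t)\<^sup>2 \<le> exp (1 / t)" using False by (intro square_le_exp) auto
  then show ?thesis using False by (simp add: bump'_def field_simps exp_minus power2_eq_square)
qed (simp add: bump'_def)

lemma bump_nonneg: "0 \<le> bump t" and bump_le_1: "bump t \<le> 1" and bump_pos: "t > 0 \<Longrightarrow> bump t > 0"
  and bump_0: "t \<le> 0 \<Longrightarrow> bump t = 0"
  by (auto simp: bump_def)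

lemma bump_mono: "s \<le> t \<Longrightarrow> bump s \<le> bump t"
  by (auto simp: bump_def field_simps)

lemma bump'_0: "t \<le> 0 \<Longrightarrow> bump' t = 0" by (simp add: bump'_def)

lemma bump_lipschitz: "\<bar>bump s - bump t\<bar> \<le> \<bar>s - t\<bar>"
proof -
  have "norm (bump s - bump t) \<le> 1 * norm (s - t)"
    by (rule field_differentiable_bound[where S=UNIV and f'=bump'])
      (auto simp: bump_deriv bump'_nonneg bump'_le_1)
  then show ?thesis by simp
qed

text \<open>Rescaled bumps approximate the indicator of the positive half-line from within [0, 1];
  products of them over the faces of a box will approximate the indicator of the box.\<close>

lemma bump_scale_tendsto: "(\<lambda>k. bump (real k * t)) \<longlonglongrightarrow> (if t > 0 then 1 else 0)"
proof (cases "t > 0")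
  case True
  have "(\<lambda>k. exp (- ((1 / t) * (1 / real k)))) \<longlonglongrightarrow> exp (- ((1 / t) * 0))"
    by (intro tendsto_intros lim_1_over_n)
  moreover have "\<forall>\<^sub>F k in sequentially. exp (- ((1 / t) * (1 / real k))) = bump (real k * t)"
    using eventually_gt_at_top[of 0]
    by eventually_elim (use True in \<open>auto simp: bump_def field_simps zero_less_mult_iff mult_le_0_iff\<close>)
  ultimately show ?thesis using True by (auto elim: Lim_transform_eventually)
qed (simp add: bump_0 mult_nonneg_nonpos)

text \<open>\<open>ramp t = t exp (- 1 / t)\<close> is a smooth substitute for the positive part with
  slope in \<open>[0, 1]\<close> and \<open>ramp t \<ge> t - 1\<close>.\<close>

definition ramp :: "real \<Rightarrow> real" where
  "ramp t = t * bump t"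

definition ramp' :: "real \<Rightarrow> real" where
  "ramp' t = bump t + t * bump' t"

lemma ramp_deriv: "(ramp has_real_derivative ramp' t) (at t)"
  unfolding ramp_def[abs_def] ramp'_def by (auto intro!: derivative_eq_intros bump_deriv)

lemma ramp'_nonneg: "0 \<le> ramp' t"
  by (cases "t \<le> 0") (auto simp: ramp'_def bump_0 bump'_0 bump_nonneg bump'_nonneg)

lemma ramp'_le_1: "ramp' t \<le> 1"
proof (cases "t \<le> 0")
  case False
  have "ramp' t = (1 + 1 / t) * exp (- 1 / t)"
    using False by (simp add: ramp'_def bump_def bump'_def power2_eq_square field_simps)
  also have "\<dots> \<le> exp (1 / t) * exp (- 1 / t)"
    by (intro mult_right_mono exp_ge_add_one_self) auto
  finally show ?thesis by (simp flip: exp_add)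
qed (simp add: ramp'_def bump_0 bump'_0)

lemma ramp_ge: "t - 1 \<le> ramp t"
proof (cases "t \<le> 0")
  case False
  have "1 + (- 1 / t) \<le> exp (- 1 / t)" by (rule exp_ge_add_one_self)
  then have "t * (1 + (- 1 / t)) \<le> t * exp (- 1 / t)" using False by (intro mult_left_mono) auto
  then show ?thesis using False by (simp add: ramp_def bump_def algebra_simps)
qed (simp add: ramp_def bump_0)

lemma ramp_0: "t \<le> 0 \<Longrightarrow> ramp t = 0" by (simp add: ramp_def bump_0)

lemma ramp_nonneg: "ramp t \<ge> 0" by (simp add: ramp_def bump_def)

lemma ramp_mono: "s \<le> t \<Longrightarrow> ramp s \<le> ramp t"
  by (rule DERIV_nonneg_imp_nondecreasing) (use ramp_deriv ramp'_nonneg in blast)+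

subsection \<open>Closure properties of smoothness\<close>

lemma partial_deriv_eqI: "(f has_derivative f') (at x) \<Longrightarrow> partial_deriv i f x = f' (axis i 1)"
  unfolding partial_deriv_def using frechet_derivative_at by metis

lemma partial_deriv_GDERIV: "GDERIV f x :> g \<Longrightarrow> partial_deriv i f x = g $ i"
  by (auto simp: gderiv_def inner_axis' dest!: partial_deriv_eqI[of _ _ _ i])

lemma grad_eqI: "GDERIV f x :> g \<Longrightarrow> grad f x = g"
  by (simp add: grad_def partial_deriv_GDERIV vec_eq_iff)

lemma linear_eq_inner_axis: "linear f' \<Longrightarrow> f' h = h \<bullet> (\<chi> i. f' (axis i 1))" for f' :: "real^'n \<Rightarrow> real"
proof -
  assume l: "linear f'"
  have "f' h = f' (\<Sum>i\<in>UNIV. h $ i *\<^sub>R axis i 1)"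
    by (simp add: basis_expansion flip: scalar_mult_eq_scaleR)
  also have "\<dots> = (\<Sum>i\<in>UNIV. h $ i * f' (axis i 1))"
    using l by (simp add: linear_sum linear_cmul)
  finally show ?thesis by (simp add: inner_vec_def)
qed

lemma GDERIV_grad: "f differentiable (at x) \<Longrightarrow> GDERIV f x :> grad f x"
  for f :: "real^'n \<Rightarrow> real"
proof -
  assume "f differentiable (at x)"
  then have d: "(f has_derivative frechet_derivative f (at x)) (at x)"
    by (simp add: frechet_derivative_works)
  then have "frechet_derivative f (at x) = (\<lambda>h. h \<bullet> grad f x)"
    using linear_eq_inner_axis[OF has_derivative_linear[OF d]]
    unfolding grad_def partial_deriv_def by blast
  then show ?thesis using d by (simp add: gderiv_def)
qed

lemma GDERIV_differentiable: "GDERIV f x :> g \<Longrightarrow> f differentiable (at x)"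
  by (auto simp: gderiv_def differentiable_def)

lemma GDERIV_transform_within_open:
  "GDERIV f x :> g \<Longrightarrow> open S \<Longrightarrow> x \<in> S \<Longrightarrow> (\<And>y. y \<in> S \<Longrightarrow> f y = f' y) \<Longrightarrow> GDERIV f' x :> g"
  unfolding gderiv_def by (erule (2) has_derivative_transform_within_open) simp

text \<open>Derivatives at a point of an open set see only the values in that set. This lets the
  closure lemmas below replace a partial derivative by a formula that is known on \<open>S\<close>
  only.\<close>

lemma Ck_on_cong:
  assumes "open S" "\<And>x. x \<in> S \<Longrightarrow> f x = g x"
  shows "Ck_on k S f \<longleftrightarrow> Ck_on k S g"
  using assms(2)
proof (induction k arbitrary: f g)
  case 0
  then show ?case by (auto cong: continuous_on_cong)
next
  case (Suc k)
  have *: "f differentiable at x \<longleftrightarrow> g differentiable at x" if "x \<in> S" for x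
    using that Suc.prems assms(1)
    by (metis GDERIV_differentiable GDERIV_grad GDERIV_transform_within_open)
  have d: "partial_deriv i f x = partial_deriv i g x" if "x \<in> S" "f differentiable at x" for x i
    using that Suc.prems assms(1)
    by (metis GDERIV_grad GDERIV_transform_within_open partial_deriv_GDERIV)
  show ?case
  proof (cases "\<forall>x\<in>S. f differentiable at x")
    case True
    then have "Ck_on k S (partial_deriv i f) = Ck_on k S (partial_deriv i g)" for i
      using d by (intro Suc.IH) auto
    then show ?thesis using * by auto
  qed (use * in auto)
qed

lemma Ck_on_SucD: "Ck_on (Suc k) S f \<Longrightarrow> Ck_on k S f"
proof (induction k arbitrary: f)
  case 0
  then show ?case
    by (auto intro!: continuous_at_imp_continuous_on differentiable_imp_continuous_within)
qed auto

lemma Ck_on_differentiable: "Ck_on (Suc k) S f \<Longrightarrow> x \<in> S \<Longrightarrow> f differentiable (at x)"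
  by simp

lemma Ck_on_const: "Ck_on k S (\<lambda>_. c)" for S :: "(real^'n) set"
proof (induction k arbitrary: c)
  case (Suc k)
  have "partial_deriv i (\<lambda>_::real^'n. c) = (\<lambda>_. 0)" for i
    using partial_deriv_GDERIV[OF GDERIV_const[of c]] by fastforce
  then show ?case using Suc by simp
qed simp

lemma Ck_on_coord: "Ck_on k S (\<lambda>x. x $ i)" for S :: "(real^'n) set"
proof (cases k)
  case (Suc k')
  have d: "GDERIV (\<lambda>x. x $ i) x :> axis i 1" for x :: "real^'n"
    unfolding gderiv_def inner_axis by (auto intro!: derivative_eq_intros bounded_linear_imp_has_derivative bounded_linear_vec_nth)
  have "partial_deriv j (\<lambda>x::real^'n. x $ i) = (\<lambda>_. axis i 1 $ j)" for j
    using partial_deriv_GDERIV[OF d] by fastforce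
  then show ?thesis using Suc GDERIV_differentiable[OF d] Ck_on_const by auto
qed (auto intro!: continuous_intros)

lemma Ck_on_add:
  assumes "open S"
  shows "Ck_on k S f \<Longrightarrow> Ck_on k S g \<Longrightarrow> Ck_on k S (\<lambda>x. f x + g x)"
proof (induction k arbitrary: f g)
  case (Suc k)
  have d: "GDERIV (\<lambda>x. f x + g x) x :> grad f x + grad g x" if "x \<in> S" for x
    using Suc.prems that by (intro GDERIV_add GDERIV_grad) auto
  have "Ck_on k S (partial_deriv i (\<lambda>x. f x + g x))" for i
    using Suc.IH[of "partial_deriv i f" "partial_deriv i g"] Suc.prems partial_deriv_GDERIV[OF d]
    by (subst Ck_on_cong[OF assms, where g="\<lambda>x. partial_deriv i f x + partial_deriv i g x"])
      (auto simp: grad_def)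
  then show ?case using GDERIV_differentiable[OF d] by auto
qed (auto intro!: continuous_intros)

lemma Ck_on_mult:
  assumes "open S"
  shows "Ck_on k S f \<Longrightarrow> Ck_on k S g \<Longrightarrow> Ck_on k S (\<lambda>x. f x * g x)"
proof (induction k arbitrary: f g)
  case (Suc k)
  have d: "GDERIV (\<lambda>x. f x * g x) x :> f x *\<^sub>R grad g x + g x *\<^sub>R grad f x" if "x \<in> S" for x
    using Suc.prems that by (intro GDERIV_mult GDERIV_grad) auto
  have "Ck_on k S (partial_deriv i (\<lambda>x. f x * g x))" for i
    using Ck_on_add[OF assms, of k "\<lambda>x. f x * partial_deriv i g x" "\<lambda>x. g x * partial_deriv i f x"]
      Suc.IH[of f "partial_deriv i g"] Suc.IH[of g "partial_deriv i f"]
      Suc.prems Ck_on_SucD[OF Suc.prems(1)] Ck_on_SucD[OF Suc.prems(2)]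
      partial_deriv_GDERIV[OF d]
    by (subst Ck_on_cong[OF assms, where g="\<lambda>x. f x * partial_deriv i g x + g x * partial_deriv i f x"])
      (auto simp: grad_def)
  then show ?case using GDERIV_differentiable[OF d] by auto
qed (auto intro!: continuous_intros)

lemma Ck_on_sum:
  assumes "open S" "finite I" "\<And>j. j \<in> I \<Longrightarrow> Ck_on k S (f j)"
  shows "Ck_on k S (\<lambda>x. \<Sum>j\<in>I. f j x)"
  using assms(2,3) by (induction I) (auto intro: Ck_on_add[OF assms(1)] Ck_on_const)

lemma Ck_on_prod:
  assumes "open S" "finite I" "\<And>j. j \<in> I \<Longrightarrow> Ck_on k S (f j)"
  shows "Ck_on k S (\<lambda>x. \<Prod>j\<in>I. f j x)"
  using assms(2,3) by (induction I) (auto intro: Ck_on_mult[OF assms(1)] Ck_on_const)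

lemma Ck_on_diff:
  assumes "open S" "Ck_on k S f" "Ck_on k S g"
  shows "Ck_on k S (\<lambda>x. f x - g x)"
  using Ck_on_add[OF assms(1,2) Ck_on_mult[OF assms(1) Ck_on_const[of k S "-1"] assms(3)]] by simp

text \<open>Induction on the order: a partial derivative of h o f is (h' o f) times a partial
  derivative of f. The witness sequence in \<open>smooth_real_on\<close> provides an h' that is
  again smooth, so the induction hypothesis applies with h generalized.\<close>

lemma Ck_on_compose:
  assumes "open S" "\<And>x. x \<in> S \<Longrightarrow> f x \<in> T"
  shows "smooth_real_on T h \<Longrightarrow> Ck_on k S f \<Longrightarrow> Ck_on k S (\<lambda>x. h (f x))"
proof (induction k arbitrary: h)
  case 0
  obtain h' where h': "\<And>t. t \<in> T \<Longrightarrow> (h has_real_derivative h' t) (at t)"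
    using smooth_real_on_deriv[OF 0(1)] by metis
  then have "continuous_on T h" by (meson DERIV_isCont continuous_at_imp_continuous_on)
  then show ?case using 0 assms(2) by (auto intro: continuous_on_compose2)
next
  case (Suc k)
  obtain h' where h': "smooth_real_on T h'" "\<And>t. t \<in> T \<Longrightarrow> (h has_real_derivative h' t) (at t)"
    using smooth_real_on_deriv[OF Suc.prems(1)] by metis
  have d: "GDERIV (\<lambda>x. h (f x)) x :> h' (f x) *\<^sub>R grad f x" if "x \<in> S" for x
    using Suc.prems that assms(2) h' by (intro GDERIV_DERIV_compose GDERIV_grad) auto
  have "Ck_on k S (partial_deriv i (\<lambda>x. h (f x)))" for i
    using Ck_on_mult[OF assms(1) Suc.IH[OF h'(1)], of "partial_deriv i f"]
      Ck_on_SucD[OF Suc.prems(2)] Suc.prems partial_deriv_GDERIV[OF d]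
    by (subst Ck_on_cong[OF assms(1), where g="\<lambda>x. h' (f x) * partial_deriv i f x"])
      (auto simp: grad_def)
  then show ?case using GDERIV_differentiable[OF d] by auto
qed

lemma Cinf_on_inner:
  assumes S: "open S" and f: "\<And>i. Cinf_on S (\<lambda>x. f x $ i)" and g: "\<And>i. Cinf_on S (\<lambda>x. g x $ i)"
  shows "Cinf_on S (\<lambda>x. f x \<bullet> (g x :: real^'m))"
  using f g unfolding Cinf_on_def inner_vec_def
  by (auto intro!: Ck_on_sum[OF S] Ck_on_mult[OF S])

lemma Cinf_on_const: "Cinf_on S (\<lambda>_. c)"
  and Cinf_on_coord: "Cinf_on S (\<lambda>x. x $ i)"
  by (auto simp: Cinf_on_def Ck_on_const Ck_on_coord)

lemma Cinf_on_add: "open S \<Longrightarrow> Cinf_on S f \<Longrightarrow> Cinf_on S g \<Longrightarrow> Cinf_on S (\<lambda>x. f x + g x)"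
  and Cinf_on_diff: "open S \<Longrightarrow> Cinf_on S f \<Longrightarrow> Cinf_on S g \<Longrightarrow> Cinf_on S (\<lambda>x. f x - g x)"
  and Cinf_on_mult: "open S \<Longrightarrow> Cinf_on S f \<Longrightarrow> Cinf_on S g \<Longrightarrow> Cinf_on S (\<lambda>x. f x * g x)"
  by (auto simp: Cinf_on_def Ck_on_add Ck_on_diff Ck_on_mult)

lemma Cinf_on_sum: "open S \<Longrightarrow> finite I \<Longrightarrow> (\<And>j. j \<in> I \<Longrightarrow> Cinf_on S (f j)) \<Longrightarrow> Cinf_on S (\<lambda>x. \<Sum>j\<in>I. f j x)"
  and Cinf_on_prod: "open S \<Longrightarrow> finite I \<Longrightarrow> (\<And>j. j \<in> I \<Longrightarrow> Cinf_on S (f j)) \<Longrightarrow> Cinf_on S (\<lambda>x. \<Prod>j\<in>I. f j x)"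
  by (auto simp: Cinf_on_def Ck_on_sum Ck_on_prod)

lemma Cinf_on_compose:
  "open S \<Longrightarrow> (\<And>x. x \<in> S \<Longrightarrow> f x \<in> T) \<Longrightarrow> smooth_real_on T h \<Longrightarrow> Cinf_on S f \<Longrightarrow> Cinf_on S (\<lambda>x. h (f x))"
  by (auto simp: Cinf_on_def intro: Ck_on_compose)

lemma Cinf_on_norm_sq: "open S \<Longrightarrow> Cinf_on S (\<lambda>x. (x - c) \<bullet> (x - c))"
  by (auto intro!: Cinf_on_inner Cinf_on_diff Cinf_on_coord Cinf_on_const)

lemmas Cinf_intros = Cinf_on_const Cinf_on_coord Cinf_on_add[OF open_UNIV] Cinf_on_diff[OF open_UNIV]
  Cinf_on_mult[OF open_UNIV] Cinf_on_sum[OF open_UNIV] Cinf_on_norm_sq[OF open_UNIV]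
  Cinf_on_compose[OF open_UNIV UNIV_I smooth_real_on_bump]

lemma Cinf_GDERIV: "Cinf_on UNIV f \<Longrightarrow> GDERIV f x :> grad f x"
  unfolding Cinf_on_def using Ck_on_differentiable[of 0 UNIV f x] GDERIV_grad by blast

lemma Cinf_partial_deriv: "Cinf_on UNIV f \<Longrightarrow> Cinf_on UNIV (partial_deriv i f)"
  unfolding Cinf_on_def by (metis Ck_on.simps(2))

lemma Cinf_continuous_on: "Cinf_on UNIV f \<Longrightarrow> continuous_on S f"
  unfolding Cinf_on_def using Ck_on.simps(1) continuous_on_subset by blast

lemma Cinf_continuous_on_partial: "Cinf_on UNIV f \<Longrightarrow> continuous_on S (partial_deriv i f)"
  by (simp add: Cinf_partial_deriv Cinf_continuous_on)

lemma Cinf_continuous_on_grad: "Cinf_on UNIV f \<Longrightarrow> continuous_on S (grad f)"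
  unfolding grad_def[abs_def] by (intro continuous_intros Cinf_continuous_on_partial)

lemma grad_nth: "grad f x $ i = partial_deriv i f x"
  by (simp add: grad_def)

section \<open>Weak gradients\<close>

text \<open>The positive and the negative part of h are densities of two finite measures that agree
  on boxes. Boxes form an intersection-stable generator of the Borel sets, so the measures are
  equal, and uniqueness of densities makes the two parts agree almost everywhere; being never
  positive together, they vanish. The Borel version \<open>h'\<close> is taken because boxes
  generate only the Borel sets.\<close>

lemma AE_zero_if_box_integrals_zero:
  fixes h :: "'a::euclidean_space \<Rightarrow> real"
  assumes h: "integrable lebesgue h"
    and box0: "\<And>a b. (LINT x|lebesgue. indicator (box a b) x * h x) = 0"
  shows "AE x in lebesgue. h x = 0"
proof -
  obtain h' where h'[measurable]: "h' \<in> borel_measurable lborel" and eq: "AE x in lborel. h x = h' x"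
    using completion_ex_borel_measurable_real[of h lborel] h by auto
  have eqc: "AE x in lebesgue. h x = h' x" using eq by (rule AE_completion)
  have h'c: "h' \<in> borel_measurable lebesgue" using h' by (rule measurable_completion)
  have "integrable lebesgue h'" using h eqc h'c by (subst integrable_cong_AE[of _ _ h]) (auto elim: eventually_mono)
  then have i': "integrable lborel h'" using h' integrable_completion by blast
  have b0: "(LINT x|lborel. indicator (box a b) x * h' x) = 0" for a b
  proof -
    have "(LINT x|lborel. indicator (box a b) x * h' x) = (LINT x|lebesgue. indicator (box a b) x * h' x)"
      by (rule integral_completion[symmetric]) measurable
    also have "\<dots> = (LINT x|lebesgue. indicator (box a b) x * h x)"
      using eqc h h'c
      by (intro integral_cong_AE borel_measurable_times borel_measurable_indicator) (auto simp: open_box sets_completionI_sets)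
    finally show ?thesis using box0 by simp
  qed
  \<comment> \<open>\<open>ennreal\<close> sends negative numbers to 0, so \<open>N 1\<close> and
    \<open>N (-1)\<close> have the positive and the negative part of \<open>h'\<close> as
    densities.\<close>
  define N where "N s = density lborel (\<lambda>x. ennreal (s * h' x))" for s :: real
  have em: "emeasure (N s) A = ennreal (LINT x|lborel. max 0 (s * h' x) * indicator A x)"
    if A: "A \<in> sets borel" for s A
  proof -
    have "emeasure (N s) A = (\<integral>\<^sup>+x. ennreal (s * h' x) * indicator A x \<partial>lborel)"
      unfolding N_def using A by (subst emeasure_density) auto
    also have "\<dots> = (\<integral>\<^sup>+x. ennreal (max 0 (s * h' x) * indicator A x) \<partial>lborel)"
      by (intro nn_integral_cong) (auto simp: indicator_def max_def ennreal_neg)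
    also have "\<dots> = ennreal (LINT x|lborel. max 0 (s * h' x) * indicator A x)"
      using A i' by (intro nn_integral_eq_integral integrable_real_mult_indicator integrable_max) auto
    finally show ?thesis .
  qed
  let ?E = "range (\<lambda>(a, b). box a b :: 'a set)"
  have "N 1 = N (-1)"
  proof (rule measure_eqI_generator_eq[where E = ?E and \<Omega> = UNIV])
    show "Int_stable ?E"
      by (auto simp: Int_stable_def box_Int_box)
    show "sets (N 1) = sigma_sets UNIV ?E" "sets (N (-1)) = sigma_sets UNIV ?E"
      by (simp_all add: N_def borel_eq_box)
    fix X assume "X \<in> ?E"
    then obtain a b where X: "X = box a b" by auto
    have "integrable lborel (\<lambda>x. max 0 (s * h' x) * indicator X x)" for s :: real
      using i' X by (intro integrable_real_mult_indicator integrable_max) auto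
    note D = Bochner_Integration.integral_diff[OF this[of 1] this[of "-1"]]
    have "(LINT x|lborel. max 0 (1 * h' x) * indicator X x) - (LINT x|lborel. max 0 (-1 * h' x) * indicator X x)
        = (LINT x|lborel. indicator (box a b) x * h' x)"
      by (subst D[symmetric], rule Bochner_Integration.integral_cong) (auto simp: X indicator_def max_def)
    then show "emeasure (N 1) X = emeasure (N (-1)) X" using b0 X by (simp add: em)
  next
    show "range (\<lambda>n::nat. box (- (real n *\<^sub>R One)) (real n *\<^sub>R One) :: 'a set) \<subseteq> ?E" 
      "(\<Union>n::nat. box (- (real n *\<^sub>R One)) (real n *\<^sub>R One) :: 'a set) = UNIV"
      unfolding UN_box_eq_UNIV by auto
  qed (auto simp: em)
  moreover have "finite_measure (N 1)"
    by (rule finite_measureI) (simp add: em[of UNIV, simplified] N_def[THEN arg_cong[of _ _ space], simplified])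
  then have "sigma_finite_measure (N 1)" by (rule finite_measure.axioms(1))
  ultimately have "AE x in lborel. ennreal (1 * h' x) = ennreal (-1 * h' x)"
    unfolding N_def by (subst sigma_finite_density_unique[symmetric]) auto
  then have "AE x in lborel. h x = 0"
    using eq by eventually_elim (metis ennreal_eq_0_iff ennreal_neg linorder_le_cases mult_1 mult_minus1 neg_le_0_iff_le order_antisym)
  then show ?thesis by (rule AE_completion)
qed

lemma integrable_lebesgue_on_iff:
  fixes f :: "'a::euclidean_space \<Rightarrow> 'b::{banach, second_countable_topology}"
  assumes "S \<in> sets lebesgue"
  shows "integrable (lebesgue_on S) f \<longleftrightarrow> integrable lebesgue (\<lambda>x. indicator S x *\<^sub>R f x)"
  using assms by (intro integrable_restrict_space) auto

lemma integral_lebesgue_on: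
  fixes f :: "'a::euclidean_space \<Rightarrow> 'b::{banach, second_countable_topology}"
  assumes "S \<in> sets lebesgue"
  shows "(LINT x|lebesgue_on S. f x) = (LINT x|lebesgue. indicator S x *\<^sub>R f x)"
  using assms by (intro integral_restrict_space) auto

lemma open_sets_lebesgue: "open S \<Longrightarrow> S \<in> sets lebesgue"
  by (auto intro!: sets_completionI_sets)

lemma compact_sets_lebesgue: "compact S \<Longrightarrow> S \<in> sets lebesgue"
  by (auto intro!: sets_completionI_sets borel_closed compact_imp_closed)

section \<open>Test functions, their supports and bounds\<close>

lemma eq_0_outside_support: "x \<notin> closure {x. \<psi> x \<noteq> 0} \<Longrightarrow> \<psi> x = 0"
  using closure_subset[of "{x. \<psi> x \<noteq> 0}"] by auto

lemma grad_outside: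
  assumes "x \<notin> closure {x. \<psi> x \<noteq> 0}"
  shows "grad \<psi> x = 0"
proof -
  have "GDERIV \<psi> x :> 0"
  proof (rule GDERIV_transform_within_open[OF GDERIV_const])
    show "open (- closure {x. \<psi> x \<noteq> 0})" by (rule open_Compl[OF closed_closure])
    show "0 = \<psi> y" if "y \<in> - closure {x. \<psi> x \<noteq> 0}" for y
      using that closure_subset[of "{x. \<psi> x \<noteq> 0}"] by auto
  qed (use assms in auto)
  then show ?thesis by (rule grad_eqI)
qed

lemma partial_deriv_outside: "x \<notin> closure {x. \<psi> x \<noteq> 0} \<Longrightarrow> partial_deriv i \<psi> x = 0"
  using grad_outside[of x \<psi>] grad_nth[of \<psi> x i] by simp

lemma test_functionI:
  assumes "Cinf_on UNIV \<psi>" "\<And>x. x \<notin> K \<Longrightarrow> \<psi> x = 0" "compact K" "K \<subseteq> \<Omega>"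
  shows "test_function \<Omega> \<psi>"
proof -
  have "closure {x. \<psi> x \<noteq> 0} \<subseteq> K"
    using assms by (intro closure_minimal) (auto simp: compact_imp_closed)
  moreover have "compact (closure {x. \<psi> x \<noteq> 0})"
    using calculation assms(3) by (metis closed_closure compact_Int_closed inf.absorb_iff2)
  ultimately show ?thesis using assms by (auto simp: test_function_def)
qed

lemma test_function_Cinf: "test_function \<Omega> \<psi> \<Longrightarrow> Cinf_on UNIV \<psi>"
  by (simp add: test_function_def)

lemma test_function_obtain:
  assumes "test_function \<Omega> \<psi>"
  obtains K where "compact K" "K \<subseteq> \<Omega>" "\<And>x. x \<notin> K \<Longrightarrow> \<psi> x = 0" "\<And>x. x \<notin> K \<Longrightarrow> grad \<psi> x = 0"
    "\<And>x i. x \<notin> K \<Longrightarrow> partial_deriv i \<psi> x = 0"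
proof (rule that[of "closure {x. \<psi> x \<noteq> 0}"])
  show "compact (closure {x. \<psi> x \<noteq> 0})" "closure {x. \<psi> x \<noteq> 0} \<subseteq> \<Omega>"
    using assms unfolding test_function_def by blast+
qed (erule eq_0_outside_support grad_outside partial_deriv_outside)+

lemma compact_support_bounded:
  fixes f :: "'a::topological_space \<Rightarrow> 'b::real_normed_vector"
  assumes "compact K" "\<And>x. x \<notin> K \<Longrightarrow> f x = 0" "continuous_on UNIV f"
  obtains C where "C > 0" "\<And>x. norm (f x) \<le> C"
proof -
  have "compact (f ` K)" using assms by (meson compact_continuous_image continuous_on_subset subset_UNIV)
  then obtain C where C: "\<forall>y\<in>f ` K. norm y \<le> C" using compact_imp_bounded bounded_iff by blast
  show ?thesis
  proof (rule that[of "max 1 C"])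
    show "norm (f x) \<le> max 1 C" for x using C assms(2)[of x] by (cases "x \<in> K") auto
  qed auto
qed

lemma test_function_bounds:
  assumes "test_function \<Omega> \<psi>"
  obtains C where "C > 0" "\<And>x. \<bar>\<psi> x\<bar> \<le> C" "\<And>x. norm (grad \<psi> x) \<le> C" "\<And>x i. \<bar>partial_deriv i \<psi> x\<bar> \<le> C"
proof -
  obtain K where K: "compact K" "K \<subseteq> \<Omega>" "\<And>x. x \<notin> K \<Longrightarrow> \<psi> x = 0" "\<And>x. x \<notin> K \<Longrightarrow> grad \<psi> x = 0"
    "\<And>x i. x \<notin> K \<Longrightarrow> partial_deriv i \<psi> x = 0"
    by (rule test_function_obtain[OF assms]) blast
  note [simp] = Cinf_continuous_on[OF test_function_Cinf[OF assms]]
    Cinf_continuous_on_grad[OF test_function_Cinf[OF assms]]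
  obtain C1 where C1: "C1 > 0" "\<And>x. norm (\<psi> x) \<le> C1" using compact_support_bounded[of K \<psi>] K by auto
  obtain C2 where C2: "C2 > 0" "\<And>x. norm (grad \<psi> x) \<le> C2" using compact_support_bounded[of K "grad \<psi>"] K by auto
  show ?thesis
  proof (rule that[of "max C1 C2"])
    show "\<bar>partial_deriv i \<psi> x\<bar> \<le> max C1 C2" for x i
      using component_le_norm_cart[of "grad \<psi> x" i] C2(2)[of x] by (simp add: grad_nth)
    show "\<bar>\<psi> x\<bar> \<le> max C1 C2" "norm (grad \<psi> x) \<le> max C1 C2" for x
      using C1(2)[of x] C2(2)[of x] by simp_all
  qed (use C1(1) in simp)
qed

lemma continuous_on_measurable_lebesgue_on:
  fixes f :: "'a::euclidean_space \<Rightarrow> 'b::euclidean_space"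
  assumes "continuous_on UNIV f" shows "f \<in> borel_measurable (lebesgue_on S)"
proof -
  have "f \<in> borel_measurable lborel" using borel_measurable_continuous_onI[OF assms] by simp
  from measurable_restrict_space1[OF measurable_completion[OF this]] show ?thesis .
qed

lemma integrable_scaleR_compact_support:
  fixes g :: "real^'n \<Rightarrow> 'b::euclidean_space" and f :: "real^'n \<Rightarrow> real"
  assumes "open \<Omega>" "locally_integrable \<Omega> g" "continuous_on UNIV f"
    and K: "compact K" "K \<subseteq> \<Omega>" "\<And>x. x \<notin> K \<Longrightarrow> f x = 0"
  shows "integrable (lebesgue_on \<Omega>) (\<lambda>x. f x *\<^sub>R g x)"
proof -
  obtain C where C: "\<And>x. norm (f x) \<le> C" using compact_support_bounded[of K f] K assms(3) by metis
  have gK: "integrable lebesgue (\<lambda>x. indicator K x *\<^sub>R g x)"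
    using assms K by (auto simp: locally_integrable_def set_integrable_def)
  have fm: "f \<in> borel_measurable lebesgue"
    using continuous_on_measurable_lebesgue_on[OF assms(3), of UNIV] by simp
  have "integrable lebesgue (\<lambda>x. f x *\<^sub>R (indicator K x *\<^sub>R g x))"
  proof (rule Bochner_Integration.integrable_bound)
    show "integrable lebesgue (\<lambda>x. C *\<^sub>R norm (indicator K x *\<^sub>R g x))"
      using gK by (intro integrable_scaleR_right integrable_norm)
    show "AE x in lebesgue. norm (f x *\<^sub>R indicat_real K x *\<^sub>R g x) \<le> norm (C *\<^sub>R norm (indicat_real K x *\<^sub>R g x))"
    proof (rule AE_I2)
      fix x
      have "norm (f x *\<^sub>R y) \<le> norm (C *\<^sub>R norm y)" for y :: 'b
        using C[of x] by (auto simp: abs_mult intro!: mult_right_mono)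
      then show "norm (f x *\<^sub>R indicat_real K x *\<^sub>R g x) \<le> norm (C *\<^sub>R norm (indicat_real K x *\<^sub>R g x))" .
    qed
    show "(\<lambda>x. f x *\<^sub>R indicat_real K x *\<^sub>R g x) \<in> borel_measurable lebesgue"
      by (intro borel_measurable_scaleR[OF fm borel_measurable_integrable[OF gK]])
  qed
  moreover have "indicator \<Omega> x *\<^sub>R (f x *\<^sub>R g x) = f x *\<^sub>R (indicator K x *\<^sub>R g x)" for x
    using K by (auto simp: indicator_def)
  ultimately show ?thesis
    using assms(1) by (simp only: integrable_lebesgue_on_iff open_sets_lebesgue)
qed

text \<open>The fundamental lemma of the calculus of variations. Smooth product functions converge
  boundedly to the indicator of a box compactly contained in \<Omega>, so f has integral zero over
  all such boxes; this forces f to vanish almost everywhere in each of them, and by Lindeloef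
  countably many of them cover \<Omega>.\<close>

lemma AE_zero_if_test_integrals_zero:
  fixes f :: "real^'n \<Rightarrow> real"
  assumes \<Omega>: "open \<Omega>" and f: "locally_integrable \<Omega> f"
    and z: "\<And>\<psi>. test_function \<Omega> \<psi> \<Longrightarrow> (LINT x|lebesgue_on \<Omega>. f x * \<psi> x) = 0"
  shows "AE x in lebesgue_on \<Omega>. f x = 0"
proof -
  have box_zero: "(LINT x|lebesgue. indicator (box a b) x * f x) = 0" if ab: "cbox a b \<subseteq> \<Omega>" for a b
  proof -
    \<comment> \<open>Each factor belongs to one face of the box: it vanishes on and beyond that
      face and tends to one on the inner side. All supports lie in the closed box, hence in
      \<Omega>.\<close>
    define \<psi> where "\<psi> k x = (\<Prod>i\<in>UNIV. bump (real k * (x $ i - a $ i)) * bump (real k * (b $ i - x $ i)))"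
      for k and x :: "real^'n"
    have \<psi>_out: "\<psi> k x = 0" if x: "x \<notin> box a b" for k x
    proof -
      obtain i where "x $ i \<le> a $ i \<or> b $ i \<le> x $ i"
        using x by (auto simp: mem_box_cart not_less)
      then have "real k * (x $ i - a $ i) \<le> 0 \<or> real k * (b $ i - x $ i) \<le> 0"
        by (auto intro!: mult_nonneg_nonpos)
      then have "bump (real k * (x $ i - a $ i)) * bump (real k * (b $ i - x $ i)) = 0"
        by (auto simp: bump_0)
      then show ?thesis by (auto simp: \<psi>_def intro!: exI[of _ i])
    qed
    have t: "test_function \<Omega> (\<psi> k)" for k
    proof (rule test_functionI[of _ "cbox a b"])
      show "Cinf_on UNIV (\<psi> k)"
        unfolding \<psi>_def by (intro Cinf_on_prod Cinf_intros) auto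
      show "\<psi> k x = 0" if "x \<notin> cbox a b" for x
        using that \<psi>_out[of x k] box_subset_cbox[of a b] by blast
    qed (use ab in auto)
    have fK: "integrable lebesgue (\<lambda>x. indicator (cbox a b) x * f x)"
      using f ab by (auto simp: locally_integrable_def set_integrable_def)
    have le1: "\<bar>\<psi> k x\<bar> \<le> 1" and ge0: "0 \<le> \<psi> k x" for k x
    proof -
      show "0 \<le> \<psi> k x" unfolding \<psi>_def by (intro prod_nonneg mult_nonneg_nonneg ballI bump_nonneg)
      moreover have "\<psi> k x \<le> 1" unfolding \<psi>_def
        by (intro prod_le_1 conjI mult_nonneg_nonneg mult_le_one bump_nonneg bump_le_1)
      ultimately show "\<bar>\<psi> k x\<bar> \<le> 1" by simp
    qed
    have "(\<lambda>k. LINT x|lebesgue. \<psi> k x * (indicator (cbox a b) x * f x)) \<longlonglongrightarrow> (LINT x|lebesgue. indicator (box a b) x * f x)"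
    proof (rule integral_dominated_convergence[where w="\<lambda>x. \<bar>indicator (cbox a b) x * f x\<bar>"])
      show "(\<lambda>x. indicat_real (box a b) x * f x) \<in> borel_measurable lebesgue"
      proof -
        have "(\<lambda>x. indicat_real (box a b) x * (indicator (cbox a b) x * f x)) \<in> borel_measurable lebesgue"
          by (intro borel_measurable_times[OF borel_measurable_indicator borel_measurable_integrable[OF fK]])
            (auto simp: sets_completionI_sets)
        moreover have "(\<lambda>x. indicat_real (box a b) x * (indicator (cbox a b) x * f x)) = (\<lambda>x. indicat_real (box a b) x * f x)"
          using box_subset_cbox[of a b] by (auto simp: indicator_def fun_eq_iff)
        ultimately show ?thesis by simp
      qed
      show "(\<lambda>x. \<psi> k x * (indicat_real (cbox a b) x * f x)) \<in> borel_measurable lebesgue" for k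
        using continuous_on_measurable_lebesgue_on[OF Cinf_continuous_on[OF test_function_Cinf[OF t[of k]]], of UNIV]
        by (intro borel_measurable_times[OF _ borel_measurable_integrable[OF fK]]) simp
      show "AE x in lebesgue. (\<lambda>k. \<psi> k x * (indicat_real (cbox a b) x * f x)) \<longlonglongrightarrow> indicat_real (box a b) x * f x"
      proof (rule AE_I2)
        fix x
        show "(\<lambda>k. \<psi> k x * (indicat_real (cbox a b) x * f x)) \<longlonglongrightarrow> indicat_real (box a b) x * f x"
        proof (cases "x \<in> box a b")
          case True
          have "(\<lambda>k. \<psi> k x) \<longlonglongrightarrow> (\<Prod>i::'n\<in>UNIV. (if x $ i - a $ i > 0 then 1 else 0) * (if b $ i - x $ i > 0 then 1 else 0))"
            unfolding \<psi>_def by (intro tendsto_intros bump_scale_tendsto)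
          then have "(\<lambda>k. \<psi> k x) \<longlonglongrightarrow> 1" using True by (simp add: mem_box_cart)
          then have "(\<lambda>k. \<psi> k x * (indicat_real (cbox a b) x * f x)) \<longlonglongrightarrow> 1 * (indicat_real (cbox a b) x * f x)"
            by (intro tendsto_intros)
          then show ?thesis using True box_subset_cbox[of a b] by (auto simp: indicator_def)
        qed (simp add: \<psi>_out)
      qed
      show "AE x in lebesgue. norm (\<psi> k x * (indicat_real (cbox a b) x * f x)) \<le> \<bar>indicat_real (cbox a b) x * f x\<bar>" for k
        using le1[of k] by (auto intro!: AE_I2 mult_left_le_one_le simp: abs_mult)
    qed (use fK in auto)
    moreover have "(LINT x|lebesgue. \<psi> k x * (indicator (cbox a b) x * f x)) = 0" for k
    proof -
      have "(LINT x|lebesgue. \<psi> k x * (indicator (cbox a b) x * f x)) = (LINT x|lebesgue. indicator \<Omega> x *\<^sub>R (f x * \<psi> k x))"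
        using ab \<psi>_out[of _ k] box_subset_cbox[of a b]
        by (intro Bochner_Integration.integral_cong) (auto simp: indicator_def)
      then show ?thesis using z[OF t[of k]] by (simp add: integral_lebesgue_on open_sets_lebesgue \<Omega>)
    qed
    ultimately show ?thesis by (simp add: tendsto_const_iff)
  qed
  have local: "AE x in lebesgue. x \<in> box c d \<longrightarrow> f x = 0" if cd: "cbox c d \<subseteq> \<Omega>" for c d
  proof -
    have "AE x in lebesgue. indicator (box c d) x * f x = 0"
    proof (rule AE_zero_if_box_integrals_zero)
      have "integrable lebesgue (\<lambda>x. indicator (cbox c d) x * f x)"
        using f cd by (auto simp: locally_integrable_def set_integrable_def)
      then have "integrable lebesgue (\<lambda>x. indicator (cbox c d) x * f x * indicator (box c d) x)"
        by (intro integrable_real_mult_indicator) auto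
      moreover have "(\<lambda>x. indicator (cbox c d) x * f x * indicator (box c d) x) = (\<lambda>x. indicator (box c d) x * f x)"
        using box_subset_cbox[of c d] by (auto simp: indicator_def fun_eq_iff)
      ultimately show "integrable lebesgue (\<lambda>x. indicator (box c d) x * f x)" by simp
      fix a b
      \<comment> \<open>The integral is known to vanish only for boxes whose closed hull lies in
        \<Omega>. Intersecting an arbitrary box with \<open>box c d\<close> gives such a box, or the
        empty set.\<close>
      obtain a' b' where ab': "box a b \<inter> box c d = box a' b'" using box_Int_box by blast
      have "(LINT x|lebesgue. indicator (box a b) x * (indicator (box c d) x * f x)) = (LINT x|lebesgue. indicator (box a' b') x * f x)"
        using ab' by (intro Bochner_Integration.integral_cong) (auto simp: indicator_def)
      also have "\<dots> = 0"
      proof (cases "box a' b' = {}")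
        case False
        then have "cbox a' b' = closure (box a' b')" by (simp add: closure_box)
        also have "\<dots> \<subseteq> cbox c d"
          using ab' box_subset_cbox[of c d] by (intro closure_minimal) auto
        finally show ?thesis using cd by (intro box_zero) auto
      qed simp
      finally show "(LINT x|lebesgue. indicator (box a b) x * (indicator (box c d) x * f x)) = 0" .
    qed
    then show ?thesis by (rule eventually_mono) (auto simp: indicator_def)
  qed
  have "\<exists>\<F>. countable \<F> \<and> (\<forall>X\<in>\<F>. \<exists>c d. X = box c d \<and> cbox c d \<subseteq> \<Omega>) \<and> \<Union>\<F> = \<Omega>"
  proof -
    define S where "S = {X. \<exists>c d. X = box c d \<and> cbox c d \<subseteq> \<Omega>}"
    have "\<Union>S = \<Omega>"
    proof
      show "\<Union>S \<subseteq> \<Omega>" using box_subset_cbox unfolding S_def by blast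
      show "\<Omega> \<subseteq> \<Union>S"
      proof
        fix x assume x: "x \<in> \<Omega>"
        then obtain c d where "x \<in> box c d" "cbox c d \<subseteq> \<Omega>"
          by (rule open_contains_cbox[OF \<Omega>])
        then show "x \<in> \<Union>S" unfolding S_def by blast
      qed
    qed
    moreover obtain \<F> where F: "\<F> \<subseteq> S" "countable \<F>" "\<Union>\<F> = \<Union>S"
      by (rule Lindelof[of S]) (auto simp: S_def)
    moreover have "\<exists>c d. X = box c d \<and> cbox c d \<subseteq> \<Omega>" if "X \<in> \<F>" for X
      using subsetD[OF F(1) that] unfolding S_def by simp
    ultimately show ?thesis by (intro exI[of _ \<F>] conjI ballI) simp_all
  qed
  then obtain \<F> where "countable \<F> \<and> (\<forall>X\<in>\<F>. \<exists>c d. X = box c d \<and> cbox c d \<subseteq> \<Omega>) \<and> \<Union>\<F> = \<Omega>"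
    by (rule exE)
  then have \<F>: "countable \<F>" "\<forall>X\<in>\<F>. \<exists>c d. X = box c d \<and> cbox c d \<subseteq> \<Omega>" "\<Union>\<F> = \<Omega>"
    by simp_all
  have "AE x in lebesgue. \<forall>X\<in>\<F>. x \<in> X \<longrightarrow> f x = 0"
    unfolding AE_ball_countable[OF \<F>(1)]
  proof
    fix X assume "X \<in> \<F>"
    then obtain c d where "X = box c d" "cbox c d \<subseteq> \<Omega>" using bspec[OF \<F>(2)] by metis
    then show "AE x in lebesgue. x \<in> X \<longrightarrow> f x = 0" using local by simp
  qed
  then have "AE x in lebesgue. x \<in> \<Omega> \<longrightarrow> f x = 0"
    by (rule eventually_mono) (use \<F> in auto)
  then show ?thesis using \<Omega> by (subst AE_restrict_space_iff) (auto simp: open_sets_lebesgue)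
qed

lemma locally_integrable_nth: "locally_integrable \<Omega> g \<Longrightarrow> locally_integrable \<Omega> (\<lambda>x. g x $ i)"
  for g :: "real^'n \<Rightarrow> real^'m"
  unfolding locally_integrable_def set_integrable_def
  using integrable_inner_left[of "axis i 1" lebesgue] by (fastforce simp: inner_axis)

lemma integrable_mult_test:
  assumes "open \<Omega>" "locally_integrable \<Omega> f" "test_function \<Omega> \<psi>"
  shows "integrable (lebesgue_on \<Omega>) (\<lambda>x. f x * \<psi> x)"
    "integrable (lebesgue_on \<Omega>) (\<lambda>x. f x * partial_deriv i \<psi> x)"
proof -
  obtain K where K: "compact K" "K \<subseteq> \<Omega>" "\<And>x. x \<notin> K \<Longrightarrow> \<psi> x = 0" "\<And>x. x \<notin> K \<Longrightarrow> grad \<psi> x = 0"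
    "\<And>x i. x \<notin> K \<Longrightarrow> partial_deriv i \<psi> x = 0"
    by (rule test_function_obtain[OF assms(3)]) blast
  note c = test_function_Cinf[OF assms(3)]
  show "integrable (lebesgue_on \<Omega>) (\<lambda>x. f x * \<psi> x)"
    using integrable_scaleR_compact_support[OF assms(1,2) Cinf_continuous_on[OF c] K(1,2,3)]
    by (simp add: mult.commute)
  show "integrable (lebesgue_on \<Omega>) (\<lambda>x. f x * partial_deriv i \<psi> x)"
    using integrable_scaleR_compact_support[OF assms(1,2) Cinf_continuous_on_partial[OF c] K(1,2), of i] K(5)
    by (simp add: mult.commute)
qed

lemma weak_grad_unique:
  assumes \<Omega>: "open \<Omega>" and g: "is_weak_grad \<Omega> u g" and h: "is_weak_grad \<Omega> u h"
  shows "AE x in lebesgue_on \<Omega>. g x = h x"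
proof -
  have "AE x in lebesgue_on \<Omega>. g x $ i - h x $ i = 0" for i
  proof (rule AE_zero_if_test_integrals_zero[OF \<Omega>])
    have gi: "locally_integrable \<Omega> (\<lambda>x. g x $ i)" and hi: "locally_integrable \<Omega> (\<lambda>x. h x $ i)"
      using g h by (auto simp: is_weak_grad_def locally_integrable_nth)
    then show "locally_integrable \<Omega> (\<lambda>x. g x $ i - h x $ i)"
      by (auto simp: locally_integrable_def intro: set_integral_diff)
    fix \<psi> assume t: "test_function \<Omega> \<psi>"
    show "(LINT x|lebesgue_on \<Omega>. (g x $ i - h x $ i) * \<psi> x) = 0"
      using g h t integrable_mult_test(1)[OF \<Omega> gi t] integrable_mult_test(1)[OF \<Omega> hi t]
      by (simp add: is_weak_grad_def left_diff_distrib)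
  qed
  then have "AE x in lebesgue_on \<Omega>. \<forall>i. g x $ i - h x $ i = 0" by (simp add: AE_all_countable)
  then show ?thesis by (rule eventually_mono) (simp add: vec_eq_iff)
qed

text \<open>This allows the gradient picked by \<open>SOME\<close> to be exchanged for an explicitly
  computed one under every integral.\<close>

lemma weak_grad_AE_eq:
  assumes "open \<Omega>" "is_weak_grad \<Omega> u g"
  shows "AE x in lebesgue_on \<Omega>. weak_grad \<Omega> u x = g x"
  using weak_grad_unique[OF assms(1) _ assms(2)] someI[of "is_weak_grad \<Omega> u", OF assms(2)]
  by (simp add: weak_grad_def)

section \<open>Integrals of derivatives of compactly supported functions\<close>

lemma integral_translation:
  fixes f :: "'a::euclidean_space \<Rightarrow> real"
  assumes "f \<in> borel_measurable borel"
  shows "(LINT x|lborel. f (c + x)) = (LINT x|lborel. f x)"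
  using integral_distr[of "(+) c" lborel borel f] assms by (simp add: lborel_distr_plus)

text \<open>Translation invariance makes the integrals of the difference quotients vanish.\<close>

lemma integral_directional_derivative:
  fixes f :: "'a::euclidean_space \<Rightarrow> real"
  assumes cont: "continuous_on UNIV f" and supp: "\<And>x. norm x > R \<Longrightarrow> f x = 0"
    and d: "\<And>x. ((\<lambda>t. f (x + t *\<^sub>R e)) has_real_derivative f' x) (at 0)"
    and bd: "\<And>x. \<bar>f' x\<bar> \<le> C"
  shows "(LINT x|lborel. f' x) = 0"
proof -
  have [measurable]: "f \<in> borel_measurable borel" using cont by (rule borel_measurable_continuous_onI)
  have tr[measurable]: "(\<lambda>x. f (x + c)) \<in> borel_measurable borel" for c
    using cont by (intro borel_measurable_continuous_onI continuous_on_compose2[OF cont] continuous_intros) auto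
  obtain C0 where C0: "\<And>x. norm (f x) \<le> C0"
    by (rule compact_support_bounded[of "cball 0 R" f]) (use supp cont in auto)
  have intf: "integrable lborel f"
    using supp C0
    by (intro integrableI_bounded_set[OF _ _ emeasure_bounded_finite, of "cball 0 R" _ C0])
      (auto intro!: AE_I2 simp: not_le)
  \<comment> \<open>Difference quotients in direction \<open>e\<close> with step 1 / (n + 1). No
    step exceeds one, so all quotients are supported in the ball of radius
    \<open>R + norm e\<close>, where the bound \<open>C\<close> on the derivative dominates
    them.\<close>
  define s where "s n x = real (Suc n) * (f (x + (1 / real (Suc n)) *\<^sub>R e) - f x)" for n x
  have dl: "((\<lambda>t. f (x + t *\<^sub>R e)) has_real_derivative f' (x + t *\<^sub>R e)) (at t)" for x t
  proof -
    have "((\<lambda>r. f ((x + t *\<^sub>R e) + r *\<^sub>R e)) has_real_derivative f' (x + t *\<^sub>R e)) (at (t - t))"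
      using d[of "x + t *\<^sub>R e"] by simp
    then have "((\<lambda>r. f ((x + t *\<^sub>R e) + (r - t) *\<^sub>R e)) has_real_derivative f' (x + t *\<^sub>R e) * 1) (at t)"
      by (rule DERIV_chain2) (auto intro!: derivative_eq_intros)
    then show ?thesis by (simp add: algebra_simps)
  qed
  have lip: "\<bar>f (x + t *\<^sub>R e) - f x\<bar> \<le> C * \<bar>t\<bar>" for x t
    using field_differentiable_bound[of UNIV "\<lambda>t. f (x + t *\<^sub>R e)" "\<lambda>t. f' (x + t *\<^sub>R e)" C t 0] dl bd by simp
  have sb: "\<bar>s n x\<bar> \<le> C * indicator (cball 0 (R + norm e)) x" for n x
  proof (cases "norm x \<le> R + norm e")
    case True
    have "\<bar>s n x\<bar> \<le> real (Suc n) * (C * \<bar>1 / real (Suc n)\<bar>)"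
      unfolding s_def abs_mult using lip[of x "1 / real (Suc n)"] by (intro mult_mono) auto
    then show ?thesis using True by simp
  next
    case False
    have "norm x \<le> norm (x + (1 / real (Suc n)) *\<^sub>R e) + norm ((1 / real (Suc n)) *\<^sub>R e)"
      using norm_triangle_ineq4[of "x + (1 / real (Suc n)) *\<^sub>R e" "(1 / real (Suc n)) *\<^sub>R e"] by simp
    moreover have "norm ((1 / real (Suc n)) *\<^sub>R e) \<le> norm e" by (simp add: divide_le_eq mult_le_cancel_left1)
    ultimately have "norm (x + (1 / real (Suc n)) *\<^sub>R e) > R" using False by linarith
    moreover have "norm x > R" using False norm_ge_zero[of e] by linarith
    ultimately show ?thesis using supp False by (simp add: s_def)
  qed
  have [measurable]: "s n \<in> borel_measurable borel" for n unfolding s_def by measurable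
  have slim: "(\<lambda>n. s n x) \<longlonglongrightarrow> f' x" for x
  proof -
    have "((\<lambda>h. (f (x + h *\<^sub>R e) - f x) / h) \<longlongrightarrow> f' x) (at 0)"
      using d[of x] by (simp add: DERIV_def)
    moreover have "filterlim (\<lambda>n. 1 / real (Suc n)) (at 0) sequentially"
      unfolding filterlim_at using LIMSEQ_Suc[OF lim_1_over_n] by auto
    ultimately have "(\<lambda>n. (f (x + (1 / real (Suc n)) *\<^sub>R e) - f x) / (1 / real (Suc n))) \<longlonglongrightarrow> f' x"
      by (rule filterlim_compose)
    then show ?thesis by (simp add: s_def mult.commute)
  qed
  have [measurable]: "f' \<in> borel_measurable borel"
    by (rule borel_measurable_LIMSEQ_real[of _ s]) (use slim in auto)
  have "(\<lambda>n. LINT x|lborel. s n x) \<longlonglongrightarrow> (LINT x|lborel. f' x)"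
  proof (rule integral_dominated_convergence[where w="\<lambda>x. C * indicator (cball 0 (R + norm e)) x"])
    show "integrable lborel (\<lambda>x. C * indicator (cball 0 (R + norm e)) x)"
      by (intro integrable_mult_right integrable_real_indicator emeasure_bounded_finite) auto
  qed (use sb slim in auto)
  moreover have "(LINT x|lborel. s n x) = 0" for n
  proof -
    have "integrable lborel (\<lambda>x. f ((1 / real (Suc n)) *\<^sub>R e + x))"
      using intf integrable_distr_eq[of "(+) ((1 / real (Suc n)) *\<^sub>R e)" lborel borel f]
      by (simp add: lborel_distr_plus)
    then show ?thesis
      using intf integral_translation[of f "(1 / real (Suc n)) *\<^sub>R e"] by (simp add: s_def add.commute)
  qed
  ultimately show ?thesis by (simp add: tendsto_const_iff)
qed

lemma GDERIV_line:
  assumes "GDERIV f x :> g"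
  shows "((\<lambda>t. f (x + t *\<^sub>R e)) has_real_derivative g \<bullet> e) (at 0)"
proof -
  have "((\<lambda>t. x + t *\<^sub>R e) has_derivative (\<lambda>t. t *\<^sub>R e)) (at 0)"
    by (auto intro!: derivative_eq_intros)
  moreover have "(f has_derivative (\<lambda>h. h \<bullet> g)) (at (x + 0 *\<^sub>R e))" using assms by (simp add: gderiv_def)
  ultimately have "((\<lambda>t. f (x + t *\<^sub>R e)) has_derivative (\<lambda>t. (t *\<^sub>R e) \<bullet> g)) (at 0)"
    by (rule has_derivative_compose)
  then show ?thesis by (simp add: has_field_derivative_def inner_commute mult_commute_abs)
qed

lemma integral_partial_deriv_zero:
  fixes f :: "real^'n \<Rightarrow> real"
  assumes K: "compact K" "\<And>x. x \<notin> K \<Longrightarrow> f x = 0" and c: "continuous_on UNIV f"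
    and d: "\<And>x. GDERIV f x :> g x" and b: "\<And>x. norm (g x) \<le> C"
  shows "(LINT x|lborel. g x $ i) = 0"
proof -
  obtain R where R: "\<And>x. x \<in> K \<Longrightarrow> norm x \<le> R" using compact_imp_bounded[OF K(1)] bounded_iff by blast
  show ?thesis
  proof (rule integral_directional_derivative[OF c, of R "axis i 1" _ C])
    show "f x = 0" if "R < norm x" for x using that K(2) R[of x] by fastforce
    show "((\<lambda>t. f (x + t *\<^sub>R axis i 1)) has_real_derivative g x $ i) (at 0)" for x
      using GDERIV_line[OF d[of x], of "axis i 1"] by (simp add: inner_axis)
    show "\<bar>g x $ i\<bar> \<le> C" for x using component_le_norm_cart[of "g x" i] b[of x] by simp
  qed
qed

section \<open>Null sequences in Lebesgue spaces\<close>

lemma finite_measure_lebesgue_on: "open \<Omega> \<Longrightarrow> bounded \<Omega> \<Longrightarrow> finite_measure (lebesgue_on \<Omega>)"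
proof (rule finite_measureI)
  assume "open \<Omega>" "bounded \<Omega>"
  then have "emeasure lebesgue \<Omega> \<noteq> \<infinity>"
    using emeasure_bounded_finite[of \<Omega>] by (simp add: emeasure_completion main_part_sets borel_open)
  then show "emeasure (lebesgue_on \<Omega>) (space (lebesgue_on \<Omega>)) \<noteq> \<infinity>"
    using \<open>open \<Omega>\<close> by (simp add: emeasure_restrict_space open_sets_lebesgue)
qed

lemma powr_add_le:
  fixes a b s :: real
  assumes "0 \<le> a" "0 \<le> b" "0 \<le> s"
  shows "(a + b) powr s \<le> 2 powr s * (a powr s + b powr s)"
proof -
  have "(a + b) powr s \<le> (2 * max a b) powr s" using assms by (intro powr_mono2) auto
  also have "\<dots> = 2 powr s * max a b powr s" using assms by (intro powr_mult)
  also have "max a b powr s \<le> a powr s + b powr s" by (auto simp: max_def)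
  finally show ?thesis by simp
qed

lemma norm_powr_add_le:
  "0 \<le> s \<Longrightarrow> norm (a + b) powr s \<le> 2 powr s * (norm a powr s + norm b powr s)"
  using powr_mono2[of s "norm (a + b)" "norm a + norm b"] powr_add_le[of "norm a" "norm b" s]
    norm_triangle_ineq[of a b] by fastforce

lemma in_Lp_measurable: "in_Lp \<Omega> s f \<Longrightarrow> f \<in> borel_measurable (lebesgue_on \<Omega>)"
  and in_Lp_integrable: "in_Lp \<Omega> s f \<Longrightarrow> integrable (lebesgue_on \<Omega>) (\<lambda>x. norm (f x) powr s)"
  by (auto simp: in_Lp_def)

lemma in_Lp_bound:
  assumes "in_Lp \<Omega> s f" "0 \<le> s" "g \<in> borel_measurable (lebesgue_on \<Omega>)"
    and "AE x in lebesgue_on \<Omega>. norm (g x) \<le> C * norm (f x)"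
  shows "in_Lp \<Omega> s g"
  unfolding in_Lp_def
proof
  show "integrable (lebesgue_on \<Omega>) (\<lambda>x. norm (g x) powr s)"
  proof (rule Bochner_Integration.integrable_bound)
    show "integrable (lebesgue_on \<Omega>) (\<lambda>x. \<bar>C\<bar> powr s * norm (f x) powr s)"
      using assms(1) by (intro integrable_mult_right in_Lp_integrable)
    show "AE x in lebesgue_on \<Omega>. norm (norm (g x) powr s) \<le> norm (\<bar>C\<bar> powr s * norm (f x) powr s)"
      using assms(4)
    proof eventually_elim
      case (elim x)
      have "norm (g x) powr s \<le> (\<bar>C\<bar> * norm (f x)) powr s"
        using elim assms(2) mult_right_mono[OF abs_ge_self[of C] norm_ge_zero[of "f x"]] by (intro powr_mono2) auto
      then show ?case by (simp add: powr_mult)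
    qed
  qed (use assms(3) in measurable)
qed fact

lemma in_Lp_add:
  assumes "in_Lp \<Omega> s f" "in_Lp \<Omega> s g" "0 \<le> s"
  shows "in_Lp \<Omega> s (\<lambda>x. f x + g x)"
  unfolding in_Lp_def
proof
  have [measurable]: "f \<in> borel_measurable (lebesgue_on \<Omega>)" "g \<in> borel_measurable (lebesgue_on \<Omega>)"
    using assms in_Lp_measurable by auto
  show "(\<lambda>x. f x + g x) \<in> borel_measurable (lebesgue_on \<Omega>)" by measurable
  show "integrable (lebesgue_on \<Omega>) (\<lambda>x. norm (f x + g x) powr s)"
  proof (rule Bochner_Integration.integrable_bound)
    show "integrable (lebesgue_on \<Omega>) (\<lambda>x. 2 powr s * (norm (f x) powr s + norm (g x) powr s))"
      using assms by (intro integrable_mult_right Bochner_Integration.integrable_add in_Lp_integrable)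
    show "AE x in lebesgue_on \<Omega>. norm (norm (f x + g x) powr s) \<le> norm (2 powr s * (norm (f x) powr s + norm (g x) powr s))"
      using norm_powr_add_le[OF assms(3)] by (intro AE_I2) (simp add: abs_mult)
  qed measurable
qed

lemma in_Lp_scaleR: "in_Lp \<Omega> s f \<Longrightarrow> 0 \<le> s \<Longrightarrow> in_Lp \<Omega> s (\<lambda>x. c *\<^sub>R f x)"
  by (rule in_Lp_bound[of _ _ f _ "\<bar>c\<bar>"]) (auto intro: in_Lp_measurable borel_measurable_scaleR)

lemma in_Lp_diff: "in_Lp \<Omega> s f \<Longrightarrow> in_Lp \<Omega> s g \<Longrightarrow> 0 \<le> s \<Longrightarrow> in_Lp \<Omega> s (\<lambda>x. f x - g x)"
  using in_Lp_add[of \<Omega> s f "\<lambda>x. (-1) *\<^sub>R g x"] in_Lp_scaleR[of \<Omega> s g "-1"] by simp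

lemma in_Lp_cong_AE:
  assumes "in_Lp \<Omega> s f" "0 \<le> s" "g \<in> borel_measurable (lebesgue_on \<Omega>)" "AE x in lebesgue_on \<Omega>. g x = f x"
  shows "in_Lp \<Omega> s g"
  using assms(4) by (intro in_Lp_bound[OF assms(1,2,3), of 1]) (auto elim: eventually_mono)

lemma in_Lp_bounded:
  fixes f :: "real^'n \<Rightarrow> 'b::euclidean_space"
  assumes "open \<Omega>" "bounded \<Omega>" "0 \<le> s" "f \<in> borel_measurable (lebesgue_on \<Omega>)"
    and "AE x in lebesgue_on \<Omega>. norm (f x) \<le> C"
  shows "in_Lp \<Omega> s f"
proof -
  interpret finite_measure "lebesgue_on \<Omega>" using assms by (intro finite_measure_lebesgue_on)
  have "in_Lp \<Omega> s (\<lambda>_. C)" by (simp add: in_Lp_def)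
  from assms(5) have "AE x in lebesgue_on \<Omega>. norm (f x) \<le> 1 * norm C" by eventually_elim simp
  with in_Lp_bound[OF \<open>in_Lp \<Omega> s (\<lambda>_. C)\<close> assms(3,4), of 1] show ?thesis by simp
qed

text \<open>On a set of finite measure only large values matter: a^r \<le> 1 + a^s for r \<le>
  s.\<close>

lemma in_Lp_mono:
  fixes f :: "real^'n \<Rightarrow> 'b::euclidean_space"
  assumes "open \<Omega>" "bounded \<Omega>" "in_Lp \<Omega> s f" "0 \<le> r" "r \<le> s"
  shows "in_Lp \<Omega> r f"
  unfolding in_Lp_def
proof
  interpret finite_measure "lebesgue_on \<Omega>" using assms by (intro finite_measure_lebesgue_on)
  show m[measurable]: "f \<in> borel_measurable (lebesgue_on \<Omega>)" using assms in_Lp_measurable by auto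
  show "integrable (lebesgue_on \<Omega>) (\<lambda>x. norm (f x) powr r)"
  proof (rule Bochner_Integration.integrable_bound)
    show "integrable (lebesgue_on \<Omega>) (\<lambda>x. 1 + norm (f x) powr s)"
      using assms by (intro Bochner_Integration.integrable_add in_Lp_integrable) auto
    show "AE x in lebesgue_on \<Omega>. norm (norm (f x) powr r) \<le> norm (1 + norm (f x) powr s)"
    proof (rule AE_I2)
      fix x
      show "norm (norm (f x) powr r) \<le> norm (1 + norm (f x) powr s)"
      proof (cases "norm (f x) \<le> 1")
        case True
        then have "norm (f x) powr r \<le> 1" using assms by (intro powr_le1) auto
        then show ?thesis by (simp add: add_increasing2)
      next
        case False
        then have "norm (f x) powr r \<le> norm (f x) powr s" using assms by (intro powr_mono) auto
        then show ?thesis by simp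
      qed
    qed
  qed measurable
qed

lemma in_Lp_imp_integrable:
  fixes f :: "real^'n \<Rightarrow> 'b::euclidean_space"
  assumes "open \<Omega>" "bounded \<Omega>" "in_Lp \<Omega> s f" "1 \<le> s"
  shows "integrable (lebesgue_on \<Omega>) f"
proof -
  have "in_Lp \<Omega> 1 f" using assms by (intro in_Lp_mono[of \<Omega> s f 1]) auto
  then show ?thesis by (auto simp: in_Lp_def integrable_norm_iff)
qed

text \<open>The Bochner integral of a non-integrable function is 0, so membership in L^s is made
  part of the notion; convergence of the integrals alone could hold spuriously. Integrals of powers
  are used in place of norms, so that sums are handled by the pointwise bound
  \<open>norm_powr_add_le\<close>.\<close>

definition Lp_null :: "(real^'n) set \<Rightarrow> real \<Rightarrow> (nat \<Rightarrow> real^'n \<Rightarrow> 'b::euclidean_space) \<Rightarrow> bool" where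
  "Lp_null \<Omega> s F \<longleftrightarrow> (\<forall>n. in_Lp \<Omega> s (F n)) \<and>
     (\<lambda>n. LINT x|lebesgue_on \<Omega>. norm (F n x) powr s) \<longlonglongrightarrow> 0"

lemma Lp_null_dominated:
  assumes F: "Lp_null \<Omega> s F" and s: "0 \<le> s" and m: "\<And>n. G n \<in> borel_measurable (lebesgue_on \<Omega>)"
    and b: "\<And>n. AE x in lebesgue_on \<Omega>. norm (G n x) \<le> C * norm (F n x)"
  shows "Lp_null \<Omega> s G"
  unfolding Lp_null_def
proof
  show i: "\<forall>n. in_Lp \<Omega> s (G n)" using assms in_Lp_bound[of \<Omega> s "F _" "G _" C] by (auto simp: Lp_null_def)
  show "(\<lambda>n. LINT x|lebesgue_on \<Omega>. norm (G n x) powr s) \<longlonglongrightarrow> 0"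
  proof (rule tendsto_sandwich[OF _ _ tendsto_const])
    have "(\<lambda>n. \<bar>C\<bar> powr s * (LINT x|lebesgue_on \<Omega>. norm (F n x) powr s)) \<longlonglongrightarrow> \<bar>C\<bar> powr s * 0"
      using F by (intro tendsto_intros) (auto simp: Lp_null_def)
    then show "(\<lambda>n. \<bar>C\<bar> powr s * (LINT x|lebesgue_on \<Omega>. norm (F n x) powr s)) \<longlonglongrightarrow> 0" by simp
    show "\<forall>\<^sub>F n in sequentially. (LINT x|lebesgue_on \<Omega>. norm (G n x) powr s) \<le> \<bar>C\<bar> powr s * (LINT x|lebesgue_on \<Omega>. norm (F n x) powr s)"
    proof (rule always_eventually, rule allI)
      fix n
      have "(LINT x|lebesgue_on \<Omega>. norm (G n x) powr s) \<le> (LINT x|lebesgue_on \<Omega>. \<bar>C\<bar> powr s * norm (F n x) powr s)"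
      proof (rule integral_mono_AE)
        show "AE x in lebesgue_on \<Omega>. norm (G n x) powr s \<le> \<bar>C\<bar> powr s * norm (F n x) powr s"
          using b[of n]
        proof eventually_elim
          case (elim x)
          have "norm (G n x) powr s \<le> (\<bar>C\<bar> * norm (F n x)) powr s"
            using elim s mult_right_mono[OF abs_ge_self[of C] norm_ge_zero[of "F n x"]] by (intro powr_mono2) auto
          then show ?case by (simp add: powr_mult)
        qed
      qed (use i F in \<open>auto simp: in_Lp_def Lp_null_def\<close>)
      then show "(LINT x|lebesgue_on \<Omega>. norm (G n x) powr s) \<le> \<bar>C\<bar> powr s * (LINT x|lebesgue_on \<Omega>. norm (F n x) powr s)"
        by simp
    qed
  qed simp
qed

lemma Lp_null_add:
  assumes F: "Lp_null \<Omega> s F" and G: "Lp_null \<Omega> s G" and s: "0 \<le> s"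
  shows "Lp_null \<Omega> s (\<lambda>n x. F n x + G n x)"
  unfolding Lp_null_def
proof
  have iF: "in_Lp \<Omega> s (F n)" and iG: "in_Lp \<Omega> s (G n)" for n using F G by (auto simp: Lp_null_def)
  show i: "\<forall>n. in_Lp \<Omega> s (\<lambda>x. F n x + G n x)" using iF iG s in_Lp_add by blast
  show "(\<lambda>n. LINT x|lebesgue_on \<Omega>. norm (F n x + G n x) powr s) \<longlonglongrightarrow> 0"
  proof (rule tendsto_sandwich[OF _ _ tendsto_const])
    let ?b = "\<lambda>n. 2 powr s * ((LINT x|lebesgue_on \<Omega>. norm (F n x) powr s) + (LINT x|lebesgue_on \<Omega>. norm (G n x) powr s))"
    have "?b \<longlonglongrightarrow> 2 powr s * (0 + 0)"
      using F G by (intro tendsto_intros) (auto simp: Lp_null_def)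
    then show "?b \<longlonglongrightarrow> 0" by simp
    show "\<forall>\<^sub>F n in sequentially. (LINT x|lebesgue_on \<Omega>. norm (F n x + G n x) powr s) \<le> ?b n"
    proof (rule always_eventually, rule allI)
      fix n
      have "(LINT x|lebesgue_on \<Omega>. norm (F n x + G n x) powr s)
          \<le> (LINT x|lebesgue_on \<Omega>. 2 powr s * (norm (F n x) powr s + norm (G n x) powr s))"
        using i iF iG norm_powr_add_le[OF s]
        by (intro integral_mono_AE integrable_mult_right Bochner_Integration.integrable_add AE_I2) (auto simp: in_Lp_def)
      then show "(LINT x|lebesgue_on \<Omega>. norm (F n x + G n x) powr s) \<le> ?b n"
        using iF iG by (simp add: in_Lp_def)
    qed
  qed simp
qed

lemma Lp_null_subseq: "Lp_null \<Omega> s F \<Longrightarrow> strict_mono r \<Longrightarrow> Lp_null \<Omega> s (\<lambda>n. F (r n))"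
  unfolding Lp_null_def using LIMSEQ_subseq_LIMSEQ[of _ 0 r] by (auto simp: o_def)

lemma Lp_null_DCT:
  assumes m: "\<And>n. F n \<in> borel_measurable (lebesgue_on \<Omega>)" and w: "in_Lp \<Omega> s w" and s: "0 < s"
    and b: "\<And>n. AE x in lebesgue_on \<Omega>. norm (F n x) \<le> norm (w x)"
    and lim: "AE x in lebesgue_on \<Omega>. (\<lambda>n. F n x) \<longlonglongrightarrow> 0"
  shows "Lp_null \<Omega> s F"
  unfolding Lp_null_def
proof
  show "\<forall>n. in_Lp \<Omega> s (F n)" using assms in_Lp_bound[OF w, of "F _" 1] by auto
  have "(\<lambda>n. LINT x|lebesgue_on \<Omega>. norm (F n x) powr s) \<longlonglongrightarrow> (LINT x|lebesgue_on \<Omega>. 0)"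
  proof (rule integral_dominated_convergence[where w="\<lambda>x. norm (w x) powr s"])
    show "AE x in lebesgue_on \<Omega>. (\<lambda>n. norm (F n x) powr s) \<longlonglongrightarrow> 0"
      using lim
    proof eventually_elim
      case (elim x)
      then show ?case using s tendsto_zero_powrI[OF tendsto_norm_zero[OF elim] tendsto_const _ s] by simp
    qed
    show "AE x in lebesgue_on \<Omega>. norm (norm (F n x) powr s) \<le> norm (w x) powr s" for n
      using b[of n] by eventually_elim (use s in \<open>auto intro: powr_mono2\<close>)
  qed (use m w in \<open>auto simp: in_Lp_def\<close>)
  then show "(\<lambda>n. LINT x|lebesgue_on \<Omega>. norm (F n x) powr s) \<longlonglongrightarrow> 0" by simp
qed

text \<open>Above the level \<open>e\<close> one has a = a^(1 - s) a^s \<le> e^(1 - s) a^s. The free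
  parameter \<open>e\<close> replaces an interpolation between exponents: it is sent to zero in
  \<open>Lp_null_mono\<close> and balanced against the integral in the sup bound.\<close>

lemma le_eps_powr:
  fixes a e s :: real
  assumes "0 \<le> a" "0 < e" "1 \<le> s"
  shows "a \<le> e + e powr (1 - s) * a powr s"
proof (cases "a \<le> e")
  case False
  then have "a powr (1 - s) \<le> e powr (1 - s)" using assms by (intro powr_mono2') auto
  then have "a powr (1 - s) * a powr s \<le> e powr (1 - s) * a powr s" by (intro mult_right_mono) auto
  moreover have "a powr (1 - s) * a powr s = a" using False assms by (simp flip: powr_add)
  ultimately show ?thesis using assms by simp
qed (simp add: add_increasing2)

lemma Lp_null_mono:
  assumes \<Omega>: "open \<Omega>" "bounded \<Omega>" and F: "Lp_null \<Omega> s F" and r: "0 < r" "r \<le> s"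
  shows "Lp_null \<Omega> r F"
proof -
  interpret finite_measure "lebesgue_on \<Omega>" using \<Omega> by (intro finite_measure_lebesgue_on)
  have iS: "in_Lp \<Omega> s (F n)" and ir: "in_Lp \<Omega> r (F n)" for n
    using F r in_Lp_mono[OF \<Omega>, of s "F n" r] by (auto simp: Lp_null_def)
  have "(\<lambda>n. LINT x|lebesgue_on \<Omega>. norm (F n x) powr r) \<longlonglongrightarrow> 0"
  proof (rule LIMSEQ_I)
    fix d :: real assume d: "d > 0"
    define m where "m = measure (lebesgue_on \<Omega>) \<Omega>"
    \<comment> \<open>The constant part e contributes at most d / 2 to the integral; the summand 1
      covers a set of measure zero. \<open>k\<close> is the matching constant from
      \<open>le_eps_powr\<close> with exponent s / r.\<close>
    define e where "e = d / (2 * (m + 1))"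
    define k where "k = e powr (1 - s / r)"
    have m0: "m \<ge> 0" by (simp add: m_def)
    have e: "e > 0" "e * m < d / 2"
      using d m0 by (auto simp: e_def field_simps add_pos_nonneg)
    have "(\<lambda>n. k * (LINT x|lebesgue_on \<Omega>. norm (F n x) powr s)) \<longlonglongrightarrow> k * 0"
      using F by (intro tendsto_intros) (auto simp: Lp_null_def)
    then have "\<forall>\<^sub>F n in sequentially. k * (LINT x|lebesgue_on \<Omega>. norm (F n x) powr s) < d / 2"
      using d by (intro order_tendstoD(2)) auto
    then obtain N where N: "\<And>n. n \<ge> N \<Longrightarrow> k * (LINT x|lebesgue_on \<Omega>. norm (F n x) powr s) < d / 2"
      by (auto simp: eventually_sequentially)
    show "\<exists>N. \<forall>n\<ge>N. norm ((LINT x|lebesgue_on \<Omega>. norm (F n x) powr r) - 0) < d"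
    proof (intro exI[of _ N] allI impI)
      fix n assume n: "n \<ge> N"
      have le: "a powr r \<le> e + k * a powr s" if "a \<ge> 0" for a :: real
        using le_eps_powr[of "a powr r" e "s / r"] that e r by (simp add: k_def powr_powr)
      have "(LINT x|lebesgue_on \<Omega>. norm (F n x) powr r) \<le> (LINT x|lebesgue_on \<Omega>. e + k * norm (F n x) powr s)"
        using iS ir
        by (intro integral_mono_AE AE_I2 le Bochner_Integration.integrable_add integrable_mult_right)
          (auto simp: in_Lp_def)
      also have "\<dots> = e * m + k * (LINT x|lebesgue_on \<Omega>. norm (F n x) powr s)"
        using iS by (simp add: in_Lp_def m_def mult.commute space_restrict_space)
      also have "\<dots> < d" using N[OF n] e by linarith
      finally show "norm ((LINT x|lebesgue_on \<Omega>. norm (F n x) powr r) - 0) < d" by simp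
    qed
  qed
  with ir show ?thesis by (simp add: Lp_null_def)
qed

lemma Lp_null_imp_L1_null:
  assumes \<Omega>: "open \<Omega>" "bounded \<Omega>" and F: "Lp_null \<Omega> s F" and s: "1 \<le> s"
  shows "(\<lambda>n. LINT x|lebesgue_on \<Omega>. norm (F n x)) \<longlonglongrightarrow> 0"
  using Lp_null_mono[OF \<Omega> F, of 1] s by (simp add: Lp_null_def)

lemma Lp_null_AE_subseq:
  assumes "open \<Omega>" "bounded \<Omega>" "Lp_null \<Omega> s F" "1 \<le> s"
  obtains r :: "nat \<Rightarrow> nat" where "strict_mono r" "AE x in lebesgue_on \<Omega>. (\<lambda>n. F (r n) x) \<longlonglongrightarrow> 0"
  using tendsto_L1_AE_subseq[OF _ Lp_null_imp_L1_null[OF assms]] assms in_Lp_imp_integrable[OF assms(1,2) _ assms(4)]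
  unfolding Lp_null_def by blast

text \<open>On a bounded set convergence in L^s implies convergence in L^1, and the multiplier is
  bounded. This is how identities for test functions pass to their Sobolev limits.\<close>

lemma integral_mult_tendsto:
  fixes F :: "nat \<Rightarrow> real^'n \<Rightarrow> 'b::euclidean_space"
  assumes \<Omega>: "open \<Omega>" "bounded \<Omega>" and F: "Lp_null \<Omega> s (\<lambda>n x. F n x - f x)" and f: "in_Lp \<Omega> s f" and s: "1 \<le> s"
    and h: "h \<in> borel_measurable (lebesgue_on \<Omega>)" "\<And>x. x \<in> \<Omega> \<Longrightarrow> norm (h x) \<le> C"
  shows "integrable (lebesgue_on \<Omega>) (\<lambda>x. f x \<bullet> h x)"
    and "(\<lambda>n. LINT x|lebesgue_on \<Omega>. F n x \<bullet> h x) \<longlonglongrightarrow> (LINT x|lebesgue_on \<Omega>. f x \<bullet> h x)"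
proof -
  have i: "integrable (lebesgue_on \<Omega>) (\<lambda>x. g x \<bullet> h x)" if g: "integrable (lebesgue_on \<Omega>) g" for g :: "real^'n \<Rightarrow> 'b"
  proof (rule Bochner_Integration.integrable_bound)
    show "integrable (lebesgue_on \<Omega>) (\<lambda>x. C * norm (g x))" using g by (intro integrable_mult_right integrable_norm)
    show "AE x in lebesgue_on \<Omega>. norm (g x \<bullet> h x) \<le> norm (C * norm (g x))"
    proof (rule AE_I2)
      fix x assume "x \<in> space (lebesgue_on \<Omega>)"
      then have "norm (h x) \<le> \<bar>C\<bar>" using h(2)[of x] by (simp add: space_restrict_space)
      then have "norm (g x) * norm (h x) \<le> norm (g x) * \<bar>C\<bar>" by (intro mult_left_mono) auto
      then show "norm (g x \<bullet> h x) \<le> norm (C * norm (g x))"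
        using Cauchy_Schwarz_ineq2[of "g x" "h x"] by (simp add: abs_mult mult.commute)
    qed
  qed (intro borel_measurable_inner h borel_measurable_integrable[OF g])
  have fi: "integrable (lebesgue_on \<Omega>) f" using in_Lp_imp_integrable[OF \<Omega> f s] .
  show "integrable (lebesgue_on \<Omega>) (\<lambda>x. f x \<bullet> h x)" by (rule i[OF fi])
  have di: "integrable (lebesgue_on \<Omega>) (\<lambda>x. F n x - f x)" for n
    using in_Lp_imp_integrable[OF \<Omega> _ s] F by (auto simp: Lp_null_def)
  have Fi: "integrable (lebesgue_on \<Omega>) (F n)" for n
    using Bochner_Integration.integrable_add[OF di[of n] fi] by simp
  have "(\<lambda>n. (LINT x|lebesgue_on \<Omega>. F n x \<bullet> h x) - (LINT x|lebesgue_on \<Omega>. f x \<bullet> h x)) \<longlonglongrightarrow> 0"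
  proof (rule Lim_null_comparison)
    have "(\<lambda>n. \<bar>C\<bar> * (LINT x|lebesgue_on \<Omega>. norm (F n x - f x))) \<longlonglongrightarrow> \<bar>C\<bar> * 0"
      using Lp_null_imp_L1_null[OF \<Omega> F s] by (intro tendsto_intros)
    then show "(\<lambda>n. \<bar>C\<bar> * (LINT x|lebesgue_on \<Omega>. norm (F n x - f x))) \<longlonglongrightarrow> 0" by simp
    show "\<forall>\<^sub>F n in sequentially. norm ((LINT x|lebesgue_on \<Omega>. F n x \<bullet> h x) - (LINT x|lebesgue_on \<Omega>. f x \<bullet> h x))
        \<le> \<bar>C\<bar> * (LINT x|lebesgue_on \<Omega>. norm (F n x - f x))"
    proof (rule always_eventually, rule allI)
      fix n
      have "norm ((LINT x|lebesgue_on \<Omega>. F n x \<bullet> h x) - (LINT x|lebesgue_on \<Omega>. f x \<bullet> h x)) = norm (LINT x|lebesgue_on \<Omega>. (F n x - f x) \<bullet> h x)"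
        using i[OF Fi[of n]] i[OF fi] by (simp add: inner_diff_left)
      also have "\<dots> \<le> (LINT x|lebesgue_on \<Omega>. norm ((F n x - f x) \<bullet> h x))"
        by (rule integral_norm_bound)
      also have "\<dots> \<le> (LINT x|lebesgue_on \<Omega>. \<bar>C\<bar> * norm (F n x - f x))"
      proof (rule integral_mono_AE)
        show "AE x in lebesgue_on \<Omega>. norm ((F n x - f x) \<bullet> h x) \<le> \<bar>C\<bar> * norm (F n x - f x)"
        proof (rule AE_I2)
          fix x assume "x \<in> space (lebesgue_on \<Omega>)"
          then have "norm (h x) \<le> \<bar>C\<bar>" using h(2)[of x] by (simp add: space_restrict_space)
          then have "norm (F n x - f x) * norm (h x) \<le> norm (F n x - f x) * \<bar>C\<bar>" by (intro mult_left_mono) auto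
          then show "norm ((F n x - f x) \<bullet> h x) \<le> \<bar>C\<bar> * norm (F n x - f x)"
            using Cauchy_Schwarz_ineq2[of "F n x - f x" "h x"] by (simp add: mult.commute)
        qed
      qed (use i[OF di] di in \<open>auto intro: integrable_norm\<close>)
      finally show "norm ((LINT x|lebesgue_on \<Omega>. F n x \<bullet> h x) - (LINT x|lebesgue_on \<Omega>. f x \<bullet> h x))
        \<le> \<bar>C\<bar> * (LINT x|lebesgue_on \<Omega>. norm (F n x - f x))" by simp
    qed
  qed
  then show "(\<lambda>n. LINT x|lebesgue_on \<Omega>. F n x \<bullet> h x) \<longlonglongrightarrow> (LINT x|lebesgue_on \<Omega>. f x \<bullet> h x)"
    by (simp add: LIM_zero_iff)
qed

lemma in_Lp_subset:
  fixes f :: "real^'n \<Rightarrow> 'b::euclidean_space"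
  assumes "open \<Omega>" "open U" "U \<subseteq> \<Omega>" "in_Lp \<Omega> s f"
  shows "in_Lp U s f"
    and "(LINT x|lebesgue_on U. norm (f x) powr s) \<le> (LINT x|lebesgue_on \<Omega>. norm (f x) powr s)"
proof -
  have ind: "indicat_real U x = indicat_real U x * indicat_real \<Omega> x" for x
    using assms(3) by (auto simp: indicator_def)
  have m: "f \<in> borel_measurable (lebesgue_on U)"
    using in_Lp_measurable[OF assms(4)] assms(3)
    by (metis inf.absorb_iff2 measurable_restrict_mono)
  have i: "integrable lebesgue (\<lambda>x. indicator \<Omega> x *\<^sub>R (norm (f x) powr s))"
    using assms by (simp only: integrable_lebesgue_on_iff[symmetric] open_sets_lebesgue in_Lp_integrable)
  have iU: "integrable lebesgue (\<lambda>x. indicator U x *\<^sub>R (norm (f x) powr s))"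
    using integrable_mult_indicator[OF open_sets_lebesgue[OF assms(2)] i]
    by (simp only: scaleR_scaleR ind[symmetric])
  show "in_Lp U s f" unfolding in_Lp_def
    using m iU assms(2) by (simp only: integrable_lebesgue_on_iff open_sets_lebesgue)
  show "(LINT x|lebesgue_on U. norm (f x) powr s) \<le> (LINT x|lebesgue_on \<Omega>. norm (f x) powr s)"
    using assms(1-3) i iU
    by (simp only: integral_lebesgue_on open_sets_lebesgue) (intro integral_mono, auto simp: indicator_def)
qed

lemma in_Lp_extend:
  fixes f :: "real^'n \<Rightarrow> 'b::euclidean_space"
  assumes "open \<Omega>" "open U" "U \<subseteq> \<Omega>" "in_Lp U s f" "\<And>x. x \<notin> U \<Longrightarrow> f x = 0"
  shows "in_Lp \<Omega> s f"
    and "(LINT x|lebesgue_on \<Omega>. norm (f x) powr s) = (LINT x|lebesgue_on U. norm (f x) powr s)"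
proof -
  have U: "U \<in> sets lebesgue" "U \<inter> space lebesgue \<in> sets lebesgue" "\<Omega> \<in> sets lebesgue" using assms by (auto simp: open_sets_lebesgue)
  have eq: "indicat_real \<Omega> x *\<^sub>R norm (f x) powr s = indicat_real U x *\<^sub>R norm (f x) powr s" for x
    using assms(3,5) by (cases "x \<in> U") (auto simp: indicator_def)
  have "(\<lambda>x. indicat_real U x *\<^sub>R f x) \<in> borel_measurable lebesgue"
    using in_Lp_measurable[OF assms(4)] borel_measurable_restrict_space_iff[OF U(2)] by blast
  moreover have "(\<lambda>x. indicat_real U x *\<^sub>R f x) = f" using assms(5) by (auto simp: indicator_def fun_eq_iff)
  ultimately have "f \<in> borel_measurable lebesgue" by simp
  then have m: "f \<in> borel_measurable (lebesgue_on \<Omega>)" by (rule measurable_restrict_space1)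
  have "integrable lebesgue (\<lambda>x. indicator U x *\<^sub>R (norm (f x) powr s))"
    using in_Lp_integrable[OF assms(4)] U by (simp only: integrable_lebesgue_on_iff)
  then show "in_Lp \<Omega> s f" unfolding in_Lp_def using m U
    by (simp only: integrable_lebesgue_on_iff eq)
  show "(LINT x|lebesgue_on \<Omega>. norm (f x) powr s) = (LINT x|lebesgue_on U. norm (f x) powr s)"
    using U by (simp only: integral_lebesgue_on eq)
qed

section \<open>Sobolev functions with zero boundary values\<close>

text \<open>The function is paired with a named gradient, as an element of the closure of the set of
  pairs (\<phi>, grad \<phi>). Linear combinations and truncations can then be followed with
  explicit gradients; the connection with \<open>W01p\<close> and the chosen
  \<open>weak_grad\<close> is made only at both ends of the argument.\<close>

definition W0grad :: "(real^'n) set \<Rightarrow> real \<Rightarrow> (real^'n \<Rightarrow> real) \<Rightarrow> (real^'n \<Rightarrow> real^'n) \<Rightarrow> bool" where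
  "W0grad \<Omega> s u g \<longleftrightarrow> in_Lp \<Omega> s u \<and> in_Lp \<Omega> s g \<and>
     (\<exists>\<phi>. (\<forall>n. test_function \<Omega> (\<phi> n)) \<and> Lp_null \<Omega> s (\<lambda>n x. \<phi> n x - u x) \<and>
       Lp_null \<Omega> s (\<lambda>n x. grad (\<phi> n) x - g x))"

lemma W0gradE:
  assumes "W0grad \<Omega> s u g"
  obtains \<phi> where "in_Lp \<Omega> s u" "in_Lp \<Omega> s g" "\<And>n. test_function \<Omega> (\<phi> n)"
    "Lp_null \<Omega> s (\<lambda>n x. \<phi> n x - u x)" "Lp_null \<Omega> s (\<lambda>n x. grad (\<phi> n) x - g x)"
  using assms unfolding W0grad_def by (elim conjE exE) (rule that, simp_all)

lemma W0gradI:
  assumes "in_Lp \<Omega> s u" "in_Lp \<Omega> s g" "\<And>n. test_function \<Omega> (\<phi> n)"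
    "Lp_null \<Omega> s (\<lambda>n x. \<phi> n x - u x)" "Lp_null \<Omega> s (\<lambda>n x. grad (\<phi> n) x - g x)"
  shows "W0grad \<Omega> s u g"
  unfolding W0grad_def by (intro conjI exI[of _ \<phi>] allI assms)

lemma test_function_measurable:
  assumes "test_function \<Omega> \<psi>"
  shows "\<psi> \<in> borel_measurable (lebesgue_on S)" "grad \<psi> \<in> borel_measurable (lebesgue_on S)"
    "partial_deriv i \<psi> \<in> borel_measurable (lebesgue_on S)"
  using test_function_Cinf[OF assms]
  by (auto intro!: continuous_on_measurable_lebesgue_on Cinf_continuous_on Cinf_continuous_on_grad
      Cinf_continuous_on_partial)

lemma test_function_in_Lp:
  assumes "open \<Omega>" "bounded \<Omega>" "0 \<le> s" "test_function \<Omega> \<psi>"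
  shows "in_Lp \<Omega> s \<psi>" "in_Lp \<Omega> s (grad \<psi>)"
proof -
  obtain C where C: "C > 0" "\<And>x. \<bar>\<psi> x\<bar> \<le> C" "\<And>x. norm (grad \<psi> x) \<le> C" "\<And>x i. \<bar>partial_deriv i \<psi> x\<bar> \<le> C"
    by (rule test_function_bounds[OF assms(4)]) blast
  show "in_Lp \<Omega> s \<psi>" "in_Lp \<Omega> s (grad \<psi>)"
    using C test_function_measurable[OF assms(4)]
    by (auto intro!: in_Lp_bounded[OF assms(1-3), of _ C])
qed

lemma Lp_null_zero: "Lp_null \<Omega> s (\<lambda>n x. 0)"
  by (simp add: Lp_null_def in_Lp_def)

lemma W0grad_test_function:
  assumes "open \<Omega>" "bounded \<Omega>" "0 \<le> s" "test_function \<Omega> \<psi>"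
  shows "W0grad \<Omega> s \<psi> (grad \<psi>)"
  using test_function_in_Lp[OF assms] assms(4)
  by (intro W0gradI[where \<phi> = "\<lambda>_. \<psi>"]) (auto simp: Lp_null_zero)

lemma grad_lincomb:
  assumes "Cinf_on UNIV \<phi>" "Cinf_on UNIV \<psi>"
  shows "grad (\<lambda>x. \<phi> x + c * \<psi> x) x = grad \<phi> x + c *\<^sub>R grad \<psi> x"
  using GDERIV_add[OF Cinf_GDERIV[OF assms(1)] GDERIV_mult[OF GDERIV_const[where k = c] Cinf_GDERIV[OF assms(2)]], of x]
  by (intro grad_eqI) simp

lemma test_function_lincomb:
  assumes "test_function \<Omega> \<phi>" "test_function \<Omega> \<psi>"
  shows "test_function \<Omega> (\<lambda>x. \<phi> x + c * \<psi> x)"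
proof -
  obtain K where K: "compact K" "K \<subseteq> \<Omega>" "\<And>x. x \<notin> K \<Longrightarrow> \<phi> x = 0" by (rule test_function_obtain[OF assms(1)]) blast
  obtain L where L: "compact L" "L \<subseteq> \<Omega>" "\<And>x. x \<notin> L \<Longrightarrow> \<psi> x = 0" by (rule test_function_obtain[OF assms(2)]) blast
  show ?thesis
    by (rule test_functionI[of _ "K \<union> L"])
      (use K L test_function_Cinf[OF assms(1)] test_function_Cinf[OF assms(2)] in \<open>auto intro!: Cinf_intros\<close>)
qed

lemma Lp_null_scaleR: "Lp_null \<Omega> s F \<Longrightarrow> 0 \<le> s \<Longrightarrow> Lp_null \<Omega> s (\<lambda>n x. c *\<^sub>R F n x)"
  by (rule Lp_null_dominated[of _ _ F _ "\<bar>c\<bar>"])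
    (auto simp: Lp_null_def intro!: borel_measurable_scaleR dest: in_Lp_measurable)

lemma W0grad_lincomb:
  assumes "W0grad \<Omega> s u g" "W0grad \<Omega> s v h" "0 \<le> s"
  shows "W0grad \<Omega> s (\<lambda>x. u x + c * v x) (\<lambda>x. g x + c *\<^sub>R h x)"
proof -
  obtain \<phi> where \<phi>: "in_Lp \<Omega> s u" "in_Lp \<Omega> s g" "\<And>n. test_function \<Omega> (\<phi> n)"
    "Lp_null \<Omega> s (\<lambda>n x. \<phi> n x - u x)" "Lp_null \<Omega> s (\<lambda>n x. grad (\<phi> n) x - g x)"
    by (rule W0gradE[OF assms(1)]) blast
  obtain \<psi> where \<psi>: "in_Lp \<Omega> s v" "in_Lp \<Omega> s h" "\<And>n. test_function \<Omega> (\<psi> n)"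
    "Lp_null \<Omega> s (\<lambda>n x. \<psi> n x - v x)" "Lp_null \<Omega> s (\<lambda>n x. grad (\<psi> n) x - h x)"
    by (rule W0gradE[OF assms(2)]) blast
  show ?thesis
  proof (rule W0gradI[where \<phi> = "\<lambda>n x. \<phi> n x + c * \<psi> n x"])
    show "in_Lp \<Omega> s (\<lambda>x. u x + c * v x)" "in_Lp \<Omega> s (\<lambda>x. g x + c *\<^sub>R h x)"
      using in_Lp_add[OF \<phi>(1) in_Lp_scaleR[OF \<psi>(1)], of c] in_Lp_add[OF \<phi>(2) in_Lp_scaleR[OF \<psi>(2)], of c] assms(3)
      by auto
    show "test_function \<Omega> (\<lambda>x. \<phi> n x + c * \<psi> n x)" for n using \<phi>(3) \<psi>(3) by (rule test_function_lincomb)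
    have "(\<lambda>n x. \<phi> n x + c * \<psi> n x - (u x + c * v x)) = (\<lambda>n x. (\<phi> n x - u x) + c *\<^sub>R (\<psi> n x - v x))"
      by (auto simp: algebra_simps fun_eq_iff)
    then show "Lp_null \<Omega> s (\<lambda>n x. \<phi> n x + c * \<psi> n x - (u x + c * v x))"
      using Lp_null_add[OF \<phi>(4) Lp_null_scaleR[OF \<psi>(4) assms(3), of c] assms(3)] by simp
    have "(\<lambda>n x. grad (\<lambda>x. \<phi> n x + c * \<psi> n x) x - (g x + c *\<^sub>R h x))
        = (\<lambda>n x. (grad (\<phi> n) x - g x) + c *\<^sub>R (grad (\<psi> n) x - h x))"
      using grad_lincomb[OF test_function_Cinf[OF \<phi>(3)] test_function_Cinf[OF \<psi>(3)]]
      by (auto simp: algebra_simps fun_eq_iff)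
    then show "Lp_null \<Omega> s (\<lambda>n x. grad (\<lambda>x. \<phi> n x + c * \<psi> n x) x - (g x + c *\<^sub>R h x))"
      using Lp_null_add[OF \<phi>(5) Lp_null_scaleR[OF \<psi>(5) assms(3), of c] assms(3)] by simp
  qed
qed

lemma test_function_zero: "test_function \<Omega> (\<lambda>_. 0)"
  by (rule test_functionI[of _ "{}"]) (auto intro: Cinf_on_const)

lemma W0grad_zero: "W0grad \<Omega> s (\<lambda>_. 0) (\<lambda>_. 0)" for \<Omega> :: "(real^'n) set"
proof -
  have "grad (\<lambda>_::real^'n. 0) = (\<lambda>_. 0)" using grad_eqI[OF GDERIV_const[of 0]] by fastforce
  then show ?thesis
    by (intro W0gradI[where \<phi> = "\<lambda>_ _. 0"]) (auto simp: Lp_null_zero in_Lp_def test_function_zero)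
qed

lemma W0grad_scale:
  "W0grad \<Omega> s u g \<Longrightarrow> 0 \<le> s \<Longrightarrow> W0grad \<Omega> s (\<lambda>x. c * u x) (\<lambda>x. c *\<^sub>R g x)"
  using W0grad_lincomb[OF W0grad_zero, of \<Omega> s u g c] by simp

lemma W0grad_minus:
  "W0grad \<Omega> s u g \<Longrightarrow> 0 \<le> s \<Longrightarrow> W0grad \<Omega> s (\<lambda>x. - u x) (\<lambda>x. - g x)"
  using W0grad_scale[of \<Omega> s u g "-1"] by simp

lemma test_function_mono: "test_function U \<psi> \<Longrightarrow> U \<subseteq> \<Omega> \<Longrightarrow> test_function \<Omega> \<psi>"
  unfolding test_function_def by blast

lemma test_function_eq_0:
  assumes "test_function U \<psi>" "x \<notin> U"
  shows "\<psi> x = 0" "grad \<psi> x = 0"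
proof -
  have "x \<notin> closure {x. \<psi> x \<noteq> 0}" using assms unfolding test_function_def by blast
  then show "\<psi> x = 0" "grad \<psi> x = 0" using eq_0_outside_support grad_outside by blast+
qed

lemma Lp_null_extend:
  assumes "open \<Omega>" "open U" "U \<subseteq> \<Omega>" "Lp_null U s F" "\<And>n x. x \<notin> U \<Longrightarrow> F n x = 0"
  shows "Lp_null \<Omega> s F"
  using assms in_Lp_extend[OF assms(1-3), of s "F _"] unfolding Lp_null_def by simp

lemma Lp_null_subset:
  assumes "open \<Omega>" "open U" "U \<subseteq> \<Omega>" "Lp_null \<Omega> s F"
  shows "Lp_null U s F"
  unfolding Lp_null_def
proof
  have i: "in_Lp \<Omega> s (F n)" for n using assms(4) by (simp add: Lp_null_def)
  show "\<forall>n. in_Lp U s (F n)" using in_Lp_subset[OF assms(1-3) i] by simp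
  show "(\<lambda>n. LINT x|lebesgue_on U. norm (F n x) powr s) \<longlonglongrightarrow> 0"
  proof (rule tendsto_sandwich[OF _ _ tendsto_const])
    show "(\<lambda>n. LINT x|lebesgue_on \<Omega>. norm (F n x) powr s) \<longlonglongrightarrow> 0" using assms(4) by (simp add: Lp_null_def)
  qed (use in_Lp_subset(2)[OF assms(1-3) i] in auto)
qed

text \<open>A test function on \<open>U\<close> is one on \<Omega>, so the same approximating
  sequence serves. Perturbations built in a small ball become competitors on the whole domain in
  this way.\<close>

lemma W0grad_extend:
  assumes "open \<Omega>" "open U" "U \<subseteq> \<Omega>" "W0grad U s v h" "\<And>x. x \<notin> U \<Longrightarrow> v x = 0" "\<And>x. x \<notin> U \<Longrightarrow> h x = 0"
  shows "W0grad \<Omega> s v h"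
proof -
  obtain \<phi> where \<phi>: "in_Lp U s v" "in_Lp U s h" "\<And>n. test_function U (\<phi> n)"
    "Lp_null U s (\<lambda>n x. \<phi> n x - v x)" "Lp_null U s (\<lambda>n x. grad (\<phi> n) x - h x)"
    by (rule W0gradE[OF assms(4)]) blast
  show ?thesis
  proof (rule W0gradI[where \<phi> = \<phi>])
    show "in_Lp \<Omega> s v" "in_Lp \<Omega> s h" using in_Lp_extend(1)[OF assms(1-3)] \<phi> assms(5,6) by blast+
    show "test_function \<Omega> (\<phi> n)" for n using test_function_mono[OF \<phi>(3) assms(3)] .
    show "Lp_null \<Omega> s (\<lambda>n x. \<phi> n x - v x)" "Lp_null \<Omega> s (\<lambda>n x. grad (\<phi> n) x - h x)"
      using test_function_eq_0[OF \<phi>(3)] assms(5,6)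
      by (auto intro!: Lp_null_extend[OF assms(1-3)] \<phi>(4,5))
  qed
qed

subsection \<open>Integration by parts\<close>

lemma continuous_imp_locally_integrable:
  fixes f :: "real^'n \<Rightarrow> 'b::euclidean_space"
  assumes "continuous_on U f"
  shows "locally_integrable U f"
  unfolding locally_integrable_def
proof (intro allI impI)
  fix K assume K: "compact K \<and> K \<subseteq> U"
  then have i: "integrable lborel (\<lambda>x. indicator K x *\<^sub>R f x)"
    using assms by (intro borel_integrable_compact) (auto intro: continuous_on_subset)
  have "integrable lebesgue (\<lambda>x. indicator K x *\<^sub>R f x)"
    using integrable_completion[OF borel_measurable_integrable[OF i]] i by simp
  then show "set_integrable lebesgue K f" by (simp add: set_integrable_def)
qed

lemma GDERIV_isCont: "GDERIV f x :> g \<Longrightarrow> isCont f x"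
  unfolding gderiv_def by (rule has_derivative_continuous)

text \<open>Multiplying by \<psi> makes the product, extended by zero, differentiable on the whole
  space, where the integral of its gradient vanishes. The factor \<open>a\<close> lives on
  \<open>U\<close> only, as the p-Laplace field of a quadratic polynomial is smooth only where the
  gradient of the polynomial does not vanish.\<close>

lemma integral_by_parts_test:
  fixes a :: "real^'n \<Rightarrow> real"
  assumes U: "open U" and t: "test_function U \<psi>" and a: "\<And>x. x \<in> U \<Longrightarrow> GDERIV a x :> b x"
    and b: "continuous_on U b"
  shows "(LINT x|lebesgue_on U. a x * partial_deriv i \<psi> x) = - (LINT x|lebesgue_on U. b x $ i * \<psi> x)"
    and "integrable (lebesgue_on U) (\<lambda>x. a x * partial_deriv i \<psi> x)"
    and "integrable (lebesgue_on U) (\<lambda>x. b x $ i * \<psi> x)"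
proof -
  obtain K where K: "compact K" "K \<subseteq> U" "\<And>x. x \<notin> K \<Longrightarrow> \<psi> x = 0" "\<And>x. x \<notin> K \<Longrightarrow> grad \<psi> x = 0"
    by (rule test_function_obtain[OF t]) blast
  have ca: "continuous_on U a" using a GDERIV_isCont by (intro continuous_at_imp_continuous_on) blast
  note C = test_function_Cinf[OF t]
  \<comment> \<open>The gradient of \<open>a * \<psi>\<close>: product rule on \<open>U\<close>,
    zero off \<open>K\<close>. The two open sets \<open>U\<close> and \<open>- K\<close> cover the
    space and the formulas agree on the overlap, which gives continuity.\<close>
  define g where "g x = (if x \<in> U then a x *\<^sub>R grad \<psi> x + \<psi> x *\<^sub>R b x else 0)" for x
  have g0: "g x = 0" if "x \<notin> K" for x using that K by (simp add: g_def)
  have KU: "U \<union> (- K) = UNIV" using K by auto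
  have "continuous_on (U \<union> (- K)) g"
  proof (rule continuous_on_open_Un)
    have "continuous_on U (\<lambda>x. a x *\<^sub>R grad \<psi> x + \<psi> x *\<^sub>R b x)"
      by (intro continuous_intros ca b Cinf_continuous_on[OF C] Cinf_continuous_on_grad[OF C])
    then show "continuous_on U g" by (rule continuous_on_eq) (simp add: g_def)
    have "continuous_on (- K) (\<lambda>x. 0 :: real^'n)" by simp
    then show "continuous_on (- K) g" by (rule continuous_on_eq) (simp add: g0)
  qed (rule U open_Compl[OF compact_imp_closed[OF K(1)]])+
  then have cg: "continuous_on UNIV g" by (simp add: KU)
  obtain B where "B > 0" and B: "\<And>x. norm (g x) \<le> B"
    by (rule compact_support_bounded[of K g]) (use K(1) g0 cg in auto)
  have d: "GDERIV (\<lambda>x. a x * \<psi> x) x :> g x" for x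
  proof (cases "x \<in> U")
    case True
    then show ?thesis using GDERIV_mult[OF a[OF True] Cinf_GDERIV[OF C]] by (simp add: g_def)
  next
    case False
    have "GDERIV (\<lambda>x. a x * \<psi> x) x :> 0"
    proof (rule GDERIV_transform_within_open[OF GDERIV_const])
      show "open (- K)" by (rule open_Compl[OF compact_imp_closed[OF K(1)]])
      show "0 = a y * \<psi> y" if "y \<in> - K" for y using that K by simp
    qed (use False K in auto)
    then show ?thesis using False by (simp add: g_def)
  qed
  have "(LINT x|lborel. g x $ i) = 0"
  proof (rule integral_partial_deriv_zero[OF K(1) _ _ d B])
    show "a x * \<psi> x = 0" if "x \<notin> K" for x using that K by simp
    show "continuous_on UNIV (\<lambda>x. a x * \<psi> x)"
      using d GDERIV_isCont by (intro continuous_at_imp_continuous_on) blast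
  qed
  moreover have "(\<lambda>x. g x $ i) \<in> borel_measurable lborel"
    using cg by (simp add: borel_measurable_continuous_onI continuous_on_component)
  ultimately have "(LINT x|lebesgue. g x $ i) = 0" by (simp add: integral_completion)
  moreover have "g x $ i = indicator U x *\<^sub>R (a x * partial_deriv i \<psi> x + b x $ i * \<psi> x)" for x
    by (simp add: g_def grad_nth)
  ultimately have z: "(LINT x|lebesgue_on U. a x * partial_deriv i \<psi> x + b x $ i * \<psi> x) = 0"
    using U by (simp add: integral_lebesgue_on open_sets_lebesgue)
  show i1: "integrable (lebesgue_on U) (\<lambda>x. a x * partial_deriv i \<psi> x)"
    by (rule integrable_mult_test(2)[OF U continuous_imp_locally_integrable[OF ca] t])
  have "continuous_on U (\<lambda>x. b x $ i)" using b by (intro continuous_intros)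
  then show i2: "integrable (lebesgue_on U) (\<lambda>x. b x $ i * \<psi> x)"
    by (intro integrable_mult_test(1)[OF U continuous_imp_locally_integrable t])
  show "(LINT x|lebesgue_on U. a x * partial_deriv i \<psi> x) = - (LINT x|lebesgue_on U. b x $ i * \<psi> x)"
    using z i1 i2 by simp
qed

lemma integrable_imp_locally_integrable:
  fixes f :: "real^'n \<Rightarrow> 'b::euclidean_space"
  assumes "open \<Omega>" "integrable (lebesgue_on \<Omega>) f"
  shows "locally_integrable \<Omega> f"
  unfolding locally_integrable_def set_integrable_def
proof (intro allI impI)
  fix K assume K: "compact K \<and> K \<subseteq> \<Omega>"
  have i: "integrable lebesgue (\<lambda>x. indicator \<Omega> x *\<^sub>R f x)"
    using assms by (simp only: integrable_lebesgue_on_iff open_sets_lebesgue)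
  have ind: "indicat_real K x = indicat_real K x * indicat_real \<Omega> x" for x
    using K by (auto simp: indicator_def)
  show "integrable lebesgue (\<lambda>x. indicator K x *\<^sub>R f x)"
    using integrable_mult_indicator[OF compact_sets_lebesgue i, of K] K
    by (simp only: scaleR_scaleR ind[symmetric])
qed

lemma W0grad_is_weak_grad:
  assumes \<Omega>: "open \<Omega>" "bounded \<Omega>" and s: "1 \<le> s" and w: "W0grad \<Omega> s u g"
  shows "is_weak_grad \<Omega> u g"
proof -
  obtain \<phi> where \<phi>: "in_Lp \<Omega> s u" "in_Lp \<Omega> s g" "\<And>n. test_function \<Omega> (\<phi> n)"
    "Lp_null \<Omega> s (\<lambda>n x. \<phi> n x - u x)" "Lp_null \<Omega> s (\<lambda>n x. grad (\<phi> n) x - g x)"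
    by (rule W0gradE[OF w]) blast
  show ?thesis unfolding is_weak_grad_def
  proof (intro conjI allI impI)
    show "locally_integrable \<Omega> u" "locally_integrable \<Omega> g"
      using in_Lp_imp_integrable[OF \<Omega> _ s] \<phi>(1,2) \<Omega>(1) by (auto intro: integrable_imp_locally_integrable)
    fix \<psi> i assume t: "test_function \<Omega> \<psi>"
    obtain C where C: "C > 0" "\<And>x. \<bar>\<psi> x\<bar> \<le> C" "\<And>x. norm (grad \<psi> x) \<le> C" "\<And>x i. \<bar>partial_deriv i \<psi> x\<bar> \<le> C"
      by (rule test_function_bounds[OF t]) blast
    have l1: "(\<lambda>n. LINT x|lebesgue_on \<Omega>. \<phi> n x \<bullet> partial_deriv i \<psi> x) \<longlonglongrightarrow> (LINT x|lebesgue_on \<Omega>. u x \<bullet> partial_deriv i \<psi> x)"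
      using C(4) test_function_measurable[OF t] by (intro integral_mult_tendsto[OF \<Omega> \<phi>(4,1) s]) auto
    have l2: "(\<lambda>n. LINT x|lebesgue_on \<Omega>. grad (\<phi> n) x \<bullet> (\<psi> x *\<^sub>R axis i 1)) \<longlonglongrightarrow> (LINT x|lebesgue_on \<Omega>. g x \<bullet> (\<psi> x *\<^sub>R axis i 1))"
      using C(2) test_function_measurable[OF t]
      by (intro integral_mult_tendsto[OF \<Omega> \<phi>(5,2) s borel_measurable_scaleR, of _ _ C]) (auto simp: norm_axis_1)
    have eq: "(LINT x|lebesgue_on \<Omega>. \<phi> n x \<bullet> partial_deriv i \<psi> x) = - (LINT x|lebesgue_on \<Omega>. grad (\<phi> n) x \<bullet> (\<psi> x *\<^sub>R axis i 1))" for n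
      using integral_by_parts_test(1)[OF \<Omega>(1) t Cinf_GDERIV[OF test_function_Cinf[OF \<phi>(3)[of n]]]
          Cinf_continuous_on_grad[OF test_function_Cinf[OF \<phi>(3)[of n]]], of i]
      by (simp add: inner_axis mult.commute)
    have "(LINT x|lebesgue_on \<Omega>. u x \<bullet> partial_deriv i \<psi> x) = - (LINT x|lebesgue_on \<Omega>. g x \<bullet> (\<psi> x *\<^sub>R axis i 1))"
      using LIMSEQ_unique[OF l1] tendsto_minus[OF l2] by (simp only: eq)
    then show "(LINT x|lebesgue_on \<Omega>. u x * partial_deriv i \<psi> x) = - (LINT x|lebesgue_on \<Omega>. g x $ i * \<psi> x)"
      by (simp add: inner_axis mult.commute)
  qed
qed

text \<open>\<open>B i\<close> is the gradient of the i-th component of the field, so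
  \<open>\<Sum>i\<in>UNIV. B i x $ i\<close> is its divergence. There is no boundary term because v
  is a limit of functions with compact support in \<open>U\<close>; the bounds on the field and on
  its divergence permit the passage to the limit.\<close>

lemma W0grad_by_parts:
  fixes A :: "real^'n \<Rightarrow> real^'n"
  assumes U: "open U" "bounded U" and s: "1 \<le> s" and w: "W0grad U s v h"
    and A: "\<And>x i. x \<in> U \<Longrightarrow> GDERIV (\<lambda>y. A y $ i) x :> B i x" and B: "\<And>i. continuous_on U (B i)"
    and bd: "\<And>x. x \<in> U \<Longrightarrow> norm (A x) \<le> C" "\<And>x. x \<in> U \<Longrightarrow> \<bar>\<Sum>i\<in>UNIV. B i x $ i\<bar> \<le> C"
  shows "(LINT x|lebesgue_on U. h x \<bullet> A x) = - (LINT x|lebesgue_on U. v x * (\<Sum>i\<in>UNIV. B i x $ i))"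
    and "integrable (lebesgue_on U) (\<lambda>x. h x \<bullet> A x)"
    and "integrable (lebesgue_on U) (\<lambda>x. v x * (\<Sum>i\<in>UNIV. B i x $ i))"
proof -
  obtain \<phi> where \<phi>: "in_Lp U s v" "in_Lp U s h" "\<And>n. test_function U (\<phi> n)"
    "Lp_null U s (\<lambda>n x. \<phi> n x - v x)" "Lp_null U s (\<lambda>n x. grad (\<phi> n) x - h x)"
    by (rule W0gradE[OF w]) blast
  have "continuous_on U (\<lambda>y. A y $ i)" for i
    using A GDERIV_isCont by (intro continuous_at_imp_continuous_on) blast
  then have "continuous_on U A" using continuous_on_vec_lambda[of U "\<lambda>i y. A y $ i"] by simp
  then have mA: "A \<in> borel_measurable (lebesgue_on U)"
    using U(1) by (intro continuous_imp_measurable_on_sets_lebesgue open_sets_lebesgue)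
  have "continuous_on U (\<lambda>x. \<Sum>i\<in>UNIV. B i x $ i)" using B by (intro continuous_intros)
  then have mB: "(\<lambda>x. \<Sum>i\<in>UNIV. B i x $ i) \<in> borel_measurable (lebesgue_on U)"
    using U(1) by (intro continuous_imp_measurable_on_sets_lebesgue open_sets_lebesgue)
  have bB: "\<And>x. x \<in> U \<Longrightarrow> norm (\<Sum>i\<in>UNIV. B i x $ i) \<le> C" using bd(2) by simp
  show "integrable (lebesgue_on U) (\<lambda>x. h x \<bullet> A x)"
    by (rule integral_mult_tendsto(1)[OF U \<phi>(5,2) s mA bd(1)])
  show "integrable (lebesgue_on U) (\<lambda>x. v x * (\<Sum>i\<in>UNIV. B i x $ i))"
    using integral_mult_tendsto(1)[OF U \<phi>(4,1) s mB bB] by simp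
  have l1: "(\<lambda>n. LINT x|lebesgue_on U. grad (\<phi> n) x \<bullet> A x) \<longlonglongrightarrow> (LINT x|lebesgue_on U. h x \<bullet> A x)"
    by (rule integral_mult_tendsto(2)[OF U \<phi>(5,2) s mA bd(1)])
  have l2: "(\<lambda>n. LINT x|lebesgue_on U. \<phi> n x \<bullet> (\<Sum>i\<in>UNIV. B i x $ i)) \<longlonglongrightarrow> (LINT x|lebesgue_on U. v x \<bullet> (\<Sum>i\<in>UNIV. B i x $ i))"
    by (rule integral_mult_tendsto(2)[OF U \<phi>(4,1) s mB bB])
  have eq: "(LINT x|lebesgue_on U. grad (\<phi> n) x \<bullet> A x) = - (LINT x|lebesgue_on U. \<phi> n x \<bullet> (\<Sum>i\<in>UNIV. B i x $ i))" for n
  proof -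
    note ibp = integral_by_parts_test[OF U(1) \<phi>(3)[of n] A B]
    have "(LINT x|lebesgue_on U. grad (\<phi> n) x \<bullet> A x) = (LINT x|lebesgue_on U. (\<Sum>i\<in>UNIV. A x $ i * partial_deriv i (\<phi> n) x))"
      by (simp add: inner_vec_def grad_nth mult.commute)
    also have "\<dots> = (\<Sum>i\<in>UNIV. LINT x|lebesgue_on U. A x $ i * partial_deriv i (\<phi> n) x)"
      using ibp(2) by (intro Bochner_Integration.integral_sum) blast
    also have "\<dots> = - (\<Sum>i\<in>UNIV. LINT x|lebesgue_on U. B i x $ i * \<phi> n x)"
      using ibp(1) by (simp add: sum_negf)
    also have "(\<Sum>i\<in>UNIV. LINT x|lebesgue_on U. B i x $ i * \<phi> n x) = (LINT x|lebesgue_on U. (\<Sum>i\<in>UNIV. B i x $ i * \<phi> n x))"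
      using ibp(3) by (intro Bochner_Integration.integral_sum[symmetric]) blast
    finally show ?thesis by (simp add: sum_distrib_left mult.commute)
  qed
  have "(LINT x|lebesgue_on U. h x \<bullet> A x) = - (LINT x|lebesgue_on U. v x \<bullet> (\<Sum>i\<in>UNIV. B i x $ i))"
    using LIMSEQ_unique[OF l1] tendsto_minus[OF l2] by (simp only: eq)
  then show "(LINT x|lebesgue_on U. h x \<bullet> A x) = - (LINT x|lebesgue_on U. v x * (\<Sum>i\<in>UNIV. B i x $ i))"
    by simp
qed

subsection \<open>The relation to the Sobolev space\<close>

lemma Lp_norm_powr:
  "s > 0 \<Longrightarrow> Lp_norm \<Omega> s f powr s = (LINT x|lebesgue_on \<Omega>. norm (f x) powr s)"
  unfolding Lp_norm_def by (simp add: powr_powr integral_nonneg_AE)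

lemma Lp_norm_tendsto_0_iff:
  assumes "s > 0"
  shows "(\<lambda>n. Lp_norm \<Omega> s (F n)) \<longlonglongrightarrow> 0 \<longleftrightarrow> (\<lambda>n. LINT x|lebesgue_on \<Omega>. norm (F n x) powr s) \<longlonglongrightarrow> 0"
proof
  assume "(\<lambda>n. Lp_norm \<Omega> s (F n)) \<longlonglongrightarrow> 0"
  then have "(\<lambda>n. Lp_norm \<Omega> s (F n) powr s) \<longlonglongrightarrow> 0"
    by (rule tendsto_zero_powrI[OF _ tendsto_const _ assms]) (simp add: Lp_norm_def)
  then show "(\<lambda>n. LINT x|lebesgue_on \<Omega>. norm (F n x) powr s) \<longlonglongrightarrow> 0" using assms by (simp add: Lp_norm_powr)
next
  assume "(\<lambda>n. LINT x|lebesgue_on \<Omega>. norm (F n x) powr s) \<longlonglongrightarrow> 0"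
  then show "(\<lambda>n. Lp_norm \<Omega> s (F n)) \<longlonglongrightarrow> 0" unfolding Lp_norm_def
    by (rule tendsto_zero_powrI[OF _ tendsto_const]) (use assms in \<open>auto intro: integral_nonneg_AE\<close>)
qed

text \<open>Completeness of Lebesgue measure. It supplies the measurability of
  \<open>weak_grad\<close>, which is pinned down only almost everywhere.\<close>

lemma borel_measurable_lebesgue_on_AE:
  fixes f g :: "real^'n \<Rightarrow> 'b::euclidean_space"
  assumes S: "S \<in> sets lebesgue" and f: "f \<in> borel_measurable (lebesgue_on S)" and ae: "AE x in lebesgue_on S. f x = g x"
  shows "g \<in> borel_measurable (lebesgue_on S)"
proof -
  have S': "S \<inter> space lebesgue \<in> sets lebesgue" using S by simp
  have "(\<lambda>x. indicat_real S x *\<^sub>R f x) \<in> borel_measurable lebesgue"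
    using f borel_measurable_restrict_space_iff[OF S'] by blast
  moreover have "AE x in lebesgue. indicat_real S x *\<^sub>R f x = indicat_real S x *\<^sub>R g x"
    using ae unfolding AE_restrict_space_iff[OF S'] by (auto simp: indicator_def elim: eventually_mono)
  ultimately have "(\<lambda>x. indicat_real S x *\<^sub>R g x) \<in> borel_measurable lebesgue" by (rule borel_measurable_AE)
  then show ?thesis using borel_measurable_restrict_space_iff[OF S'] by blast
qed

lemma W0grad_imp_W01p:
  assumes \<Omega>: "open \<Omega>" "bounded \<Omega>" and s: "1 \<le> s" and w: "W0grad \<Omega> s u g"
  shows "u \<in> W01p \<Omega> s" and "AE x in lebesgue_on \<Omega>. weak_grad \<Omega> u x = g x"
proof -
  obtain \<phi> where \<phi>: "in_Lp \<Omega> s u" "in_Lp \<Omega> s g" "\<And>n. test_function \<Omega> (\<phi> n)"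
    "Lp_null \<Omega> s (\<lambda>n x. \<phi> n x - u x)" "Lp_null \<Omega> s (\<lambda>n x. grad (\<phi> n) x - g x)"
    by (rule W0gradE[OF w]) blast
  note wg = W0grad_is_weak_grad[OF \<Omega> s w]
  show ae: "AE x in lebesgue_on \<Omega>. weak_grad \<Omega> u x = g x" by (rule weak_grad_AE_eq[OF \<Omega>(1) wg])
  have m: "weak_grad \<Omega> u \<in> borel_measurable (lebesgue_on \<Omega>)"
    using ae by (intro borel_measurable_lebesgue_on_AE[OF open_sets_lebesgue[OF \<Omega>(1)] in_Lp_measurable[OF \<phi>(2)]])
      (auto elim: eventually_mono)
  have il: "in_Lp \<Omega> s (weak_grad \<Omega> u)" using ae s by (intro in_Lp_cong_AE[OF \<phi>(2) _ m]) auto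
  have "Lp_null \<Omega> s (\<lambda>n x. grad (\<phi> n) x - weak_grad \<Omega> u x)"
  proof (rule Lp_null_dominated[OF \<phi>(5), of _ 1])
    show "(\<lambda>x. grad (\<phi> n) x - weak_grad \<Omega> u x) \<in> borel_measurable (lebesgue_on \<Omega>)" for n
      using m test_function_measurable[OF \<phi>(3)] by (intro borel_measurable_diff)
    show "AE x in lebesgue_on \<Omega>. norm (grad (\<phi> n) x - weak_grad \<Omega> u x) \<le> 1 * norm (grad (\<phi> n) x - g x)" for n
      using ae by eventually_elim simp
  qed (use s in auto)
  then show "u \<in> W01p \<Omega> s"
    unfolding W01p_def W1p_def using \<phi> il wg s
    by (auto simp: Lp_norm_tendsto_0_iff Lp_null_def intro!: exI[of _ \<phi>])
qed

lemma W01p_imp_W0grad: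
  assumes \<Omega>: "open \<Omega>" "bounded \<Omega>" and s: "1 \<le> s" and u: "u \<in> W01p \<Omega> s"
  shows "W0grad \<Omega> s u (weak_grad \<Omega> u)"
proof -
  obtain \<phi> where "in_Lp \<Omega> s u" "in_Lp \<Omega> s (weak_grad \<Omega> u)" and t: "\<And>n. test_function \<Omega> (\<phi> n)"
    and l: "(\<lambda>n. Lp_norm \<Omega> s (\<lambda>x. \<phi> n x - u x)) \<longlonglongrightarrow> 0"
      "(\<lambda>n. Lp_norm \<Omega> s (\<lambda>x. grad (\<phi> n) x - weak_grad \<Omega> u x)) \<longlonglongrightarrow> 0"
    using u unfolding W01p_def W1p_def by auto
  then show ?thesis
    using s test_function_in_Lp[OF \<Omega> _ t]
    by (intro W0gradI[where \<phi> = \<phi>]) (auto simp: Lp_null_def Lp_norm_tendsto_0_iff intro!: in_Lp_diff)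
qed

section \<open>Truncation below a smooth function\<close>

text \<open>Two nested bumps of the squared distance, which is smooth also at the centre. The inner
  one vanishes up to radius r1, and \<open>k\<close> is scaled so that it exceeds one beyond r2; the
  outer one therefore equals \<open>bump 1\<close> inside and 0 outside, and is divided by
  \<open>bump 1\<close>. The gap between r2 and r3 holds the closed support in an open ball.\<close>

lemma cutoff_exists:
  fixes x0 :: "real^'n"
  assumes r: "0 < r1" "r1 < r2" "r2 < r3"
  obtains \<eta> where "test_function (ball x0 r3) \<eta>" "\<And>x. 0 \<le> \<eta> x" "\<And>x. \<eta> x \<le> 1"
    "\<And>x. dist x0 x \<le> r1 \<Longrightarrow> \<eta> x = 1"
proof -
  have sq: "r1\<^sup>2 < r2\<^sup>2" using r by (intro power_strict_mono) auto
  define k where "k = 1 / bump (r2\<^sup>2 - r1\<^sup>2)"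
  have b: "bump (r2\<^sup>2 - r1\<^sup>2) > 0" using sq by (intro bump_pos) auto
  have k: "k > 0" using b by (simp add: k_def)
  have b1: "bump 1 > 0" by (simp add: bump_pos)
  define \<eta> where "\<eta> x = bump (1 - k * bump ((x - x0) \<bullet> (x - x0) - r1\<^sup>2)) * (1 / bump 1)" for x :: "real^'n"
  have d: "(x - x0) \<bullet> (x - x0) = (dist x0 x)\<^sup>2" for x
    by (simp add: norm_minus_commute[of x0] dist_norm dot_square_norm)
  show ?thesis
  proof (rule that[of \<eta>])
    show "test_function (ball x0 r3) \<eta>"
    proof (rule test_functionI[of _ "cball x0 r2"])
      show "Cinf_on UNIV \<eta>" unfolding \<eta>_def by (intro Cinf_intros)
      show "\<eta> x = 0" if "x \<notin> cball x0 r2" for x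
      proof -
        have "r2\<^sup>2 \<le> (dist x0 x)\<^sup>2" using that r by (intro power_mono) auto
        then have "bump (r2\<^sup>2 - r1\<^sup>2) \<le> bump ((dist x0 x)\<^sup>2 - r1\<^sup>2)" by (intro bump_mono) simp
        then have "1 \<le> k * bump ((dist x0 x)\<^sup>2 - r1\<^sup>2)" using b by (simp add: k_def)
        then show ?thesis by (simp add: \<eta>_def d bump_0)
      qed
      show "cball x0 r2 \<subseteq> ball x0 r3" using r by auto
    qed simp
    show "0 \<le> \<eta> x" for x using b1 by (simp add: \<eta>_def bump_nonneg)
    show "\<eta> x \<le> 1" for x
      using b1 bump_mono[of "1 - k * bump ((x - x0) \<bullet> (x - x0) - r1\<^sup>2)" 1] k
      by (simp add: \<eta>_def bump_nonneg)
    show "\<eta> x = 1" if "dist x0 x \<le> r1" for x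
    proof -
      have "(dist x0 x)\<^sup>2 \<le> r1\<^sup>2" using that by (intro power_mono) auto
      then show ?thesis using b1 by (simp add: \<eta>_def d bump_0)
    qed
  qed
qed

text \<open>If \<xi>_n are test functions converging to u, then
  \<open>\<eta> * bump (\<xi>_n - \<phi>)\<close> are test functions on \<open>U\<close>, because
  \<eta> has compact support there. The error in their gradients splits into three terms, two of
  which inherit L^s convergence through the bounds on \<open>bump\<close> and
  \<open>bump'\<close>.\<close>

lemma W0grad_truncation:
  assumes \<Omega>: "open \<Omega>" "bounded \<Omega>" and U: "open U" "U \<subseteq> \<Omega>" and s: "1 \<le> s" and w: "W0grad \<Omega> s u g"
    and \<phi>: "Cinf_on UNIV \<phi>" and \<eta>: "test_function U \<eta>"
  shows "W0grad U s (\<lambda>x. \<eta> x * bump (u x - \<phi> x))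
    (\<lambda>x. (\<eta> x * bump' (u x - \<phi> x)) *\<^sub>R (g x - grad \<phi> x) + bump (u x - \<phi> x) *\<^sub>R grad \<eta> x)"
    (is "W0grad U s ?v ?h")
proof -
  have bU: "bounded U" using \<Omega> U bounded_subset by blast
  have s0: "0 \<le> s" "0 < s" using s by auto
  obtain \<psi> where \<psi>: "in_Lp \<Omega> s u" "in_Lp \<Omega> s g" "\<And>n. test_function \<Omega> (\<psi> n)"
    "Lp_null \<Omega> s (\<lambda>n x. \<psi> n x - u x)" "Lp_null \<Omega> s (\<lambda>n x. grad (\<psi> n) x - g x)"
    by (rule W0gradE[OF w]) blast
  note N = Lp_null_subset[OF \<Omega>(1) U \<psi>(4)] Lp_null_subset[OF \<Omega>(1) U \<psi>(5)]
  obtain r where r: "strict_mono r" and ae: "AE x in lebesgue_on U. (\<lambda>n. \<psi> (r n) x - u x) \<longlonglongrightarrow> 0"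
    by (rule Lp_null_AE_subseq[OF U(1) bU N(1) s])
  define \<xi> where "\<xi> n = \<psi> (r n)" for n
  have N1: "Lp_null U s (\<lambda>n x. \<xi> n x - u x)" and N2: "Lp_null U s (\<lambda>n x. grad (\<xi> n) x - g x)"
    using Lp_null_subseq[OF N(1) r] Lp_null_subseq[OF N(2) r] by (simp_all add: \<xi>_def)
  have C\<xi>: "Cinf_on UNIV (\<xi> n)" for n using test_function_Cinf[OF \<psi>(3)] by (simp add: \<xi>_def)
  obtain C where C: "C > 0" "\<And>x. \<bar>\<eta> x\<bar> \<le> C" "\<And>x. norm (grad \<eta> x) \<le> C" "\<And>x i. \<bar>partial_deriv i \<eta> x\<bar> \<le> C"
    by (rule test_function_bounds[OF \<eta>]) blast
  note [measurable] = in_Lp_measurable[OF in_Lp_subset(1)[OF \<Omega>(1) U \<psi>(1)]]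
    in_Lp_measurable[OF in_Lp_subset(1)[OF \<Omega>(1) U \<psi>(2)]]
  have [measurable]: "\<eta> \<in> borel_measurable (lebesgue_on U)" "grad \<eta> \<in> borel_measurable (lebesgue_on U)"
    "\<phi> \<in> borel_measurable (lebesgue_on U)" "grad \<phi> \<in> borel_measurable (lebesgue_on U)"
    "\<xi> n \<in> borel_measurable (lebesgue_on U)" "grad (\<xi> n) \<in> borel_measurable (lebesgue_on U)" for n
    using test_function_Cinf[OF \<eta>] \<phi> C\<xi>
    by (auto intro!: continuous_on_measurable_lebesgue_on Cinf_continuous_on Cinf_continuous_on_grad)
  have [measurable]: "bump \<in> borel_measurable borel" "bump' \<in> borel_measurable borel"
    by (intro borel_measurable_continuous_onI continuous_on_bump continuous_on_bump')+
  have v1: "\<bar>\<eta> x * bump y\<bar> \<le> C" for x y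
    using mult_mono[OF C(2)[of x] bump_le_1[of y]] C(1) bump_nonneg[of y] by (simp add: abs_mult)
  have inv: "in_Lp U s ?v"
    by (rule in_Lp_bounded[OF U(1) bU s0(1), of _ C]) (measurable, simp add: v1)
  have "compact (grad \<phi> ` closure \<Omega>)"
    using \<Omega> \<phi> by (intro compact_continuous_image Cinf_continuous_on_grad) (auto simp: compact_closure)
  then obtain C' where C': "\<And>x. x \<in> closure \<Omega> \<Longrightarrow> norm (grad \<phi> x) \<le> C'"
    using compact_imp_bounded bounded_iff by (metis imageI)
  have in\<phi>: "in_Lp U s (grad \<phi>)"
    using C' U(2) closure_subset[of \<Omega>]
    by (intro in_Lp_bounded[OF U(1) bU s0(1), of _ C'] AE_I2) (auto simp: space_restrict_space)
  have inf: "in_Lp U s (\<lambda>x. g x - grad \<phi> x)"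
    by (rule in_Lp_diff[OF in_Lp_subset(1)[OF \<Omega>(1) U \<psi>(2)] in\<phi> s0(1)])
  have inh: "in_Lp U s ?h"
  proof (rule in_Lp_add[OF _ _ s0(1)])
    show "in_Lp U s (\<lambda>x. (\<eta> x * bump' (u x - \<phi> x)) *\<^sub>R (g x - grad \<phi> x))"
    proof (rule in_Lp_bound[OF inf s0(1), of _ C])
      show "AE x in lebesgue_on U. norm ((\<eta> x * bump' (u x - \<phi> x)) *\<^sub>R (g x - grad \<phi> x)) \<le> C * norm (g x - grad \<phi> x)"
      proof (rule AE_I2)
        fix x
        have "\<bar>\<eta> x * bump' (u x - \<phi> x)\<bar> \<le> C"
          using mult_mono[OF C(2)[of x] bump'_le_1[of "u x - \<phi> x"]] C(1) bump'_nonneg[of "u x - \<phi> x"] by (simp add: abs_mult)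
        then show "norm ((\<eta> x * bump' (u x - \<phi> x)) *\<^sub>R (g x - grad \<phi> x)) \<le> C * norm (g x - grad \<phi> x)"
          unfolding norm_scaleR by (intro mult_right_mono) auto
      qed
    qed measurable
    show "in_Lp U s (\<lambda>x. bump (u x - \<phi> x) *\<^sub>R grad \<eta> x)"
    proof (rule in_Lp_bounded[OF U(1) bU s0(1), of _ C])
      show "AE x in lebesgue_on U. norm (bump (u x - \<phi> x) *\<^sub>R grad \<eta> x) \<le> C"
      proof (rule AE_I2)
        fix x
        show "norm (bump (u x - \<phi> x) *\<^sub>R grad \<eta> x) \<le> C"
          using mult_mono[OF bump_le_1[of "u x - \<phi> x"] C(3)[of x]] bump_nonneg[of "u x - \<phi> x"] by simp
      qed
    qed measurable
  qed
  have d: "GDERIV (\<lambda>x. \<eta> x * bump (\<xi> n x - \<phi> x)) x :>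
      (\<eta> x * bump' (\<xi> n x - \<phi> x)) *\<^sub>R (grad (\<xi> n) x - grad \<phi> x) + bump (\<xi> n x - \<phi> x) *\<^sub>R grad \<eta> x" for n x
    using GDERIV_mult[OF Cinf_GDERIV[OF test_function_Cinf[OF \<eta>], of x]
        GDERIV_DERIV_compose[OF GDERIV_diff[OF Cinf_GDERIV[OF C\<xi>[of n], of x] Cinf_GDERIV[OF \<phi>, of x]] bump_deriv]]
    by simp
  show ?thesis
  proof (rule W0gradI[where \<phi> = "\<lambda>n x. \<eta> x * bump (\<xi> n x - \<phi> x)"])
    show "in_Lp U s ?v" "in_Lp U s ?h" by (fact inv inh)+
    obtain K where K: "compact K" "K \<subseteq> U" "\<And>x. x \<notin> K \<Longrightarrow> \<eta> x = 0"
      by (rule test_function_obtain[OF \<eta>]) blast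
    show "test_function U (\<lambda>x. \<eta> x * bump (\<xi> n x - \<phi> x))" for n
    proof (rule test_functionI[OF _ _ K(1,2)])
      show "Cinf_on UNIV (\<lambda>x. \<eta> x * bump (\<xi> n x - \<phi> x))"
        by (intro Cinf_intros C\<xi> \<phi> test_function_Cinf[OF \<eta>])
    qed (simp add: K(3))
    show "Lp_null U s (\<lambda>n x. \<eta> x * bump (\<xi> n x - \<phi> x) - \<eta> x * bump (u x - \<phi> x))"
    proof (rule Lp_null_dominated[OF N1 s0(1), of _ C])
      show "AE x in lebesgue_on U. norm (\<eta> x * bump (\<xi> n x - \<phi> x) - \<eta> x * bump (u x - \<phi> x)) \<le> C * norm (\<xi> n x - u x)" for n
      proof (rule AE_I2)
        fix x
        have "norm (\<eta> x * bump (\<xi> n x - \<phi> x) - \<eta> x * bump (u x - \<phi> x)) = \<bar>\<eta> x\<bar> * \<bar>bump (\<xi> n x - \<phi> x) - bump (u x - \<phi> x)\<bar>"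
          by (simp add: abs_mult flip: right_diff_distrib)
        also have "\<dots> \<le> C * \<bar>(\<xi> n x - \<phi> x) - (u x - \<phi> x)\<bar>"
          using C by (intro mult_mono bump_lipschitz) auto
        finally show "norm (\<eta> x * bump (\<xi> n x - \<phi> x) - \<eta> x * bump (u x - \<phi> x)) \<le> C * norm (\<xi> n x - u x)" by simp
      qed
    qed measurable
    have P1: "Lp_null U s (\<lambda>n x. (\<eta> x * bump' (\<xi> n x - \<phi> x)) *\<^sub>R (grad (\<xi> n) x - g x))"
    proof (rule Lp_null_dominated[OF N2 s0(1), of _ C])
      show "AE x in lebesgue_on U. norm ((\<eta> x * bump' (\<xi> n x - \<phi> x)) *\<^sub>R (grad (\<xi> n) x - g x)) \<le> C * norm (grad (\<xi> n) x - g x)" for n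
      proof (rule AE_I2)
        fix x
        have "\<bar>\<eta> x * bump' (\<xi> n x - \<phi> x)\<bar> \<le> C"
          using mult_mono[OF C(2)[of x] bump'_le_1[of "\<xi> n x - \<phi> x"]] C(1) bump'_nonneg[of "\<xi> n x - \<phi> x"] by (simp add: abs_mult)
        then show "norm ((\<eta> x * bump' (\<xi> n x - \<phi> x)) *\<^sub>R (grad (\<xi> n) x - g x)) \<le> C * norm (grad (\<xi> n) x - g x)"
          unfolding norm_scaleR by (intro mult_right_mono) auto
      qed
    qed measurable
    have P2: "Lp_null U s (\<lambda>n x. (bump (\<xi> n x - \<phi> x) - bump (u x - \<phi> x)) *\<^sub>R grad \<eta> x)"
    proof (rule Lp_null_dominated[OF N1 s0(1), of _ C])
      show "AE x in lebesgue_on U. norm ((bump (\<xi> n x - \<phi> x) - bump (u x - \<phi> x)) *\<^sub>R grad \<eta> x) \<le> C * norm (\<xi> n x - u x)" for n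
      proof (rule AE_I2)
        fix x
        show "norm ((bump (\<xi> n x - \<phi> x) - bump (u x - \<phi> x)) *\<^sub>R grad \<eta> x) \<le> C * norm (\<xi> n x - u x)"
          using mult_mono[OF bump_lipschitz[of "\<xi> n x - \<phi> x" "u x - \<phi> x"] C(3)[of x]] by (simp add: mult.commute)
      qed
    qed measurable
    \<comment> \<open>Here the factor \<open>g - grad \<phi>\<close> belongs merely to L^s, so
      smallness has to come from pointwise convergence of \<open>bump'\<close> with
      \<open>C * norm (g - grad \<phi>)\<close> as majorant. This is why a subsequence converging
      almost everywhere was selected.\<close>
    have P3: "Lp_null U s (\<lambda>n x. (\<eta> x * (bump' (\<xi> n x - \<phi> x) - bump' (u x - \<phi> x))) *\<^sub>R (g x - grad \<phi> x))"
    proof (rule Lp_null_DCT[OF _ in_Lp_scaleR[OF inf s0(1), of C] s0(2)])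
      show "AE x in lebesgue_on U. norm ((\<eta> x * (bump' (\<xi> n x - \<phi> x) - bump' (u x - \<phi> x))) *\<^sub>R (g x - grad \<phi> x)) \<le> norm (C *\<^sub>R (g x - grad \<phi> x))" for n
      proof (rule AE_I2)
        fix x
        have "\<bar>bump' (\<xi> n x - \<phi> x) - bump' (u x - \<phi> x)\<bar> \<le> 1"
          using bump'_nonneg[of "\<xi> n x - \<phi> x"] bump'_nonneg[of "u x - \<phi> x"] bump'_le_1[of "\<xi> n x - \<phi> x"] bump'_le_1[of "u x - \<phi> x"]
          by linarith
        then have "\<bar>\<eta> x * (bump' (\<xi> n x - \<phi> x) - bump' (u x - \<phi> x))\<bar> \<le> \<bar>C\<bar>"
          using mult_mono[OF C(2)[of x], of "\<bar>bump' (\<xi> n x - \<phi> x) - bump' (u x - \<phi> x)\<bar>" 1] C(1) by (simp add: abs_mult)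
        then show "norm ((\<eta> x * (bump' (\<xi> n x - \<phi> x) - bump' (u x - \<phi> x))) *\<^sub>R (g x - grad \<phi> x)) \<le> norm (C *\<^sub>R (g x - grad \<phi> x))"
          unfolding norm_scaleR by (intro mult_right_mono) auto
      qed
      show "AE x in lebesgue_on U. (\<lambda>n. (\<eta> x * (bump' (\<xi> n x - \<phi> x) - bump' (u x - \<phi> x))) *\<^sub>R (g x - grad \<phi> x)) \<longlonglongrightarrow> 0"
        using ae
      proof eventually_elim
        case (elim x)
        then have "(\<lambda>n. \<xi> n x) \<longlonglongrightarrow> u x" by (simp add: \<xi>_def LIM_zero_iff)
        then have "(\<lambda>n. \<xi> n x - \<phi> x) \<longlonglongrightarrow> u x - \<phi> x" by (intro tendsto_intros)
        then have "(\<lambda>n. bump' (\<xi> n x - \<phi> x)) \<longlonglongrightarrow> bump' (u x - \<phi> x)"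
          using continuous_on_bump'[of UNIV] by (intro continuous_on_tendsto_compose[of UNIV bump']) auto
        then have "(\<lambda>n. (\<eta> x * (bump' (\<xi> n x - \<phi> x) - bump' (u x - \<phi> x))) *\<^sub>R (g x - grad \<phi> x))
            \<longlonglongrightarrow> (\<eta> x * (bump' (u x - \<phi> x) - bump' (u x - \<phi> x))) *\<^sub>R (g x - grad \<phi> x)"
          by (intro tendsto_intros)
        then show ?case by simp
      qed
    qed measurable
    have "(\<lambda>n x. grad (\<lambda>x. \<eta> x * bump (\<xi> n x - \<phi> x)) x - ?h x) =
        (\<lambda>n x. ((\<eta> x * bump' (\<xi> n x - \<phi> x)) *\<^sub>R (grad (\<xi> n) x - g x)
          + (bump (\<xi> n x - \<phi> x) - bump (u x - \<phi> x)) *\<^sub>R grad \<eta> x)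
          + (\<eta> x * (bump' (\<xi> n x - \<phi> x) - bump' (u x - \<phi> x))) *\<^sub>R (g x - grad \<phi> x))"
      unfolding grad_eqI[OF d] by (auto simp: fun_eq_iff algebra_simps)
    then show "Lp_null U s (\<lambda>n x. grad (\<lambda>x. \<eta> x * bump (\<xi> n x - \<phi> x)) x - ?h x)"
      using Lp_null_add[OF Lp_null_add[OF P1 P2 s0(1)] P3 s0(1)] by simp
  qed
qed

section \<open>Local minimizers of the Dirichlet energies\<close>

text \<open>The supporting hyperplane of z \<mapsto> |z|^s / s at z. After Cauchy-Schwarz it is
  Young's inequality for |w| and |z|^(s - 1) with the conjugate exponents s and s / (s - 1).\<close>

lemma norm_powr_gradient_ineq:
  fixes w z :: "'a::real_inner"
  assumes s: "1 < s"
  shows "norm z powr s / s + norm z powr (s - 2) * (z \<bullet> (w - z)) \<le> norm w powr s / s"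
proof (cases "z = 0")
  case False
  define t where "t = s / (s - 1)"
  have t: "t > 1" "1 / s + 1 / t = 1" using s by (auto simp: t_def field_simps)
  have zz: "norm z powr (s - 2) * (z \<bullet> z) = norm z powr s"
  proof -
    have "z \<bullet> z = norm z powr 2" using False by (simp add: dot_square_norm powr_numeral)
    then show ?thesis by (simp only: powr_add[symmetric] diff_add_cancel)
  qed
  have "norm z powr (s - 2) * (z \<bullet> w) \<le> norm z powr (s - 2) * (norm z * norm w)"
    by (intro mult_left_mono norm_cauchy_schwarz) auto
  also have "\<dots> = norm w * norm z powr (s - 1)"
    using False by (simp add: powr_mult_base algebra_simps)
  also have "\<dots> \<le> norm w powr s / s + (norm z powr (s - 1)) powr t / t"
    using s t by (intro Youngs_inequality) auto
  also have "(norm z powr (s - 1)) powr t = norm z powr s" using s by (simp add: powr_powr t_def)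
  finally have "norm z powr (s - 2) * (z \<bullet> w) \<le> norm w powr s / s + norm z powr s / t" .
  moreover have "norm z powr s / s + norm z powr s / t = norm z powr s"
    using t(2) by (metis distrib_left mult.right_neutral times_divide_eq_right mult_1_right)
  ultimately show ?thesis using zz by (simp add: inner_diff_right right_diff_distrib)
qed (use s in simp)

text \<open>Average the supporting hyperplane at the intermediate point z, evaluated at a and at b:
  the linear terms cancel since the weighted sum of a - z and b - z is zero.\<close>

lemma norm_powr_convex:
  fixes a b :: "'a::real_inner"
  assumes s: "1 < s" and \<theta>: "0 \<le> \<theta>" "\<theta> \<le> 1"
  shows "norm ((1 - \<theta>) *\<^sub>R a + \<theta> *\<^sub>R b) powr s \<le> (1 - \<theta>) * norm a powr s + \<theta> * norm b powr s"
proof -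
  define z where "z = (1 - \<theta>) *\<^sub>R a + \<theta> *\<^sub>R b"
  define c where "c = norm z powr (s - 2)"
  have "(1 - \<theta>) * (norm z powr s / s + c * (z \<bullet> (a - z))) \<le> (1 - \<theta>) * (norm a powr s / s)"
    unfolding c_def using \<theta> by (intro mult_left_mono norm_powr_gradient_ineq s) auto
  moreover have "\<theta> * (norm z powr s / s + c * (z \<bullet> (b - z))) \<le> \<theta> * (norm b powr s / s)"
    unfolding c_def using \<theta> by (intro mult_left_mono norm_powr_gradient_ineq s) auto
  moreover have "(1 - \<theta>) * (c * (z \<bullet> (a - z))) + \<theta> * (c * (z \<bullet> (b - z))) = 0"
  proof -
    have "(1 - \<theta>) *\<^sub>R (a - z) + \<theta> *\<^sub>R (b - z) = 0" by (simp add: z_def algebra_simps)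
    then have "z \<bullet> ((1 - \<theta>) *\<^sub>R (a - z) + \<theta> *\<^sub>R (b - z)) = 0" by simp
    then have "(1 - \<theta>) * (z \<bullet> (a - z)) + \<theta> * (z \<bullet> (b - z)) = 0" by (simp add: inner_add_right)
    then have "c * ((1 - \<theta>) * (z \<bullet> (a - z)) + \<theta> * (z \<bullet> (b - z))) = 0" by simp
    then show ?thesis by (simp add: algebra_simps)
  qed
  moreover have "N \<le> (1 - \<theta>) * Na + \<theta> * Nb"
    if "(1 - \<theta>) * (N + A) \<le> (1 - \<theta>) * Na" "\<theta> * (N + B) \<le> \<theta> * Nb" "(1 - \<theta>) * A + \<theta> * B = 0" for N A B Na Nb
    using that by (simp add: algebra_simps)
  ultimately have "norm z powr s / s \<le> (1 - \<theta>) * (norm a powr s / s) + \<theta> * (norm b powr s / s)"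
    by blast
  then have "norm z powr s \<le> (1 - \<theta>) * norm a powr s + \<theta> * norm b powr s"
    using s by (simp add: field_simps)
  then show ?thesis by (simp only: z_def)
qed

text \<open>Nonempty open sets have positive measure. This converts almost everywhere statements
  into statements at points, which continuity then spreads.\<close>

lemma AE_open_witness:
  fixes U V :: "(real^'n) set"
  assumes "open U" "AE x in lebesgue_on U. P x" "open V" "V \<subseteq> U" "V \<noteq> {}"
  obtains x where "x \<in> V" "P x"
proof -
  have "\<exists>x\<in>V. P x"
  proof (rule ccontr)
    assume n: "\<not> (\<exists>x\<in>V. P x)"
    have "AE x in lebesgue. x \<in> U \<longrightarrow> P x"
      using assms(1,2) by (subst (asm) AE_restrict_space_iff) (auto simp: open_sets_lebesgue)
    then have "AE x in lebesgue. x \<notin> V" by eventually_elim (use assms(4) n in auto)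
    then have "V \<in> null_sets lebesgue"
      using assms(3) by (subst (asm) AE_iff_null_sets[symmetric]) (auto simp: open_sets_lebesgue)
    then show False using assms(3,5) open_not_negligible negligible_iff_null_sets by blast
  qed
  then show ?thesis using that by blast
qed

lemma integral_pos_open:
  fixes f :: "real^'n \<Rightarrow> real"
  assumes U: "open U" and i: "integrable (lebesgue_on U) f" and nn: "\<And>x. x \<in> U \<Longrightarrow> 0 \<le> f x"
    and V: "open V" "V \<noteq> {}" "V \<subseteq> U" "\<And>x. x \<in> V \<Longrightarrow> 0 < f x"
  shows "0 < (LINT x|lebesgue_on U. f x)"
proof -
  have "0 \<le> (LINT x|lebesgue_on U. f x)"
    using nn by (intro integral_nonneg_AE AE_I2) (simp add: space_restrict_space)
  moreover have "(LINT x|lebesgue_on U. f x) \<noteq> 0"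
  proof
    assume "(LINT x|lebesgue_on U. f x) = 0"
    then have "AE x in lebesgue_on U. f x = 0"
      using nn by (subst integral_nonneg_eq_0_iff_AE[OF i, symmetric]) (auto intro!: AE_I2 simp: space_restrict_space)
    then obtain x where "x \<in> V" "f x = 0" by (rule AE_open_witness[OF U _ V(1,3,2)])
    then show False using V(4)[of x] by simp
  qed
  ultimately show ?thesis by linarith
qed

section \<open>Quadratic polynomials and their p-Laplace fields\<close>

definition quad :: "real^'n \<Rightarrow> real \<Rightarrow> real^'n \<Rightarrow> real^'n^'n \<Rightarrow> real^'n \<Rightarrow> real" where
  "quad x0 \<alpha> \<gamma> S x = \<alpha> + \<gamma> \<bullet> (x - x0) + (x - x0) \<bullet> (S *v (x - x0)) / 2"

lemma symmetric_matrix_inner: "transpose S = S \<Longrightarrow> x \<bullet> (S *v y) = (S *v x) \<bullet> y" for S :: "real^'n^'n"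
  by (metis dot_lmul_matrix transpose_matrix_vector)

lemma Cinf_quad: "Cinf_on UNIV (quad x0 \<alpha> \<gamma> S)"
proof -
  have "Cinf_on UNIV (\<lambda>x. \<alpha> + \<gamma> \<bullet> (x - x0) + (x - x0) \<bullet> (S *v (x - x0)) * (1 / 2))"
    by (intro Cinf_intros Cinf_on_inner) (auto simp: matrix_vector_mult_def intro!: Cinf_intros)
  then show ?thesis by (simp add: quad_def[abs_def])
qed

lemma GDERIV_quad:
  assumes S: "transpose S = S"
  shows "GDERIV (quad x0 \<alpha> \<gamma> S) x :> \<gamma> + S *v (x - x0)"
proof -
  have "(quad x0 \<alpha> \<gamma> S has_derivative (\<lambda>h. \<gamma> \<bullet> h + (h \<bullet> (S *v (x - x0)) + (x - x0) \<bullet> (S *v h)) / 2)) (at x)"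
    unfolding quad_def[abs_def]
    by (auto intro!: derivative_eq_intros bounded_linear.has_derivative[OF matrix_vector_mul_bounded_linear])
  moreover have "(\<lambda>h. \<gamma> \<bullet> h + (h \<bullet> (S *v (x - x0)) + (x - x0) \<bullet> (S *v h)) / 2) = (\<lambda>h. h \<bullet> (\<gamma> + S *v (x - x0)))"
    using symmetric_matrix_inner[OF S, of "x - x0"] by (auto simp: inner_commute inner_add_right)
  ultimately show ?thesis by (simp add: gderiv_def)
qed

lemma GDERIV_affine_component:
  "GDERIV (\<lambda>y. (\<gamma> + S *v (y - x0)) $ i) x :> S $ i" for S :: "real^'n^'n"
proof -
  have "((\<lambda>y. S $ i \<bullet> (y - x0) + \<gamma> $ i) has_derivative (\<lambda>h. h \<bullet> S $ i)) (at x)"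
    by (auto intro!: derivative_eq_intros simp: inner_commute)
  then show ?thesis by (simp add: gderiv_def matrix_vector_mul_component add.commute)
qed

lemma GDERIV_affine_norm_sq:
  fixes S :: "real^'n^'n"
  assumes S: "transpose S = S"
  shows "GDERIV (\<lambda>y. (\<gamma> + S *v (y - x0)) \<bullet> (\<gamma> + S *v (y - x0))) x :> 2 *\<^sub>R (S *v (\<gamma> + S *v (x - x0)))"
proof -
  let ?G = "\<gamma> + S *v (x - x0)"
  have "((\<lambda>x. x - x0) has_derivative (\<lambda>h. h)) (at x)" by (auto intro!: derivative_eq_intros)
  from bounded_linear.has_derivative[OF matrix_vector_mul_bounded_linear this]
  have "((\<lambda>y. \<gamma> + S *v (y - x0)) has_derivative (\<lambda>h. S *v h)) (at x)"
    by (auto intro!: derivative_eq_intros)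
  from has_derivative_inner[OF this this]
  have "((\<lambda>y. (\<gamma> + S *v (y - x0)) \<bullet> (\<gamma> + S *v (y - x0))) has_derivative (\<lambda>h. ?G \<bullet> (S *v h) + (S *v h) \<bullet> ?G)) (at x)" .
  moreover have "(\<lambda>h. ?G \<bullet> (S *v h) + (S *v h) \<bullet> ?G) = (\<lambda>h. h \<bullet> (2 *\<^sub>R (S *v ?G)))"
  proof
    fix h
    have "h \<bullet> (S *v ?G) = (S *v h) \<bullet> ?G" by (rule symmetric_matrix_inner[OF S])
    then show "?G \<bullet> (S *v h) + (S *v h) \<bullet> ?G = h \<bullet> (2 *\<^sub>R (S *v ?G))"
      by (simp add: inner_commute[of ?G])
  qed
  ultimately show ?thesis by (simp add: gderiv_def)
qed

text \<open>With a = (s - 2) / 2 the field is |G|^(s - 2) G. The power of the norm is written as a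
  power of G \<bullet> G, which is a polynomial, so that the only singularity is at the zeros of
  G.\<close>

lemma p_field_GDERIV:
  fixes S :: "real^'n^'n"
  defines "G \<equiv> \<lambda>x0 \<gamma> x. \<gamma> + S *v (x - x0)"
  assumes S: "transpose S = S" and nz: "G x0 \<gamma> x \<noteq> 0"
  shows "GDERIV (\<lambda>y. ((G x0 \<gamma> y \<bullet> G x0 \<gamma> y) powr a *\<^sub>R G x0 \<gamma> y) $ i) x :>
     (G x0 \<gamma> x \<bullet> G x0 \<gamma> x) powr a *\<^sub>R S $ i
     + (G x0 \<gamma> x $ i * (2 * a * (G x0 \<gamma> x \<bullet> G x0 \<gamma> x) powr (a - 1))) *\<^sub>R (S *v G x0 \<gamma> x)"
proof -
  have pos: "G x0 \<gamma> x \<bullet> G x0 \<gamma> x > 0" using nz by simp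
  have d: "((\<lambda>t. t powr a) has_real_derivative a * (G x0 \<gamma> x \<bullet> G x0 \<gamma> x) powr (a - 1)) (at (G x0 \<gamma> x \<bullet> G x0 \<gamma> x))"
    using pos by (rule has_real_derivative_powr)
  have "GDERIV (\<lambda>y. (G x0 \<gamma> y \<bullet> G x0 \<gamma> y) powr a) x :> (a * (G x0 \<gamma> x \<bullet> G x0 \<gamma> x) powr (a - 1)) *\<^sub>R (2 *\<^sub>R (S *v G x0 \<gamma> x))"
    using GDERIV_DERIV_compose[OF GDERIV_affine_norm_sq[OF S, of \<gamma> x0 x] d[unfolded G_def]] by (simp add: G_def)
  from GDERIV_mult[OF this, of "\<lambda>y. G x0 \<gamma> y $ i" "S $ i"] show ?thesis
    using GDERIV_affine_component[of \<gamma> S x0 i x] by (simp add: G_def algebra_simps)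
qed

text \<open>Let H be the gradient of the quadratic polynomial, A = |H|^(s - 2) H and v = \<eta> bump
  (u - \<phi>), whose gradient is h. Hypothesis \<open>neg\<close> says div A < 0 up to a positive
  factor. A pointwise estimate gives |g - h|^s \<le> |g|^s - s h \<bullet> A, and the integral of h
  \<bullet> A equals minus that of v div A. The latter is strictly positive because v \<ge> 0 and v
  > 0 on an open set around x0, where u exceeds the polynomial.\<close>

lemma energy_decrease:
  fixes \<Omega> :: "(real^'n) set" and S :: "real^'n^'n"
  defines "G \<equiv> \<lambda>x0 \<gamma> x. \<gamma> + S *v (x - x0)"
  assumes \<Omega>: "open \<Omega>" "bounded \<Omega>" and s: "2 < s" "s \<le> m" and w: "W0grad \<Omega> m u g"
    and S: "transpose S = S" and r: "0 < r1" "r1 < r" and sub: "ball x0 r \<subseteq> \<Omega>"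
    and neg: "\<And>x. x \<in> cball x0 r \<Longrightarrow> (G x0 \<gamma> x \<bullet> G x0 \<gamma> x) * trace S + (s - 2) * (G x0 \<gamma> x \<bullet> (S *v G x0 \<gamma> x)) < 0"
    and below: "\<And>x. x \<in> ball x0 r \<Longrightarrow> r1 \<le> dist x0 x \<Longrightarrow> u x \<le> quad x0 \<alpha> \<gamma> S x"
    and above: "u x0 > quad x0 \<alpha> \<gamma> S x0" and cont: "continuous_on (ball x0 r) u"
    and \<eta>: "test_function (ball x0 r) \<eta>" "\<And>x. 0 \<le> \<eta> x" "\<And>x. \<eta> x \<le> 1" "\<And>x. dist x0 x \<le> r1 \<Longrightarrow> \<eta> x = 1"
  defines "h \<equiv> \<lambda>x. (\<eta> x * bump' (u x - quad x0 \<alpha> \<gamma> S x)) *\<^sub>R (g x - grad (quad x0 \<alpha> \<gamma> S) x)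
      + bump (u x - quad x0 \<alpha> \<gamma> S x) *\<^sub>R grad \<eta> x"
  shows "(LINT x|lebesgue_on \<Omega>. norm (g x - h x) powr s) < (LINT x|lebesgue_on \<Omega>. norm (g x) powr s)"
proof -
  define U where "U = ball x0 r"
  define \<phi> where "\<phi> = quad x0 \<alpha> \<gamma> S"
  define H where "H x = G x0 \<gamma> x" for x
  define a where "a = (s - 2) / 2"
  define v where "v x = \<eta> x * bump (u x - \<phi> x)" for x
  define \<theta> where "\<theta> x = \<eta> x * bump' (u x - \<phi> x)" for x
  define A where "A x = (H x \<bullet> H x) powr a *\<^sub>R H x" for x
  define B where "B i x = (H x \<bullet> H x) powr a *\<^sub>R S $ i + (H x $ i * (2 * a * (H x \<bullet> H x) powr (a - 1))) *\<^sub>R (S *v H x)" for i x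
  have U: "open U" "bounded U" "U \<subseteq> \<Omega>" using sub by (auto simp: U_def)
  have m1: "1 \<le> m" and m0: "0 \<le> m" using s by auto
  have gr: "grad \<phi> x = H x" for x
    unfolding \<phi>_def H_def G_def by (rule grad_eqI[OF GDERIV_quad[OF S]])
  have h_eq: "h x = \<theta> x *\<^sub>R (g x - H x) + bump (u x - \<phi> x) *\<^sub>R grad \<eta> x" for x
    by (simp add: h_def \<theta>_def gr[symmetric] \<phi>_def)
  have trunc: "W0grad U m v h"
    using W0grad_truncation[OF \<Omega> U(1,3) m1 w Cinf_quad \<eta>(1)[folded U_def], of x0 \<alpha> \<gamma> S]
    by (simp add: v_def[abs_def] h_def \<phi>_def)
  have outU: "v x = 0" "h x = 0" if "x \<notin> U" for x
    using test_function_eq_0[OF \<eta>(1)[folded U_def] that] by (simp_all add: v_def h_eq \<theta>_def)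
  have inM: "in_Lp \<Omega> m g" "in_Lp \<Omega> m h"
    using w W0grad_extend[OF \<Omega>(1) U(1,3) trunc outU] by (auto simp: W0grad_def)
  have inS: "in_Lp \<Omega> s g" "in_Lp \<Omega> s (\<lambda>x. g x - h x)"
    using in_Lp_mono[OF \<Omega> inM(1), of s] in_Lp_mono[OF \<Omega> in_Lp_diff[OF inM m0], of s] s by auto
  \<comment> \<open>The gradient of \<eta> contributes nothing: where
    \<open>bump (u x - \<phi> x)\<close> is positive inside \<open>U\<close>, hypothesis
    \<open>below\<close> forces the distance from x0 to be less than r1, and there \<eta> is
    constant.\<close>
  have h2: "h x = \<theta> x *\<^sub>R (g x - H x)" for x
  proof -
    have "bump (u x - \<phi> x) *\<^sub>R grad \<eta> x = 0"
    proof (cases "x \<in> U \<and> u x > \<phi> x")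
      case True
      then have x: "dist x0 x < r1" using below[of x] by (force simp: U_def \<phi>_def)
      have "GDERIV \<eta> x :> 0"
      proof (rule GDERIV_transform_within_open[OF GDERIV_const])
        show "open (ball x0 r1)" by simp
        show "1 = \<eta> y" if "y \<in> ball x0 r1" for y using \<eta>(4)[of y] that by simp
      qed (use x in simp)
      then show ?thesis by (simp add: grad_eqI)
    next
      case False
      then show ?thesis using test_function_eq_0(2)[OF \<eta>(1)[folded U_def], of x] by (auto simp: bump_0)
    qed
    then show ?thesis by (simp add: h_eq)
  qed
  have \<theta>: "0 \<le> \<theta> x" "\<theta> x \<le> 1" for x
    using \<eta>(2,3)[of x] bump'_nonneg[of "u x - \<phi> x"] bump'_le_1[of "u x - \<phi> x"]
    by (auto simp: \<theta>_def intro: mult_le_one)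
  have A_norm: "A x = norm (H x) powr (s - 2) *\<^sub>R H x" for x
  proof (cases "H x = 0")
    case False
    then have e: "H x \<bullet> H x = norm (H x) powr 2" by (simp add: dot_square_norm powr_numeral)
    have "2 * a = s - 2" by (simp add: a_def)
    then have "(H x \<bullet> H x) powr a = norm (H x) powr (s - 2)" by (simp only: e powr_powr)
    then show ?thesis by (simp add: A_def)
  qed (simp add: A_def)
  \<comment> \<open>Convexity bounds the power at the combination of g and H; the supporting
    hyperplane at H then trades |H|^s for |g|^s and a linear term, which is a multiple of h
    \<bullet> A because h = \<theta> (g - H).\<close>
  have pt: "norm (g x - h x) powr s \<le> norm (g x) powr s - s * (h x \<bullet> A x)" for x
  proof -
    have "g x - h x = (1 - \<theta> x) *\<^sub>R g x + \<theta> x *\<^sub>R H x" by (simp add: h2 algebra_simps)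
    then have "norm (g x - h x) powr s \<le> (1 - \<theta> x) * norm (g x) powr s + \<theta> x * norm (H x) powr s"
      using norm_powr_convex[OF _ \<theta>, of s x "g x" "H x"] s by simp
    also have "\<theta> x * norm (H x) powr s \<le> \<theta> x * (norm (g x) powr s - s * (norm (H x) powr (s - 2) * (H x \<bullet> (g x - H x))))"
    proof (rule mult_left_mono[OF _ \<theta>(1)])
      have "(norm (H x) powr s / s + norm (H x) powr (s - 2) * (H x \<bullet> (g x - H x))) * s \<le> norm (g x) powr s / s * s"
        using norm_powr_gradient_ineq[of s "H x" "g x"] s by (intro mult_right_mono) auto
      then show "norm (H x) powr s \<le> norm (g x) powr s - s * (norm (H x) powr (s - 2) * (H x \<bullet> (g x - H x)))"
        using s by (simp add: algebra_simps)
    qed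
    finally show ?thesis by (simp add: h2 A_norm inner_commute algebra_simps)
  qed
  have neg': "(H x \<bullet> H x) * trace S + (s - 2) * (H x \<bullet> (S *v H x)) < 0" if "x \<in> cball x0 r" for x
    using neg[OF that] by (simp add: H_def)
  \<comment> \<open>At a zero of H the left side of \<open>neg'\<close> would be 0, so the strict
    inequality itself keeps A away from its singularity.\<close>
  have nz: "H x \<noteq> 0" if "x \<in> cball x0 r" for x using neg'[OF that] by auto
  have UC: "x \<in> cball x0 r" if "x \<in> U" for x using that by (simp add: U_def)
  have cH: "continuous_on T H" for T
    unfolding H_def G_def
    by (intro continuous_intros bounded_linear.continuous_on[OF matrix_vector_mul_bounded_linear])
  have cP: "continuous_on (cball x0 r) (\<lambda>x. (H x \<bullet> H x) powr b)" for b
    using nz by (intro continuous_on_powr continuous_intros cH) auto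
  have cA: "continuous_on (cball x0 r) A" unfolding A_def by (intro continuous_intros cP cH)
  have cB: "continuous_on (cball x0 r) (B i)" for i
    unfolding B_def
    by (intro continuous_intros cP cH bounded_linear.continuous_on[OF matrix_vector_mul_bounded_linear])
  \<comment> \<open>The divergence is |H|^(s - 4) (|H|^2 trace S + (s - 2) H \<bullet> S H); the
    last product is the infinity-Laplacian of the polynomial, which dominates for large s.\<close>
  have dB: "(\<Sum>i\<in>UNIV. B i x $ i) = (H x \<bullet> H x) powr (a - 1) * ((H x \<bullet> H x) * trace S + (s - 2) * (H x \<bullet> (S *v H x)))"
    if "x \<in> cball x0 r" for x
  proof -
    have pos: "H x \<bullet> H x > 0" using nz[OF that] by simp
    have p: "(H x \<bullet> H x) powr a = (H x \<bullet> H x) powr (a - 1) * (H x \<bullet> H x)"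
      using pos by (simp add: powr_mult_base mult.commute)
    have "(\<Sum>i\<in>UNIV. B i x $ i) = (H x \<bullet> H x) powr a * trace S
        + 2 * a * (H x \<bullet> H x) powr (a - 1) * (H x \<bullet> (S *v H x))"
    proof -
      define P0 P1 where "P0 = (H x \<bullet> H x) powr a" and "P1 = (H x \<bullet> H x) powr (a - 1)"
      have "(\<Sum>i\<in>UNIV. B i x $ i) = (\<Sum>i\<in>UNIV. P0 * S $ i $ i + 2 * a * P1 * (H x $ i * (S *v H x) $ i))"
        by (simp add: B_def P0_def[symmetric] P1_def[symmetric] mult_ac)
      also have "\<dots> = P0 * trace S + 2 * a * P1 * (H x \<bullet> (S *v H x))"
        by (simp add: sum.distrib trace_def inner_vec_def sum_distrib_left)
      finally show ?thesis by (simp only: P0_def P1_def)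
    qed
    also have "2 * a = s - 2" by (simp add: a_def)
    finally show ?thesis by (simp add: p algebra_simps)
  qed
  have dneg: "(\<Sum>i\<in>UNIV. B i x $ i) < 0" if "x \<in> cball x0 r" for x
    unfolding dB[OF that] using neg'[OF that] nz[OF that] by (intro mult_pos_neg) auto
  have cS: "continuous_on (cball x0 r) (\<lambda>x. \<Sum>i\<in>UNIV. B i x $ i)" by (intro continuous_intros cB)
  have "bounded (A ` cball x0 r)" "bounded ((\<lambda>x. \<Sum>i\<in>UNIV. B i x $ i) ` cball x0 r)"
    using compact_continuous_image[OF cA] compact_continuous_image[OF cS] compact_imp_bounded by auto
  then obtain C1 C2 where C1: "\<forall>y\<in>A ` cball x0 r. norm y \<le> C1"
    and C2: "\<forall>y\<in>(\<lambda>x. \<Sum>i\<in>UNIV. B i x $ i) ` cball x0 r. norm y \<le> C2"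
    unfolding bounded_iff by blast
  have bA: "norm (A x) \<le> max C1 C2" and bB: "\<bar>\<Sum>i\<in>UNIV. B i x $ i\<bar> \<le> max C1 C2" if "x \<in> U" for x
    using C1 C2 UC[OF that] by (force simp: le_max_iff_disj)+
  have GA: "GDERIV (\<lambda>y. A y $ i) x :> B i x" if "x \<in> U" for x i
    unfolding A_def B_def H_def G_def
    by (rule p_field_GDERIV[OF S]) (use nz[OF UC[OF that]] in \<open>simp add: H_def G_def\<close>)
  have cBU: "continuous_on U (B i)" for i using cB by (rule continuous_on_subset) (auto simp: U_def)
  note parts = W0grad_by_parts[OF U(1,2) m1 trunc GA cBU bA bB]
  have cf: "continuous_on U (\<lambda>x. u x - \<phi> x)"
    using cont Cinf_continuous_on[OF Cinf_quad] by (auto simp: U_def \<phi>_def intro!: continuous_intros)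
  have "0 < (LINT x|lebesgue_on U. - (v x * (\<Sum>i\<in>UNIV. B i x $ i)))"
  proof (rule integral_pos_open[OF U(1)])
    show "integrable (lebesgue_on U) (\<lambda>x. - (v x * (\<Sum>i\<in>UNIV. B i x $ i)))" using parts(3) by simp
    show "0 \<le> - (v x * (\<Sum>i\<in>UNIV. B i x $ i))" if "x \<in> U" for x
    proof -
      have "0 \<le> v x" using \<eta>(2)[of x] bump_nonneg by (simp add: v_def)
      then show ?thesis using dneg[OF UC[OF that]] by (simp add: mult_nonneg_nonpos)
    qed
    let ?V = "ball x0 r1 \<inter> {x \<in> U. 0 < u x - \<phi> x}"
    have "{x \<in> U. 0 < u x - \<phi> x} = U \<inter> (\<lambda>x. u x - \<phi> x) -` {0<..}" by auto
    then have "open {x \<in> U. 0 < u x - \<phi> x}"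
      using continuous_open_preimage[OF cf U(1) open_greaterThan] by simp
    then show "open ?V" by (intro open_Int open_ball)
    have "x0 \<in> ?V" using above r by (simp add: U_def \<phi>_def)
    then show "?V \<noteq> {}" by blast
    show "?V \<subseteq> U" by blast
    show "0 < - (v x * (\<Sum>i\<in>UNIV. B i x $ i))" if x: "x \<in> ?V" for x
    proof -
      have "0 < v x" using x \<eta>(4)[of x] by (simp add: v_def bump_pos)
      then show ?thesis using dneg[OF UC] x by (simp add: mult_pos_neg)
    qed
  qed
  then have posU: "0 < (LINT x|lebesgue_on U. h x \<bullet> A x)" using parts(1) by simp
  have ind: "indicator \<Omega> x *\<^sub>R (h x \<bullet> A x) = indicat_real U x *\<^sub>R (h x \<bullet> A x)" for x
    using outU(2)[of x] U(3) by (cases "x \<in> U") (auto simp: indicator_def)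
  have iO: "integrable (lebesgue_on \<Omega>) (\<lambda>x. h x \<bullet> A x)"
    using parts(2) U(1) \<Omega>(1) by (simp only: integrable_lebesgue_on_iff open_sets_lebesgue ind)
  have eO: "(LINT x|lebesgue_on \<Omega>. h x \<bullet> A x) = (LINT x|lebesgue_on U. h x \<bullet> A x)"
    using U(1) \<Omega>(1) by (simp only: integral_lebesgue_on open_sets_lebesgue ind)
  have "(LINT x|lebesgue_on \<Omega>. norm (g x - h x) powr s) \<le> (LINT x|lebesgue_on \<Omega>. norm (g x) powr s - s * (h x \<bullet> A x))"
    using inS iO pt by (intro integral_mono) (auto simp: in_Lp_def)
  also have "\<dots> = (LINT x|lebesgue_on \<Omega>. norm (g x) powr s) - s * (LINT x|lebesgue_on \<Omega>. h x \<bullet> A x)"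
    using inS iO by (simp add: in_Lp_def)
  also have "\<dots> < (LINT x|lebesgue_on \<Omega>. norm (g x) powr s)" using posU eO s by simp
  finally show ?thesis .
qed

section \<open>Minimality under perturbations in a ball and its limit\<close>

definition dirichlet_energy :: "(real^'n) set \<Rightarrow> real \<Rightarrow> real \<Rightarrow> (real^'n \<Rightarrow> real^'n) \<Rightarrow> real" where
  "dirichlet_energy \<Omega> p q g =
     (LINT x|lebesgue_on \<Omega>. norm (g x) powr p) / p + (LINT x|lebesgue_on \<Omega>. norm (g x) powr q) / q"

text \<open>Competitors may differ from u on \<open>B\<close> by any amount: smallness has already
  been removed by convexity, and the term with the sup norm no longer occurs. The class is invariant
  under u \<mapsto> - u, which reduces subsolutions and supersolutions to one argument.\<close>

definition local_minimizer ::
  "(real^'n) set \<Rightarrow> real \<Rightarrow> real \<Rightarrow> (real^'n \<Rightarrow> real) \<Rightarrow> (real^'n \<Rightarrow> real^'n) \<Rightarrow> (real^'n) set \<Rightarrow> bool" where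
  "local_minimizer \<Omega> p q u g B \<longleftrightarrow> W0grad \<Omega> (max p q) u g \<and> continuous_on (closure \<Omega>) u \<and>
     (\<forall>w h. W0grad \<Omega> (max p q) w h \<and> continuous_on (closure \<Omega>) w \<and> (\<forall>x. x \<notin> B \<longrightarrow> w x = u x) \<longrightarrow>
        dirichlet_energy \<Omega> p q g \<le> dirichlet_energy \<Omega> p q h)"

lemma dirichlet_energy_minus: "dirichlet_energy \<Omega> p q (\<lambda>x. - g x) = dirichlet_energy \<Omega> p q g"
  by (simp add: dirichlet_energy_def)

lemma local_minimizer_minus:
  assumes "local_minimizer \<Omega> p q u g B" "0 \<le> max p q"
  shows "local_minimizer \<Omega> p q (\<lambda>x. - u x) (\<lambda>x. - g x) B"
  unfolding local_minimizer_def
proof (intro conjI allI impI)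
  show "W0grad \<Omega> (max p q) (\<lambda>x. - u x) (\<lambda>x. - g x)" "continuous_on (closure \<Omega>) (\<lambda>x. - u x)"
    using assms by (auto simp: local_minimizer_def intro: W0grad_minus continuous_on_minus)
  fix w h assume w: "W0grad \<Omega> (max p q) w h \<and> continuous_on (closure \<Omega>) w \<and> (\<forall>x. x \<notin> B \<longrightarrow> w x = - u x)"
  then have "W0grad \<Omega> (max p q) (\<lambda>x. - w x) (\<lambda>x. - h x)" "continuous_on (closure \<Omega>) (\<lambda>x. - w x)"
    "\<forall>x. x \<notin> B \<longrightarrow> - w x = u x"
    using assms(2) by (auto intro: W0grad_minus continuous_on_minus)
  then have "dirichlet_energy \<Omega> p q g \<le> dirichlet_energy \<Omega> p q (\<lambda>x. - h x)"
    using assms(1) unfolding local_minimizer_def by blast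
  then show "dirichlet_energy \<Omega> p q (\<lambda>x. - g x) \<le> dirichlet_energy \<Omega> p q h"
    by (simp only: dirichlet_energy_minus)
qed

text \<open>Being smooth, the perturbed quadratic test function is a strict supersolution of both the
  \<open>p\<close>- and the \<open>q\<close>-Laplace equation for large exponents, so cutting off the minimizer at its level
  would lower both energies.\<close>

lemma superjet_inf_laplacian:
  fixes \<Omega> :: "(real^'n) set" and S :: "real^'n^'n" and u :: "nat \<Rightarrow> real^'n \<Rightarrow> real"
  assumes \<Omega>: "open \<Omega>" "bounded \<Omega>" and \<rho>: "0 < \<rho>" "cball x0 \<rho> \<subseteq> \<Omega>"
    and p: "filterlim p at_top sequentially" and q: "filterlim q at_top sequentially"
    and min: "\<forall>\<^sub>F n in sequentially. local_minimizer \<Omega> (p n) (q n) (u n) (g n) (ball x0 \<rho>)"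
    and lim: "uniform_limit (cball x0 \<rho>) u U sequentially"
    and S: "transpose S = S"
    and jet: "\<And>\<delta>. 0 < \<delta> \<Longrightarrow> \<forall>\<^sub>F x in at x0. U x \<le> quad x0 (U x0) \<gamma> S x + \<delta> * (norm (x - x0))\<^sup>2"
  shows "0 \<le> \<gamma> \<bullet> (S *v \<gamma>)"
proof (rule ccontr)
  assume "\<not> 0 \<le> \<gamma> \<bullet> (S *v \<gamma>)"
  then have neg: "\<gamma> \<bullet> (S *v \<gamma>) < 0" by simp
  \<comment> \<open>Adding 4 \<delta> times the identity to S raises \<gamma> \<bullet> S \<gamma>
    by at most half of its absolute value, so it stays negative. The summand 1 keeps the denominator
    visibly positive.\<close>
  define \<delta> where "\<delta> = - (\<gamma> \<bullet> (S *v \<gamma>)) / (8 * (\<gamma> \<bullet> \<gamma> + 1))"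
  have gg: "0 < \<gamma> \<bullet> \<gamma> + 1" by (simp add: add_nonneg_pos)
  have \<delta>: "0 < \<delta>" unfolding \<delta>_def using neg gg by (intro divide_pos_pos mult_pos_pos) auto
  have "4 * \<delta> * (\<gamma> \<bullet> \<gamma>) \<le> 4 * \<delta> * (\<gamma> \<bullet> \<gamma> + 1)" using \<delta> by simp
  also have "\<dots> = - (\<gamma> \<bullet> (S *v \<gamma>)) / 2" using gg by (simp add: \<delta>_def field_simps)
  finally have \<delta>2: "4 * \<delta> * (\<gamma> \<bullet> \<gamma>) \<le> - (\<gamma> \<bullet> (S *v \<gamma>)) / 2" .
  \<comment> \<open>The new polynomial exceeds the old one by 2 \<delta> |x - x0|^2: one half
    absorbs the error allowed in the jet, the other half makes the contact at x0 strict.\<close>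
  define S' where "S' = S + (4 * \<delta>) *\<^sub>R mat 1"
  have S'v: "S' *v y = S *v y + (4 * \<delta>) *\<^sub>R y" for y
    by (simp add: S'_def matrix_vector_mult_add_rdistrib flip: scaleR_matrix_vector_assoc)
  have S'sym: "transpose S' = S'"
    using S by (simp add: S'_def transpose_def mat_def vec_eq_iff)
  define H where "H x = \<gamma> + S' *v (x - x0)" for x
  define k where "k x = H x \<bullet> (S' *v H x)" for x
  have cH: "continuous_on T H" for T
    unfolding H_def
    by (intro continuous_intros bounded_linear.continuous_on[OF matrix_vector_mul_bounded_linear])
  have ck: "continuous_on T k" for T
    unfolding k_def
    by (intro continuous_intros cH bounded_linear.continuous_on[OF matrix_vector_mul_bounded_linear])
  have "k x0 = \<gamma> \<bullet> (S *v \<gamma>) + 4 * \<delta> * (\<gamma> \<bullet> \<gamma>)"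
    by (simp add: k_def H_def S'v inner_add_right)
  then have k0: "k x0 < 0" using \<delta>2 neg by linarith
  define \<epsilon> where "\<epsilon> = - k x0 / 2"
  have \<epsilon>: "0 < \<epsilon>" using k0 by (simp add: \<epsilon>_def)
  have "\<forall>\<^sub>F x in nhds x0. k x < - \<epsilon>"
  proof -
    have "(k \<longlongrightarrow> k x0) (nhds x0)" using ck[of UNIV] by (simp add: continuous_on_eq_continuous_at continuous_at tendsto_at_iff_tendsto_nhds)
    then show ?thesis by (rule order_tendstoD(2)) (use k0 in \<open>simp add: \<epsilon>_def\<close>)
  qed
  moreover have "\<forall>\<^sub>F x in nhds x0. U x \<le> quad x0 (U x0) \<gamma> S x + \<delta> * (norm (x - x0))\<^sup>2"
    using jet[OF \<delta>] unfolding eventually_at_filter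
    by (rule eventually_mono) (auto simp: quad_def)
  ultimately have "\<forall>\<^sub>F x in nhds x0. k x < - \<epsilon> \<and> U x \<le> quad x0 (U x0) \<gamma> S x + \<delta> * (norm (x - x0))\<^sup>2"
    by (rule eventually_conj)
  then obtain d where d: "d > 0" and dk: "\<And>x. dist x x0 < d \<Longrightarrow> k x < - \<epsilon>"
    and dU: "\<And>x. dist x x0 < d \<Longrightarrow> U x \<le> quad x0 (U x0) \<gamma> S x + \<delta> * (norm (x - x0))\<^sup>2"
    unfolding eventually_nhds_metric by blast
  define r where "r = min \<rho> (d / 2)"
  have r: "0 < r" "r \<le> \<rho>" "r < d" using d \<rho> by (auto simp: r_def)
  define r1 where "r1 = r / 4"
  \<comment> \<open>The polynomial is lowered by c. At distance at least r1 the strict gap is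
    \<delta> r1^2 = 2 c, which covers c and the uniform error c / 2; at the centre lowering by c
    beats the error c / 2, so the approximating function sticks out.\<close>
  define c where "c = \<delta> * r1\<^sup>2 / 2"
  have c: "c > 0" using \<delta> r by (simp add: c_def r1_def)
  have q': "quad x0 \<alpha> \<gamma> S' x = quad x0 \<alpha> \<gamma> S x + 2 * \<delta> * (norm (x - x0))\<^sup>2" for \<alpha> x
    by (simp add: quad_def S'v inner_add_right add_divide_distrib dot_square_norm)
  define \<alpha> where "\<alpha> = U x0 - c"
  have "compact ((\<lambda>x. (H x \<bullet> H x) * trace S') ` cball x0 r)"
    by (intro compact_continuous_image continuous_intros cH) auto
  then obtain T where T: "\<forall>y\<in>(\<lambda>x. (H x \<bullet> H x) * trace S') ` cball x0 r. norm y \<le> T"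
    using compact_imp_bounded bounded_iff by blast
  have cutoff: "0 < r1" "r1 < r / 2" "r / 2 < r" using r by (auto simp: r1_def)
  obtain \<eta> where \<eta>: "test_function (ball x0 r) \<eta>" "\<And>x. 0 \<le> \<eta> x" "\<And>x. \<eta> x \<le> 1" "\<And>x. dist x0 x \<le> r1 \<Longrightarrow> \<eta> x = 1"
    by (rule cutoff_exists[OF cutoff, of x0]) blast
  \<comment> \<open>For exponents s beyond 2 + T / \<epsilon> the term (s - 2) k, with k < -
    \<epsilon>, outweighs the trace term, whose absolute value is at most T on the closed
    ball.\<close>
  have "\<forall>\<^sub>F n in sequentially. p n > max 2 (2 + T / \<epsilon>)" "\<forall>\<^sub>F n in sequentially. q n > max 2 (2 + T / \<epsilon>)"
    using p q filterlim_at_top_dense by blast+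
  moreover have "\<forall>\<^sub>F n in sequentially. \<forall>x\<in>cball x0 \<rho>. dist (u n x) (U x) < c / 2"
    using uniform_limitD[OF lim, of "c / 2"] c by simp
  ultimately have "\<forall>\<^sub>F n in sequentially. p n > max 2 (2 + T / \<epsilon>) \<and> q n > max 2 (2 + T / \<epsilon>) \<and>
      (\<forall>x\<in>cball x0 \<rho>. dist (u n x) (U x) < c / 2) \<and> local_minimizer \<Omega> (p n) (q n) (u n) (g n) (ball x0 \<rho>)"
    using min by (intro eventually_conj)
  then obtain n where n: "p n > max 2 (2 + T / \<epsilon>) \<and> q n > max 2 (2 + T / \<epsilon>) \<and>
      (\<forall>x\<in>cball x0 \<rho>. dist (u n x) (U x) < c / 2) \<and> local_minimizer \<Omega> (p n) (q n) (u n) (g n) (ball x0 \<rho>)"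
    by (rule eventually_happens'[OF sequentially_bot, THEN exE])
  note pn = n[THEN conjunct1] and qn = n[THEN conjunct2, THEN conjunct1]
    and un = n[THEN conjunct2, THEN conjunct2, THEN conjunct1, THEN bspec]
    and mn = n[THEN conjunct2, THEN conjunct2, THEN conjunct2]
  define m where "m = max (p n) (q n)"
  have w: "W0grad \<Omega> m (u n) (g n)" and cu: "continuous_on (closure \<Omega>) (u n)"
    using mn by (auto simp: local_minimizer_def m_def)
  define h where "h x = (\<eta> x * bump' (u n x - quad x0 \<alpha> \<gamma> S' x)) *\<^sub>R (g n x - grad (quad x0 \<alpha> \<gamma> S') x)
      + bump (u n x - quad x0 \<alpha> \<gamma> S' x) *\<^sub>R grad \<eta> x" for x
  define v where "v x = \<eta> x * bump (u n x - quad x0 \<alpha> \<gamma> S' x)" for x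
  have r1r: "r1 < r" using r by (simp add: r1_def)
  have bs: "ball x0 r \<subseteq> \<Omega>" using r \<rho> by fastforce
  have dec: "(LINT x|lebesgue_on \<Omega>. norm (g n x - h x) powr s) < (LINT x|lebesgue_on \<Omega>. norm (g n x) powr s)"
    if s: "s > max 2 (2 + T / \<epsilon>)" "s \<le> m" for s
    unfolding h_def
  proof (rule energy_decrease[OF \<Omega> _ s(2) w S'sym cutoff(1) r1r bs _ _ _ _ \<eta>])
    show "2 < s" using s by simp
    show "(\<gamma> + S' *v (x - x0)) \<bullet> (\<gamma> + S' *v (x - x0)) * trace S' + (s - 2) * ((\<gamma> + S' *v (x - x0)) \<bullet> (S' *v (\<gamma> + S' *v (x - x0)))) < 0"
      if x: "x \<in> cball x0 r" for x
    proof -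
      have "norm ((H x \<bullet> H x) * trace S') \<le> T" using T x by blast
      then have "(H x \<bullet> H x) * trace S' \<le> T" by simp
      moreover have "(s - 2) * k x \<le> (s - 2) * (- \<epsilon>)"
        using dk[of x] x r s by (intro mult_left_mono) (auto simp: dist_commute)
      moreover have "T < (s - 2) * \<epsilon>" using s \<epsilon> by (simp add: field_simps)
      ultimately show ?thesis by (simp add: H_def k_def)
    qed
    show "u n x \<le> quad x0 \<alpha> \<gamma> S' x" if x: "x \<in> ball x0 r" "r1 \<le> dist x0 x" for x
    proof -
      have "\<bar>u n x - U x\<bar> < c / 2" using un[of x] x r by (simp add: dist_real_def)
      then have "u n x \<le> U x + c / 2" by linarith
      moreover have "U x \<le> quad x0 (U x0) \<gamma> S' x - \<delta> * (norm (x - x0))\<^sup>2"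
        using dU[of x] x r by (simp add: q' dist_commute)
      moreover have "\<delta> * r1\<^sup>2 \<le> \<delta> * (norm (x - x0))\<^sup>2"
        using x cutoff \<delta> by (intro mult_left_mono power_mono) (auto simp: dist_norm norm_minus_commute)
      moreover have "quad x0 \<alpha> \<gamma> S' x = quad x0 (U x0) \<gamma> S' x - \<delta> * r1\<^sup>2 / 2"
        by (simp add: \<alpha>_def quad_def c_def)
      ultimately show ?thesis using c unfolding c_def by linarith
    qed
    show "quad x0 \<alpha> \<gamma> S' x0 < u n x0"
    proof -
      have "\<bar>u n x0 - U x0\<bar> < c / 2" using un[of x0] \<rho> by (simp add: dist_real_def)
      then have "U x0 - c < u n x0" using c by linarith
      then show ?thesis by (simp add: quad_def \<alpha>_def)
    qed
    show "continuous_on (ball x0 r) (u n)"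
      using cu bs closure_subset by (rule continuous_on_subset[OF _ order_trans])
  qed
  have "dirichlet_energy \<Omega> (p n) (q n) (g n) \<le> dirichlet_energy \<Omega> (p n) (q n) (\<lambda>x. g n x + (-1) *\<^sub>R h x)"
  proof -
    have m1: "1 \<le> m" "0 \<le> m" using pn by (auto simp: m_def)
    have "W0grad (ball x0 r) m v h"
      unfolding v_def h_def by (rule W0grad_truncation[OF \<Omega> open_ball bs m1(1) w Cinf_quad \<eta>(1)])
    moreover have "v x = 0" "h x = 0" if "x \<notin> ball x0 r" for x
      using test_function_eq_0[OF \<eta>(1) that] by (simp_all add: v_def h_def)
    ultimately have "W0grad \<Omega> m v h" using W0grad_extend[OF \<Omega>(1) open_ball bs] by blast
    then have "W0grad \<Omega> m (\<lambda>x. u n x + (-1) * v x) (\<lambda>x. g n x + (-1) *\<^sub>R h x)"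
      using W0grad_lincomb[OF w _ m1(2)] by blast
    moreover have "continuous_on (closure \<Omega>) (\<lambda>x. u n x + (-1) * v x)"
      unfolding v_def
      by (intro continuous_intros cu Cinf_continuous_on[OF test_function_Cinf[OF \<eta>(1)]]
          continuous_on_compose2[OF continuous_on_bump[of UNIV]] Cinf_continuous_on[OF Cinf_quad]) auto
    moreover have "u n x + (-1) * v x = u n x" if "x \<notin> ball x0 \<rho>" for x
      using test_function_eq_0(1)[OF \<eta>(1), of x] that r by (simp add: v_def)
    ultimately show ?thesis using mn unfolding local_minimizer_def m_def by blast
  qed
  moreover have "dirichlet_energy \<Omega> (p n) (q n) (\<lambda>x. g n x + (-1) *\<^sub>R h x) < dirichlet_energy \<Omega> (p n) (q n) (g n)"
    unfolding dirichlet_energy_def using dec[OF pn] dec[OF qn] pn qn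
    by (intro add_strict_mono divide_strict_right_mono) (auto simp: m_def)
  ultimately show False by simp
qed

section \<open>Least energy solutions are local minimizers\<close>

text \<open>A continuous function exceeds every level below its maximal modulus on a nonempty open
  set, which is not negligible. Hence the essential supremum is the maximum.\<close>

lemma Linf_norm_eq:
  fixes u :: "real^'n \<Rightarrow> real"
  assumes \<Omega>: "open \<Omega>" and c: "continuous_on \<Omega> u" and b: "\<And>x. x \<in> \<Omega> \<Longrightarrow> \<bar>u x\<bar> \<le> M"
    and x1: "x1 \<in> \<Omega>" "\<bar>u x1\<bar> = M"
  shows "Linf_norm \<Omega> u = M"
proof -
  let ?E = "esssup (lebesgue_on \<Omega>) (\<lambda>x. ereal (norm (u x)))"
  have [measurable]: "u \<in> borel_measurable (lebesgue_on \<Omega>)"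
    using c \<Omega> by (intro continuous_imp_measurable_on_sets_lebesgue open_sets_lebesgue)
  have "?E \<le> ereal M"
    using b by (intro esssup_I AE_I2) (auto simp: space_restrict_space)
  moreover have "ereal M \<le> ?E"
  proof (rule ccontr)
    assume "\<not> ereal M \<le> ?E"
    then have "?E < ereal M" by (simp only: not_le)
    then obtain r where r: "?E < ereal r" "ereal r < ereal M" using ereal_dense2[of ?E "ereal M"] by blast
    have "{x \<in> \<Omega>. r < \<bar>u x\<bar>} = \<Omega> \<inter> (\<lambda>x. \<bar>u x\<bar>) -` {r<..}" by auto
    then have V: "open {x \<in> \<Omega>. r < \<bar>u x\<bar>}"
      using continuous_open_preimage[OF continuous_on_rabs[OF c] \<Omega> open_greaterThan] by simp
    have "x1 \<in> {x \<in> \<Omega>. r < \<bar>u x\<bar>}" using x1 r by simp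
    then have "{x \<in> \<Omega>. r < \<bar>u x\<bar>} \<noteq> {}" by blast
    then obtain x where x: "x \<in> {x \<in> \<Omega>. r < \<bar>u x\<bar>}" "ereal (norm (u x)) \<le> ?E"
      using AE_open_witness[OF \<Omega> esssup_AE[of "\<lambda>x. ereal (norm (u x))"] V] by blast
    then have "ereal (norm (u x)) < ereal r" using r(1) by (metis order_le_less_trans)
    then show False using x(1) by simp
  qed
  ultimately have "?E = ereal M" by (rule antisym)
  then show ?thesis by (simp only: Linf_norm_def real_of_ereal.simps)
qed

lemma W0grad_Lp_norm:
  assumes \<Omega>: "open \<Omega>" "bounded \<Omega>" and m: "1 \<le> m" and w: "W0grad \<Omega> m u g" and s: "0 < s"
  shows "Lp_norm \<Omega> s (weak_grad \<Omega> u) powr s = (LINT x|lebesgue_on \<Omega>. norm (g x) powr s)"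
proof -
  have ae: "AE x in lebesgue_on \<Omega>. weak_grad \<Omega> u x = g x" by (rule W0grad_imp_W01p(2)[OF \<Omega> m w])
  have [measurable]: "g \<in> borel_measurable (lebesgue_on \<Omega>)" "weak_grad \<Omega> u \<in> borel_measurable (lebesgue_on \<Omega>)"
    using w W0grad_imp_W01p(1)[OF \<Omega> m w] in_Lp_measurable unfolding W0grad_def W01p_def W1p_def by blast+
  have "(LINT x|lebesgue_on \<Omega>. norm (weak_grad \<Omega> u x) powr s) = (LINT x|lebesgue_on \<Omega>. norm (g x) powr s)"
    using ae by (intro integral_cong_AE) (measurable, auto elim: eventually_mono)
  then show ?thesis using s by (simp add: Lp_norm_powr)
qed

lemma integral_norm_powr_segment:
  fixes g h :: "real^'n \<Rightarrow> real^'n"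
  assumes s: "1 < s" and g: "in_Lp \<Omega> s g" and h: "in_Lp \<Omega> s h" and t: "0 \<le> t" "t \<le> 1"
  shows "(LINT x|lebesgue_on \<Omega>. norm ((1 - t) *\<^sub>R g x + t *\<^sub>R h x) powr s)
    \<le> (1 - t) * (LINT x|lebesgue_on \<Omega>. norm (g x) powr s) + t * (LINT x|lebesgue_on \<Omega>. norm (h x) powr s)"
proof -
  have i: "in_Lp \<Omega> s (\<lambda>x. (1 - t) *\<^sub>R g x + t *\<^sub>R h x)"
    using s by (intro in_Lp_add in_Lp_scaleR g h) auto
  have "(LINT x|lebesgue_on \<Omega>. norm ((1 - t) *\<^sub>R g x + t *\<^sub>R h x) powr s)
    \<le> (LINT x|lebesgue_on \<Omega>. (1 - t) * norm (g x) powr s + t * norm (h x) powr s)"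
    using i g h norm_powr_convex[OF s t] by (intro integral_mono) (auto simp: in_Lp_def)
  also have "\<dots> = (1 - t) * (LINT x|lebesgue_on \<Omega>. norm (g x) powr s) + t * (LINT x|lebesgue_on \<Omega>. norm (h x) powr s)"
    using g h by (simp add: in_Lp_def)
  finally show ?thesis .
qed

text \<open>Convexity yields both bounds. From above, t \<mapsto> integral lies below its chord;
  from below, g is the midpoint of the point on the segment to h and the corresponding point on the
  segment to the reflection k = 2 g - h.\<close>

lemma integral_norm_powr_segment_tendsto:
  fixes g h :: "real^'n \<Rightarrow> real^'n"
  assumes s: "1 < s" and g: "in_Lp \<Omega> s g" and h: "in_Lp \<Omega> s h"
  shows "((\<lambda>t. LINT x|lebesgue_on \<Omega>. norm ((1 - t) *\<^sub>R g x + t *\<^sub>R h x) powr s) \<longlongrightarrow>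
    (LINT x|lebesgue_on \<Omega>. norm (g x) powr s)) (at_right 0)"
proof -
  define P where "P f = (LINT x|lebesgue_on \<Omega>. norm (f x) powr s)" for f :: "real^'n \<Rightarrow> real^'n"
  define f where "f t x = (1 - t) *\<^sub>R g x + t *\<^sub>R h x" for t x
  define k where "k x = 2 *\<^sub>R g x - h x" for x
  have k: "in_Lp \<Omega> s k" unfolding k_def using s by (intro in_Lp_diff in_Lp_scaleR g h) auto
  have up: "P (f t) \<le> (1 - t) * P g + t * P h" if "0 \<le> t" "t \<le> 1" for t
    unfolding P_def f_def by (rule integral_norm_powr_segment[OF s g h that])
  have lo: "2 * P g - ((1 - t) * P g + t * P k) \<le> P (f t)" if t: "0 \<le> t" "t \<le> 1" for t
  proof -
    define f' where "f' x = (1 - t) *\<^sub>R g x + t *\<^sub>R k x" for x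
    have i: "in_Lp \<Omega> s (f t)" "in_Lp \<Omega> s f'"
      unfolding f_def f'_def using s by (intro in_Lp_add in_Lp_scaleR g h k; simp)+
    have "(1 - 1/2) *\<^sub>R f t x + (1/2) *\<^sub>R f' x = g x" for x
    proof -
      have "f t x + f' x = 2 *\<^sub>R g x" by (simp add: f_def f'_def k_def algebra_simps scaleR_2)
      then have "(1/2) *\<^sub>R (f t x + f' x) = (1/2) *\<^sub>R (2 *\<^sub>R g x)" by simp
      then show ?thesis by (simp add: scaleR_add_right)
    qed
    then have "P g \<le> (1 - 1/2) * P (f t) + (1/2) * P f'"
      using integral_norm_powr_segment[OF s i, of "1/2"] by (simp add: P_def)
    moreover have "P f' \<le> (1 - t) * P g + t * P k"
      unfolding P_def f'_def by (rule integral_norm_powr_segment[OF s g k t])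
    ultimately show ?thesis by simp
  qed
  have ev: "\<forall>\<^sub>F t in at_right (0::real). 0 \<le> t \<and> t \<le> 1"
    by (auto simp: eventually_at_right_field intro!: exI[of _ 1])
  have "((\<lambda>t. P (f t)) \<longlongrightarrow> P g) (at_right 0)"
  proof (rule tendsto_sandwich)
    show "\<forall>\<^sub>F t in at_right 0. 2 * P g - ((1 - t) * P g + t * P k) \<le> P (f t)"
      using ev by eventually_elim (auto intro: lo)
    show "\<forall>\<^sub>F t in at_right 0. P (f t) \<le> (1 - t) * P g + t * P h"
      using ev by eventually_elim (auto intro: up)
    have "((\<lambda>t. 2 * P g - ((1 - t) * P g + t * P k)) \<longlongrightarrow> 2 * P g - ((1 - 0) * P g + 0 * P k)) (at_right 0)"
      by (intro tendsto_intros)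
    then show "((\<lambda>t. 2 * P g - ((1 - t) * P g + t * P k)) \<longlongrightarrow> P g) (at_right 0)" by simp
    have "((\<lambda>t. (1 - t) * P g + t * P h) \<longlongrightarrow> (1 - 0) * P g + 0 * P h) (at_right 0)"
      by (intro tendsto_intros)
    then show "((\<lambda>t. (1 - t) * P g + t * P h) \<longlongrightarrow> P g) (at_right 0)" by simp
  qed
  then show ?thesis by (simp add: P_def f_def)
qed

lemma powr_ge_tangent: "1 + r * (y - 1) \<le> y powr r" if "0 \<le> y" "1 < r" for y r :: real
proof -
  have "r * (1 / r + (y - 1)) \<le> r * (y powr r / r)"
    using norm_powr_gradient_ineq[of r 1 y] that by (intro mult_left_mono) auto
  then show ?thesis using that by (simp add: algebra_simps)
qed

text \<open>The left side is maximal at s = 1, by the tangent of y \<mapsto> y^(p / q) at y = 1 for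
  y = s^q. It expresses that along the ray through a point of the Nehari set the energy is largest
  at that point when q < p.\<close>

lemma scaled_energy_max:
  fixes s p q :: real
  assumes "0 < q" "q < p" "0 < s"
  shows "s powr q / q - s powr p / p \<le> 1 / q - 1 / p"
proof -
  have "1 + p / q * (s powr q - 1) \<le> (s powr q) powr (p / q)"
    using assms by (intro powr_ge_tangent) auto
  also have "\<dots> = s powr p" using assms by (simp add: powr_powr)
  finally have "(1 + p / q * (s powr q - 1)) / p \<le> s powr p / p" using assms by (intro divide_right_mono) auto
  moreover have "(1 + p / q * (s powr q - 1)) / p = 1 / p + (s powr q / q - 1 / q)"
    using assms by (simp add: add_divide_distrib diff_divide_distrib)
  ultimately show ?thesis by linarith
qed

text \<open>For p < q one small step towards the competitor can be compared directly with u. For q <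
  p the step \<open>wt t\<close> leaves the Nehari set and has to be multiplied by a factor s to
  return. Since the energy on the ray through u is largest at u, one may compare s
  \<open>wt t\<close> with s u; dividing by t and letting t tend to 0 removes the factor.\<close>

lemma least_energy_local_minimizer:
  fixes \<Omega> :: "(real^'n) set"
  assumes \<Omega>: "open \<Omega>" "bounded \<Omega>" and pq: "1 < p" "1 < q" and l: "0 < l"
    and les: "least_energy_solution \<Omega> p q l u" and nn: "\<And>y. y \<in> \<Omega> \<Longrightarrow> 0 \<le> u y"
    and mx: "only_max_point \<Omega> u xm" and xm: "xm \<in> \<Omega>" "0 < u xm"
    and B: "cball x0 \<rho> \<subseteq> \<Omega>" "xm \<notin> cball x0 \<rho>" "0 < \<rho>"
  shows "local_minimizer \<Omega> p q u (weak_grad \<Omega> u) (ball x0 \<rho>)"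
proof -
  define m where "m = max p q"
  define g where "g = weak_grad \<Omega> u"
  define M where "M = u xm"
  have m: "1 \<le> m" "0 \<le> m" "p \<le> m" "q \<le> m" using pq by (auto simp: m_def)
  have X: "u \<in> Xpq \<Omega> p q" using les by (auto simp: least_energy_solution_def nehari_def)
  have cu: "continuous_on (closure \<Omega>) u" using X by (simp add: Xpq_def)
  have wu: "W0grad \<Omega> m u g" using X W01p_imp_W0grad[OF \<Omega> m(1)] by (simp add: Xpq_def m_def g_def)
  have uM: "u y \<le> M" if "y \<in> closure \<Omega>" for y
    using mx that unfolding only_max_point_def M_def by (cases "y = xm") (auto intro: less_imp_le)
  have M: "0 < M" using xm by (simp add: M_def)
  have cO: "\<Omega> \<subseteq> closure \<Omega>" by (rule closure_subset)
  have LM: "Linf_norm \<Omega> u = M"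
    using uM nn xm cO by (intro Linf_norm_eq[OF \<Omega>(1) continuous_on_subset[OF cu cO]])
      (auto simp: M_def)
  show ?thesis
    unfolding local_minimizer_def m_def[symmetric] g_def[symmetric]
  proof (intro conjI allI impI)
    show "W0grad \<Omega> m u g" "continuous_on (closure \<Omega>) u" by fact+
    fix w h assume wh: "W0grad \<Omega> m w h \<and> continuous_on (closure \<Omega>) w \<and> (\<forall>x. x \<notin> ball x0 \<rho> \<longrightarrow> w x = u x)"
    then have ww: "W0grad \<Omega> m w h" and cw: "continuous_on (closure \<Omega>) w" and eq: "\<And>x. x \<notin> ball x0 \<rho> \<Longrightarrow> w x = u x"
      by auto
    define wt where "wt t x = (1 - t) * u x + t * w x" for t x
    define gt where "gt t x = (1 - t) *\<^sub>R g x + t *\<^sub>R h x" for t x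
    have Wt: "W0grad \<Omega> m (wt t) (gt t)" for t
      using W0grad_lincomb[OF W0grad_scale[OF wu m(2), of "1 - t"] ww m(2), of t]
      by (simp add: wt_def[abs_def] gt_def[abs_def])
    have ct: "continuous_on (closure \<Omega>) (wt t)" for t
      unfolding wt_def by (intro continuous_intros cu cw)
    have in_s: "in_Lp \<Omega> s g" "in_Lp \<Omega> s h" if "s \<in> {p, q}" for s
      using in_Lp_mono[OF \<Omega>, of m _ s] wu ww that m pq by (auto simp: W0grad_def)
    define P where "P f = (LINT x|lebesgue_on \<Omega>. norm (f x) powr p)" for f :: "real^'n \<Rightarrow> real^'n"
    define R where "R f = (LINT x|lebesgue_on \<Omega>. norm (f x) powr q)" for f :: "real^'n \<Rightarrow> real^'n"
    have F: "dirichlet_energy \<Omega> p q f = P f / p + R f / q" for f by (simp add: dirichlet_energy_def P_def R_def)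
    have Pt: "P (gt t) \<le> (1 - t) * P g + t * P h" and Rt: "R (gt t) \<le> (1 - t) * R g + t * R h"
      if "0 \<le> t" "t \<le> 1" for t
      unfolding P_def R_def gt_def
      using integral_norm_powr_segment[OF pq(1) in_s[of p] that] integral_norm_powr_segment[OF pq(2) in_s[of q] that]
      by auto
    have cB: "cball x0 \<rho> \<subseteq> closure \<Omega>" using B cO by blast
    have ne: "cball x0 \<rho> \<noteq> {}" using B by auto
    obtain y0 where y0: "y0 \<in> cball x0 \<rho>" "\<And>y. y \<in> cball x0 \<rho> \<Longrightarrow> u y \<le> u y0"
      using continuous_attains_sup[OF compact_cball ne continuous_on_subset[OF cu cB]] by blast
    have y0M: "u y0 < M"
    proof -
      have "y0 \<in> closure \<Omega>" "y0 \<noteq> xm" using y0(1) cB B(2) by auto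
      then show ?thesis using mx by (simp add: only_max_point_def M_def)
    qed
    have "compact ((\<lambda>x. w x - u x) ` cball x0 \<rho>)"
      by (intro compact_continuous_image continuous_intros continuous_on_subset[OF cu cB] continuous_on_subset[OF cw cB]) auto
    then obtain K where K: "\<forall>y\<in>(\<lambda>x. w x - u x) ` cball x0 \<rho>. norm y \<le> K"
      using compact_imp_bounded bounded_iff by blast
    have Kx: "\<bar>w x - u x\<bar> \<le> max K 1" for x
      using K eq[of x] by (cases "x \<in> ball x0 \<rho>") (auto simp: le_max_iff_disj)
    \<comment> \<open>For t < \<tau> the change t |w - u| in the ball is at most
      \<open>M - u y0\<close>, the gap below the maximum, and at most M; the latter, with u \<ge> 0,
      prevents values below - M. The maximum with 1 keeps the divisor positive.\<close>
    define \<tau> where "\<tau> = min 1 (min (M - u y0) M / max K 1)"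
    have \<tau>: "0 < \<tau>" using y0M M by (auto simp: \<tau>_def)
    have small: "t * max K 1 \<le> M - u y0" "t * max K 1 \<le> M" "t \<le> 1" if "0 < t" "t < \<tau>" for t
    proof -
      have "t \<le> min (M - u y0) M / max K 1" using that by (simp add: \<tau>_def)
      then have "t * max K 1 \<le> min (M - u y0) M" by (subst (asm) pos_le_divide_eq) auto
      then show "t * max K 1 \<le> M - u y0" "t * max K 1 \<le> M" by auto
      show "t \<le> 1" using that by (simp add: \<tau>_def)
    qed
    have bdt: "\<bar>wt t x\<bar> \<le> M" if t: "0 < t" "t < \<tau>" and x: "x \<in> \<Omega>" for t x
    proof (cases "x \<in> ball x0 \<rho>")
      case True
      have "\<bar>t * (w x - u x)\<bar> \<le> t * max K 1"
        using t Kx[of x] by (simp add: abs_mult mult_left_mono)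
      moreover have "wt t x = u x + t * (w x - u x)" by (simp add: wt_def algebra_simps)
      moreover have "u x \<le> u y0" using y0(2)[of x] True by simp
      ultimately show ?thesis using small[OF t] nn[OF x] by linarith
    next
      case False
      then have "wt t x = u x" using eq by (simp add: wt_def algebra_simps)
      then show ?thesis using uM[of x] nn[OF x] x cO by auto
    qed
    have wtm: "wt t xm = M" for t
      using eq[of xm] B by (simp add: wt_def M_def algebra_simps)
    have Lt: "Linf_norm \<Omega> (\<lambda>x. c * wt t x) = c * M" if t: "0 < t" "t < \<tau>" and c: "0 < c" for t c
    proof (rule Linf_norm_eq[OF \<Omega>(1) _ _ xm(1)])
      show "continuous_on \<Omega> (\<lambda>x. c * wt t x)" by (intro continuous_on_mult_left continuous_on_subset[OF ct cO])
      show "\<bar>c * wt t x\<bar> \<le> c * M" if "x \<in> \<Omega>" for x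
        using bdt[OF t that] c by (simp add: abs_mult)
      show "\<bar>c * wt t xm\<bar> = c * M" using wtm[of t] c M by (simp add: abs_mult)
    qed
    have Xt: "(\<lambda>x. c * wt t x) \<in> Xpq \<Omega> p q" for c t
      using W0grad_imp_W01p(1)[OF \<Omega> m(1) W0grad_scale[OF Wt[of t] m(2), of c]] ct[of t]
      by (auto simp: Xpq_def m_def intro!: continuous_on_mult_left)
    have Np: "Lp_norm \<Omega> p (weak_grad \<Omega> (\<lambda>x. c * wt t x)) powr p = c powr p * P (gt t)"
      and Nq: "Lp_norm \<Omega> q (weak_grad \<Omega> (\<lambda>x. c * wt t x)) powr q = c powr q * R (gt t)" if c: "0 < c" for c t
      using W0grad_Lp_norm[OF \<Omega> m(1) W0grad_scale[OF Wt[of t] m(2), of c]] pq c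
      by (simp_all add: P_def R_def powr_mult)
    have Nu: "Lp_norm \<Omega> p (weak_grad \<Omega> u) powr p = P g" "Lp_norm \<Omega> q (weak_grad \<Omega> u) powr q = R g"
      using W0grad_Lp_norm[OF \<Omega> m(1) wu] pq by (simp_all add: P_def R_def)
    have Eu: "energy \<Omega> p q l u = P g / p + R g / q - l / p * M powr p"
      by (simp add: energy_def Nu LM)
    have Et: "energy \<Omega> p q l (\<lambda>x. c * wt t x) = c powr p * P (gt t) / p + c powr q * R (gt t) / q - l / p * (c * M) powr p"
      if "0 < t" "t < \<tau>" "0 < c" for t c
      using Np[OF that(3), of t] Nq[OF that(3), of t] Lt[OF that] by (simp add: energy_def)
    have R0: "0 \<le> R f" and P0: "0 \<le> P f" for f by (auto simp: P_def R_def intro: integral_nonneg_AE)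
    show "dirichlet_energy \<Omega> p q g \<le> dirichlet_energy \<Omega> p q h"
      using les unfolding least_energy_solution_def
    proof
      assume "real CARD('n) < p \<and> p < q \<and> u \<in> Xpq \<Omega> p q \<and> (\<forall>v\<in>Xpq \<Omega> p q. energy \<Omega> p q l u \<le> energy \<Omega> p q l v)"
      then have le: "energy \<Omega> p q l u \<le> energy \<Omega> p q l v" if "v \<in> Xpq \<Omega> p q" for v using that by blast
      define t where "t = \<tau> / 2"
      have t: "0 < t" "t < \<tau>" "t \<le> 1" using \<tau> small[of t] by (auto simp: t_def)
      have "P g / p + R g / q \<le> P (gt t) / p + R (gt t) / q"
        using le[OF Xt[of 1 t]] Et[OF t(1,2), of 1] Eu by simp
      also have "\<dots> \<le> ((1 - t) * P g + t * P h) / p + ((1 - t) * R g + t * R h) / q"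
        using Pt[of t] Rt[of t] t pq by (intro add_mono divide_right_mono) auto
      also have "\<dots> = (1 - t) * (P g / p + R g / q) + t * (P h / p + R h / q)"
        by (simp add: add_divide_distrib diff_divide_distrib algebra_simps)
      finally have "t * (P g / p + R g / q) \<le> t * (P h / p + R h / q)" by (simp add: left_diff_distrib)
      then show ?thesis using t by (simp add: F)
    next
      assume as: "real CARD('n) < q \<and> q < p \<and> u \<in> nehari \<Omega> p q l \<and> (\<forall>v\<in>nehari \<Omega> p q l. energy \<Omega> p q l u \<le> energy \<Omega> p q l v)"
      then have qp: "q < p" and un: "u \<in> nehari \<Omega> p q l"
        and le: "\<And>v. v \<in> nehari \<Omega> p q l \<Longrightarrow> energy \<Omega> p q l u \<le> energy \<Omega> p q l v" by auto
      have PR: "P g + R g = l * M powr p" using un by (simp add: nehari_def Nu LM)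
      have lM: "0 < l * M powr p" using l M by simp
      \<comment> \<open>If the q-integral of the gradient vanished, the gradient and with it the
        p-integral would vanish too, contradicting the Nehari identity, whose right side is
        positive.\<close>
      have Rg: "0 < R g"
      proof (rule ccontr)
        assume "\<not> 0 < R g"
        then have "R g = 0" using R0[of g] by simp
        then have "AE x in lebesgue_on \<Omega>. norm (g x) powr q = 0"
          unfolding R_def using in_s(1)[of q] by (subst (asm) integral_nonneg_eq_0_iff_AE) (auto simp: in_Lp_def)
        then have "AE x in lebesgue_on \<Omega>. norm (g x) powr p = 0" by eventually_elim simp
        then have "P g = 0" unfolding P_def by (rule integral_eq_zero_AE)
        then show False using PR lM \<open>R g = 0\<close> by simp
      qed
      \<comment> \<open>The Nehari identity for s \<open>wt t\<close> reads s^p D(t) = s^q R(gt t)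
        by homogeneity, and is solvable for s once D(t) and R(gt t) are positive. By the identity
        for u both tend to R(g) > 0.\<close>
      define D where "D t = l * M powr p - P (gt t)" for t
      have limP: "((\<lambda>t. P (gt t)) \<longlongrightarrow> P g) (at_right 0)" and limR: "((\<lambda>t. R (gt t)) \<longlongrightarrow> R g) (at_right 0)"
        unfolding P_def R_def gt_def
        using integral_norm_powr_segment_tendsto[OF pq(1) in_s[of p]] integral_norm_powr_segment_tendsto[OF pq(2) in_s[of q]]
        by auto
      have limD: "(D \<longlongrightarrow> R g) (at_right 0)"
      proof -
        have "(D \<longlongrightarrow> l * M powr p - P g) (at_right 0)" unfolding D_def by (intro tendsto_intros limP)
        moreover have "l * M powr p - P g = R g" using PR by simp
        ultimately show ?thesis by simp
      qed
      have key: "0 \<le> R (gt t) / D t * ((P h - P g) / p) + (R h - R g) / q"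
        if t: "0 < t" "t < \<tau>" and Dt: "0 < D t" and Rp: "0 < R (gt t)" for t
      proof -
        define s where "s = (R (gt t) / D t) powr (1 / (p - q))"
        have s: "0 < s" using Dt Rp by (simp add: s_def)
        have spq: "s powr (p - q) = R (gt t) / D t" using qp Dt Rp by (simp add: s_def powr_powr)
        have sp: "s powr p = s powr q * (R (gt t) / D t)"
          using s spq by (metis add.commute diff_add_cancel powr_add)
        have cM: "(s * M) powr p = s powr p * M powr p" using s M by (simp add: powr_mult)
        have "s powr p * P (gt t) + s powr q * R (gt t) = l * (s * M) powr p"
        proof -
          have "s powr p * D t = s powr q * R (gt t)" using Dt by (simp add: sp)
          then show ?thesis unfolding cM D_def by (simp add: algebra_simps)
        qed
        then have "(\<lambda>x. s * wt t x) \<in> nehari \<Omega> p q l"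
          unfolding nehari_def using Xt[of s t] Np[OF s, of t] Nq[OF s, of t] Lt[OF t s] xm(1) wtm[of t] s M
          by (auto intro!: bexI[of _ xm])
        from le[OF this] have "energy \<Omega> p q l u \<le> s powr p * P (gt t) / p + s powr q * R (gt t) / q - l / p * (s * M) powr p"
          using Et[OF t s] by simp
        \<comment> \<open>The left side is the energy of s u. Expressing the sup norm term through
          the Nehari identity turns it into R(g) times the function bounded in
          \<open>scaled_energy_max\<close>.\<close>
        moreover have "s powr p * P g / p + s powr q * R g / q - l / p * (s * M) powr p \<le> energy \<Omega> p q l u"
        proof -
          have "R g * (s powr q / q - s powr p / p) \<le> R g * (1 / q - 1 / p)"
            using scaled_energy_max[of q p s] pq qp s Rg by (intro mult_left_mono) auto
          moreover have "energy \<Omega> p q l u = R g * (1 / q - 1 / p)"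
          proof -
            have "l / p * M powr p = (P g + R g) / p" by (simp add: PR)
            then show ?thesis by (simp add: Eu right_diff_distrib add_divide_distrib)
          qed
          moreover have "s powr p * P g / p + s powr q * R g / q - l / p * (s * M) powr p = R g * (s powr q / q - s powr p / p)"
          proof -
            have "l / p * (s * M) powr p = s powr p * (P g + R g) / p" by (simp add: cM PR)
            then show ?thesis by (simp add: distrib_left right_diff_distrib add_divide_distrib mult.commute)
          qed
          ultimately show ?thesis by simp
        qed
        ultimately have "s powr p * P g / p + s powr q * R g / q \<le> s powr p * P (gt t) / p + s powr q * R (gt t) / q"
          by linarith
        also have "\<dots> \<le> s powr p * (P g + t * (P h - P g)) / p + s powr q * (R g + t * (R h - R g)) / q"
          using Pt[of t] Rt[of t] t small[OF t] pq
          by (intro add_mono divide_right_mono mult_left_mono) (auto simp: algebra_simps)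
        finally have le0: "0 \<le> (s powr q * t) * (R (gt t) / D t * ((P h - P g) / p) + (R h - R g) / q)"
          unfolding sp by (simp add: algebra_simps add_divide_distrib diff_divide_distrib)
        show ?thesis
        proof (rule ccontr)
          assume "\<not> ?thesis"
          then have "(s powr q * t) * (R (gt t) / D t * ((P h - P g) / p) + (R h - R g) / q) < 0"
            using s t by (intro mult_pos_neg) auto
          then show False using le0 by simp
        qed
      qed
      \<comment> \<open>The rescaling distorts the relative weight of the p-term and the q-term by
        R(gt t) / D(t). As t tends to 0 this ratio tends to one, and what remains is the difference
        of the two Dirichlet energies.\<close>
      have "((\<lambda>t. R (gt t) / D t * ((P h - P g) / p) + (R h - R g) / q) \<longlongrightarrow> R g / R g * ((P h - P g) / p) + (R h - R g) / q) (at_right 0)"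
        using Rg by (intro tendsto_intros limR limD) auto
      moreover have "\<forall>\<^sub>F t in at_right 0. 0 \<le> R (gt t) / D t * ((P h - P g) / p) + (R h - R g) / q"
      proof -
        have "\<forall>\<^sub>F t in at_right 0. 0 < t \<and> t < \<tau>"
          using \<tau> by (auto simp: eventually_at_right_field intro!: exI[of _ \<tau>])
        then show ?thesis
          using order_tendstoD(1)[OF limD Rg] order_tendstoD(1)[OF limR Rg]
        proof eventually_elim
          case (elim t)
          then show ?case using key[of t] by blast
        qed
      qed
      ultimately have "0 \<le> R g / R g * ((P h - P g) / p) + (R h - R g) / q"
        by (intro tendsto_lowerbound) auto
      then show ?thesis using Rg by (simp add: F diff_divide_distrib)
    qed
  qed
qed

section \<open>The supremum is controlled by the gradient\<close>

lemma lborel_integral_affine: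
  fixes f :: "'a::euclidean_space \<Rightarrow> real"
  assumes [measurable]: "f \<in> borel_measurable borel" and c: "0 < c"
  shows "(LINT x|lborel. f (b + c *\<^sub>R x)) = (LINT x|lborel. f x) / c ^ DIM('a)"
    and "integrable lborel f \<Longrightarrow> integrable lborel (\<lambda>x. f (b + c *\<^sub>R x))"
proof -
  have L: "lborel = density (distr lborel borel (\<lambda>x. b + c *\<^sub>R x)) (\<lambda>_. ennreal (c ^ DIM('a)))"
    using lborel_affine[of c b] c by simp
  have "(LINT x|lborel. f x) = (LINT x|density (distr lborel borel (\<lambda>x. b + c *\<^sub>R x)) (\<lambda>_. ennreal (c ^ DIM('a))). f x)"
    by (subst L) simp
  also have "\<dots> = (LINT x|distr lborel borel (\<lambda>x. b + c *\<^sub>R x). c ^ DIM('a) *\<^sub>R f x)"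
    using c by (intro integral_density) auto
  also have "\<dots> = (LINT x|lborel. c ^ DIM('a) *\<^sub>R f (b + c *\<^sub>R x))"
    by (intro integral_distr) auto
  finally show "(LINT x|lborel. f (b + c *\<^sub>R x)) = (LINT x|lborel. f x) / c ^ DIM('a)"
    using c by simp
  assume "integrable lborel f"
  then have "integrable (density (distr lborel borel (\<lambda>x. b + c *\<^sub>R x)) (\<lambda>_. ennreal (c ^ DIM('a)))) f"
    by (subst (asm) L) simp
  then have "integrable (distr lborel borel (\<lambda>x. b + c *\<^sub>R x)) (\<lambda>x. c ^ DIM('a) *\<^sub>R f x)"
    using c by (subst (asm) integrable_density) auto
  then have "integrable lborel (\<lambda>x. c ^ DIM('a) *\<^sub>R f (b + c *\<^sub>R x))"
    by (subst (asm) integrable_distr_eq) auto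
  then show "integrable lborel (\<lambda>x. f (b + c *\<^sub>R x))" using c by simp
qed

lemma continuous_compact_support_integrable:
  fixes f :: "'a::euclidean_space \<Rightarrow> real"
  assumes "compact K" "\<And>x. x \<notin> K \<Longrightarrow> f x = 0" "continuous_on UNIV f"
  shows "integrable lborel f"
proof -
  have "integrable lborel (\<lambda>x. indicator K x *\<^sub>R f x)"
    using assms by (intro borel_integrable_compact) (auto intro: continuous_on_subset)
  moreover have "(\<lambda>x. indicator K x *\<^sub>R f x) = f" using assms(2) by (auto simp: indicator_def fun_eq_iff)
  ultimately show ?thesis by simp
qed

text \<open>The test function is averaged over the segments joining \<open>x\<close> to a unit cube on which it
  vanishes; the dilation with centre \<open>x\<close> and ratio \<open>t\<close> costs the factor \<open>t powr (- N)\<close>.\<close>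

lemma test_function_sup_bound:
  fixes \<Omega> :: "(real^'n) set"
  assumes \<Omega>: "open \<Omega>" "bounded \<Omega>"
  obtains C where "1 \<le> C"
    "\<And>s \<psi> J x. real CARD('n) + 1 \<le> s \<Longrightarrow> test_function \<Omega> \<psi> \<Longrightarrow> 0 < J \<Longrightarrow>
       (LINT x|lebesgue_on \<Omega>. norm (grad \<psi> x) powr s) \<le> J \<Longrightarrow> \<bar>\<psi> x\<bar> \<le> C * J powr (1 / s)"
proof -
  define N where "N = real CARD('n)"
  obtain \<rho> where \<rho>: "0 < \<rho>" "\<And>x. x \<in> \<Omega> \<Longrightarrow> norm x < \<rho>"
    using \<Omega>(2) unfolding bounded_pos by (metis less_add_one add_pos_pos zero_less_one le_less_trans)
  \<comment> \<open>A unit cube all of whose points have every coordinate at least \<rho>, hence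
    norm at least \<rho>, so that it misses \<Omega>.\<close>
  define a0 b0 :: "real^'n" where "a0 = (\<chi> i. \<rho>)" and "b0 = (\<chi> i. \<rho> + 1)"
  have Qne: "cbox a0 b0 \<noteq> {}" by (auto simp: a0_def b0_def interval_eq_empty_cart not_less)
  then have Qcont: "measure lborel (cbox a0 b0) = 1"
    by (subst content_cbox_cart) (auto simp: a0_def b0_def)
  have Qout: "y \<notin> \<Omega>" if "y \<in> cbox a0 b0" for y
  proof
    assume "y \<in> \<Omega>"
    then have "norm y < \<rho>" by (rule \<rho>(2))
    moreover obtain i :: 'n where True by blast
    have "\<rho> \<le> y $ i" using that by (simp add: mem_box_cart a0_def)
    then have "\<rho> \<le> norm y" using component_le_norm_cart[of y i] by linarith
    ultimately show False by simp
  qed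
  obtain D0 where D0: "\<And>y. y \<in> cbox a0 b0 \<Longrightarrow> norm y \<le> D0"
    using bounded_cbox[of a0 b0] unfolding bounded_iff by blast
  define D where "D = max 1 (D0 + \<rho>)"
  have D: "1 \<le> D" "\<And>x y. x \<in> \<Omega> \<Longrightarrow> y \<in> cbox a0 b0 \<Longrightarrow> norm (y - x) \<le> D"
  proof -
    fix x y assume "x \<in> \<Omega>" "y \<in> cbox a0 b0"
    then show "norm (y - x) \<le> D"
      using D0[of y] \<rho>(2)[of x] norm_triangle_ineq4[of y x] unfolding D_def by linarith
  qed (simp add: D_def)
  \<comment> \<open>2 D comes from the estimate of the derivative after balancing, and N + 1 bounds
    the integral of r^(e - 1) over (0, 1). Neither depends on s, which is the point of the
    estimate.\<close>
  define C where "C = 2 * D * (N + 1)"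
  have N1: "1 \<le> N" by (simp add: N_def Suc_leI)
  show ?thesis
  proof (rule that[of C])
    have "1 * 1 \<le> (2 * D) * (N + 1)" using D(1) N1 by (intro mult_mono) auto
    then show "1 \<le> C" by (simp add: C_def)
    fix s \<psi> J x
    assume s: "real CARD('n) + 1 \<le> s" and t: "test_function \<Omega> \<psi>" and J: "0 < J"
      and I: "(LINT x|lebesgue_on \<Omega>. norm (grad \<psi> x) powr s) \<le> J"
    have s1: "1 < s" "0 < s" using s N1 unfolding N_def by linarith+
    show "\<bar>\<psi> x\<bar> \<le> C * J powr (1 / s)"
    proof (cases "x \<in> \<Omega>")
      case False
      then show ?thesis using test_function_eq_0(1)[OF t] \<open>1 \<le> C\<close> by simp
    next
      case x: True
      obtain K where K: "compact K" "K \<subseteq> \<Omega>" "\<And>x. x \<notin> K \<Longrightarrow> \<psi> x = 0" "\<And>x. x \<notin> K \<Longrightarrow> grad \<psi> x = 0"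
        by (rule test_function_obtain[OF t]) blast
      note Ci = test_function_Cinf[OF t]
      define G where "G y = norm (grad \<psi> y) powr s" for y
      have cG: "continuous_on UNIV G"
        unfolding G_def using s1 by (intro continuous_on_powr' continuous_intros Cinf_continuous_on_grad[OF Ci]) auto
      have [measurable]: "G \<in> borel_measurable borel" using cG by (rule borel_measurable_continuous_onI)
      have iG: "integrable lborel G"
        by (rule continuous_compact_support_integrable[OF K(1) _ cG]) (simp add: G_def K(4))
      have IG: "(LINT y|lborel. G y) \<le> J"
      proof -
        have "(LINT y|lborel. G y) = (LINT y|lebesgue. G y)" by (rule integral_completion[symmetric]) simp
        also have "\<dots> = (LINT y|lebesgue. indicator \<Omega> y *\<^sub>R G y)"
          using K by (intro Bochner_Integration.integral_cong) (auto simp: indicator_def G_def)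
        also have "\<dots> = (LINT y|lebesgue_on \<Omega>. G y)"
          using \<Omega>(1) by (simp add: integral_lebesgue_on open_sets_lebesgue)
        finally show ?thesis using I by (simp add: G_def)
      qed
      define Q where "Q = cbox a0 b0"
      \<comment> \<open>The mean of \<psi> over the cube contracted towards x with ratio r; it
        equals \<psi>(x) at r = 0 and 0 at r = 1.\<close>
      define a where "a r = integral Q (\<lambda>y. \<psi> (x + r *\<^sub>R (y - x)))" for r :: real
      define a' where "a' r = integral Q (\<lambda>y. grad \<psi> (x + r *\<^sub>R (y - x)) \<bullet> (y - x))" for r :: real
      have lin: "((\<lambda>r. x + r *\<^sub>R (y - x)) has_derivative (\<lambda>r. r *\<^sub>R (y - x))) (at r)" for y r
        by (auto intro!: derivative_eq_intros)
      have da: "(a has_real_derivative a' r) (at r)" for r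
        unfolding a_def a'_def Q_def
      proof (rule leibniz_rule_field_derivative[where U = UNIV, simplified])
        show "((\<lambda>r. \<psi> (x + r *\<^sub>R (y - x))) has_real_derivative grad \<psi> (x + r *\<^sub>R (y - x)) \<bullet> (y - x)) (at r)" for r y
        proof -
          have "(\<psi> has_derivative (\<lambda>h. h \<bullet> grad \<psi> (x + r *\<^sub>R (y - x)))) (at (x + r *\<^sub>R (y - x)))"
            using Cinf_GDERIV[OF Ci] by (simp add: gderiv_def)
          from has_derivative_compose[OF lin this] show ?thesis
            by (simp add: has_field_derivative_def inner_commute mult_commute_abs)
        qed
        show "(\<lambda>y. \<psi> (x + r *\<^sub>R (y - x))) integrable_on cbox a0 b0" for r
          by (intro integrable_continuous continuous_on_compose2[OF Cinf_continuous_on[OF Ci, of UNIV]] continuous_intros) auto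
        show "continuous_on (UNIV \<times> cbox a0 b0) (\<lambda>(r, y). grad \<psi> (x + r *\<^sub>R (y - x)) \<bullet> (y - x))"
          unfolding split_beta
          by (intro continuous_intros continuous_on_compose2[OF Cinf_continuous_on_grad[OF Ci, of UNIV]]) auto
      qed
      have a0v: "a 0 = \<psi> x" using Qcont by (simp add: a_def Q_def)
      have a1v: "a 1 = 0"
      proof -
        have "a 1 = integral Q (\<lambda>y. 0)" unfolding a_def
          by (rule integral_cong) (use Qout test_function_eq_0(1)[OF t] in \<open>auto simp: Q_def\<close>)
        then show ?thesis by simp
      qed
      define k where "k = 2 * D * J powr (1 / s)"
      \<comment> \<open>The derivative of the mean is of order r^(- N / s) = r^(e - 1), integrable
        since s > N. The assumption s \<ge> N + 1 bounds e from below by 1 / (N + 1), uniformly in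
        s.\<close>
      define e where "e = 1 - N / s"
      have k0: "0 < k" using D(1) J by (simp add: k_def)
      have e: "1 / (N + 1) \<le> e" "0 < e"
      proof -
        have "N / s \<le> N / (N + 1)" using s N1 by (intro divide_left_mono) (auto simp: N_def)
        then show "1 / (N + 1) \<le> e" using N1 by (simp add: e_def field_simps)
        then show "0 < e" using N1 by (smt (verit) divide_pos_pos)
      qed
      have bound: "\<bar>a' r\<bar> \<le> k * r powr (e - 1)" if r: "0 < r" for r
      proof -
        \<comment> \<open>After the dilation by r the integral of |grad \<psi>|^s over the cube is
          at most J / r^N. This \<tau> makes the two terms of \<open>le_eps_powr\<close> equal in
          the worst case.\<close>
        define \<tau> where "\<tau> = (J / r ^ CARD('n)) powr (1 / s)"
        have \<tau>: "0 < \<tau>" using J r by (simp add: \<tau>_def)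
        have \<tau>s: "\<tau> powr s = J / r ^ CARD('n)" using J r s1 by (simp add: \<tau>_def powr_powr)
        have \<tau>e: "\<tau> = J powr (1 / s) * r powr (e - 1)"
        proof -
          have "r ^ CARD('n) = r powr N" using r by (simp add: N_def powr_realpow)
          then have "\<tau> = J powr (1 / s) / (r powr N) powr (1 / s)" using J r by (simp add: \<tau>_def powr_divide)
          also have "(r powr N) powr (1 / s) = r powr (N / s)" by (simp add: powr_powr)
          also have "J powr (1 / s) / r powr (N / s) = J powr (1 / s) * r powr (e - 1)"
            by (simp add: e_def powr_minus_divide)
          finally show ?thesis .
        qed
        define F where "F y = G ((1 - r) *\<^sub>R x + r *\<^sub>R y)" for y
        have FG: "F y = G (x + r *\<^sub>R (y - x))" for y
          unfolding F_def by (rule arg_cong[of _ _ G]) (simp add: algebra_simps)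
        have cF: "continuous_on S F" for S
          unfolding F_def by (intro continuous_on_compose2[OF cG] continuous_intros) auto
        have iF: "integrable lborel F" unfolding F_def by (rule lborel_integral_affine(2)[OF _ r iG]) simp
        have F0: "0 \<le> F y" for y by (simp add: F_def G_def)
        have "integral Q F = (LINT y|lborel. indicator Q y *\<^sub>R F y)"
        proof -
          have "set_integrable lborel Q F" unfolding set_integrable_def Q_def
            by (intro borel_integrable_compact cF) auto
          from set_borel_integral_eq_integral(2)[OF this] show ?thesis by (simp add: set_lebesgue_integral_def)
        qed
        also have "\<dots> \<le> (LINT y|lborel. F y)"
          using F0 by (intro integral_mono[OF _ iF] borel_integrable_compact[of Q F] cF) (auto simp: Q_def indicator_def)
        also have "\<dots> = (LINT y|lborel. G y) / r ^ CARD('n)"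
          unfolding F_def by (subst lborel_integral_affine(1)[OF _ r]) simp_all
        also have "\<dots> \<le> J / r ^ CARD('n)" using IG r by (intro divide_right_mono) auto
        finally have intF: "integral Q F \<le> \<tau> powr s" by (simp add: \<tau>s)
        have pt: "norm (grad \<psi> (x + r *\<^sub>R (y - x)) \<bullet> (y - x)) \<le> D * (\<tau> + \<tau> powr (1 - s) * F y)" if y: "y \<in> Q" for y
        proof -
          have "norm (grad \<psi> (x + r *\<^sub>R (y - x)) \<bullet> (y - x)) \<le> norm (grad \<psi> (x + r *\<^sub>R (y - x))) * norm (y - x)"
            using Cauchy_Schwarz_ineq2 by simp
          also have "\<dots> \<le> (\<tau> + \<tau> powr (1 - s) * F y) * D"
            using le_eps_powr[OF norm_ge_zero \<tau>, of s "grad \<psi> (x + r *\<^sub>R (y - x))"] s1 D(2)[OF x, of y] y \<tau> F0[of y]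
            by (intro mult_mono) (auto simp: FG G_def Q_def)
          finally show ?thesis by (simp add: mult.commute)
        qed
        have "\<bar>a' r\<bar> \<le> integral Q (\<lambda>y. D * (\<tau> + \<tau> powr (1 - s) * F y))"
          unfolding a'_def real_norm_def[symmetric] Q_def
        proof (rule integral_norm_bound_integral)
          show "(\<lambda>y. grad \<psi> (x + r *\<^sub>R (y - x)) \<bullet> (y - x)) integrable_on cbox a0 b0"
            by (intro integrable_continuous continuous_on_compose2[OF Cinf_continuous_on_grad[OF Ci, of UNIV]] continuous_intros) auto
          show "(\<lambda>y. D * (\<tau> + \<tau> powr (1 - s) * F y)) integrable_on cbox a0 b0"
            by (intro integrable_continuous continuous_intros cF)
        qed (use pt in \<open>simp add: Q_def\<close>)
        also have "\<dots> = D * (\<tau> + \<tau> powr (1 - s) * integral Q F)"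
        proof -
          have iF': "F integrable_on cbox a0 b0" by (intro integrable_continuous cF)
          have "integral (cbox a0 b0) (\<lambda>y. \<tau> + \<tau> powr (1 - s) * F y) = \<tau> + \<tau> powr (1 - s) * integral (cbox a0 b0) F"
            using iF' Qcont by (subst integral_add) (auto intro!: integrable_on_mult_right)
          then show ?thesis by (simp add: Q_def)
        qed
        also have "\<dots> \<le> D * (\<tau> + \<tau> powr (1 - s) * \<tau> powr s)"
          using intF D(1) by (intro mult_left_mono add_left_mono) auto
        also have "\<tau> powr (1 - s) * \<tau> powr s = \<tau>" using \<tau> by (simp flip: powr_add)
        finally show ?thesis by (simp add: k_def \<tau>e)
      qed
      define b where "b r = k * (r powr e / e)" for r
      have db: "(b has_real_derivative k * r powr (e - 1)) (at r)" if "0 < r" for r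
        unfolding b_def using that e(2) by (auto intro!: derivative_eq_intros)
      \<comment> \<open>\<open>b\<close> is a primitive of the bound on the derivative of the mean.
        As that bound blows up at 0, the comparison is made on [r, 1] and r is sent to 0
        afterwards.\<close>
      have mono: "\<bar>a r\<bar> \<le> b 1" if r: "0 < r" "r < 1" for r
      proof -
        have "b r - a r \<le> b 1 - a 1"
        proof (rule DERIV_nonneg_imp_nondecreasing[where f = "\<lambda>r. b r - a r"])
          show "r \<le> 1" using r by simp
          fix t assume t: "r \<le> t" "t \<le> 1"
          show "\<exists>y. ((\<lambda>r. b r - a r) has_real_derivative y) (at t) \<and> 0 \<le> y"
            using bound[of t] t r by (intro exI[of _ "k * t powr (e - 1) - a' t"] conjI DERIV_diff db da) auto
        qed
        moreover have "b r + a r \<le> b 1 + a 1"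
        proof (rule DERIV_nonneg_imp_nondecreasing[where f = "\<lambda>r. b r + a r"])
          show "r \<le> 1" using r by simp
          fix t assume t: "r \<le> t" "t \<le> 1"
          show "\<exists>y. ((\<lambda>r. b r + a r) has_real_derivative y) (at t) \<and> 0 \<le> y"
            using bound[of t] t r by (intro exI[of _ "k * t powr (e - 1) + a' t"] conjI DERIV_add db da) auto
        qed
        moreover have "0 \<le> b r" using k0 e by (simp add: b_def)
        ultimately show ?thesis using a1v by linarith
      qed
      have "(a \<longlongrightarrow> a 0) (at_right 0)"
        using DERIV_isCont[OF da[of 0]] by (simp add: isCont_def filterlim_at_split)
      then have "((\<lambda>r. \<bar>a r\<bar>) \<longlongrightarrow> \<bar>a 0\<bar>) (at_right 0)" by (intro tendsto_intros)
      moreover have "\<forall>\<^sub>F r in at_right 0. \<bar>a r\<bar> \<le> b 1"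
        using mono by (auto simp: eventually_at_right_field intro!: exI[of _ 1])
      ultimately have "\<bar>a 0\<bar> \<le> b 1" by (intro tendsto_upperbound) auto
      also have "b 1 \<le> k * (N + 1)"
      proof -
        have "1 / e \<le> N + 1" using e N1 by (simp add: field_simps)
        then have "k * (1 / e) \<le> k * (N + 1)" using k0 by (intro mult_left_mono) auto
        then show ?thesis by (simp add: b_def)
      qed
      also have "\<dots> = C * J powr (1 / s)" by (simp add: k_def C_def)
      finally show ?thesis by (simp add: a0v)
    qed
  qed
qed

text \<open>The gradient integrals of the approximating test functions are eventually controlled by
  J. Their uniform bound passes to u almost everywhere along a subsequence, and continuity excludes
  the open set of exceptions.\<close>

lemma W0grad_sup_bound:
  fixes \<Omega> :: "(real^'n) set"
  assumes \<Omega>: "open \<Omega>" "bounded \<Omega>"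
  obtains C where "1 \<le> C"
    "\<And>s m u g J x. real CARD('n) + 1 \<le> s \<Longrightarrow> s \<le> m \<Longrightarrow> W0grad \<Omega> m u g \<Longrightarrow> continuous_on \<Omega> u \<Longrightarrow> 0 < J \<Longrightarrow>
       (LINT x|lebesgue_on \<Omega>. norm (g x) powr s) \<le> J \<Longrightarrow> x \<in> \<Omega> \<Longrightarrow> \<bar>u x\<bar> \<le> C * J powr (1 / s)"
proof -
  obtain C where C: "1 \<le> C"
    "\<And>s \<psi> J x. real CARD('n) + 1 \<le> s \<Longrightarrow> test_function \<Omega> \<psi> \<Longrightarrow> 0 < J \<Longrightarrow>
       (LINT x|lebesgue_on \<Omega>. norm (grad \<psi> x) powr s) \<le> J \<Longrightarrow> \<bar>\<psi> x\<bar> \<le> C * J powr (1 / s)"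
    by (rule test_function_sup_bound[OF \<Omega>]) blast
  show ?thesis
  proof (rule that[of "4 * C"])
    show "1 \<le> 4 * C" using C(1) by simp
    fix s m u g J x
    assume s: "real CARD('n) + 1 \<le> s" "s \<le> m" and w: "W0grad \<Omega> m u g" and c: "continuous_on \<Omega> u" and J: "0 < J"
      and I: "(LINT x|lebesgue_on \<Omega>. norm (g x) powr s) \<le> J" and x: "x \<in> \<Omega>"
    have s1: "1 \<le> s" "0 < s" "0 \<le> s" "1 \<le> m" using s by auto
    obtain \<psi> where \<psi>: "in_Lp \<Omega> m u" "in_Lp \<Omega> m g" "\<And>n. test_function \<Omega> (\<psi> n)"
      "Lp_null \<Omega> m (\<lambda>n x. \<psi> n x - u x)" "Lp_null \<Omega> m (\<lambda>n x. grad (\<psi> n) x - g x)"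
      by (rule W0gradE[OF w]) blast
    have gs: "in_Lp \<Omega> s g" by (rule in_Lp_mono[OF \<Omega> \<psi>(2) s1(3) s(2)])
    have N: "Lp_null \<Omega> s (\<lambda>n x. grad (\<psi> n) x - g x)" by (rule Lp_null_mono[OF \<Omega> \<psi>(5) s1(2) s(2)])
    obtain r where r: "strict_mono r" and ae: "AE x in lebesgue_on \<Omega>. (\<lambda>n. \<psi> (r n) x - u x) \<longlonglongrightarrow> 0"
      by (rule Lp_null_AE_subseq[OF \<Omega> \<psi>(4) s1(4)])
    \<comment> \<open>2^s is the constant for the power of a sum, and 2 J bounds the error plus the
      integral of g. The s-th root of 2^s 2 is at most 4, uniformly in s \<ge> 1.\<close>
    define J' where "J' = 2 powr s * (2 * J)"
    have "\<forall>\<^sub>F n in sequentially. (LINT x|lebesgue_on \<Omega>. norm (grad (\<psi> n) x - g x) powr s) < J"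
      using N J by (intro order_tendstoD(2)) (auto simp: Lp_null_def)
    then have ev: "\<forall>\<^sub>F n in sequentially. \<forall>x. \<bar>\<psi> n x\<bar> \<le> C * J' powr (1 / s)"
    proof eventually_elim
      case (elim n)
      have i: "in_Lp \<Omega> s (\<lambda>x. grad (\<psi> n) x - g x)" using N by (simp add: Lp_null_def)
      have pw: "norm (grad (\<psi> n) x) powr s \<le> 2 powr s * (norm (grad (\<psi> n) x - g x) powr s + norm (g x) powr s)" for x
        using norm_powr_add_le[OF s1(3), of "grad (\<psi> n) x - g x" "g x"] by simp
      have "(LINT x|lebesgue_on \<Omega>. norm (grad (\<psi> n) x) powr s)
          \<le> (LINT x|lebesgue_on \<Omega>. 2 powr s * (norm (grad (\<psi> n) x - g x) powr s + norm (g x) powr s))"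
        using i gs test_function_in_Lp(2)[OF \<Omega> s1(3) \<psi>(3)[of n]] pw
        by (intro integral_mono) (auto simp: in_Lp_def)
      also have "\<dots> = 2 powr s * ((LINT x|lebesgue_on \<Omega>. norm (grad (\<psi> n) x - g x) powr s) + (LINT x|lebesgue_on \<Omega>. norm (g x) powr s))"
        using i gs by (simp add: in_Lp_def)
      also have "\<dots> \<le> J'" unfolding J'_def using elim I by (intro mult_left_mono) auto
      finally show ?case using C(2)[OF s(1) \<psi>(3), of J'] J by (simp add: J'_def)
    qed
    have J'le: "C * J' powr (1 / s) \<le> 4 * C * J powr (1 / s)"
    proof -
      have "J' powr (1 / s) = (2 powr s) powr (1 / s) * (2 powr (1 / s) * J powr (1 / s))"
        using J by (simp add: J'_def powr_mult)
      also have "(2 powr s) powr (1 / s) = (2::real)" using s1 by (simp add: powr_powr)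
      finally have eq: "J' powr (1 / s) = 2 * (2 powr (1 / s) * J powr (1 / s))" .
      have "(2::real) powr (1 / s) \<le> 2 powr 1" using s1 by (intro powr_mono) auto
      then have "J' powr (1 / s) \<le> 2 * (2 * J powr (1 / s))"
        unfolding eq by (intro mult_left_mono mult_right_mono) auto
      then have "C * J' powr (1 / s) \<le> C * (2 * (2 * J powr (1 / s)))" using C(1) by (intro mult_left_mono) auto
      then show ?thesis by simp
    qed
    have bd: "AE x in lebesgue_on \<Omega>. \<bar>u x\<bar> \<le> C * J' powr (1 / s)"
      using ae
    proof eventually_elim
      case (elim x)
      then have "(\<lambda>n. \<psi> (r n) x) \<longlonglongrightarrow> u x" by (simp add: LIM_zero_iff)
      then have "(\<lambda>n. \<bar>\<psi> (r n) x\<bar>) \<longlonglongrightarrow> \<bar>u x\<bar>" by (intro tendsto_intros)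
      moreover have "\<forall>\<^sub>F n in sequentially. \<bar>\<psi> (r n) x\<bar> \<le> C * J' powr (1 / s)"
        using eventually_subseq[OF r ev] by eventually_elim blast
      ultimately show ?case by (intro tendsto_upperbound) auto
    qed
    show "\<bar>u x\<bar> \<le> 4 * C * J powr (1 / s)"
    proof (rule ccontr)
      assume n: "\<not> ?thesis"
      define V where "V = {y \<in> \<Omega>. 4 * C * J powr (1 / s) < \<bar>u y\<bar>}"
      have "V = \<Omega> \<inter> (\<lambda>y. \<bar>u y\<bar>) -` {4 * C * J powr (1 / s)<..}" by (auto simp: V_def)
      then have "open V" using continuous_open_preimage[OF continuous_on_rabs[OF c] \<Omega>(1) open_greaterThan] by simp
      moreover have "x \<in> V" using n x by (simp add: V_def)
      moreover have "V \<subseteq> \<Omega>" by (auto simp: V_def)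
      ultimately obtain y where "y \<in> V" "\<bar>u y\<bar> \<le> C * J' powr (1 / s)"
        using AE_open_witness[OF \<Omega>(1) bd] by (metis empty_iff)
      then show False using J'le by (simp add: V_def)
    qed
  qed
qed

section \<open>The inradius\<close>

text \<open>Differentiation under the integral sign is carried out for gauge integrals over a box,
  while weak gradients are tested with Lebesgue integrals over \<Omega>. This connects the
  two.\<close>

lemma integral_cbox_eq_lebesgue_on:
  fixes f :: "real^'n \<Rightarrow> real"
  assumes \<Omega>: "open \<Omega>" "\<Omega> \<subseteq> cbox a b" and f: "continuous_on UNIV f" "\<And>x. x \<notin> \<Omega> \<Longrightarrow> f x = 0"
  shows "integral (cbox a b) f = (LINT x|lebesgue_on \<Omega>. f x)"
proof -
  have m: "f \<in> borel_measurable lborel" using borel_measurable_continuous_onI[OF f(1)] by simp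
  have "set_integrable lborel (cbox a b) f" unfolding set_integrable_def
    by (rule borel_integrable_compact[OF compact_cbox continuous_on_subset[OF f(1) subset_UNIV]])
  from set_borel_integral_eq_integral(2)[OF this]
  have "integral (cbox a b) f = (LINT x|lborel. indicator (cbox a b) x *\<^sub>R f x)"
    by (simp add: set_lebesgue_integral_def)
  also have "\<dots> = (LINT x|lborel. f x)"
    using \<Omega>(2) f(2) by (intro Bochner_Integration.integral_cong) (auto simp: indicator_def)
  also have "\<dots> = (LINT x|lebesgue. f x)" by (rule integral_completion[OF m, symmetric])
  also have "\<dots> = (LINT x|lebesgue. indicator \<Omega> x *\<^sub>R f x)"
    using f(2) by (intro Bochner_Integration.integral_cong) (auto simp: indicator_def)
  finally show ?thesis using \<Omega>(1) by (simp add: integral_lebesgue_on open_sets_lebesgue)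
qed

lemma weak_grad_AE_le_Linf_norm:
  assumes "in_Linf \<Omega> g"
  shows "AE x in lebesgue_on \<Omega>. norm (g x) \<le> Linf_norm \<Omega> g"
proof -
  let ?E = "esssup (lebesgue_on \<Omega>) (\<lambda>x. ereal (norm (g x)))"
  have fin: "?E < \<infinity>" using assms by (simp add: in_Linf_def)
  have "AE x in lebesgue_on \<Omega>. ereal (norm (g x)) \<le> ?E" by (rule esssup_AE)
  then show ?thesis
  proof eventually_elim
    case (elim x)
    then have "?E = ereal (real_of_ereal ?E)" using fin by (cases ?E) auto
    then show ?case using elim unfolding Linf_norm_def by (metis ereal_less_eq(3))
  qed
qed

text \<open>An unnormalized mollifier of radius \<epsilon> centred at c; the squared distance makes
  it smooth at the centre.\<close>

definition ball_bump :: "real \<Rightarrow> real^'n \<Rightarrow> real^'n \<Rightarrow> real" where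
  "ball_bump \<epsilon> c z = bump (\<epsilon>\<^sup>2 - (z - c) \<bullet> (z - c))"

lemma ball_bump_test_function:
  assumes "0 < \<epsilon>" "cball c \<epsilon> \<subseteq> \<Omega>"
  shows "test_function \<Omega> (ball_bump \<epsilon> c)"
proof (rule test_functionI[OF _ _ compact_cball assms(2)])
  show "Cinf_on UNIV (ball_bump \<epsilon> c)" unfolding ball_bump_def[abs_def] by (intro Cinf_intros)
  show "ball_bump \<epsilon> c z = 0" if "z \<notin> cball c \<epsilon>" for z
  proof -
    have "\<epsilon>\<^sup>2 \<le> (norm (z - c))\<^sup>2"
      using that assms by (intro power_mono) (auto simp: dist_norm norm_minus_commute)
    then show ?thesis by (simp add: ball_bump_def bump_0 dot_square_norm)
  qed
qed

lemma ball_bump_GDERIV: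
  "GDERIV (ball_bump \<epsilon> c) z :> (- 2 * bump' (\<epsilon>\<^sup>2 - (z - c) \<bullet> (z - c))) *\<^sub>R (z - c)"
proof -
  have "((\<lambda>z. \<epsilon>\<^sup>2 - (z - c) \<bullet> (z - c)) has_derivative (\<lambda>h. - (2 * (h \<bullet> (z - c))))) (at z)"
    by (auto intro!: derivative_eq_intros simp: inner_commute)
  then have "GDERIV (\<lambda>z. \<epsilon>\<^sup>2 - (z - c) \<bullet> (z - c)) z :> (- 2) *\<^sub>R (z - c)" by (simp add: gderiv_def)
  from GDERIV_DERIV_compose[OF this bump_deriv] show ?thesis
    by (simp add: ball_bump_def[abs_def] mult.commute)
qed

text \<open>The means of \<open>w\<close> against a bump moving along the segment have derivative at most
  \<open>L * norm d\<close>, by the definition of the weak gradient.\<close>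

lemma weak_gradient_bound_segment:
  fixes \<Omega> :: "(real^'n) set"
  assumes \<Omega>: "open \<Omega>" "bounded \<Omega>" and wg: "is_weak_grad \<Omega> w g"
    and L: "AE x in lebesgue_on \<Omega>. norm (g x) \<le> L" and cw: "continuous_on (closure \<Omega>) w"
    and ball: "ball x (norm d) \<subseteq> \<Omega>" and \<tau>: "0 < \<tau>" "\<tau> < 1" and d: "d \<noteq> 0"
  shows "\<bar>w (x + \<tau> *\<^sub>R d) - w x\<bar> \<le> L * norm d"
proof -
  \<comment> \<open>Differentiation under the integral requires an integrand that is continuous on a
    whole box containing \<Omega>, hence the Tietze extension.\<close>
  obtain W where W: "continuous_on UNIV W" "\<And>z. z \<in> closure \<Omega> \<Longrightarrow> W z = w z"
    using Tietze_unbounded[of "closure \<Omega>" w UNIV] cw by (metis closed_closedin closed_closure subtopology_UNIV)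
  obtain a0 b0 where cb: "\<Omega> \<subseteq> cbox a0 b0" using bounded_subset_cbox_symmetric[OF \<Omega>(2)] by metis
  have xin: "x \<in> \<Omega>" using ball d by (metis centre_in_ball subsetD zero_less_norm_iff)
  have L0: "0 \<le> L"
    using AE_open_witness[OF \<Omega>(1) L \<Omega>(1)] xin by (metis empty_iff norm_ge_zero order_refl order_trans)
  have tin: "x + t *\<^sub>R d \<in> \<Omega>" if "0 \<le> t" "t \<le> \<tau>" for t
  proof -
    have "\<bar>t\<bar> * norm d < 1 * norm d" using that \<tau> d by (intro mult_strict_right_mono) auto
    then show ?thesis using ball by (intro subsetD[OF ball]) (simp add: dist_norm)
  qed
  have approx: "\<bar>w (x + \<tau> *\<^sub>R d) - w x\<bar> \<le> L * norm d + 2 * \<eta>" if \<eta>: "0 < \<eta>" for \<eta>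
  proof -
    have "\<exists>\<epsilon>>0. \<forall>z. dist z y < \<epsilon> \<longrightarrow> \<bar>W z - W y\<bar> < \<eta>" for y
      using W(1) \<eta> unfolding continuous_on_iff by (auto simp: dist_real_def)
    then obtain e1 e2 where e1: "0 < e1" "\<And>z. dist z x < e1 \<Longrightarrow> \<bar>W z - W x\<bar> < \<eta>"
      and e2: "0 < e2" "\<And>z. dist z (x + \<tau> *\<^sub>R d) < e2 \<Longrightarrow> \<bar>W z - W (x + \<tau> *\<^sub>R d)\<bar> < \<eta>" by metis
    \<comment> \<open>The first two terms control the oscillation of w near the two endpoints. The
      third, positive since \<tau> < 1, keeps every bump centred on the segment inside the ball
      contained in \<Omega>.\<close>
    define \<epsilon> where "\<epsilon> = min (min (e1 / 2) (e2 / 2)) ((1 - \<tau>) * norm d / 2)"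
    have \<epsilon>: "0 < \<epsilon>" "\<epsilon> < e1" "\<epsilon> < e2" "\<epsilon> < (1 - \<tau>) * norm d"
      using e1 e2 \<tau> d by (auto simp: \<epsilon>_def min_less_iff_disj)
    define c where "c t = x + t *\<^sub>R d" for t
    have sub: "cball (c t) \<epsilon> \<subseteq> \<Omega>" if t: "0 \<le> t" "t \<le> \<tau>" for t
    proof (rule order_trans[OF _ ball], rule subsetI)
      fix z assume "z \<in> cball (c t) \<epsilon>"
      then have "norm (z - c t) \<le> \<epsilon>" by (simp add: dist_norm norm_minus_commute)
      moreover have "norm (z - x) \<le> norm (z - c t) + norm (t *\<^sub>R d)"
        using norm_triangle_ineq[of "z - c t" "t *\<^sub>R d"] by (simp add: c_def)
      moreover have "norm (t *\<^sub>R d) \<le> \<tau> * norm d" using t by (simp add: mult_right_mono)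
      ultimately have "norm (z - x) < norm d" using \<epsilon>(4) by (simp add: left_diff_distrib)
      then show "z \<in> ball x (norm d)" by (simp add: dist_norm norm_minus_commute)
    qed
    have T: "test_function \<Omega> (ball_bump \<epsilon> (c t))" if "0 \<le> t" "t \<le> \<tau>" for t
      by (rule ball_bump_test_function[OF \<epsilon>(1) sub[OF that]])
    define A where "A t = integral (cbox a0 b0) (\<lambda>z. W z * ball_bump \<epsilon> (c t) z)" for t
    define P where "P t z = bump' (\<epsilon>\<^sup>2 - (z - c t) \<bullet> (z - c t)) * (2 * ((z - c t) \<bullet> d))" for t z
    have cbb: "continuous_on S (ball_bump \<epsilon> y)" for S y
      unfolding ball_bump_def[abs_def]
      by (intro continuous_intros continuous_on_compose2[OF continuous_on_bump[of UNIV]]) auto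
    have dA: "(A has_real_derivative integral (cbox a0 b0) (\<lambda>z. W z * P t z)) (at t)" for t
      unfolding A_def
    proof (rule leibniz_rule_field_derivative[where U = UNIV, simplified])
      show "((\<lambda>t. W z * ball_bump \<epsilon> (c t) z) has_real_derivative W z * P t z) (at t)" for t z
      proof -
        have "((\<lambda>t. \<epsilon>\<^sup>2 - (z - c t) \<bullet> (z - c t)) has_derivative (\<lambda>r. r * (2 * ((z - c t) \<bullet> d)))) (at t)"
          unfolding c_def by (auto intro!: derivative_eq_intros simp: inner_commute algebra_simps)
        then have "((\<lambda>t. \<epsilon>\<^sup>2 - (z - c t) \<bullet> (z - c t)) has_real_derivative 2 * ((z - c t) \<bullet> d)) (at t)"
          by (simp add: has_field_derivative_def mult_commute_abs)
        from DERIV_cmult[OF DERIV_chain2[OF bump_deriv this]] show ?thesis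
          by (simp add: ball_bump_def P_def)
      qed
      show "(\<lambda>z. W z * ball_bump \<epsilon> (c t) z) integrable_on cbox a0 b0" for t
        by (intro integrable_continuous continuous_intros continuous_on_subset[OF W(1)] cbb) auto
      show "continuous_on (UNIV \<times> cbox a0 b0) (\<lambda>(t, z). W z * P t z)"
        unfolding split_beta P_def c_def
        by (intro continuous_intros continuous_on_compose2[OF W(1)] continuous_on_compose2[OF continuous_on_bump'[of UNIV]]) auto
    qed
    define m where "m = (LINT z|lborel. ball_bump \<epsilon> (0 :: real^'n) z)"
    have mt: "(LINT z|lebesgue_on \<Omega>. ball_bump \<epsilon> (c t) z) = m" if t: "0 \<le> t" "t \<le> \<tau>" for t
    proof -
      have "(LINT z|lebesgue_on \<Omega>. ball_bump \<epsilon> (c t) z) = (LINT z|lebesgue. indicator \<Omega> z *\<^sub>R ball_bump \<epsilon> (c t) z)"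
        using \<Omega>(1) by (simp add: integral_lebesgue_on open_sets_lebesgue)
      also have "\<dots> = (LINT z|lebesgue. ball_bump \<epsilon> (c t) z)"
        using test_function_eq_0(1)[OF T[OF t]] by (intro Bochner_Integration.integral_cong) (auto simp: indicator_def)
      also have "\<dots> = (LINT z|lborel. ball_bump \<epsilon> (c t) z)"
        using borel_measurable_continuous_onI[OF cbb] by (intro integral_completion) simp
      also have "\<dots> = (LINT z|lborel. ball_bump \<epsilon> (c t) (c t + z))"
        by (rule integral_translation[symmetric]) (rule borel_measurable_continuous_onI[OF cbb])
      finally show ?thesis by (simp add: m_def ball_bump_def)
    qed
    have ib: "integrable (lebesgue_on \<Omega>) (ball_bump \<epsilon> (c t))" if t: "0 \<le> t" "t \<le> \<tau>" for t
      using in_Lp_imp_integrable[OF \<Omega> test_function_in_Lp(1)[OF \<Omega> _ T[OF t], of 1]] by simp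
    have b0: "0 \<le> ball_bump \<epsilon> y z" for y z by (simp add: ball_bump_def bump_nonneg)
    have m0: "0 < m"
    proof -
      have "0 < (LINT z|lebesgue_on \<Omega>. ball_bump \<epsilon> (c 0) z)"
      proof (rule integral_pos_open[OF \<Omega>(1) ib _ open_ball])
        show "ball (c 0) \<epsilon> \<noteq> {}" using \<epsilon> by simp
        show "ball (c 0) \<epsilon> \<subseteq> \<Omega>" using sub[of 0] \<tau> by (auto simp: subset_iff)
        show "0 < ball_bump \<epsilon> (c 0) z" if "z \<in> ball (c 0) \<epsilon>" for z
        proof -
          have "(norm (z - c 0))\<^sup>2 < \<epsilon>\<^sup>2"
            using that by (intro power_strict_mono) (auto simp: dist_norm norm_minus_commute)
          then show ?thesis by (simp add: ball_bump_def dot_square_norm bump_pos)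
        qed
      qed (use \<tau> b0 in auto)
      then show ?thesis using mt[of 0] \<tau> by simp
    qed
    have Alim: "\<bar>A t - W (c t) * m\<bar> \<le> \<eta> * m" if t: "0 \<le> t" "t \<le> \<tau>" and near: "\<And>z. dist z (c t) \<le> \<epsilon> \<Longrightarrow> \<bar>W z - W (c t)\<bar> \<le> \<eta>" for t
    proof -
      have "integrable (lebesgue_on \<Omega>) (\<lambda>z. W z * ball_bump \<epsilon> (c t) z)"
        by (rule integrable_mult_test(1)[OF \<Omega>(1) continuous_imp_locally_integrable[OF continuous_on_subset[OF W(1) subset_UNIV]] T[OF t]])
      note iW = this
      have "A t = (LINT z|lebesgue_on \<Omega>. W z * ball_bump \<epsilon> (c t) z)"
        unfolding A_def using test_function_eq_0(1)[OF T[OF t]]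
        by (intro integral_cbox_eq_lebesgue_on[OF \<Omega>(1) cb] continuous_intros W(1) cbb) auto
      then have "A t - W (c t) * m = (LINT z|lebesgue_on \<Omega>. W z * ball_bump \<epsilon> (c t) z - W (c t) * ball_bump \<epsilon> (c t) z)"
        using iW ib[OF t] mt[OF t] by simp
      also have "\<bar>\<dots>\<bar> \<le> (LINT z|lebesgue_on \<Omega>. \<bar>W z * ball_bump \<epsilon> (c t) z - W (c t) * ball_bump \<epsilon> (c t) z\<bar>)"
        by (rule integral_abs_bound)
      also have "\<dots> \<le> (LINT z|lebesgue_on \<Omega>. \<eta> * ball_bump \<epsilon> (c t) z)"
      proof (rule integral_mono)
        fix z
        have "\<bar>W z * ball_bump \<epsilon> (c t) z - W (c t) * ball_bump \<epsilon> (c t) z\<bar> = \<bar>W z - W (c t)\<bar> * ball_bump \<epsilon> (c t) z"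
          using b0[of "c t" z] by (simp add: abs_mult flip: left_diff_distrib)
        also have "\<dots> \<le> \<eta> * ball_bump \<epsilon> (c t) z"
        proof (cases "dist z (c t) \<le> \<epsilon>")
          case True
          then show ?thesis by (intro mult_right_mono near b0)
        next
          case False
          then have "ball_bump \<epsilon> (c t) z = 0"
            using test_function_eq_0(1)[OF ball_bump_test_function[OF \<epsilon>(1) order_refl]] by (simp add: dist_commute)
          then show ?thesis by simp
        qed
        finally show "\<bar>W z * ball_bump \<epsilon> (c t) z - W (c t) * ball_bump \<epsilon> (c t) z\<bar> \<le> \<eta> * ball_bump \<epsilon> (c t) z" .
      qed (use iW ib[OF t] in auto)
      finally show ?thesis using mt[OF t] by simp
    qed
    have dbound: "\<bar>integral (cbox a0 b0) (\<lambda>z. W z * P t z)\<bar> \<le> L * norm d * m" if t: "0 \<le> t" "t \<le> \<tau>" for t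
    proof -
      \<comment> \<open>Differentiating the moving bump in t amounts to minus the directional
        derivative along d in the space variable. It is this derivative that the definition of the
        weak gradient moves onto w.\<close>
      have PT: "P t z = - (\<Sum>i\<in>UNIV. d $ i * partial_deriv i (ball_bump \<epsilon> (c t)) z)" for z
      proof -
        define bb where "bb = bump' (\<epsilon>\<^sup>2 - (z - c t) \<bullet> (z - c t))"
        have pd: "partial_deriv i (ball_bump \<epsilon> (c t)) z = (- 2 * bb) * (z - c t) $ i" for i
          using partial_deriv_GDERIV[OF ball_bump_GDERIV] by (simp add: bb_def)
        have ip: "(z - c t) \<bullet> d = (\<Sum>i\<in>UNIV. (z - c t) $ i * d $ i)" by (simp only: inner_vec_def inner_real_def)
        show ?thesis
          unfolding pd P_def bb_def[symmetric] ip sum_distrib_left sum_negf[symmetric]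
          by (intro sum.cong refl) (simp add: mult_ac)
      qed
      have P0: "P t z = 0" if "z \<notin> \<Omega>" for z
        using test_function_eq_0(2)[OF T[OF t] that] by (simp add: PT flip: grad_nth)
      have cP: "continuous_on UNIV (P t)"
        unfolding PT[abs_def] by (intro continuous_intros Cinf_continuous_on_partial test_function_Cinf[OF T[OF t]])
      have lw: "locally_integrable \<Omega> w" and lg: "locally_integrable \<Omega> g" using wg by (auto simp: is_weak_grad_def)
      have "integral (cbox a0 b0) (\<lambda>z. W z * P t z) = (LINT z|lebesgue_on \<Omega>. W z * P t z)"
        by (intro integral_cbox_eq_lebesgue_on[OF \<Omega>(1) cb] continuous_intros W(1) cP) (simp add: P0)
      also have "\<dots> = (LINT z|lebesgue_on \<Omega>. - (\<Sum>i\<in>UNIV. d $ i * (w z * partial_deriv i (ball_bump \<epsilon> (c t)) z)))"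
        using W(2) closure_subset[of \<Omega>]
        by (intro Bochner_Integration.integral_cong) (auto simp: PT space_restrict_space sum_distrib_left mult_ac)
      also have "\<dots> = - (\<Sum>i\<in>UNIV. d $ i * (LINT z|lebesgue_on \<Omega>. w z * partial_deriv i (ball_bump \<epsilon> (c t)) z))"
        using integrable_mult_test(2)[OF \<Omega>(1) lw T[OF t]] by (simp add: Bochner_Integration.integral_sum)
      also have "\<dots> = (\<Sum>i\<in>UNIV. d $ i * (LINT z|lebesgue_on \<Omega>. g z $ i * ball_bump \<epsilon> (c t) z))"
        using wg T[OF t] by (simp add: is_weak_grad_def sum_negf)
      also have "\<dots> = (LINT z|lebesgue_on \<Omega>. (\<Sum>i\<in>UNIV. d $ i * (g z $ i * ball_bump \<epsilon> (c t) z)))"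
        using integrable_mult_test(1)[OF \<Omega>(1) locally_integrable_nth[OF lg] T[OF t]]
        by (simp add: Bochner_Integration.integral_sum)
      also have "\<bar>\<dots>\<bar> \<le> (LINT z|lebesgue_on \<Omega>. \<bar>\<Sum>i\<in>UNIV. d $ i * (g z $ i * ball_bump \<epsilon> (c t) z)\<bar>)"
        by (rule integral_abs_bound)
      also have "\<dots> \<le> (LINT z|lebesgue_on \<Omega>. L * norm d * ball_bump \<epsilon> (c t) z)"
      proof (rule integral_mono_AE)
        show "integrable (lebesgue_on \<Omega>) (\<lambda>z. \<bar>\<Sum>i\<in>UNIV. d $ i * (g z $ i * ball_bump \<epsilon> (c t) z)\<bar>)"
          using integrable_mult_test(1)[OF \<Omega>(1) locally_integrable_nth[OF lg] T[OF t]]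
          by (intro integrable_abs Bochner_Integration.integrable_sum integrable_mult_right)
        show "AE z in lebesgue_on \<Omega>. \<bar>\<Sum>i\<in>UNIV. d $ i * (g z $ i * ball_bump \<epsilon> (c t) z)\<bar> \<le> L * norm d * ball_bump \<epsilon> (c t) z"
          using L
        proof eventually_elim
          case (elim z)
          have "(\<Sum>i\<in>UNIV. d $ i * (g z $ i * ball_bump \<epsilon> (c t) z)) = (d \<bullet> g z) * ball_bump \<epsilon> (c t) z"
            by (simp add: inner_vec_def sum_distrib_right mult.assoc)
          also have "\<bar>\<dots>\<bar> \<le> (norm d * norm (g z)) * ball_bump \<epsilon> (c t) z"
            unfolding abs_mult using b0[of "c t" z] Cauchy_Schwarz_ineq2[of d "g z"] by (intro mult_mono) auto
          also have "\<dots> \<le> (norm d * L) * ball_bump \<epsilon> (c t) z"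
            using elim b0[of "c t" z] by (intro mult_right_mono mult_left_mono) auto
          finally show ?case by (simp add: mult_ac)
        qed
      qed (use ib[OF t] in simp)
      finally show ?thesis using mt[OF t] by simp
    qed
    have "norm (A \<tau> - A 0) \<le> L * norm d * m * norm (\<tau> - 0)"
    proof (rule field_differentiable_bound[where S = "{0..\<tau>}"])
      show "(A has_real_derivative integral (cbox a0 b0) (\<lambda>z. W z * P t z)) (at t within {0..\<tau>})" for t
        using dA by (rule has_field_derivative_at_within)
    qed (use dbound \<tau> in auto)
    also have "\<dots> \<le> L * norm d * m"
      using L0 m0 \<tau> by (intro mult_left_le) auto
    finally have A1: "\<bar>A \<tau> - A 0\<bar> \<le> L * norm d * m" by simp
    have A2: "\<bar>A 0 - W (c 0) * m\<bar> \<le> \<eta> * m"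
      using e1(2) \<epsilon>(2) \<tau> by (intro Alim) (auto simp: c_def intro!: less_imp_le)
    have A3: "\<bar>A \<tau> - W (c \<tau>) * m\<bar> \<le> \<eta> * m"
      using e2(2) \<epsilon>(3) \<tau> by (intro Alim) (auto simp: c_def intro!: less_imp_le)
    have "\<bar>(W (c \<tau>) - W (c 0)) * m\<bar> \<le> (L * norm d + 2 * \<eta>) * m"
      using A1 A2 A3 unfolding left_diff_distrib distrib_right by linarith
    then have "\<bar>W (c \<tau>) - W (c 0)\<bar> \<le> L * norm d + 2 * \<eta>" using m0 by (simp add: abs_mult)
    moreover have "W (c \<tau>) = w (x + \<tau> *\<^sub>R d)" "W (c 0) = w x"
      using W(2) tin[of \<tau>] xin \<tau> closure_subset[of \<Omega>] by (auto simp: c_def)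
    ultimately show ?thesis by simp
  qed
  show ?thesis
  proof (rule field_le_epsilon)
    fix e :: real assume "0 < e"
    then show "\<bar>w (x + \<tau> *\<^sub>R d) - w x\<bar> \<le> L * norm d + e" using approx[of "e / 2"] by simp
  qed
qed

text \<open>A gradient bound controls differences only along segments inside \<Omega>. The segment
  from x to y stays in the ball up to its endpoint, so the estimate holds for t < 1 and extends to
  the boundary value 0 by continuity.\<close>

lemma weak_gradient_bound_frontier:
  fixes \<Omega> :: "(real^'n) set"
  assumes \<Omega>: "open \<Omega>" "bounded \<Omega>" and w: "w \<in> W1inf \<Omega>" "w \<in> C0_closure \<Omega>"
    and x: "x \<in> \<Omega>" and y: "y \<in> frontier \<Omega>" "ball x (dist x y) \<subseteq> \<Omega>"
  shows "\<bar>w x\<bar> \<le> Linf_norm \<Omega> (weak_grad \<Omega> w) * dist x y"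
proof -
  define d where "d = y - x"
  have dn: "norm d = dist x y" by (simp add: d_def dist_norm norm_minus_commute)
  have "y \<notin> \<Omega>" using y(1) \<Omega>(1) by (simp add: frontier_def interior_open)
  then have d0: "d \<noteq> 0" using x by (auto simp: d_def)
  have wg: "is_weak_grad \<Omega> w (weak_grad \<Omega> w)"
    using w(1) someI_ex[of "is_weak_grad \<Omega> w"] unfolding W1inf_def weak_grad_def by auto
  have L: "AE x in lebesgue_on \<Omega>. norm (weak_grad \<Omega> w x) \<le> Linf_norm \<Omega> (weak_grad \<Omega> w)"
    using w(1) by (intro weak_grad_AE_le_Linf_norm) (simp add: W1inf_def)
  have cw: "continuous_on (closure \<Omega>) w" and wy: "w y = 0" using w(2) y(1) by (auto simp: C0_closure_def)
  have seg: "x + t *\<^sub>R d \<in> closure \<Omega>" if "0 < t" "t < 1" for t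
  proof -
    have "\<bar>t\<bar> * norm d < 1 * norm d" using that d0 by (intro mult_strict_right_mono) auto
    then have "x + t *\<^sub>R d \<in> ball x (dist x y)" by (simp add: dist_norm dn[unfolded dist_norm])
    then show ?thesis using y(2) closure_subset[of \<Omega>] by blast
  qed
  have ev: "\<forall>\<^sub>F t in at_left (1::real). 0 < t \<and> t < 1"
    by (auto simp: eventually_at_left_field intro!: exI[of _ 0])
  have "((\<lambda>t. x + t *\<^sub>R d) \<longlongrightarrow> x + 1 *\<^sub>R d) (at_left 1)" by (intro tendsto_intros)
  then have "((\<lambda>t. w (x + t *\<^sub>R d)) \<longlongrightarrow> w y) (at_left 1)"
  proof (intro continuous_on_tendsto_compose[OF cw])
    show "y \<in> closure \<Omega>" using y(1) by (simp add: frontier_def)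
    show "\<forall>\<^sub>F t in at_left 1. x + t *\<^sub>R d \<in> closure \<Omega>" using ev by eventually_elim (use seg in auto)
  qed (simp add: d_def)
  then have "((\<lambda>t. \<bar>w (x + t *\<^sub>R d) - w x\<bar>) \<longlongrightarrow> \<bar>w y - w x\<bar>) (at_left 1)" by (intro tendsto_intros)
  moreover have "\<forall>\<^sub>F t in at_left 1. \<bar>w (x + t *\<^sub>R d) - w x\<bar> \<le> Linf_norm \<Omega> (weak_grad \<Omega> w) * norm d"
    using ev
  proof eventually_elim
    case (elim t)
    then show ?case using weak_gradient_bound_segment[OF \<Omega> wg L cw _ _ _ d0, of x t] y(2) by (simp add: dn)
  qed
  ultimately have "\<bar>w y - w x\<bar> \<le> Linf_norm \<Omega> (weak_grad \<Omega> w) * norm d" by (intro tendsto_upperbound) auto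
  then show ?thesis by (simp add: wy dn)
qed

section \<open>Smooth cones and the inradius\<close>

lemma smooth_real_on_powr: "smooth_real_on {0<..} (\<lambda>t. t powr a)"
proof -
  define D where "D k t = (\<Prod>j<k. a - real j) * t powr (a - real k)" for k and t :: real
  show ?thesis unfolding smooth_real_on_def
  proof (intro exI[of _ D] conjI allI ballI)
    show "D 0 = (\<lambda>t. t powr a)" by (simp add: D_def fun_eq_iff)
    fix k t assume "t \<in> {0::real<..}"
    then show "(D k has_real_derivative D (Suc k) t) (at t)"
      unfolding D_def by (auto intro!: derivative_eq_intros simp: algebra_simps)
  qed
qed

text \<open>A smooth approximation from below of the cone \<open>\<lambda>x. \<rho> - dist x0 x\<close> with slope at most one.\<close>

definition smooth_cone :: "real \<Rightarrow> real \<Rightarrow> real^'n \<Rightarrow> real^'n \<Rightarrow> real" where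
  "smooth_cone \<epsilon> \<rho> x0 x = \<epsilon> * ramp ((\<rho> - sqrt (\<epsilon>\<^sup>2 + (x - x0) \<bullet> (x - x0))) / \<epsilon>)"

lemma smooth_cone_properties:
  fixes x0 :: "real^'n"
  assumes \<epsilon>: "0 < \<epsilon>" and sub: "cball x0 \<rho> \<subseteq> \<Omega>"
  shows "test_function \<Omega> (smooth_cone \<epsilon> \<rho> x0)"
    and "norm (grad (smooth_cone \<epsilon> \<rho> x0) x) \<le> 1"
    and "\<rho> - 2 * \<epsilon> \<le> smooth_cone \<epsilon> \<rho> x0 x0"
    and "0 \<le> smooth_cone \<epsilon> \<rho> x0 x" and "smooth_cone \<epsilon> \<rho> x0 x \<le> smooth_cone \<epsilon> \<rho> x0 x0"
proof -
  define \<sigma> where "\<sigma> x = sqrt (\<epsilon>\<^sup>2 + (x - x0) \<bullet> (x - x0))" for x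
  have pos: "0 < \<epsilon>\<^sup>2 + (x - x0) \<bullet> (x - x0)" for x using \<epsilon> by (simp add: add_pos_nonneg)
  have eq: "smooth_cone \<epsilon> \<rho> x0 = (\<lambda>x. (\<rho> - \<sigma> x) * bump ((\<rho> - \<sigma> x) * (1 / \<epsilon>)))"
    using \<epsilon> by (simp add: smooth_cone_def[abs_def] ramp_def \<sigma>_def)
  have "Cinf_on UNIV (\<lambda>x. (\<epsilon>\<^sup>2 + (x - x0) \<bullet> (x - x0)) powr (1 / 2))"
    by (rule Cinf_on_compose[OF open_UNIV _ smooth_real_on_powr]) (use pos in \<open>auto intro!: Cinf_intros\<close>)
  then have C\<sigma>: "Cinf_on UNIV \<sigma>" using pos by (simp add: \<sigma>_def[abs_def] powr_half_sqrt less_imp_le)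
  have C: "Cinf_on UNIV (smooth_cone \<epsilon> \<rho> x0)" unfolding eq by (intro Cinf_intros C\<sigma>)
  show "test_function \<Omega> (smooth_cone \<epsilon> \<rho> x0)"
  proof (rule test_functionI[OF C _ compact_cball sub])
    fix x assume "x \<notin> cball x0 \<rho>"
    then have "\<rho> \<le> norm (x - x0)" by (simp add: dist_norm norm_minus_commute)
    also have "\<dots> \<le> \<sigma> x" unfolding \<sigma>_def by (rule real_le_rsqrt) (simp add: dot_square_norm)
    finally have "(\<rho> - \<sigma> x) / \<epsilon> \<le> 0" using \<epsilon> by (simp add: divide_nonpos_pos)
    then show "smooth_cone \<epsilon> \<rho> x0 x = 0" by (simp add: smooth_cone_def \<sigma>_def ramp_0)
  qed
  have \<sigma>0: "\<sigma> x0 = \<epsilon>" using \<epsilon> by (simp add: \<sigma>_def)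
  \<comment> \<open>The height is lowered by 2 \<epsilon>: once because the smoothed distance equals
    \<epsilon> at the centre, once because \<open>ramp t\<close> may fall short of t by 1 before
    scaling by \<epsilon>.\<close>
  have "\<epsilon> * ((\<rho> - \<epsilon>) / \<epsilon> - 1) \<le> \<epsilon> * ramp ((\<rho> - \<epsilon>) / \<epsilon>)"
    using \<epsilon> by (intro mult_left_mono ramp_ge) auto
  moreover have "\<epsilon> * ((\<rho> - \<epsilon>) / \<epsilon> - 1) = \<rho> - 2 * \<epsilon>" using \<epsilon> by (simp add: field_simps)
  ultimately show "\<rho> - 2 * \<epsilon> \<le> smooth_cone \<epsilon> \<rho> x0 x0"
    using \<epsilon> by (simp add: smooth_cone_def)
  show "0 \<le> smooth_cone \<epsilon> \<rho> x0 x" using \<epsilon> by (simp add: smooth_cone_def ramp_nonneg)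
  have "\<sigma> x0 \<le> \<sigma> x" unfolding \<sigma>_def by (intro real_sqrt_le_mono) simp
  then show "smooth_cone \<epsilon> \<rho> x0 x \<le> smooth_cone \<epsilon> \<rho> x0 x0"
    unfolding smooth_cone_def using \<epsilon>
    by (intro mult_left_mono ramp_mono divide_right_mono diff_left_mono) (simp_all only: \<sigma>_def less_imp_le)
  have "((\<lambda>x. \<epsilon>\<^sup>2 + (x - x0) \<bullet> (x - x0)) has_derivative (\<lambda>h. 2 * (h \<bullet> (x - x0)))) (at x)"
    by (auto intro!: derivative_eq_intros simp: inner_commute)
  then have d1: "GDERIV (\<lambda>x. \<epsilon>\<^sup>2 + (x - x0) \<bullet> (x - x0)) x :> 2 *\<^sub>R (x - x0)" by (simp add: gderiv_def)
  have d2: "((\<lambda>s. \<epsilon> * ramp ((\<rho> - sqrt s) / \<epsilon>)) has_real_derivative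
      - (ramp' ((\<rho> - \<sigma> x) / \<epsilon>) * (inverse (\<sigma> x) / 2))) (at (\<epsilon>\<^sup>2 + (x - x0) \<bullet> (x - x0)))"
    using \<epsilon> pos[of x]
    by (auto intro!: derivative_eq_intros DERIV_chain2[OF ramp_deriv] simp: \<sigma>_def)
  have "GDERIV (smooth_cone \<epsilon> \<rho> x0) x :> - (ramp' ((\<rho> - \<sigma> x) / \<epsilon>) * (inverse (\<sigma> x) / 2)) *\<^sub>R (2 *\<^sub>R (x - x0))"
    using GDERIV_DERIV_compose[OF d1 d2] by (simp add: smooth_cone_def[abs_def])
  then have g: "grad (smooth_cone \<epsilon> \<rho> x0) x = - (ramp' ((\<rho> - \<sigma> x) / \<epsilon>) * (inverse (\<sigma> x) / 2)) *\<^sub>R (2 *\<^sub>R (x - x0))"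
    by (rule grad_eqI)
  have \<sigma>p: "0 < \<sigma> x" using pos by (simp add: \<sigma>_def)
  have "norm (x - x0) \<le> \<sigma> x" unfolding \<sigma>_def by (rule real_le_rsqrt) (simp add: dot_square_norm)
  then have iv: "inverse (\<sigma> x) * norm (x - x0) \<le> 1" using \<sigma>p by (simp add: field_simps)
  have "ramp' ((\<rho> - \<sigma> x) / \<epsilon>) * (inverse (\<sigma> x) * norm (x - x0)) \<le> 1"
    by (rule mult_le_one[OF ramp'_le_1 _ iv]) (use \<sigma>p in simp)
  then show "norm (grad (smooth_cone \<epsilon> \<rho> x0) x) \<le> 1"
    using \<sigma>p ramp'_nonneg[of "(\<rho> - \<sigma> x) / \<epsilon>"] by (simp add: g abs_mult)
qed

lemma test_function_W1inf:
  fixes \<Omega> :: "(real^'n) set"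
  assumes \<Omega>: "open \<Omega>" "bounded \<Omega>" and t: "test_function \<Omega> w"
  shows "w \<in> W1inf \<Omega> \<inter> C0_closure \<Omega>"
proof
  obtain C where C: "C > 0" "\<And>x. \<bar>w x\<bar> \<le> C" "\<And>x. norm (grad w x) \<le> C" "\<And>x i. \<bar>partial_deriv i w x\<bar> \<le> C"
    by (rule test_function_bounds[OF t]) blast
  have W: "W0grad \<Omega> 1 w (grad w)" by (rule W0grad_test_function[OF \<Omega> _ t]) simp
  note wg = W0grad_is_weak_grad[OF \<Omega> order_refl W]
  note ae = W0grad_imp_W01p[OF \<Omega> order_refl W]
  have m: "weak_grad \<Omega> w \<in> borel_measurable (lebesgue_on \<Omega>)"
    using ae(1) in_Lp_measurable unfolding W01p_def W1p_def by blast
  have mw: "w \<in> borel_measurable (lebesgue_on \<Omega>)" by (rule test_function_measurable(1)[OF t])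
  have "in_Linf \<Omega> w" unfolding in_Linf_def
  proof
    have "esssup (lebesgue_on \<Omega>) (\<lambda>x. ereal (norm (w x))) \<le> ereal C"
      using mw C(2) by (intro esssup_I) auto
    then show "esssup (lebesgue_on \<Omega>) (\<lambda>x. ereal (norm (w x))) < \<infinity>" by (rule order_le_less_trans) simp
  qed fact
  moreover have "in_Linf \<Omega> (weak_grad \<Omega> w)" unfolding in_Linf_def
  proof
    have "esssup (lebesgue_on \<Omega>) (\<lambda>x. ereal (norm (weak_grad \<Omega> w x))) \<le> ereal C"
    proof (rule esssup_I)
      show "AE x in lebesgue_on \<Omega>. ereal (norm (weak_grad \<Omega> w x)) \<le> ereal C"
        using ae(2) by eventually_elim (use C(3) in simp)
    qed (use m in measurable)
    then show "esssup (lebesgue_on \<Omega>) (\<lambda>x. ereal (norm (weak_grad \<Omega> w x))) < \<infinity>" by (rule order_le_less_trans) simp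
  qed fact
  ultimately show "w \<in> W1inf \<Omega>" using wg by (auto simp: W1inf_def)
  show "w \<in> C0_closure \<Omega>"
    using Cinf_continuous_on[OF test_function_Cinf[OF t]] test_function_eq_0(1)[OF t] \<Omega>(1)
    by (auto simp: C0_closure_def frontier_def interior_open)
qed

text \<open>The centre x0 maximizes the distance to the boundary. Every admissible w satisfies
  |w(x)| \<le> L dist (x, boundary) \<le> L R with L the essential bound of its gradient, so each
  quotient in the definition of \<open>Lambda_inf\<close> is at least 1 / R.\<close>

lemma inradius_Lambda_inf:
  fixes \<Omega> :: "(real^'n) set"
  assumes \<Omega>: "open \<Omega>" "bounded \<Omega>" "\<Omega> \<noteq> {}"
  obtains x0 R where "x0 \<in> \<Omega>" "0 < R" "ball x0 R \<subseteq> \<Omega>" "1 / R \<le> Lambda_inf \<Omega>"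
proof -
  define F where "F = frontier \<Omega>"
  have Fne: "F \<noteq> {}"
    using \<Omega> frontier_eq_empty[of \<Omega>] not_bounded_UNIV unfolding F_def by metis
  have Fc: "closed F" by (simp add: F_def)
  have cc: "compact (closure \<Omega>)" using \<Omega>(2) by (simp add: compact_closure)
  have cne: "closure \<Omega> \<noteq> {}" using \<Omega>(3) by simp
  obtain x0 where x0: "x0 \<in> closure \<Omega>" "\<And>x. x \<in> closure \<Omega> \<Longrightarrow> infdist x F \<le> infdist x0 F"
    using continuous_attains_sup[OF cc cne continuous_on_infdist[OF continuous_on_id]] by blast
  define R where "R = infdist x0 F"
  have nF: "x \<notin> F" if "x \<in> \<Omega>" for x using that \<Omega>(1) by (simp add: F_def frontier_def interior_open)
  have posd: "0 < infdist x F" if "x \<in> \<Omega>" for x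
    using nF[OF that] in_closed_iff_infdist_zero[OF Fc Fne, of x] infdist_nonneg[of x F] by linarith
  obtain z where z: "z \<in> \<Omega>" using \<Omega>(3) by blast
  have Rpos: "0 < R" using posd[OF z] x0(2)[of z] z closure_subset[of \<Omega>] by (auto simp: R_def)
  have x0in: "x0 \<in> \<Omega>"
  proof (rule ccontr)
    assume "x0 \<notin> \<Omega>"
    then have "x0 \<in> F" using x0(1) \<Omega>(1) by (simp add: F_def frontier_def interior_open)
    then show False using Rpos by (simp add: R_def)
  qed
  have ballsub: "ball x (infdist x F) \<subseteq> \<Omega>" if x: "x \<in> \<Omega>" for x
  proof (rule ccontr)
    assume n: "\<not> ball x (infdist x F) \<subseteq> \<Omega>"
    have "ball x (infdist x F) \<inter> frontier \<Omega> \<noteq> {}"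
    proof (rule connected_Int_frontier[OF connected_ball])
      have "x \<in> ball x (infdist x F) \<inter> \<Omega>" using x posd[OF x] by simp
      then show "ball x (infdist x F) \<inter> \<Omega> \<noteq> {}" by blast
    qed (use n in blast)
    then obtain y where "y \<in> F" "dist x y < infdist x F" by (auto simp: F_def)
    then show False using infdist_le[of y F x] by simp
  qed
  have bound: "\<bar>w x\<bar> \<le> Linf_norm \<Omega> (weak_grad \<Omega> w) * R"
    if w: "w \<in> W1inf \<Omega>" "w \<in> C0_closure \<Omega>" and x: "x \<in> \<Omega>" for w x
  proof -
    obtain y where y: "y \<in> F" "\<And>y'. y' \<in> F \<Longrightarrow> dist x y \<le> dist x y'"
      using distance_attains_inf[OF Fc Fne, of x] by blast
    have "dist x y \<le> infdist x F"
      unfolding infdist_notempty[OF Fne] using y(2) Fne by (intro cINF_greatest) auto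
    then have yd: "dist x y = infdist x F" using infdist_le[OF y(1), of x] by simp
    have "\<bar>w x\<bar> \<le> Linf_norm \<Omega> (weak_grad \<Omega> w) * dist x y"
    proof (rule weak_gradient_bound_frontier[OF \<Omega>(1,2) w x])
      show "y \<in> frontier \<Omega>" using y(1) by (simp add: F_def)
      show "ball x (dist x y) \<subseteq> \<Omega>" using ballsub[OF x] by (simp only: yd)
    qed
    also have "\<dots> \<le> Linf_norm \<Omega> (weak_grad \<Omega> w) * R"
    proof (rule mult_left_mono)
      show "dist x y \<le> R" using x0(2)[of x] x closure_subset[of \<Omega>] by (auto simp: yd R_def)
      have "AE x in lebesgue_on \<Omega>. norm (weak_grad \<Omega> w x) \<le> Linf_norm \<Omega> (weak_grad \<Omega> w)"
        using w(1) by (intro weak_grad_AE_le_Linf_norm) (simp add: W1inf_def)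
      then obtain x' where "norm (weak_grad \<Omega> w x') \<le> Linf_norm \<Omega> (weak_grad \<Omega> w)"
        using AE_open_witness[OF \<Omega>(1) _ \<Omega>(1) order_refl \<Omega>(3)] by metis
      then show "0 \<le> Linf_norm \<Omega> (weak_grad \<Omega> w)" using norm_ge_zero order_trans by blast
    qed
    finally show ?thesis .
  qed
  have "1 / R \<le> Lambda_inf \<Omega>"
    unfolding Lambda_inf_def
  proof (rule cInf_greatest)
    \<comment> \<open>The infimum of a set of reals can be estimated from below only if the set is
      nonempty. The cone of radius R / 2 smoothed at scale R / 8 has height at least R / 4, so it is
      admissible.\<close>
    have "cball x0 (R / 2) \<subseteq> \<Omega>" using ballsub[OF x0in] Rpos by (force simp: R_def)
    note sc = smooth_cone_properties[OF _ this, of "R / 8"]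
    have t: "test_function \<Omega> (smooth_cone (R / 8) (R / 2) x0)" using sc(1) Rpos by simp
    have "smooth_cone (R / 8) (R / 2) x0 x0 \<noteq> 0" using sc(3) Rpos by auto
    then show "{Linf_norm \<Omega> (weak_grad \<Omega> u) / Linf_norm \<Omega> u |u. u \<in> W1inf \<Omega> \<inter> C0_closure \<Omega> \<and> (\<exists>x\<in>\<Omega>. u x \<noteq> 0)} \<noteq> {}"
      using test_function_W1inf[OF \<Omega>(1,2) t] x0in by blast
    fix r assume "r \<in> {Linf_norm \<Omega> (weak_grad \<Omega> u) / Linf_norm \<Omega> u |u. u \<in> W1inf \<Omega> \<inter> C0_closure \<Omega> \<and> (\<exists>x\<in>\<Omega>. u x \<noteq> 0)}"
    then obtain u y where r: "r = Linf_norm \<Omega> (weak_grad \<Omega> u) / Linf_norm \<Omega> u"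
      and u: "u \<in> W1inf \<Omega>" "u \<in> C0_closure \<Omega>" and y: "y \<in> \<Omega>" "u y \<noteq> 0" by blast
    have cu: "continuous_on (closure \<Omega>) u" and fu: "\<And>x. x \<in> frontier \<Omega> \<Longrightarrow> u x = 0" using u(2) by (auto simp: C0_closure_def)
    obtain x1 where x1: "x1 \<in> closure \<Omega>" "\<And>x. x \<in> closure \<Omega> \<Longrightarrow> \<bar>u x\<bar> \<le> \<bar>u x1\<bar>"
      using continuous_attains_sup[OF cc cne continuous_on_rabs[OF cu]] by blast
    have p: "0 < \<bar>u x1\<bar>" using x1(2)[of y] y closure_subset[of \<Omega>] by auto
    have x1in: "x1 \<in> \<Omega>"
    proof (rule ccontr)
      assume "x1 \<notin> \<Omega>"
      then have "x1 \<in> frontier \<Omega>" using x1(1) \<Omega>(1) by (simp add: frontier_def interior_open)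
      then show False using fu p by simp
    qed
    have "Linf_norm \<Omega> u = \<bar>u x1\<bar>"
      using x1(2) closure_subset[of \<Omega>] x1in
      by (intro Linf_norm_eq[OF \<Omega>(1) continuous_on_subset[OF cu closure_subset]]) auto
    then show "1 / R \<le> r" using bound[OF u x1in] p Rpos by (simp add: r field_simps)
  qed
  then show ?thesis using that[of x0 R] x0in Rpos ballsub[OF x0in] by (simp add: R_def)
qed

section \<open>Infinity-harmonic functions and the strong maximum principle\<close>

text \<open>The pairs (\<gamma>, S) range over the second order superjet of U at x0; the slack
  \<delta> |x - x0|^2 for every \<delta> > 0 is the usual remainder o(|x - x0|^2). The condition is
  local and involves polynomials only. Supersolutions are expressed by applying it to - U.\<close>

definition inf_subsolution :: "(real^'n) set \<Rightarrow> (real^'n \<Rightarrow> real) \<Rightarrow> bool" where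
  "inf_subsolution D U \<longleftrightarrow> (\<forall>x0\<in>D. \<forall>\<gamma> S. transpose S = S \<longrightarrow>
     (\<forall>\<delta>>0. \<forall>\<^sub>F x in at x0. U x \<le> quad x0 (U x0) \<gamma> S x + \<delta> * (norm (x - x0))\<^sup>2) \<longrightarrow>
     0 \<le> \<gamma> \<bullet> (S *v \<gamma>))"

text \<open>Only the symmetric part of the matrix of second partial derivatives enters, so its
  symmetry is not needed.\<close>

lemma second_order_Taylor:
  fixes \<phi> :: "real^'n \<Rightarrow> real"
  assumes D: "open D" "x0 \<in> D" and \<phi>: "Ck_on 2 D \<phi>"
  obtains S where "transpose S = S" "grad \<phi> x0 \<bullet> (S *v grad \<phi> x0) = inf_laplacian \<phi> x0"
    "\<And>\<delta>. 0 < \<delta> \<Longrightarrow> \<forall>\<^sub>F x in at x0. \<bar>\<phi> x - quad x0 (\<phi> x0) (grad \<phi> x0) S x\<bar> \<le> \<delta> * (norm (x - x0))\<^sup>2"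
proof -
  define H :: "real^'n^'n" where "H = (\<chi> i. grad (partial_deriv i \<phi>) x0)"
  define S where "S = (1 / 2) *\<^sub>R (H + transpose H)"
  have d1: "\<phi> differentiable (at x)" and d2: "partial_deriv i \<phi> differentiable (at x)" if "x \<in> D" for x i
    using \<phi> that by (auto simp: numeral_2_eq_2)
  have quadS: "y \<bullet> (S *v y) = y \<bullet> (H *v y)" for y
  proof -
    have "y \<bullet> (transpose H *v y) = y \<bullet> (H *v y)"
      by (metis dot_lmul_matrix inner_commute transpose_matrix_vector)
    then show ?thesis
      by (simp add: S_def matrix_vector_mult_add_rdistrib inner_add_right flip: scaleR_matrix_vector_assoc)
  qed
  show ?thesis
  proof (rule that[of S])
    show "transpose S = S" by (simp add: S_def transpose_def vec_eq_iff)
    have "grad \<phi> x0 \<bullet> (H *v grad \<phi> x0) = inf_laplacian \<phi> x0"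
      by (simp add: H_def inner_vec_def matrix_vector_mult_def grad_nth inf_laplacian_def sum_distrib_left mult_ac)
    then show "grad \<phi> x0 \<bullet> (S *v grad \<phi> x0) = inf_laplacian \<phi> x0" by (simp add: quadS)
    have dg: "(grad \<phi> has_derivative (\<lambda>h. H *v h)) (at x0)"
    proof -
      have "(partial_deriv i \<phi> has_derivative (\<lambda>h. (H *v h) $ i)) (at x0)" for i
        using GDERIV_grad[OF d2[OF D(2), of i]]
        by (simp add: gderiv_def H_def matrix_vector_mul_component inner_commute)
      then show ?thesis
        by (subst has_derivative_componentwise_within) (auto simp: Basis_vec_def inner_axis grad_nth)
    qed
    fix \<delta> :: real assume \<delta>: "0 < \<delta>"
    obtain d where d: "0 < d" "\<And>y. norm (y - x0) < d \<Longrightarrow> norm (grad \<phi> y - grad \<phi> x0 - H *v (y - x0)) \<le> \<delta> * norm (y - x0)"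
      using dg \<delta> unfolding has_derivative_at_alt by blast
    obtain e where e: "0 < e" "ball x0 e \<subseteq> D" using D open_contains_ball by blast
    show "\<forall>\<^sub>F x in at x0. \<bar>\<phi> x - quad x0 (\<phi> x0) (grad \<phi> x0) S x\<bar> \<le> \<delta> * (norm (x - x0))\<^sup>2"
      unfolding eventually_at
    proof (intro exI[of _ "min d e"] conjI ballI impI)
      show "0 < min d e" using d e by simp
      fix x assume "x \<noteq> x0 \<and> dist x x0 < min d e"
      then have x: "norm (x - x0) < d" "norm (x - x0) < e" by (auto simp: dist_norm)
      define h where "h = x - x0"
      \<comment> \<open>The remainder along the segment. Its derivative is the error of the
        linearization of the gradient at x0, paired with h, hence at most \<delta> |h|^2; the mean
        value theorem does the rest.\<close>
      define k where "k t = \<phi> (x0 + t *\<^sub>R h) - t * (grad \<phi> x0 \<bullet> h) - t\<^sup>2 * (h \<bullet> (H *v h)) / 2" for t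
      define k' where "k' t = (grad \<phi> (x0 + t *\<^sub>R h) - grad \<phi> x0 - H *v (t *\<^sub>R h)) \<bullet> h" for t
      have small: "norm (t *\<^sub>R h) \<le> norm h" if "t \<in> {0..1}" for t
        using that by (simp add: mult_left_le_one_le)
      have dk: "(k has_real_derivative k' t) (at t within {0..1})" if t: "t \<in> {0..1}" for t
      proof -
        have "x0 + t *\<^sub>R h \<in> D" using small[OF t] x(2) by (intro subsetD[OF e(2)]) (simp add: dist_norm h_def)
        then have "(\<phi> has_derivative (\<lambda>v. v \<bullet> grad \<phi> (x0 + t *\<^sub>R h))) (at (x0 + t *\<^sub>R h))"
          using GDERIV_grad[OF d1] by (simp add: gderiv_def)
        moreover have "((\<lambda>t. x0 + t *\<^sub>R h) has_derivative (\<lambda>r. r *\<^sub>R h)) (at t)"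
          by (auto intro!: derivative_eq_intros)
        ultimately have "((\<lambda>t. \<phi> (x0 + t *\<^sub>R h)) has_derivative (\<lambda>r. (r *\<^sub>R h) \<bullet> grad \<phi> (x0 + t *\<^sub>R h))) (at t)"
          by (rule has_derivative_compose[rotated])
        then have "((\<lambda>t. \<phi> (x0 + t *\<^sub>R h)) has_real_derivative grad \<phi> (x0 + t *\<^sub>R h) \<bullet> h) (at t)"
          by (simp add: has_field_derivative_def inner_commute mult_commute_abs)
        then have "(k has_real_derivative grad \<phi> (x0 + t *\<^sub>R h) \<bullet> h - grad \<phi> x0 \<bullet> h - t * (h \<bullet> (H *v h))) (at t)"
          unfolding k_def by (auto intro!: derivative_eq_intros)
        moreover have "k' t = grad \<phi> (x0 + t *\<^sub>R h) \<bullet> h - grad \<phi> x0 \<bullet> h - t * (h \<bullet> (H *v h))"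
          by (simp add: k'_def inner_diff_left inner_commute[of "H *v h"] matrix_vector_mult_scaleR)
        ultimately show ?thesis by (simp add: has_field_derivative_at_within)
      qed
      have bk: "norm (k' t) \<le> \<delta> * (norm h)\<^sup>2" if t: "t \<in> {0..1}" for t
      proof -
        have "norm (k' t) \<le> norm (grad \<phi> (x0 + t *\<^sub>R h) - grad \<phi> x0 - H *v (t *\<^sub>R h)) * norm h"
          unfolding k'_def using Cauchy_Schwarz_ineq2 by simp
        also have "\<dots> \<le> (\<delta> * norm (t *\<^sub>R h)) * norm h"
          using d(2)[of "x0 + t *\<^sub>R h"] small[OF t] x(1) by (intro mult_right_mono) (auto simp: h_def)
        also have "\<dots> \<le> (\<delta> * norm h) * norm h"
          using small[OF t] \<delta> by (intro mult_right_mono mult_left_mono) auto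
        finally show ?thesis by (simp add: power2_eq_square)
      qed
      have "norm (k 1 - k 0) \<le> \<delta> * (norm h)\<^sup>2 * norm (1 - 0 :: real)"
        by (rule field_differentiable_bound[of "{0..1}" k k']) (use dk bk in auto)
      moreover have "k 1 - k 0 = \<phi> x - quad x0 (\<phi> x0) (grad \<phi> x0) S x"
        by (simp add: k_def h_def quad_def quadS)
      ultimately show "\<bar>\<phi> x - quad x0 (\<phi> x0) (grad \<phi> x0) S x\<bar> \<le> \<delta> * (norm (x - x0))\<^sup>2"
        by (simp add: h_def)
    qed
  qed
qed

lemma quad_minus: "quad x0 (- \<alpha>) (- \<gamma>) (- S) x = - quad x0 \<alpha> \<gamma> S x"
proof -
  have "(- S) *v y = - (S *v y)" for y by (simp add: matrix_vector_mult_def vec_eq_iff sum_negf)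
  then show ?thesis by (simp add: quad_def)
qed

text \<open>The Taylor polynomial of a function touching from above has the jet required at the
  point. Touching from below is touching of - U from above with jet (- \<gamma>, - S), for which the
  cubic expression \<gamma> \<bullet> S \<gamma> changes sign.\<close>

lemma inf_harmonicI:
  assumes D: "bounded_domain D" and c: "continuous_on (closure D) U"
    and sub: "inf_subsolution D U" and super: "inf_subsolution D (\<lambda>x. - U x)"
  shows "inf_harmonic D U"
  unfolding inf_harmonic_def
proof (intro conjI ballI allI impI D c)
  have oD: "open D" using D by (simp add: bounded_domain_def)
  fix x0 \<phi> assume x0: "x0 \<in> D" and \<phi>: "Ck_on 2 D \<phi>"
  obtain S where S: "transpose S = S" "grad \<phi> x0 \<bullet> (S *v grad \<phi> x0) = inf_laplacian \<phi> x0"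
    "\<And>\<delta>. 0 < \<delta> \<Longrightarrow> \<forall>\<^sub>F x in at x0. \<bar>\<phi> x - quad x0 (\<phi> x0) (grad \<phi> x0) S x\<bar> \<le> \<delta> * (norm (x - x0))\<^sup>2"
    by (rule second_order_Taylor[OF oD x0 \<phi>]) blast
  have ev: "\<forall>\<^sub>F x in at x0. x \<in> D - {x0}"
    using oD x0 by (auto simp: eventually_at_filter eventually_nhds)
  {
    assume t: "touches_above D \<phi> U x0"
    have "\<forall>\<^sub>F x in at x0. U x \<le> quad x0 (U x0) (grad \<phi> x0) S x + \<delta> * (norm (x - x0))\<^sup>2" if "0 < \<delta>" for \<delta>
      using S(3)[OF that] ev
    proof eventually_elim
      case (elim x)
      then have "U x < \<phi> x" "\<phi> x0 = U x0" using t by (auto simp: touches_above_def)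
      then show ?case using elim(1) by (simp add: abs_le_iff)
    qed
    then have "0 \<le> grad \<phi> x0 \<bullet> (S *v grad \<phi> x0)"
      using sub x0 S(1) unfolding inf_subsolution_def by blast
    then show "0 \<le> inf_laplacian \<phi> x0" by (simp add: S(2))
  }
  {
    assume t: "touches_below D \<phi> U x0"
    have "\<forall>\<^sub>F x in at x0. - U x \<le> quad x0 (- U x0) (- grad \<phi> x0) (- S) x + \<delta> * (norm (x - x0))\<^sup>2" if "0 < \<delta>" for \<delta>
      using S(3)[OF that] ev
    proof eventually_elim
      case (elim x)
      then have "\<phi> x < U x" "\<phi> x0 = U x0" using t by (auto simp: touches_below_def)
      then show ?case using elim(1) unfolding quad_minus by (simp add: abs_le_iff)
    qed
    moreover have "transpose (- S) = - S" using S(1) by (simp add: transpose_def vec_eq_iff)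
    ultimately have "0 \<le> (- grad \<phi> x0) \<bullet> ((- S) *v (- grad \<phi> x0))"
      using super x0 unfolding inf_subsolution_def by blast
    also have "(- S) *v (- grad \<phi> x0) = S *v grad \<phi> x0"
      by (simp add: matrix_vector_mult_def)
    finally show "inf_laplacian \<phi> x0 \<le> 0" using S(2) by simp
  }
qed

lemma outer_product_mult: "(\<chi> i j. a $ i * a $ j) *v e = (a \<bullet> e) *\<^sub>R a" for a e :: "real^'n"
  by (simp add: matrix_vector_mult_def vec_eq_iff inner_vec_def sum_distrib_left sum_distrib_right mult_ac)

text \<open>Hopf's argument: near the boundary of the set where the maximum is attained, \<open>U\<close> is compared
  with the radial quartic \<open>\<lambda>x. m + \<epsilon> * ((b - r\<^sup>2)\<^sup>2 - (b - (dist c x)\<^sup>2)\<^sup>2)\<close>, which is increasing and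
  strictly concave in the radius for \<open>b / 3 < (dist c x)\<^sup>2 < b\<close>.\<close>

lemma inf_subsolution_strong_max:
  fixes D :: "(real^'n) set"
  assumes D: "open D" "connected D" and c: "continuous_on D U" and sub: "inf_subsolution D U"
    and y: "y \<in> D" and max: "\<And>x. x \<in> D \<Longrightarrow> U x \<le> U y" and x: "x \<in> D"
  shows "U x = U y"
proof (rule ccontr)
  assume ne: "U x \<noteq> U y"
  define m where "m = U y"
  define Z where "Z = {x \<in> D. U x = m}"
  have Zcl: "closedin (top_of_set D) Z"
    unfolding Z_def using continuous_closedin_preimage_constant[OF c] by simp
  have "\<not> openin (top_of_set D) Z"
  proof
    assume "openin (top_of_set D) Z"
    then have "Z = {} \<or> Z = D" using D(2) Zcl unfolding connected_clopen by blast
    then show False using y x ne by (auto simp: Z_def m_def)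
  qed
  then have "\<not> open Z" using D(1) by (simp add: openin_open_eq Z_def)
  then obtain z where z: "z \<in> Z" "\<And>e. 0 < e \<Longrightarrow> \<not> ball z e \<subseteq> Z"
    unfolding open_contains_ball by blast
  obtain s0 where s0: "0 < s0" "cball z s0 \<subseteq> D" using D(1) z(1) open_contains_cball unfolding Z_def by blast
  \<comment> \<open>Room for q within s of z, for the search ball of radius 3 s, and for the ball of
    radius 2 r < 2 s around q.\<close>
  define s where "s = s0 / 4"
  have s: "0 < s" "cball z (4 * s) \<subseteq> D" using s0 by (auto simp: s_def)
  obtain q where q: "q \<in> ball z s" "q \<notin> Z" using z(2)[OF s(1)] by blast
  have Kc: "closed (Z \<inter> cball z (3 * s))"
  proof -
    have "Z \<inter> cball z (3 * s) = {x \<in> cball z (3 * s). U x = m}"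
      using s by (auto simp: Z_def)
    moreover have "closed {x \<in> cball z (3 * s). U x = m}"
      using s by (intro continuous_closed_preimage_constant continuous_on_subset[OF c]) auto
    ultimately show ?thesis by simp
  qed
  have "z \<in> Z \<inter> cball z (3 * s)" using z s by simp
  \<comment> \<open>A point of Z nearest to q. As z competes, r < s, so the ball of radius r around
    q stays within the search ball and is disjoint from Z, while z0 lies on its boundary: an
    interior ball touching the set of maxima.\<close>
  then obtain z0 where z0: "z0 \<in> Z \<inter> cball z (3 * s)" "\<And>w. w \<in> Z \<inter> cball z (3 * s) \<Longrightarrow> dist q z0 \<le> dist q w"
    using distance_attains_inf[OF Kc, of q] by blast
  define r where "r = dist q z0"
  have r0: "0 < r" using q z0 by (auto simp: r_def)
  have rs: "r < s"
    using z0(2)[OF \<open>z \<in> Z \<inter> cball z (3 * s)\<close>] q(1) by (simp add: r_def dist_commute)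
  have inD: "w \<in> D" if "dist q w \<le> 2 * r" for w
    using that q(1) rs dist_triangle[of z w q] s by (intro subsetD[OF s(2)]) simp
  have less: "U w < m" if w: "dist q w < r" for w
  proof -
    have "w \<in> D" using inD[of w] w r0 by simp
    moreover have "w \<notin> Z"
    proof
      assume "w \<in> Z"
      moreover have "w \<in> cball z (3 * s)" using w q(1) rs dist_triangle[of z w q] s by simp
      ultimately show False using z0(2)[of w] w by (simp add: r_def)
    qed
    ultimately show ?thesis using max[of w] by (simp add: Z_def m_def)
  qed
  \<comment> \<open>On the shell the squared radius \<sigma> lies between 0.81 r^2 and 1.21 r^2, so
    b > \<sigma> makes the barrier increasing and b < 3 \<sigma> makes it strictly concave in the
    radius.\<close>
  define b where "b = 3 / 2 * r\<^sup>2"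
  define k where "k \<sigma> = (b - r\<^sup>2)\<^sup>2 - (b - \<sigma>)\<^sup>2" for \<sigma>
  define S1 where "S1 = sphere q (9 / 10 * r)"
  have S1D: "S1 \<subseteq> D" using inD r0 by (auto simp: S1_def)
  have S1ne: "S1 \<noteq> {}" using r0 by (simp add: S1_def)
  obtain w1 where w1: "w1 \<in> S1" "\<And>w. w \<in> S1 \<Longrightarrow> U w \<le> U w1"
    using continuous_attains_sup[OF _ S1ne continuous_on_subset[OF c S1D]] by (auto simp: S1_def)
  have w1m: "U w1 < m" using less[of w1] w1(1) r0 by (simp add: S1_def)
  \<comment> \<open>The factor r^4 cancels the scaling of k. On the inner sphere the barrier then
    stays above m - (m - U w1), the largest value of U there; on the outer sphere it exceeds m
    because k > 0.\<close>
  define \<epsilon> where "\<epsilon> = (m - U w1) / r ^ 4"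
  have \<epsilon>: "0 < \<epsilon>" using w1m r0 by (simp add: \<epsilon>_def)
  define h where "h w = m + \<epsilon> * k ((dist q w)\<^sup>2)" for w
  define A where "A = cball q (11 / 10 * r) - ball q (9 / 10 * r)"
  have Ac: "compact A" unfolding A_def by (intro compact_diff) auto
  have AD: "A \<subseteq> D" using inD r0 by (auto simp: A_def)
  have z0A: "z0 \<in> A" using r0 by (simp add: A_def r_def)
  have ch: "continuous_on A (\<lambda>w. U w - h w)"
    unfolding h_def k_def by (intro continuous_intros continuous_on_subset[OF c AD])
  \<comment> \<open>U - h is 0 at z0 and negative on both boundary spheres, so its maximum over the
    shell is attained in the interior, where h plus a constant touches U from above.\<close>
  obtain p where p: "p \<in> A" "\<And>w. w \<in> A \<Longrightarrow> U w - h w \<le> U p - h p"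
    using continuous_attains_sup[OF Ac _ ch] z0A by blast
  have "h z0 = m" by (simp add: h_def k_def r_def)
  moreover have "U z0 = m" using z0(1) by (simp add: Z_def)
  ultimately have p0: "0 \<le> U p - h p" using p(2)[OF z0A] by simp
  have r4: "r ^ 4 = (r\<^sup>2)\<^sup>2" by simp
  have kin: "\<epsilon> * k ((9 / 10 * r)\<^sup>2) > U w1 - m"
  proof -
    have "k ((9 / 10 * r)\<^sup>2) = - (2261 / 10000) * r ^ 4"
      unfolding k_def b_def power_mult_distrib r4 by (simp add: power2_eq_square algebra_simps)
    then have eq: "\<epsilon> * k ((9 / 10 * r)\<^sup>2) = - (2261 / 10000) * (m - U w1)" using r0 by (simp add: \<epsilon>_def)
    show ?thesis unfolding eq using w1m by (simp add: field_simps)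
  qed
  have kout: "k ((11 / 10 * r)\<^sup>2) > 0"
  proof -
    have eq: "k ((11 / 10 * r)\<^sup>2) = (1659 / 10000) * r ^ 4"
      unfolding k_def b_def power_mult_distrib r4 by (simp add: power2_eq_square algebra_simps)
    show ?thesis unfolding eq using r0 by simp
  qed
  have pn1: "dist q p \<noteq> 9 / 10 * r"
  proof
    assume e: "dist q p = 9 / 10 * r"
    then have "U p \<le> U w1" by (intro w1(2)) (simp add: S1_def)
    then show False using p0 kin by (simp add: h_def e)
  qed
  have pn2: "dist q p \<noteq> 11 / 10 * r"
  proof
    assume e: "dist q p = 11 / 10 * r"
    have "U p \<le> m" using max[of p] p(1) AD by (auto simp: m_def)
    moreover have "0 < \<epsilon> * k ((11 / 10 * r)\<^sup>2)" using \<epsilon> kout by simp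
    ultimately show False using p0 by (simp add: h_def e)
  qed
  have pr: "9 / 10 * r < dist q p" "dist q p < 11 / 10 * r" using p(1) pn1 pn2 by (auto simp: A_def)
  define a where "a = p - q"
  define \<beta> where "\<beta> = b - a \<bullet> a"
  have aa: "a \<bullet> a = (dist q p)\<^sup>2" by (simp add: a_def dist_norm norm_minus_commute dot_square_norm)
  have "(9 / 10 * r)\<^sup>2 < a \<bullet> a" "a \<bullet> a < (11 / 10 * r)\<^sup>2"
    unfolding aa using pr r0 by (auto intro!: power_strict_mono)
  then have ar: "81 / 100 * r\<^sup>2 < a \<bullet> a" "a \<bullet> a < 121 / 100 * r\<^sup>2" by (simp_all add: power2_eq_square)
  have r2: "0 < r\<^sup>2" using r0 by simp
  have \<beta>: "0 < \<beta>" "\<beta> < 2 * (a \<bullet> a)" "0 < a \<bullet> a" using ar r2 unfolding \<beta>_def b_def by linarith+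
  \<comment> \<open>The Hessian of the barrier at p, with a = p - q and \<beta> = b - |a|^2; the
    vector \<gamma> introduced next is its gradient there.\<close>
  define S :: "real^'n^'n" where "S = (4 * \<epsilon> * \<beta>) *\<^sub>R mat 1 - (8 * \<epsilon>) *\<^sub>R (\<chi> i j. a $ i * a $ j)"
  have Sv: "S *v e = (4 * \<epsilon> * \<beta>) *\<^sub>R e - (8 * \<epsilon> * (a \<bullet> e)) *\<^sub>R a" for e
    by (simp add: S_def matrix_vector_mult_diff_rdistrib outer_product_mult flip: scaleR_matrix_vector_assoc)
  have Ssym: "transpose S = S" by (simp add: S_def transpose_def mat_def vec_eq_iff mult.commute)
  define \<gamma> where "\<gamma> = (4 * \<epsilon> * \<beta>) *\<^sub>R a"
  have "0 \<le> \<gamma> \<bullet> (S *v \<gamma>)"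
  proof -
    have "\<forall>\<^sub>F w in at p. U w \<le> quad p (U p) \<gamma> S w + \<delta> * (norm (w - p))\<^sup>2" if \<delta>: "0 < \<delta>" for \<delta>
    proof -
      \<comment> \<open>The first two terms keep w in the shell. The last one makes the third order
        term of the barrier at most \<delta> |e|^2, while the fourth order term has the favourable
        sign.\<close>
      define d where "d = min (min (11 / 10 * r - dist q p) (dist q p - 9 / 10 * r)) (\<delta> / (4 * \<epsilon> * (norm a + 1)))"
      have na: "0 < norm a + 1" by (simp add: add_nonneg_pos)
      have d0: "0 < d" using pr \<delta> \<epsilon> na by (simp add: d_def)
      show ?thesis unfolding eventually_at
      proof (intro exI[of _ d] conjI ballI impI d0)
        fix w assume w: "w \<noteq> p \<and> dist w p < d"
        define e where "e = w - p"
        have en: "norm e < d" using w by (simp add: e_def dist_norm)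
        have "\<bar>dist q w - dist q p\<bar> \<le> dist w p" using dist_triangle[of q w p] dist_triangle[of q p w] by (simp add: dist_commute abs_le_iff)
        then have "w \<in> A" using w unfolding A_def d_def by (auto simp: not_less)
        then have Uw: "U w \<le> U p + (h w - h p)" using p(2)[of w] by simp
        have dw: "(dist q w)\<^sup>2 = a \<bullet> a + (2 * (a \<bullet> e) + e \<bullet> e)"
        proof -
          have "(dist q w)\<^sup>2 = (a + e) \<bullet> (a + e)"
            by (simp add: a_def e_def dist_norm norm_minus_commute dot_square_norm)
          then show ?thesis by (simp add: inner_add_left inner_add_right inner_commute)
        qed
        have "h w - h p = \<epsilon> * (k (a \<bullet> a + (2 * (a \<bullet> e) + e \<bullet> e)) - k (a \<bullet> a))"
          by (simp add: h_def dw aa[symmetric] right_diff_distrib)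
        also have "k (a \<bullet> a + (2 * (a \<bullet> e) + e \<bullet> e)) - k (a \<bullet> a)
            = 4 * \<beta> * (a \<bullet> e) + 2 * \<beta> * (e \<bullet> e) - 4 * (a \<bullet> e)\<^sup>2 - (4 * (a \<bullet> e) * (e \<bullet> e) + (e \<bullet> e)\<^sup>2)"
          by (simp add: k_def \<beta>_def power2_eq_square algebra_simps)
        also have "\<epsilon> * \<dots> = \<gamma> \<bullet> e + e \<bullet> (S *v e) / 2 - \<epsilon> * (4 * (a \<bullet> e) * (e \<bullet> e) + (e \<bullet> e)\<^sup>2)"
        proof -
          have "e \<bullet> (S *v e) / 2 = 2 * \<epsilon> * \<beta> * (e \<bullet> e) - 4 * \<epsilon> * (a \<bullet> e)\<^sup>2"
            by (simp add: Sv inner_diff_right inner_commute[of e a] power2_eq_square diff_divide_distrib)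
          then show ?thesis by (simp add: \<gamma>_def algebra_simps)
        qed
        also have "\<dots> \<le> \<gamma> \<bullet> e + e \<bullet> (S *v e) / 2 + \<delta> * (norm e)\<^sup>2"
        proof -
          have "- (a \<bullet> e) \<le> norm a * norm e" using Cauchy_Schwarz_ineq2[of a e] by linarith
          also have "\<dots> \<le> (norm a + 1) * d" using en by (intro mult_mono) auto
          also have "\<dots> \<le> (norm a + 1) * (\<delta> / (4 * \<epsilon> * (norm a + 1)))" using na by (intro mult_left_mono) (auto simp: d_def)
          also have "\<dots> = \<delta> / (4 * \<epsilon>)" using na by simp
          finally have "- (4 * \<epsilon> * (a \<bullet> e)) \<le> \<delta>" using \<epsilon> by (simp add: field_simps)
          then have "- (4 * \<epsilon> * (a \<bullet> e)) * (e \<bullet> e) \<le> \<delta> * (e \<bullet> e)" by (intro mult_right_mono) auto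
          moreover have "0 \<le> \<epsilon> * (e \<bullet> e)\<^sup>2" using \<epsilon> by simp
          ultimately have "- (\<epsilon> * (4 * (a \<bullet> e) * (e \<bullet> e) + (e \<bullet> e)\<^sup>2)) \<le> \<delta> * (e \<bullet> e)"
            by (simp add: algebra_simps)
          then show ?thesis by (simp add: dot_square_norm)
        qed
        finally show "U w \<le> quad p (U p) \<gamma> S w + \<delta> * (norm (w - p))\<^sup>2"
          using Uw by (simp add: quad_def e_def)
      qed
    qed
    moreover have "p \<in> D" using p(1) AD by blast
    ultimately show ?thesis using sub Ssym unfolding inf_subsolution_def by blast
  qed
  \<comment> \<open>Since \<gamma> is radial, only the second radial derivative of the barrier
    enters; the factor \<beta> - 2 |a|^2 carries its negative sign.\<close>
  moreover have "\<gamma> \<bullet> (S *v \<gamma>) = 64 * \<epsilon> ^ 3 * \<beta>\<^sup>2 * (a \<bullet> a) * (\<beta> - 2 * (a \<bullet> a))"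
    by (simp add: \<gamma>_def Sv inner_diff_right power2_eq_square power3_eq_cube algebra_simps)
  moreover have "64 * \<epsilon> ^ 3 * \<beta>\<^sup>2 * (a \<bullet> a) * (\<beta> - 2 * (a \<bullet> a)) < 0"
    using \<epsilon> \<beta> by (intro mult_pos_neg mult_pos_pos) auto
  ultimately show False by simp
qed

section \<open>The maxima do not collapse\<close>

lemma powr_inverse_tendsto_1: "0 < K \<Longrightarrow> ((\<lambda>p. K powr (1 / p)) \<longlongrightarrow> (1::real)) at_top"
proof -
  assume K: "0 < K"
  have "((\<lambda>p. inverse p) \<longlongrightarrow> (0::real)) at_top" by (rule tendsto_inverse_0_at_top[OF filterlim_ident])
  from tendsto_powr[OF tendsto_const this, of K] K show ?thesis by (simp add: inverse_eq_divide)
qed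

lemma power_base_gt_1_at_top: "1 < a \<Longrightarrow> filterlim (\<lambda>p. a powr p) at_top (at_top :: real filter)"
proof -
  assume a: "1 < a"
  have "filterlim (\<lambda>p. exp (p * ln a)) at_top at_top"
    using a by (intro filterlim_compose[OF exp_at_top] filterlim_at_top_mult_tendsto_pos[OF tendsto_const _ filterlim_ident]) auto
  then show ?thesis using a by (simp add: powr_def)
qed

text \<open>Only equality \<Lambda> = \<open>Lambda_inf \<Omega>\<close> requires an argument: there
  the p-th root of the constant c |\<Omega>| tends to one.\<close>

lemma lambda_root_tendsto:
  fixes \<Omega> :: "(real^'n) set"
  assumes \<Omega>: "open \<Omega>" "bounded \<Omega>" "\<Omega> \<noteq> {}" and le: "Lambda_inf \<Omega> \<le> \<Lambda>"
    and gt: "\<Lambda> > Lambda_inf \<Omega> \<longrightarrow> ((\<lambda>p. lam p powr (1 / p)) \<longlongrightarrow> \<Lambda>) at_top"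
    and eq: "\<Lambda> = Lambda_inf \<Omega> \<longrightarrow>
       (\<exists>c>1. \<forall>\<^sub>F p in at_top. lam p = c * measure lebesgue \<Omega> * Lambda_inf \<Omega> powr p)"
    and pos: "0 < Lambda_inf \<Omega>" "0 < measure lebesgue \<Omega>"
  shows "((\<lambda>p. lam p powr (1 / p)) \<longlongrightarrow> \<Lambda>) at_top"
proof (cases "\<Lambda> > Lambda_inf \<Omega>")
  case False
  then have L: "\<Lambda> = Lambda_inf \<Omega>" using le by simp
  then obtain c where c: "c > 1" "\<forall>\<^sub>F p in at_top. lam p = c * measure lebesgue \<Omega> * Lambda_inf \<Omega> powr p"
    using eq by blast
  have cm: "0 < c * measure lebesgue \<Omega>" using c pos by simp
  have "((\<lambda>p. (c * measure lebesgue \<Omega>) powr (1 / p) * Lambda_inf \<Omega>) \<longlongrightarrow> 1 * Lambda_inf \<Omega>) at_top"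
    by (intro tendsto_intros powr_inverse_tendsto_1 cm)
  moreover have "\<forall>\<^sub>F p in at_top. (c * measure lebesgue \<Omega>) powr (1 / p) * Lambda_inf \<Omega> = lam p powr (1 / p)"
    using c(2) eventually_gt_at_top[of 0]
  proof eventually_elim
    case (elim p)
    have "lam p powr (1 / p) = (c * measure lebesgue \<Omega>) powr (1 / p) * (Lambda_inf \<Omega> powr p) powr (1 / p)"
      using elim(1) cm by (simp add: powr_mult)
    then show ?case using elim(2) pos by (simp add: powr_powr)
  qed
  ultimately show ?thesis unfolding L by (simp add: tendsto_cong)
qed (use gt in blast)

lemma measure_open_pos:
  fixes \<Omega> :: "(real^'n) set"
  assumes "open \<Omega>" "bounded \<Omega>" "\<Omega> \<noteq> {}"
  shows "0 < measure lebesgue \<Omega>"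
proof -
  have "\<Omega> \<in> lmeasurable" using assms by (simp add: bounded_set_imp_lmeasurable open_sets_lebesgue)
  moreover have "\<not> negligible \<Omega>" using assms open_not_negligible by blast
  ultimately have "measure lebesgue \<Omega> \<noteq> 0" using negligible_iff_measure0 by blast
  then show ?thesis using measure_nonneg[of lebesgue \<Omega>] by linarith
qed

lemma cone_exists:
  fixes \<Omega> :: "(real^'n) set"
  assumes "ball x0 R \<subseteq> \<Omega>" "\<kappa> < R"
  obtains w where "test_function \<Omega> w" "\<And>x. norm (grad w x) \<le> 1" "\<And>x. 0 \<le> w x" "\<And>x. w x \<le> w x0" "\<kappa> \<le> w x0"
proof -
  \<comment> \<open>One quarter of the margin moves the support to a closed ball inside \<Omega>,
    two quarters are lost in the smoothing; the height is then at least \<kappa> + e.\<close>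
  define e where "e = (R - \<kappa>) / 4"
  have e: "0 < e" using assms by (simp add: e_def)
  have sub: "cball x0 (R - e) \<subseteq> \<Omega>" using assms(1) e by (intro order_trans[OF _ assms(1)]) auto
  show ?thesis
  proof (rule that[of "smooth_cone e (R - e) x0"])
    show "\<kappa> \<le> smooth_cone e (R - e) x0 x0"
    proof -
      have "\<kappa> + e = R - e - 2 * e" by (simp add: e_def field_simps)
      then show ?thesis using smooth_cone_properties(3)[OF e sub] e by linarith
    qed
  qed (use smooth_cone_properties[OF e sub] in auto)
qed

text \<open>The energy of a cone with slope at most one is governed by
  \<open>lam p * w x0 powr p\<close> against |\<Omega>|, and the former must win by a fixed factor.
  If \<Lambda> > \<open>Lambda_inf \<Omega>\<close>, a fixed cone of height \<kappa> < R with
  \<Lambda> \<kappa> > 1 makes it grow exponentially. In the borderline case no fixed height works: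
  it has to approach the reciprocal of \<open>Lambda_inf \<Omega>\<close> as p grows, and c > 1
  leaves the margin.\<close>

lemma good_test_functions:
  fixes \<Omega> :: "(real^'n) set"
  assumes \<Omega>: "open \<Omega>" "bounded \<Omega>" "\<Omega> \<noteq> {}" and le: "Lambda_inf \<Omega> \<le> \<Lambda>"
    and lpos: "\<forall>\<^sub>F p in at_top. lam p > 0"
    and lim: "((\<lambda>p. lam p powr (1 / p)) \<longlongrightarrow> \<Lambda>) at_top"
    and eq: "\<Lambda> = Lambda_inf \<Omega> \<longrightarrow>
       (\<exists>c>1. \<forall>\<^sub>F p in at_top. lam p = c * measure lebesgue \<Omega> * Lambda_inf \<Omega> powr p)"
    and x0: "0 < R" "ball x0 R \<subseteq> \<Omega>" "1 / R \<le> Lambda_inf \<Omega>"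
  obtains \<theta> where "0 < \<theta>" "\<forall>\<^sub>F p in at_top. \<exists>w. test_function \<Omega> w \<and> (\<forall>x. norm (grad w x) \<le> 1) \<and>
    (\<forall>x. 0 \<le> w x \<and> w x \<le> w x0) \<and> (1 + 2 * \<theta>) * measure lebesgue \<Omega> \<le> lam p * w x0 powr p"
proof -
  define V where "V = measure lebesgue \<Omega>"
  define L where "L = Lambda_inf \<Omega>"
  have V: "0 < V" unfolding V_def by (rule measure_open_pos[OF \<Omega>])
  have "0 < 1 / R" using x0(1) by simp
  then have L: "0 < L" "1 / R \<le> L" using x0(3) unfolding L_def by linarith+
  have RL: "1 / L \<le> R" using L x0(1) by (simp add: field_simps)
  show ?thesis
  proof (cases "\<Lambda> > L")
    case True
    have "1 / \<Lambda> < 1 / L" using True L by (simp add: frac_less2)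
    then have "1 / \<Lambda> < R" using RL by linarith
    then obtain \<kappa> where \<kappa>: "1 / \<Lambda> < \<kappa>" "\<kappa> < R" using dense by blast
    have "0 < 1 / \<Lambda>" using True L by simp
    then have \<kappa>0: "0 < \<kappa>" using \<kappa> by linarith
    have gt1: "1 < \<Lambda> * \<kappa>" using \<kappa> True L by (simp add: field_simps)
    obtain w where w: "test_function \<Omega> w" "\<And>x. norm (grad w x) \<le> 1" "\<And>x. 0 \<le> w x" "\<And>x. w x \<le> w x0" "\<kappa> \<le> w x0"
      by (rule cone_exists[OF x0(2) \<kappa>(2)]) blast
    obtain a where a: "1 < a" "a < \<Lambda> * \<kappa>" using dense[OF gt1] by blast
    have "((\<lambda>p. lam p powr (1 / p) * \<kappa>) \<longlongrightarrow> \<Lambda> * \<kappa>) at_top" by (intro tendsto_intros lim)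
    then have ev1: "\<forall>\<^sub>F p in at_top. a < lam p powr (1 / p) * \<kappa>" using a(2) by (rule order_tendstoD(1))
    have ev2: "\<forall>\<^sub>F p in at_top. 3 * V < a powr p"
      by (rule filterlim_at_top_dense[THEN iffD1, OF power_base_gt_1_at_top[OF a(1)], THEN spec])
    show ?thesis
    proof (rule that[of 1])
      show "\<forall>\<^sub>F p in at_top. \<exists>w. test_function \<Omega> w \<and> (\<forall>x. norm (grad w x) \<le> 1) \<and>
        (\<forall>x. 0 \<le> w x \<and> w x \<le> w x0) \<and> (1 + 2 * 1) * measure lebesgue \<Omega> \<le> lam p * w x0 powr p"
        using ev1 ev2 lpos eventually_gt_at_top[of 0]
      proof eventually_elim
        case (elim p)
        have "a powr p \<le> (lam p powr (1 / p) * \<kappa>) powr p" using elim a by (intro powr_mono2) auto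
        also have "\<dots> = lam p * \<kappa> powr p" using elim \<kappa>0 by (simp add: powr_mult powr_powr)
        also have "\<dots> \<le> lam p * w x0 powr p" using elim \<kappa>0 w(5) by (intro mult_left_mono powr_mono2) auto
        finally have "(1 + 2 * 1) * measure lebesgue \<Omega> \<le> lam p * w x0 powr p" using elim(2) by (simp add: V_def)
        then show ?case using w by blast
      qed
    qed simp
  next
    case False
    then have \<Lambda>L: "\<Lambda> = L" using le by (simp add: L_def)
    then obtain c where c: "c > 1" "\<forall>\<^sub>F p in at_top. lam p = c * V * L powr p"
      using eq by (auto simp: L_def V_def)
    \<comment> \<open>Chosen in (0, 1) so that c b = (1 + c) / 2 lies halfway between 1 and c. With
      height b^(1 / p) / L the product with \<open>lam p\<close> is exactly c b |\<Omega>|, and (1 +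
      c) / 2 is 1 + 2 \<theta> for \<theta> = (c - 1) / 4.\<close>
    define b where "b = (1 + c) / (2 * c)"
    have b: "0 < b" "b < 1" using c(1) by (auto simp: b_def field_simps)
    show ?thesis
    proof (rule that[of "(c - 1) / 4"])
      show "0 < (c - 1) / 4" using c(1) by simp
      show "\<forall>\<^sub>F p in at_top. \<exists>w. test_function \<Omega> w \<and> (\<forall>x. norm (grad w x) \<le> 1) \<and>
        (\<forall>x. 0 \<le> w x \<and> w x \<le> w x0) \<and> (1 + 2 * ((c - 1) / 4)) * measure lebesgue \<Omega> \<le> lam p * w x0 powr p"
        using c(2) eventually_gt_at_top[of 0]
      proof eventually_elim
        case (elim p)
        define \<kappa> where "\<kappa> = 1 / L * b powr (1 / p)"
        have "b powr (1 / p) < 1 powr (1 / p)" using b elim(2) by (intro powr_less_mono2) auto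
        then have "\<kappa> < 1 / L * 1" unfolding \<kappa>_def using L by (intro mult_strict_left_mono) auto
        then have \<kappa>R: "\<kappa> < R" using RL by simp
        have \<kappa>0: "0 < \<kappa>" using L b by (simp add: \<kappa>_def)
        obtain w where w: "test_function \<Omega> w" "\<And>x. norm (grad w x) \<le> 1" "\<And>x. 0 \<le> w x" "\<And>x. w x \<le> w x0" "\<kappa> \<le> w x0"
          by (rule cone_exists[OF x0(2) \<kappa>R]) blast
        have "\<kappa> powr p = (1 / L) powr p * b"
          unfolding \<kappa>_def using L b elim(2) by (subst powr_mult) (simp_all add: powr_powr)
        then have "lam p * \<kappa> powr p = c * V * b * (L powr p * (1 / L) powr p)" by (simp add: elim(1))
        also have "L powr p * (1 / L) powr p = 1" using L by (simp add: powr_divide)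
        also have "c * V * b * 1 = (1 + 2 * ((c - 1) / 4)) * V" using c(1) by (simp add: b_def field_simps)
        finally have "(1 + 2 * ((c - 1) / 4)) * V = lam p * \<kappa> powr p" by simp
        also have "\<dots> \<le> lam p * w x0 powr p"
          using elim \<kappa>0 w(5) c(1) V L by (intro mult_left_mono powr_mono2) auto
        finally show ?case using w unfolding V_def by blast
      qed
    qed
  qed
qed

text \<open>For \<open>q < p\<close> the Nehari identity and the uniform Sobolev inequality bound the maximum from below.\<close>

lemma max_lower_bound_superlinear:
  fixes \<Omega> :: "(real^'n) set"
  assumes \<Omega>: "open \<Omega>" "bounded \<Omega>" and Q: "0 < Q" "Q < 1" and qp: "((\<lambda>p. q p / p) \<longlongrightarrow> Q) at_top"
    and ord: "\<forall>\<^sub>F p in at_top. real CARD('n) < q p \<and> q p < p"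
    and lpos: "\<forall>\<^sub>F p in at_top. lam p > 0" and lim: "((\<lambda>p. lam p powr (1 / p)) \<longlongrightarrow> \<Lambda>) at_top" and \<Lambda>: "0 \<le> \<Lambda>"
    and sol: "\<forall>\<^sub>F p in at_top.
       least_energy_solution \<Omega> p (q p) (lam p) (u p) \<and> (\<forall>y\<in>\<Omega>. u p y \<ge> 0) \<and> only_max_point \<Omega> (u p) (x p)"
  obtains \<kappa> where "0 < \<kappa>" "\<forall>\<^sub>F p in at_top. x p \<in> \<Omega> \<longrightarrow> \<kappa> \<le> u p (x p)"
proof -
  obtain C where C: "1 \<le> C"
    "\<And>s m u g J x. real CARD('n) + 1 \<le> s \<Longrightarrow> s \<le> m \<Longrightarrow> W0grad \<Omega> m u g \<Longrightarrow> continuous_on \<Omega> u \<Longrightarrow> 0 < J \<Longrightarrow>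
       (LINT x|lebesgue_on \<Omega>. norm (g x) powr s) \<le> J \<Longrightarrow> x \<in> \<Omega> \<Longrightarrow> \<bar>u x\<bar> \<le> C * J powr (1 / s)"
    by (rule W0grad_sup_bound[OF \<Omega>]) blast
  define B where "B = C * (\<Lambda> + 1)"
  have "1 * 1 \<le> C * (\<Lambda> + 1)" using C(1) \<Lambda> by (intro mult_mono) auto
  then have B: "1 \<le> B" by (simp add: B_def)
  \<comment> \<open>The estimates below give 1 \<le> B^p M^(p - q), and p - q is eventually at least
    p (1 - Q) / 2. A maximum M below \<kappa> would make the right side less than one.\<close>
  define \<kappa> where "\<kappa> = B powr (- (2 / (1 - Q)))"
  have \<kappa>: "0 < \<kappa>" "\<kappa> \<le> 1"
  proof -
    show "0 < \<kappa>" using B by (simp add: \<kappa>_def)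
    have "B powr (- (2 / (1 - Q))) \<le> B powr 0" using B Q by (intro powr_mono) auto
    then show "\<kappa> \<le> 1" using B by (simp add: \<kappa>_def)
  qed
  have "filterlim (\<lambda>p. q p / p * p) at_top at_top"
    by (rule filterlim_tendsto_pos_mult_at_top[OF qp Q(1) filterlim_ident])
  then have "\<forall>\<^sub>F p in at_top. real CARD('n) + 1 < q p / p * p"
    by (rule filterlim_at_top_dense[THEN iffD1, THEN spec])
  then have evq: "\<forall>\<^sub>F p in at_top. real CARD('n) + 1 < q p"
    using eventually_gt_at_top[of 0] by eventually_elim simp
  have evr: "\<forall>\<^sub>F p in at_top. q p / p < (1 + Q) / 2" using qp by (rule order_tendstoD(2)) (use Q in simp)
  have evl: "\<forall>\<^sub>F p in at_top. lam p powr (1 / p) < \<Lambda> + 1" using lim by (rule order_tendstoD(2)) simp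
  show ?thesis
  proof (rule that[of \<kappa>])
    show "\<forall>\<^sub>F p in at_top. x p \<in> \<Omega> \<longrightarrow> \<kappa> \<le> u p (x p)"
      using ord lpos evq evr evl sol
    proof eventually_elim
      case (elim p)
      show "x p \<in> \<Omega> \<longrightarrow> \<kappa> \<le> u p (x p)"
      proof
        assume xp: "x p \<in> \<Omega>"
        define M where "M = u p (x p)"
        have p0: "0 < p" "0 < q p" "1 \<le> p" "q p < p" using elim(1,3) by auto
        have un: "u p \<in> nehari \<Omega> p (q p) (lam p)"
          using elim(6) p0 by (auto simp: least_energy_solution_def)
        have X: "u p \<in> W01p \<Omega> (max p (q p))" and cu: "continuous_on (closure \<Omega>) (u p)"
          using un by (auto simp: nehari_def Xpq_def)
        have mx: "max p (q p) = p" using p0 by simp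
        have W: "W0grad \<Omega> p (u p) (weak_grad \<Omega> (u p))"
          using W01p_imp_W0grad[OF \<Omega> p0(3)] X mx by simp
        have cu': "continuous_on \<Omega> (u p)" using cu closure_subset by (rule continuous_on_subset)
        have nn: "\<And>y. y \<in> \<Omega> \<Longrightarrow> 0 \<le> u p y" using elim(6) by blast
        have le: "u p y \<le> M" if "y \<in> \<Omega>" for y
          using elim(6) that closure_subset[of \<Omega>] unfolding only_max_point_def M_def
          by (cases "y = x p") (auto intro: less_imp_le)
        obtain y where y: "y \<in> \<Omega>" "u p y \<noteq> 0" using un by (auto simp: nehari_def)
        then have M0: "0 < M" using le[of y] nn[of y] by simp
        have LM: "Linf_norm \<Omega> (u p) = M"
          using nn le xp M0 by (intro Linf_norm_eq[OF \<Omega>(1) cu' _ xp]) (auto simp: M_def)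
        define J where "J = lam p * M powr p"
        have J: "0 < J" using elim(2) M0 by (simp add: J_def)
        have "Lp_norm \<Omega> p (weak_grad \<Omega> (u p)) powr p + Lp_norm \<Omega> (q p) (weak_grad \<Omega> (u p)) powr (q p) = J"
          using un by (simp add: nehari_def LM J_def)
        then have "(LINT z|lebesgue_on \<Omega>. norm (weak_grad \<Omega> (u p) z) powr q p) \<le> J"
          using p0 Lp_norm_powr[of "q p" \<Omega> "weak_grad \<Omega> (u p)"] powr_ge_zero[of "Lp_norm \<Omega> p (weak_grad \<Omega> (u p))" p]
          by linarith
        from C(2)[OF less_imp_le[OF elim(3)] less_imp_le[OF p0(4)] W cu' J this xp]
        have "M \<le> C * J powr (1 / q p)" using M0 by (simp add: M_def)
        then have "M powr q p \<le> (C * J powr (1 / q p)) powr q p" using M0 p0 by (intro powr_mono2) auto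
        also have "\<dots> = C powr q p * J" using C(1) J p0 by (simp add: powr_mult powr_powr)
        also have "\<dots> \<le> C powr p * ((\<Lambda> + 1) powr p * M powr p)"
        proof -
          have "(lam p powr (1 / p)) powr p \<le> (\<Lambda> + 1) powr p" using elim(5) p0 by (intro powr_mono2) auto
          then have "lam p \<le> (\<Lambda> + 1) powr p" using elim(2) p0 by (simp add: powr_powr)
          then show ?thesis unfolding J_def using C(1) p0 elim(2)
            by (intro mult_mono[OF powr_mono] mult_right_mono) auto
        qed
        also have "\<dots> = B powr p * M powr p" using C(1) \<Lambda> by (simp add: B_def powr_mult)
        finally have key: "M powr q p \<le> B powr p * M powr p" .
        have "M powr p = M powr q p * M powr (p - q p)" by (simp flip: powr_add)
        with key have "M powr q p * 1 \<le> M powr q p * (B powr p * M powr (p - q p))" by (simp add: mult_ac)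
        then have key2: "1 \<le> B powr p * M powr (p - q p)" using M0 by (subst (asm) mult_le_cancel_left_pos) auto
        show "\<kappa> \<le> u p (x p)"
        proof (rule ccontr)
          assume "\<not> ?thesis"
          then have M\<kappa>: "M < \<kappa>" by (simp add: M_def)
          have "q p < (1 + Q) / 2 * p" using elim(4) p0 by (simp add: divide_less_eq)
          then have ex: "p * (1 - Q) / 2 \<le> p - q p" by (simp add: field_simps)
          have "M powr (p - q p) \<le> M powr (p * (1 - Q) / 2)"
            using ex M0 M\<kappa> \<kappa> by (intro powr_mono') auto
          also have "\<dots> < \<kappa> powr (p * (1 - Q) / 2)" using M\<kappa> M0 p0 Q by (intro powr_less_mono2) auto
          also have "\<dots> = B powr (- p)"
          proof -
            have "- (2 / (1 - Q)) * (p * (1 - Q) / 2) = - p" using Q by (simp add: field_simps)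
            then show ?thesis unfolding \<kappa>_def powr_powr by (rule arg_cong)
          qed
          finally have "B powr p * M powr (p - q p) < B powr p * B powr (- p)" using B by (intro mult_strict_left_mono) auto
          also have "\<dots> = 1" using B by (simp flip: powr_add)
          finally show False using key2 by simp
        qed
      qed
    qed
  qed fact
qed

text \<open>For \<open>p < q\<close> the minimal energy is compared with the energy of half a smooth cone.\<close>

lemma max_lower_bound_sublinear:
  fixes \<Omega> :: "(real^'n) set"
  assumes \<Omega>: "open \<Omega>" "bounded \<Omega>" and Q: "1 < Q" and qp: "((\<lambda>p. q p / p) \<longlongrightarrow> Q) at_top"
    and ord: "\<forall>\<^sub>F p in at_top. real CARD('n) < p \<and> p < q p"
    and lpos: "\<forall>\<^sub>F p in at_top. lam p > 0" and lim: "((\<lambda>p. lam p powr (1 / p)) \<longlongrightarrow> \<Lambda>) at_top" and \<Lambda>: "0 \<le> \<Lambda>"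
    and x0: "x0 \<in> \<Omega>" and \<theta>: "0 < \<theta>"
    and test: "\<forall>\<^sub>F p in at_top. \<exists>w. test_function \<Omega> w \<and> (\<forall>x. norm (grad w x) \<le> 1) \<and>
      (\<forall>x. 0 \<le> w x \<and> w x \<le> w x0) \<and> (1 + 2 * \<theta>) * measure lebesgue \<Omega> \<le> lam p * w x0 powr p"
    and sol: "\<forall>\<^sub>F p in at_top.
       least_energy_solution \<Omega> p (q p) (lam p) (u p) \<and> (\<forall>y\<in>\<Omega>. u p y \<ge> 0) \<and> only_max_point \<Omega> (u p) (x p)"
  obtains \<kappa> where "0 < \<kappa>" "\<forall>\<^sub>F p in at_top. x p \<in> \<Omega> \<longrightarrow> \<kappa> \<le> u p (x p)"
proof -
  interpret finite_measure "lebesgue_on \<Omega>" using \<Omega> by (intro finite_measure_lebesgue_on)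
  define V where "V = measure lebesgue \<Omega>"
  have V: "0 < V" unfolding V_def using x0 by (intro measure_open_pos \<Omega>) auto
  have Vi: "(LINT x|lebesgue_on \<Omega>. c) = c * V" for c :: real
    using \<Omega>(1) by (simp add: V_def measure_restrict_space space_restrict_space open_sets_lebesgue mult.commute)
  \<comment> \<open>(\<Lambda> + 1) M \<le> 1 / 4 is to be contradictory: one factor 1 / 2 matches
    the scale of the competitor, the other leaves 2^(- p), which eventually drops below \<theta>
    |\<Omega>|.\<close>
  define \<kappa> where "\<kappa> = 1 / (4 * (\<Lambda> + 1))"
  have \<kappa>: "0 < \<kappa>" using \<Lambda> by (simp add: \<kappa>_def)
  have two: "\<forall>\<^sub>F p in at_top. 1 / K < 2 powr p" for K :: real
    by (rule filterlim_at_top_dense[THEN iffD1, OF power_base_gt_1_at_top, THEN spec]) simp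
  have evr: "\<forall>\<^sub>F p in at_top. (1 + Q) / 2 < q p / p" using qp by (rule order_tendstoD(1)) (use Q in simp)
  have "filterlim (\<lambda>p. (2 powr ((Q - 1) / 2)) powr p) at_top at_top"
    using Q by (intro power_base_gt_1_at_top) (simp add: gr_one_powr)
  then have ev\<theta>: "\<forall>\<^sub>F p in at_top. 1 / \<theta> < (2 powr ((Q - 1) / 2)) powr p"
    by (rule filterlim_at_top_dense[THEN iffD1, THEN spec])
  have evl: "\<forall>\<^sub>F p in at_top. lam p powr (1 / p) < \<Lambda> + 1" using lim by (rule order_tendstoD(2)) simp
  show ?thesis
  proof (rule that[of \<kappa>])
    show "\<forall>\<^sub>F p in at_top. x p \<in> \<Omega> \<longrightarrow> \<kappa> \<le> u p (x p)"
      using ord lpos evr ev\<theta> evl test sol two[of "\<theta> * V"]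
    proof eventually_elim
      case (elim p)
      show "x p \<in> \<Omega> \<longrightarrow> \<kappa> \<le> u p (x p)"
      proof
        assume xp: "x p \<in> \<Omega>"
        define M where "M = u p (x p)"
        have p0: "0 < p" "0 < q p" "1 \<le> p" "1 \<le> q p" "p < q p"
          using elim(1) by (auto intro: order_trans[of 1 "real CARD('n)"])
        have le: "energy \<Omega> p (q p) (lam p) (u p) \<le> energy \<Omega> p (q p) (lam p) v" if "v \<in> Xpq \<Omega> p (q p)" for v
          using elim(7) p0 that by (auto simp: least_energy_solution_def)
        have "u p \<in> Xpq \<Omega> p (q p)" using elim(7) p0 by (auto simp: least_energy_solution_def)
        then have cu: "continuous_on (closure \<Omega>) (u p)" by (simp add: Xpq_def)
        have cu': "continuous_on \<Omega> (u p)" using cu closure_subset by (rule continuous_on_subset)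
        have nn: "\<And>y. y \<in> \<Omega> \<Longrightarrow> 0 \<le> u p y" using elim(7) by blast
        have leM: "u p y \<le> M" if "y \<in> \<Omega>" for y
          using elim(7) that closure_subset[of \<Omega>] unfolding only_max_point_def M_def
          by (cases "y = x p") (auto intro: less_imp_le)
        have M0: "0 \<le> M" using nn[OF xp] by (simp add: M_def)
        have LM: "Linf_norm \<Omega> (u p) = M"
          using nn leM xp M0 by (intro Linf_norm_eq[OF \<Omega>(1) cu' _ xp]) (auto simp: M_def)
        have lower: "- (lam p / p * M powr p) \<le> energy \<Omega> p (q p) (lam p) (u p)"
          unfolding energy_def LM using p0 by simp
        obtain w where w: "test_function \<Omega> w" "\<And>x. norm (grad w x) \<le> 1" "\<And>x. 0 \<le> w x" "\<And>x. w x \<le> w x0"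
          and wl: "(1 + 2 * \<theta>) * V \<le> lam p * w x0 powr p" using elim(6) by (auto simp: V_def)
        \<comment> \<open>Halving makes the q-energy negligible: 2^(- q) \<le> \<theta> 2^(- p) for
          large p, as q / p stays above (1 + Q) / 2 > 1. One \<theta> of the margin 2 \<theta> pays
          for this term, the other remains as negative energy.\<close>
        define v where "v y = 1 / 2 * w y" for y
        define m where "m = max p (q p)"
        have m: "1 \<le> m" "0 \<le> m" using p0 by (auto simp: m_def)
        have Wv: "W0grad \<Omega> m v (\<lambda>y. (1 / 2) *\<^sub>R grad w y)"
          unfolding v_def by (rule W0grad_scale[OF W0grad_test_function[OF \<Omega> m(2) w(1)] m(2)])
        have cv: "continuous_on S v" for S
          unfolding v_def by (intro continuous_on_mult_left Cinf_continuous_on test_function_Cinf[OF w(1)])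
        have vX: "v \<in> Xpq \<Omega> p (q p)"
          using W0grad_imp_W01p(1)[OF \<Omega> m(1) Wv] cv by (simp add: Xpq_def m_def)
        have Lv: "Linf_norm \<Omega> v = 1 / 2 * w x0"
          using w(3,4) x0 by (intro Linf_norm_eq[OF \<Omega>(1) cv _ x0]) (auto simp: v_def)
        have Nv: "Lp_norm \<Omega> s (weak_grad \<Omega> v) powr s \<le> (1 / 2) powr s * V" if s: "0 < s" "s \<le> m" for s
        proof -
          have i: "in_Lp \<Omega> s (\<lambda>y. (1 / 2) *\<^sub>R grad w y)"
            using in_Lp_mono[OF \<Omega> Wv[unfolded W0grad_def, THEN conjunct2, THEN conjunct1], of s] s by simp
          have "Lp_norm \<Omega> s (weak_grad \<Omega> v) powr s = (LINT y|lebesgue_on \<Omega>. norm ((1 / 2) *\<^sub>R grad w y) powr s)"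
            by (rule W0grad_Lp_norm[OF \<Omega> m(1) Wv s(1)])
          also have "\<dots> \<le> (LINT y|lebesgue_on \<Omega>. (1 / 2) powr s)"
            using i w(2) s by (intro integral_mono powr_mono2) (auto simp: in_Lp_def)
          finally show ?thesis by (simp only: Vi)
        qed
        have "energy \<Omega> p (q p) (lam p) v \<le> 1 / p * ((1 / 2) powr p * V) + 1 / q p * ((1 / 2) powr q p * V) - lam p / p * (1 / 2 * w x0) powr p"
          unfolding energy_def Lv using Nv[of p] Nv[of "q p"] p0
          by (intro diff_right_mono add_mono mult_left_mono) (auto simp: m_def)
        also have "1 / q p * ((1 / 2) powr q p * V) \<le> 1 / p * ((1 / 2) powr p * (\<theta> * V))"
        proof (rule mult_mono)
          show "1 / q p \<le> 1 / p" using p0 by (simp add: frac_le)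
          have "(1 + Q) / 2 * p < q p" using elim(3) p0 by (simp add: less_divide_eq)
          then have "p * ((Q - 1) / 2) \<le> q p - p" by (simp add: field_simps)
          then have "(1 / 2) powr (q p - p) \<le> (1 / 2) powr (p * ((Q - 1) / 2))" by (intro powr_mono') auto
          also have "\<dots> = 1 / (2 powr ((Q - 1) / 2)) powr p"
            by (simp add: powr_powr powr_divide mult.commute)
          also have "\<dots> \<le> \<theta>" using elim(4) \<theta> by (simp add: field_simps)
          finally have "(1 / 2) powr p * ((1 / 2) powr (q p - p)) \<le> (1 / 2) powr p * \<theta>" by (intro mult_left_mono) auto
          then have "(1 / 2) powr q p \<le> (1 / 2) powr p * \<theta>" by (simp flip: powr_add)
          then have "(1 / 2) powr q p * V \<le> (1 / 2) powr p * \<theta> * V" using V by (intro mult_right_mono) auto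
          then show "(1 / 2) powr q p * V \<le> (1 / 2) powr p * (\<theta> * V)" by (simp add: mult.assoc)
        qed (use p0 V in auto)
        also have "lam p / p * (1 / 2 * w x0) powr p = 1 / p * ((1 / 2) powr p * (lam p * w x0 powr p))"
          unfolding powr_mult by simp
        finally have "energy \<Omega> p (q p) (lam p) v \<le> 1 / p * ((1 / 2) powr p * (V + \<theta> * V - lam p * w x0 powr p))"
          by (simp add: algebra_simps)
        also have "\<dots> \<le> 1 / p * ((1 / 2) powr p * (- (\<theta> * V)))"
          using wl p0 by (intro mult_left_mono) (auto simp: algebra_simps)
        finally have "- (lam p / p * M powr p) \<le> 1 / p * ((1 / 2) powr p * (- (\<theta> * V)))"
          using lower le[OF vX] by linarith
        then have "1 / p * ((1 / 2) powr p * (\<theta> * V)) \<le> 1 / p * (lam p * M powr p)" by simp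
        then have a1: "(1 / 2) powr p * (\<theta> * V) \<le> lam p * M powr p"
          using p0 by (subst (asm) mult_le_cancel_left_pos) auto
        have "(lam p powr (1 / p)) powr p \<le> (\<Lambda> + 1) powr p" using elim(5) p0 by (intro powr_mono2) auto
        then have "lam p \<le> (\<Lambda> + 1) powr p" using elim(2) p0 by (simp add: powr_powr)
        then have "lam p * M powr p \<le> (\<Lambda> + 1) powr p * M powr p" by (intro mult_right_mono) auto
        also have "\<dots> = ((\<Lambda> + 1) * M) powr p" using \<Lambda> M0 by (simp add: powr_mult)
        finally have a2: "(1 / 2) powr p * (\<theta> * V) \<le> ((\<Lambda> + 1) * M) powr p" using a1 by linarith
        show "\<kappa> \<le> u p (x p)"
        proof (rule ccontr)
          assume "\<not> ?thesis"
          then have "M \<le> \<kappa>" by (simp add: M_def)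
          then have "(\<Lambda> + 1) * M \<le> (\<Lambda> + 1) * \<kappa>" using \<Lambda> by (intro mult_left_mono) auto
          also have "\<dots> = 1 / 2 * (1 / 2)" using \<Lambda> by (simp add: \<kappa>_def)
          finally have "((\<Lambda> + 1) * M) powr p \<le> (1 / 2 * (1 / 2)) powr p"
            using \<Lambda> M0 p0 by (intro powr_mono2) auto
          also have "\<dots> = (1 / 2) powr p * (1 / 2) powr p" by (rule powr_mult)
          finally have "(1 / 2) powr p * (\<theta> * V) \<le> (1 / 2) powr p * (1 / 2) powr p" using a2 by linarith
          then have "\<theta> * V \<le> (1 / 2) powr p" by (subst (asm) mult_le_cancel_left_pos) auto
          also have "(1 / 2) powr p = 1 / 2 powr p" by (simp add: powr_divide)
          also have "\<dots> < \<theta> * V" using elim(8) \<theta> V by (simp add: field_simps)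
          finally show False by simp
        qed
      qed
    qed
  qed fact
qed

section \<open>Passage to the limit and the maximum principle on the punctured domain\<close>

theorem theorem4p14:
  fixes \<Omega> :: "(real^'n) set"
    and q lam :: "real \<Rightarrow> real"
    and Q \<Lambda> :: real
    and u :: "real \<Rightarrow> real^'n \<Rightarrow> real"
    and x :: "real \<Rightarrow> real^'n"
    and u\<^sub>\<Lambda> :: "real^'n \<Rightarrow> real"
    and x\<^sub>\<Lambda> :: "real^'n"
  assumes "CARD('n) \<ge> 2"
    and "smooth_bounded_domain \<Omega>"
    and "((\<lambda>p. q p / p) \<longlongrightarrow> Q) at_top"
    and "0 < Q \<and> Q < 1 \<and> (\<forall>\<^sub>F p in at_top. real CARD('n) < q p \<and> q p < p)
       \<or> 1 < Q \<and> (\<forall>\<^sub>F p in at_top. real CARD('n) < p \<and> p < q p)"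
    and "\<Lambda> \<ge> Lambda_inf \<Omega>"
    and "\<forall>\<^sub>F p in at_top. lam p > 0"
    and "\<Lambda> > Lambda_inf \<Omega> \<longrightarrow> ((\<lambda>p. lam p powr (1 / p)) \<longlongrightarrow> \<Lambda>) at_top"
    and "\<Lambda> = Lambda_inf \<Omega> \<longrightarrow>
       (\<exists>c>1. \<forall>\<^sub>F p in at_top. lam p = c * measure lebesgue \<Omega> * Lambda_inf \<Omega> powr p)"
    and "\<forall>\<^sub>F p in at_top.
       least_energy_solution \<Omega> p (q p) (lam p) (u p) \<and> (\<forall>y\<in>\<Omega>. u p y \<ge> 0) \<and>
       only_max_point \<Omega> (u p) (x p)"
    and "limit_pair \<Omega> u x u\<^sub>\<Lambda> x\<^sub>\<Lambda>"
  shows "inf_harmonic (\<Omega> - {x\<^sub>\<Lambda>}) u\<^sub>\<Lambda> \<and>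
    (\<forall>y\<in>\<Omega>. u\<^sub>\<Lambda> y > 0) \<and> only_max_point \<Omega> u\<^sub>\<Lambda> x\<^sub>\<Lambda>"
proof -
  have N2: "2 \<le> CARD('n)" and \<Omega>: "open \<Omega>" "connected \<Omega>" "\<Omega> \<noteq> {}" "bounded \<Omega>"
    using assms(1,2) by (auto simp: smooth_bounded_domain_def bounded_domain_def)
  note qp = assms(3) and Qc = assms(4) and Lle = assms(5) and lpos = assms(6) and lgt = assms(7)
    and leq = assms(8) and sol = assms(9)
  obtain z0 R where z0: "z0 \<in> \<Omega>" "0 < R" "ball z0 R \<subseteq> \<Omega>" "1 / R \<le> Lambda_inf \<Omega>"
    by (rule inradius_Lambda_inf[OF \<Omega>(1,4,3)]) blast
  have "0 < 1 / R" using z0(2) by simp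
  then have Linf: "0 < Lambda_inf \<Omega>" using z0(4) by linarith
  have L0: "0 \<le> \<Lambda>" using Linf Lle by linarith
  have lim: "((\<lambda>p. lam p powr (1 / p)) \<longlongrightarrow> \<Lambda>) at_top"
    by (rule lambda_root_tendsto[OF \<Omega>(1,4,3) Lle lgt leq Linf measure_open_pos[OF \<Omega>(1,4,3)]])
  obtain \<kappa> where \<kappa>: "0 < \<kappa>" "\<forall>\<^sub>F p in at_top. x p \<in> \<Omega> \<longrightarrow> \<kappa> \<le> u p (x p)"
    using Qc
  proof
    assume Q: "0 < Q \<and> Q < 1 \<and> (\<forall>\<^sub>F p in at_top. real CARD('n) < q p \<and> q p < p)"
    show thesis
      by (rule max_lower_bound_superlinear[OF \<Omega>(1,4) Q[THEN conjunct1] Q[THEN conjunct2, THEN conjunct1] qp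
            Q[THEN conjunct2, THEN conjunct2] lpos lim L0 sol]) (rule that)
  next
    assume Q: "1 < Q \<and> (\<forall>\<^sub>F p in at_top. real CARD('n) < p \<and> p < q p)"
    obtain \<theta> where \<theta>: "0 < \<theta>" "\<forall>\<^sub>F p in at_top. \<exists>w. test_function \<Omega> w \<and> (\<forall>x. norm (grad w x) \<le> 1) \<and>
      (\<forall>x. 0 \<le> w x \<and> w x \<le> w z0) \<and> (1 + 2 * \<theta>) * measure lebesgue \<Omega> \<le> lam p * w z0 powr p"
      by (rule good_test_functions[OF \<Omega>(1,4,3) Lle lpos lim leq z0(2,3,4)])
    show thesis
      by (rule max_lower_bound_sublinear[OF \<Omega>(1,4) Q[THEN conjunct1] qp Q[THEN conjunct2] lpos lim L0 z0(1) \<theta> sol])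
        (rule that)
  qed
  obtain P where P: "filterlim P at_top sequentially" "(\<lambda>n. x (P n)) \<longlonglongrightarrow> x\<^sub>\<Lambda>"
    "uniform_limit (closure \<Omega>) (\<lambda>n. u (P n)) u\<^sub>\<Lambda> sequentially"
    and U: "u\<^sub>\<Lambda> \<in> C0_closure \<Omega>" and xL: "x\<^sub>\<Lambda> \<in> \<Omega>"
    using assms(10) unfolding limit_pair_def by blast
  define U' where "U' = u\<^sub>\<Lambda>"
  have cU: "continuous_on (closure \<Omega>) U'" and U0: "\<And>y. y \<in> frontier \<Omega> \<Longrightarrow> U' y = 0"
    using U by (auto simp: C0_closure_def U'_def)
  have ul: "uniform_limit (closure \<Omega>) (\<lambda>n. u (P n)) U' sequentially" using P(3) by (simp add: U'_def)
  have atP: "\<forall>\<^sub>F n in sequentially. A (P n)" if "\<forall>\<^sub>F p in at_top. A p" for A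
    using that P(1) unfolding filterlim_iff by blast
  have cO: "\<Omega> \<subseteq> closure \<Omega>" by (rule closure_subset)
  have xin: "\<forall>\<^sub>F n in sequentially. x (P n) \<in> \<Omega>"
    using topological_tendstoD[OF P(2) \<Omega>(1) xL] .
  have pw: "(\<lambda>n. u (P n) y) \<longlonglongrightarrow> U' y" if "y \<in> closure \<Omega>" for y
    using tendsto_uniform_limitI[OF ul that] .
  \<comment> \<open>The points of evaluation move, so uniform convergence is combined with
    continuity of the limit. This carries the lower bound \<kappa> over to the value at
    \<open>x\<^sub>\<Lambda>\<close>.\<close>
  have max_lim: "(\<lambda>n. u (P n) (x (P n))) \<longlonglongrightarrow> U' x\<^sub>\<Lambda>"
  proof -
    have "(\<lambda>n. U' (x (P n))) \<longlonglongrightarrow> U' x\<^sub>\<Lambda>"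
      using xin cO xL by (intro continuous_on_tendsto_compose[OF cU P(2)]) (auto elim: eventually_mono)
    moreover have "(\<lambda>n. u (P n) (x (P n)) - U' (x (P n))) \<longlonglongrightarrow> 0"
    proof (rule tendstoI)
      fix e :: real assume "0 < e"
      from uniform_limitD[OF ul this] xin
      show "\<forall>\<^sub>F n in sequentially. dist (u (P n) (x (P n)) - U' (x (P n))) 0 < e"
      proof eventually_elim
        case (elim n)
        then have "x (P n) \<in> closure \<Omega>" using cO by blast
        then show ?case using elim(1) by (simp add: dist_real_def)
      qed
    qed
    ultimately have "(\<lambda>n. u (P n) (x (P n)) - U' (x (P n)) + U' (x (P n))) \<longlonglongrightarrow> 0 + U' x\<^sub>\<Lambda>"
      by (intro tendsto_add)
    then show ?thesis by simp
  qed
  have "\<forall>\<^sub>F n in sequentially. \<kappa> \<le> u (P n) (x (P n))"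
    using atP[OF \<kappa>(2)] xin by eventually_elim blast
  then have "\<kappa> \<le> U' x\<^sub>\<Lambda>" by (intro tendsto_lowerbound[OF max_lim]) auto
  then have Upos: "0 < U' x\<^sub>\<Lambda>" using \<kappa>(1) by linarith
  have Unn: "0 \<le> U' y" if y: "y \<in> \<Omega>" for y
  proof (rule tendsto_lowerbound[OF pw])
    show "y \<in> closure \<Omega>" using y cO by blast
    show "\<forall>\<^sub>F n in sequentially. 0 \<le> u (P n) y" using atP[OF sol] by eventually_elim (use y in blast)
  qed simp
  have Umax: "U' y \<le> U' x\<^sub>\<Lambda>" if y: "y \<in> closure \<Omega>" for y
  proof (rule tendsto_le[OF _ max_lim pw[OF y]])
    show "\<forall>\<^sub>F n in sequentially. u (P n) y \<le> u (P n) (x (P n))"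
      using atP[OF sol]
    proof eventually_elim
      case (elim n)
      then show ?case using y unfolding only_max_point_def by (cases "y = x (P n)") (auto intro: less_imp_le)
    qed
  qed simp
  define D where "D = \<Omega> - {x\<^sub>\<Lambda>}"
  have oD: "open D" using \<Omega>(1) by (simp add: D_def open_delete)
  \<comment> \<open>Dimension at least two enters here: removing a point does not disconnect the
    domain.\<close>
  have conD: "connected D" unfolding D_def using N2 by (intro connected_open_delete \<Omega>) simp
  \<comment> \<open>The puncture is filled again by taking closures: a function constant on
    \<open>D\<close> and continuous on the closure of \<Omega> is constant up to
    \<open>x\<^sub>\<Lambda>\<close> and up to the boundary.\<close>
  have clD: "closure \<Omega> \<subseteq> insert x\<^sub>\<Lambda> (closure D)"
  proof -
    have "\<Omega> \<subseteq> insert x\<^sub>\<Lambda> D" by (auto simp: D_def)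
    from closure_mono[OF this] show ?thesis by (simp add: closure_insert)
  qed
  have "x\<^sub>\<Lambda> islimpt \<Omega>" using interior_limit_point[of x\<^sub>\<Lambda> \<Omega>] xL \<Omega>(1) by (simp add: interior_open)
  then have "x\<^sub>\<Lambda> islimpt D" unfolding D_def using islimpt_punctured by blast
  then have xLc: "x\<^sub>\<Lambda> \<in> closure D" by (simp add: closure_def)
  then have Dne: "D \<noteq> {}" by auto
  have bD: "bounded_domain D"
    using oD conD Dne \<Omega>(4) unfolding bounded_domain_def D_def by (auto intro: bounded_subset)
  have cD: "closure D \<subseteq> closure \<Omega>" unfolding D_def by (rule closure_mono) blast
  have DO: "D \<subseteq> \<Omega>" by (simp add: D_def)
  have P_at: "filterlim (\<lambda>n. q (P n)) at_top sequentially"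
  proof -
    have Q0: "0 < Q" using Qc by auto
    have "filterlim (\<lambda>p. q p / p * p) at_top at_top"
      by (rule filterlim_tendsto_pos_mult_at_top[OF qp Q0 filterlim_ident])
    moreover have "\<forall>\<^sub>F p in at_top. q p / p * p = q p" using eventually_gt_at_top[of 0] by eventually_elim simp
    ultimately have "filterlim q at_top at_top" by (simp add: filterlim_cong)
    then show ?thesis using P(1) by (rule filterlim_compose)
  qed
  \<comment> \<open>The maximum points converge to \<open>x\<^sub>\<Lambda>\<close>, which has
    positive distance from a small closed ball around z, so that ball eventually contains none of
    them and perturbations in it are admissible.\<close>
  have min: "\<exists>\<rho>>0. cball z \<rho> \<subseteq> \<Omega> \<and> (\<forall>\<^sub>F n in sequentially.
      local_minimizer \<Omega> (P n) (q (P n)) (u (P n)) (weak_grad \<Omega> (u (P n))) (ball z \<rho>) \<and> 0 \<le> max (P n) (q (P n)))"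
    if z: "z \<in> D" for z
  proof -
    obtain \<rho> where \<rho>: "0 < \<rho>" "cball z \<rho> \<subseteq> D" using oD z open_contains_cball by blast
    have "open (- cball z \<rho>)" by (intro open_Compl closed_cball)
    moreover have "x\<^sub>\<Lambda> \<in> - cball z \<rho>" using \<rho>(2) by (auto simp: D_def)
    ultimately have xo: "\<forall>\<^sub>F n in sequentially. x (P n) \<in> - cball z \<rho>"
      using topological_tendstoD[OF P(2)] by blast
    have big: "\<forall>\<^sub>F n in sequentially. 1 < P n" "\<forall>\<^sub>F n in sequentially. 1 < q (P n)"
      by (rule filterlim_at_top_dense[THEN iffD1, OF P(1), THEN spec],
          rule filterlim_at_top_dense[THEN iffD1, OF P_at, THEN spec])
    have "\<forall>\<^sub>F n in sequentially.
      local_minimizer \<Omega> (P n) (q (P n)) (u (P n)) (weak_grad \<Omega> (u (P n))) (ball z \<rho>) \<and> 0 \<le> max (P n) (q (P n))"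
      using big atP[OF lpos] atP[OF sol] xin xo atP[OF \<kappa>(2)]
    proof eventually_elim
      case (elim n)
      have "0 < u (P n) (x (P n))" using elim(5,7) \<kappa>(1) by linarith
      then have "local_minimizer \<Omega> (P n) (q (P n)) (u (P n)) (weak_grad \<Omega> (u (P n))) (ball z \<rho>)"
        using elim \<rho> DO by (intro least_energy_local_minimizer[OF \<Omega>(1,4), where xm = "x (P n)" and l = "lam (P n)"]) auto
      then show ?case using elim(1) by simp
    qed
    then show ?thesis using \<rho> DO by blast
  qed
  have sub: "inf_subsolution D U'"
    unfolding inf_subsolution_def
  proof (intro ballI allI impI)
    fix z \<gamma> and S :: "real^'n^'n"
    assume z: "z \<in> D" and S: "transpose S = S"
      and jet: "\<forall>\<delta>>0. \<forall>\<^sub>F x in at z. U' x \<le> quad z (U' z) \<gamma> S x + \<delta> * (norm (x - z))\<^sup>2"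
    obtain \<rho> where \<rho>: "0 < \<rho>" "cball z \<rho> \<subseteq> \<Omega>" and mn: "\<forall>\<^sub>F n in sequentially.
      local_minimizer \<Omega> (P n) (q (P n)) (u (P n)) (weak_grad \<Omega> (u (P n))) (ball z \<rho>) \<and> 0 \<le> max (P n) (q (P n))"
      using min[OF z] by blast
    show "0 \<le> \<gamma> \<bullet> (S *v \<gamma>)"
    proof (rule superjet_inf_laplacian[OF \<Omega>(1,4) \<rho> P(1) P_at _ _ S])
      show "\<forall>\<^sub>F n in sequentially. local_minimizer \<Omega> (P n) (q (P n)) (u (P n)) (weak_grad \<Omega> (u (P n))) (ball z \<rho>)"
        using mn by eventually_elim blast
      show "uniform_limit (cball z \<rho>) (\<lambda>n. u (P n)) U' sequentially"
        using ul by (rule uniform_limit_on_subset) (use \<rho>(2) cO in blast)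
    qed (use jet in blast)
  qed
  have super: "inf_subsolution D (\<lambda>x. - U' x)"
    unfolding inf_subsolution_def
  proof (intro ballI allI impI)
    fix z \<gamma> and S :: "real^'n^'n"
    assume z: "z \<in> D" and S: "transpose S = S"
      and jet: "\<forall>\<delta>>0. \<forall>\<^sub>F x in at z. - U' x \<le> quad z (- U' z) \<gamma> S x + \<delta> * (norm (x - z))\<^sup>2"
    obtain \<rho> where \<rho>: "0 < \<rho>" "cball z \<rho> \<subseteq> \<Omega>" and mn: "\<forall>\<^sub>F n in sequentially.
      local_minimizer \<Omega> (P n) (q (P n)) (u (P n)) (weak_grad \<Omega> (u (P n))) (ball z \<rho>) \<and> 0 \<le> max (P n) (q (P n))"
      using min[OF z] by blast
    show "0 \<le> \<gamma> \<bullet> (S *v \<gamma>)"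
    proof (rule superjet_inf_laplacian[OF \<Omega>(1,4) \<rho> P(1) P_at _ _ S, where U = "\<lambda>x. - U' x"])
      show "\<forall>\<^sub>F n in sequentially. local_minimizer \<Omega> (P n) (q (P n)) (\<lambda>x. - u (P n) x) (\<lambda>x. - weak_grad \<Omega> (u (P n)) x) (ball z \<rho>)"
        using mn by eventually_elim (rule local_minimizer_minus; blast)
      have "uniform_limit (cball z \<rho>) (\<lambda>n. u (P n)) U' sequentially"
        using ul by (rule uniform_limit_on_subset) (use \<rho>(2) cO in blast)
      then show "uniform_limit (cball z \<rho>) (\<lambda>n x. - u (P n) x) (\<lambda>x. - U' x) sequentially"
        by (rule uniform_limit_uminus)
    qed (use jet in blast)
  qed
  have cUD: "continuous_on D U'" using continuous_on_subset[OF cU] DO cO by blast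
  have harm: "inf_harmonic D U'"
    by (rule inf_harmonicI[OF bD continuous_on_subset[OF cU cD] sub super])
  \<comment> \<open>An interior zero would be a maximum of - U', a subsolution on \<open>D\<close>;
    then U' would vanish on \<open>D\<close> and by continuity at
    \<open>x\<^sub>\<Lambda>\<close>.\<close>
  have pos: "0 < U' y" if y: "y \<in> \<Omega>" for y
  proof (rule ccontr)
    assume "\<not> 0 < U' y"
    then have y0: "U' y = 0" using Unn[OF y] by simp
    then have yD: "y \<in> D" using y Upos by (auto simp: D_def)
    have "U' w = 0" if w: "w \<in> D" for w
      using inf_subsolution_strong_max[OF oD conD continuous_on_minus[OF cUD] super yD _ w] Unn DO y0 by auto
    then have "U' x\<^sub>\<Lambda> = 0"
      by (intro continuous_constant_on_closure[OF continuous_on_subset[OF cU cD] _ xLc]) auto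
    then show False using Upos by simp
  qed
  \<comment> \<open>A second maximum point would make U' constant on \<open>D\<close>; the constant
    would be positive, against the zero boundary values.\<close>
  have onlymax: "U' y < U' x\<^sub>\<Lambda>" if y: "y \<in> closure \<Omega>" "y \<noteq> x\<^sub>\<Lambda>" for y
  proof (cases "y \<in> \<Omega>")
    case False
    then have "y \<in> frontier \<Omega>" using y(1) \<Omega>(1) by (simp add: frontier_def interior_open)
    then show ?thesis using U0 Upos by simp
  next
    case True
    then have yD: "y \<in> D" using y(2) by (simp add: D_def)
    show ?thesis
    proof (rule ccontr)
      assume "\<not> ?thesis"
      then have eq: "U' y = U' x\<^sub>\<Lambda>" using Umax[OF y(1)] by simp
      have con: "U' w = U' x\<^sub>\<Lambda>" if w: "w \<in> D" for w
        using inf_subsolution_strong_max[OF oD conD cUD sub yD _ w] Umax DO cO eq by auto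
      have "frontier \<Omega> \<noteq> {}" using \<Omega>(3,4) frontier_eq_empty[of \<Omega>] not_bounded_UNIV by metis
      then obtain f where f: "f \<in> frontier \<Omega>" by blast
      then have "f \<in> closure \<Omega>" "f \<notin> \<Omega>" using \<Omega>(1) by (auto simp: frontier_def interior_open)
      then have "f \<in> closure D" using clD xL by auto
      from continuous_constant_on_closure[OF continuous_on_subset[OF cU cD] con this]
      have "U' f = U' x\<^sub>\<Lambda>" .
      then show False using U0[OF f] Upos by simp
    qed
  qed
  have "only_max_point \<Omega> U' x\<^sub>\<Lambda>"
    unfolding only_max_point_def
  proof (intro conjI ballI impI)
    show "x\<^sub>\<Lambda> \<in> closure \<Omega>" using xL cO by (rule subsetD[rotated])
  qed (rule onlymax)
  then show ?thesis
    unfolding U'_def[symmetric] D_def[symmetric] by (intro conjI ballI harm pos)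
qed

end
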